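(* Let $(I,\cdot)$ be a super Cartan datum with a root datum $(Y,X,\langle\,,\rangle)$ and let $\mathbf U$ be the associated quantum covering group. (a) For $\lambda\in X^+$, the $\mathbf U$-modules $V(\lambda)_+$ and $V(\lambda)_-$ are simple objects of $\mathcal O_{\mathrm{int}}$. (b) For $\lambda,\lambda'\in X^+$, the $\mathbf U$-modules $V(\lambda)_+$ and $V(\lambda')_+$, and respectively $V(\lambda)_-$ and $V(\lambda')_-$, are isomorphic if and only if $\lambda=\lambda'$. (Clearly, $V(\lambda)_+$ and $V(\lambda')_-$ are non-isomorphic.) (c) Any integrable module in $\mathcal O$ is a direct sum of simple modules of the form $V(\lambda)_\pm$ for various $\lambda\in X^+$.
   Context: A super Cartan datum is a finite set $I=I_{\bar 0}\sqcup I_{\bar 1}$ with $I_{\bar 1}\ne\emptyset$ and a symmetric $\mathbb Z$-valued bilinear form on $\mathbb Z[I]$ such that $d_i=\frac{i\cdot i}{2}\in\mathbb Z_{>0}$; $2\frac{i\cdot j}{i\cdot i}\in-\mathbb N$ for $i\ne j$; and $2\frac{i\cdot j}{i\cdot i}\in 2\mathbb Z$ for $i\in I_{\bar 1}$, $j\in I$. The parity $p:\mathbb Z[I]\to\mathbb Z$ is the homomorphism with $p(i)=0$ on $I_{\bar 0}$, $p(i)=1$ on $I_{\bar 1}$. A root datum consists of finitely generated free abelian groups $Y,X$, a perfect pairing $\langle\,,\rangle:Y\times X\to\mathbb Z$, and embeddings $I\subset X$ ($i\mapsto i'$), $I\subset Y$ ($i\mapsto i$) with linearly independent images and $\langle i,j'\rangle=\frac{2i\cdot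 j}{i\cdot i}$. $X^+=\{\lambda\in X\mid\langle i,\lambda\rangle\in\mathbb N\ \forall i\in I\}$. $\mathbb Z[I]$ is regarded inside $X$ via $i\mapsto i'$. For $\nu=\sum\nu_ii$, $\mathrm{ht}\,\nu=\sum\nu_i$. $\mathbb Q(q)^\pi=\mathbb Q(q)[\pi]/(\pi^2-1)$; $q_i=q^{d_i}$, $\pi_i=\pi^{p(i)}$. $[n]_i=\frac{(\pi_iq_i)^n-q_i^{-n}}{\pi_iq_i-q_i^{-1}}$, $[n]_i^!=\prod_{s=1}^n[s]_i$. ${}'\mathbf f$ is the free associative unital $\mathbb Q(q)^\pi$-superalgebra on $\theta_i$ $(i\in I)$, with weight grading $|\theta_i|=i$ and parity $p(x)=p(|x|)$. ${}'\mathbf f\otimes{}'\mathbf f$ has multiplication $(x_1\otimes x_2)(x_1'\otimes x_2')=q^{|x_2|\cdot|x_1'|}\pi^{p(x_2)p(x_1')}x_1x_1'\otimes x_2x_2'$, and $r$ is the algebra homomorphism with $r(\theta_i)=\theta_i\otimes1+1\otimes\theta_i$. $(\cdot,\cdot)$ is the unique $\mathbb Q(q)^\pi$-valued bilinear form on ${}'\mathbf f$ with $(1,1)=1$, $(\theta_i,\theta_j)=\delta_{ij}(1-\pi_iq_i^{-2})^{-1}$, $(x,y'y'')=(r(x),y'\otimes y'')$, $(xx',y'')=(x\otimes x',r(y''))$, where $(x_1\otimes x_2,x_1'\otimes x_2')=(x_1,x_1')(x_2,x_2')$. $\mathcal I$ is its radical, $\mathbf f={}'\mathbf f/\mathcal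 I$, and $\mathbf f_\nu$ is the image of the weight-$\nu$ part ${}'\mathbf f_\nu$. $\mathbf U$ (the quantum covering group) is the unital associative $\mathbb Q(q)^\pi$-superalgebra with generators $E_i,F_i$ $(i\in I)$ of parity $p(i)$ and even generators $J_\mu,K_\mu$ $(\mu\in Y)$, and relations: $K_0=1$, $K_\mu K_{\mu'}=K_{\mu+\mu'}$; $J_{2\mu}=1$, $J_\mu J_{\mu'}=J_{\mu+\mu'}$; $J_\mu K_{\mu'}=K_{\mu'}J_\mu$; $K_\mu E_i=q^{\langle\mu,i'\rangle}E_iK_\mu$, $J_\mu E_i=\pi^{\langle\mu,i'\rangle}E_iJ_\mu$; $K_\mu F_i=q^{-\langle\mu,i'\rangle}F_iK_\mu$, $J_\mu F_i=\pi^{-\langle\mu,i'\rangle}F_iJ_\mu$; $E_iF_j-\pi^{p(i)p(j)}F_jE_i=\delta_{ij}\frac{\widetilde J_i\widetilde K_i-\widetilde K_{-i}}{\pi_iq_i-q_i^{-1}}$ with $\widetilde K_{\pm i}=K_{\pm d_ii}$, $\widetilde J_i=J_{d_ii}$; and $f(E_i:i\in I)=f(F_i:i\in I)=0$ for every $f(\theta_i:i\in I)\in\mathcal I$. $x\mapsto x^+$ is the algebra homomorphism $\mathbf f\to\mathbf U$ with $\theta_i^+=E_i$. $E_i^{(n)}=E_i^n/[n]_i^!$, $F_i^{(n)}=F_i^n/[n]_i^!$. Category $\mathcal C$: $\mathbb Z_2$-graded $\mathbf U$-modules $M=M_{\bar0}\oplus M_{\bar1}$ (compatible with the grading of $\mathbf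 U$) with $M=\bigoplus_{\lambda\in X}M^\lambda$, $M^\lambda=\{m\mid K_\mu m=q^{\langle\mu,\lambda\rangle}m,\ J_\mu m=\pi^{\langle\mu,\lambda\rangle}m\ \forall\mu\in Y\}$, each $M^\lambda$ being $\mathbb Z_2$-graded; the $\mathbb Z_2$-grading is suppressed in the statement. $M_\pm=(\pi\pm1)M$, so that $M=M_+\oplus M_-$ and $\pi$ acts as $\pm1$ on $M_\pm$. $\mathcal O$: the full subcategory of those $M$ such that for each $m\in M$ there is $n\ge0$ with $x^+m=0$ for all $x\in\mathbf f_\nu$ with $\mathrm{ht}\,\nu\ge n$. $M$ is integrable if for any $m\in M$, $i\in I$ there is $n_0\ge1$ with $E_i^{(n)}m=F_i^{(n)}m=0$ for all $n\ge n_0$; $\mathcal C_{\mathrm{int}}$ is the full subcategory of integrable modules and $\mathcal O_{\mathrm{int}}=\mathcal O\cap\mathcal C_{\mathrm{int}}$. The Verma module $M(\lambda)$ is $\mathbf f$ with the unique $\mathbf U$-module structure such that $K_\mu y=q^{\langle\mu,\lambda-|y|\rangle}y$, $J_\mu y=\pi^{\langle\mu,\lambda-|y|\rangle}y$, $F_iy=\theta_iy$, $E_i1=0$. For $\lambda\in X^+$, the left ideal $\mathcal T$ of $\mathbf f$ generated by $\theta_i^{\langle i,\lambda\rangle+1}$ $(i\in I)$ is a $\mathbf U$-submodule of $M(\lambda)$, and $V(\lambda)=M(\lambda)/\mathcal T$, which is integrable.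
   Formalization: Adds the hypothesis that (d_i − p(i))⟨i,λ⟩ is even for all i in I, λ in X (implied by d_i ≡ p(i) mod 2); without it T is not a U-submodule of M(λ) for some λ in X⁺, so V(λ) is undefined (e.g. I={i} odd, d_i=2, ⟨i,λ⟩=1). *)

theory Defs
  imports
    "HOL-Computational_Algebra.Polynomial"
    "HOL-Computational_Algebra.Fraction_Field"
    "HOL-Library.Poly_Mapping"
    "HOL-Algebra.Module"
    "HOL-Algebra.QuotRing"
begin

section \<open>The ground ring \<open>\<rat>(q)[\<pi>]/(\<pi>\<^sup>2 - 1)\<close>\<close>

lemma equivp_dvd_diff: "equivp (\<lambda>p r. m dvd p - r)" for m :: "'a::comm_ring_1"
proof (rule equivpI)
  show "reflp (\<lambda>p r. m dvd p - r)" by (rule reflpI) simp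
  show "symp (\<lambda>p r. m dvd p - r)" by (rule sympI) (metis dvd_minus_iff minus_diff_eq)
  show "transp (\<lambda>p r. m dvd p - r)"
  proof (rule transpI)
    fix x y z assume "m dvd x - y" "m dvd y - z"
    then have "m dvd (x - y) + (y - z)" by (rule dvd_add)
    then show "m dvd x - z" by simp
  qed
qed

quotient_type qpi = "rat poly fract poly" / "\<lambda>p r. [:-1, 0, 1:] dvd p - r"
  by (rule equivp_dvd_diff)

instantiation qpi :: comm_ring_1
begin

lift_definition zero_qpi :: qpi is 0 .
lift_definition one_qpi :: qpi is 1 .

lift_definition plus_qpi :: "qpi \<Rightarrow> qpi \<Rightarrow> qpi" is "(+)"
  by (simp only: add_diff_add dvd_add)

lift_definition uminus_qpi :: "qpi \<Rightarrow> qpi" is uminus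
  by (simp only: minus_diff_minus dvd_minus_iff)

lift_definition minus_qpi :: "qpi \<Rightarrow> qpi \<Rightarrow> qpi" is "(-)"
proof -
  fix a b c d :: "rat poly fract poly"
  assume "[:-1, 0, 1:] dvd a - b" "[:-1, 0, 1:] dvd c - d"
  then have "[:-1, 0, 1:] dvd (a - b) - (c - d)" by (rule dvd_diff)
  moreover have "(a - b) - (c - d) = (a - c) - (b - d)" by (simp add: algebra_simps)
  ultimately show "[:-1, 0, 1:] dvd (a - c) - (b - d)" by (simp only:)
qed

lift_definition times_qpi :: "qpi \<Rightarrow> qpi \<Rightarrow> qpi" is "(*)"
proof -
  fix a b c d :: "rat poly fract poly"
  assume "[:-1, 0, 1:] dvd a - b" "[:-1, 0, 1:] dvd c - d"
  then have "[:-1, 0, 1:] dvd (a - b) * c + b * (c - d)"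
    by (intro dvd_add dvd_mult dvd_mult2)
  moreover have "(a - b) * c + b * (c - d) = a * c - b * d" by (simp add: algebra_simps)
  ultimately show "[:-1, 0, 1:] dvd a * c - b * d" by (simp only:)
qed

instance
proof
  fix a b c :: qpi
  show "a * b * c = a * (b * c)" by transfer (simp only: mult.assoc diff_self dvd_0_right)
  show "a * b = b * a" by transfer (simp only: mult.commute diff_self dvd_0_right)
  show "1 * a = a" by transfer simp
  show "a + b + c = a + (b + c)" by transfer (simp only: add.assoc diff_self dvd_0_right)
  show "a + b = b + a" by transfer (simp only: add.commute diff_self dvd_0_right)
  show "0 + a = a" by transfer simp
  show "- a + a = 0" by transfer simp
  show "a - b = a + - b" by transfer simp
  show "(a + b) * c = a * c + b * c"
    by transfer (simp only: distrib_right diff_self dvd_0_right)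
  show "(0::qpi) \<noteq> 1"
  proof transfer
    have "\<not> [:-1, 0, 1:] dvd (1 :: rat poly fract poly)"
    proof
      assume "[:-1, 0, 1:] dvd (1 :: rat poly fract poly)"
      then have "degree [:-1, 0, 1 :: rat poly fract:] \<le> degree (1 :: rat poly fract poly)"
        by (rule dvd_imp_degree_le) simp
      then show False by simp
    qed
    then show "\<not> [:-1, 0, 1:] dvd (0 - 1 :: rat poly fract poly)"
      by (metis diff_0 dvd_minus_iff)
  qed
qed

end

text \<open>The ring has zero divisors, since \<open>(\<pi> - 1) (\<pi> + 1) = 0\<close>. The inverse of a unit is
  the true inverse, all non-units are sent to \<open>0\<close>. Inverses are only ever taken of units below.\<close>

instantiation qpi :: inverse
begin
definition inverse_qpi :: "qpi \<Rightarrow> qpi" where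
  "inverse_qpi x = (if x dvd 1 then THE y. x * y = 1 else 0)"
definition divide_qpi :: "qpi \<Rightarrow> qpi \<Rightarrow> qpi" where
  "divide_qpi x y = x * inverse y"
instance ..
end

lift_definition q_elt :: qpi is "[:Fract [:0, 1:] 1:]" .
lift_definition pi_elt :: qpi is "[:0, 1:]" .


section \<open>Super Cartan data and root data\<close>

text \<open>The finite set \<open>I\<close> and the groups \<open>Y\<close>, \<open>X\<close> are types. An element of \<open>\<int>[I]\<close> is a function
  \<open>'i \<Rightarrow> int\<close>, and the form on \<open>\<int>[I]\<close> is given by its values on \<open>I\<close>.\<close>

record ('i, 'y, 'x) root_data =
  odd_part :: "'i set"
  dot :: "'i \<Rightarrow> 'i \<Rightarrow> int"
  pairing :: "'y \<Rightarrow> 'x \<Rightarrow> int"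
  coroot :: "'i \<Rightarrow> 'y"
  root :: "'i \<Rightarrow> 'x"

definition dd :: "('i, 'y, 'x) root_data \<Rightarrow> 'i \<Rightarrow> int" where
  "dd D i = dot D i i div 2"

definition par :: "('i, 'y, 'x) root_data \<Rightarrow> 'i \<Rightarrow> int" where
  "par D i = (if i \<in> odd_part D then 1 else 0)"

definition super_cartan_datum :: "('i::finite, 'y, 'x) root_data \<Rightarrow> bool" where
  "super_cartan_datum D \<longleftrightarrow>
     odd_part D \<noteq> {} \<and>
     (\<forall>i j. dot D i j = dot D j i) \<and>
     (\<forall>i. even (dot D i i) \<and> dd D i > 0) \<and>
     (\<forall>i j. i \<noteq> j \<longrightarrow> dot D i i dvd 2 * dot D i j \<and> 2 * dot D i j div dot D i i \<le> 0) \<and>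
     (\<forall>i\<in>odd_part D. \<forall>j. even (2 * dot D i j div dot D i i))"

definition zscale :: "int \<Rightarrow> 'a::ab_group_add \<Rightarrow> 'a" where
  "zscale k x = (if 0 \<le> k then ((+) x ^^ nat k) 0 else - ((+) x ^^ nat (- k)) 0)"

definition fg_free_abelian :: "'a::ab_group_add itself \<Rightarrow> bool" where
  "fg_free_abelian _ \<longleftrightarrow>
     (\<exists>B :: 'a set. finite B \<and> \<not> Modules.module.dependent zscale B \<and>
        Modules.module.span zscale B = UNIV)"

definition perfect_pairing :: "('y::ab_group_add \<Rightarrow> 'x::ab_group_add \<Rightarrow> int) \<Rightarrow> bool" where
  "perfect_pairing b \<longleftrightarrow>
     (\<forall>y. additive (b y)) \<and> (\<forall>x. additive (\<lambda>y. b y x)) \<and>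
     bij_betw b UNIV {g. additive g} \<and>
     bij_betw (\<lambda>x y. b y x) UNIV {g. additive g}"

definition root_datum :: "('i::finite, 'y::ab_group_add, 'x::ab_group_add) root_data \<Rightarrow> bool" where
  "root_datum D \<longleftrightarrow>
     fg_free_abelian TYPE('y) \<and> fg_free_abelian TYPE('x) \<and>
     perfect_pairing (pairing D) \<and>
     inj (coroot D) \<and> \<not> Modules.module.dependent zscale (range (coroot D)) \<and>
     inj (root D) \<and> \<not> Modules.module.dependent zscale (range (root D)) \<and>
     (\<forall>i j. pairing D (coroot D i) (root D j) * dot D i i = 2 * dot D i j)"

text \<open>This condition follows from \<open>d\<^sub>i \<equiv> p(i) (mod 2)\<close>. It says that the action of
  \<open>J\<close> at \<open>d\<^sub>i i\<close> on weight \<open>\<lambda>\<close>, by the power \<open>d\<^sub>i \<langle>i, \<lambda>\<rangle>\<close> of \<open>\<pi>\<close>, is by the power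
  \<open>\<langle>i, \<lambda>\<rangle>\<close> of \<open>\<pi>\<^sub>i\<close>. Whenever it fails, the left ideal \<open>\<T>\<close> defining \<open>V(\<lambda>)\<close> is not a
  submodule of the Verma module for some dominant \<open>\<lambda>\<close>. For example, if \<open>I = {i}\<close> is odd,
  \<open>d\<^sub>i = 2\<close> and \<open>\<langle>i, \<lambda>\<rangle> = 1\<close>, then
  \<open>E\<^sub>i \<theta>\<^sub>i\<^sup>2 = (\<pi> - 1) (q\<^sup>2 - q\<^sup>-\<^sup>2) / (\<pi> q\<^sup>2 - q\<^sup>-\<^sup>2) \<theta>\<^sub>i\<close>, which is not in \<open>\<T> = \<f> \<theta>\<^sub>i\<^sup>2\<close>.\<close>

definition parity_compatible :: "('i, 'y, 'x) root_data \<Rightarrow> bool" where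
  "parity_compatible D \<longleftrightarrow>
     (\<forall>i l. even ((dd D i - par D i) * pairing D (coroot D i) l))"

definition dominant :: "('i, 'y, 'x) root_data \<Rightarrow> 'x set" where
  "dominant D = {l. \<forall>i. 0 \<le> pairing D (coroot D i) l}"

definition zdot :: "('i::finite, 'y, 'x) root_data \<Rightarrow> ('i \<Rightarrow> int) \<Rightarrow> ('i \<Rightarrow> int) \<Rightarrow> int" where
  "zdot D a b = (\<Sum>i\<in>UNIV. \<Sum>j\<in>UNIV. a i * b j * dot D i j)"

definition zpar :: "('i::finite, 'y, 'x) root_data \<Rightarrow> ('i \<Rightarrow> int) \<Rightarrow> int" where
  "zpar D a = (\<Sum>i\<in>UNIV. a i * par D i)"

definition height :: "('i::finite \<Rightarrow> int) \<Rightarrow> int" where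
  "height a = (\<Sum>i\<in>UNIV. a i)"

definition zroot :: "('i::finite, 'y, 'x::ab_group_add) root_data \<Rightarrow> ('i \<Rightarrow> int) \<Rightarrow> 'x" where
  "zroot D a = (\<Sum>i\<in>UNIV. zscale (a i) (root D i))"

definition q_i :: "('i, 'y, 'x) root_data \<Rightarrow> 'i \<Rightarrow> qpi" where
  "q_i D i = q_elt powi dd D i"

definition pi_i :: "('i, 'y, 'x) root_data \<Rightarrow> 'i \<Rightarrow> qpi" where
  "pi_i D i = pi_elt powi par D i"

definition qint :: "('i, 'y, 'x) root_data \<Rightarrow> 'i \<Rightarrow> nat \<Rightarrow> qpi" where
  "qint D i n = ((pi_i D i * q_i D i) ^ n - q_i D i powi (- int n)) /
                (pi_i D i * q_i D i - q_i D i powi (- 1))"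

definition qfact :: "('i, 'y, 'x) root_data \<Rightarrow> 'i \<Rightarrow> nat \<Rightarrow> qpi" where
  "qfact D i n = (\<Prod>s=1..n. qint D i s)"


section \<open>Free algebras\<close>

text \<open>The free associative algebra on \<open>'g\<close> is the monoid algebra of the free monoid, with the
  convolution product of \<^typ>\<open>'a \<Rightarrow>\<^sub>0 'b\<close>. A separate type of words avoids a global
  instance of \<^class>\<open>monoid_add\<close> for lists.\<close>

datatype 'g free_monoid = FM (letters: "'g list")

instantiation free_monoid :: (type) monoid_add
begin
definition zero_free_monoid :: "'a free_monoid" where "0 = FM []"
definition plus_free_monoid :: "'a free_monoid \<Rightarrow> 'a free_monoid \<Rightarrow> 'a free_monoid" where
  "v + w = FM (letters v @ letters w)"
instance by standard (simp_all add: zero_free_monoid_def plus_free_monoid_def)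
end

type_synonym 'g free_alg = "'g free_monoid \<Rightarrow>\<^sub>0 qpi"

definition gen :: "'g \<Rightarrow> 'g free_alg" where
  "gen g = Poly_Mapping.single (FM [g]) 1"

definition const :: "qpi \<Rightarrow> 'g free_alg" where
  "const c = Poly_Mapping.single 0 c"

definition subst_gen :: "('g \<Rightarrow> 'h) \<Rightarrow> 'g free_alg \<Rightarrow> 'h free_alg" where
  "subst_gen h x = (\<Sum>w\<in>Poly_Mapping.keys x.
     Poly_Mapping.single (FM (map h (letters w))) (Poly_Mapping.lookup x w))"

definition class_ring :: "'a::ring_1 ring" where
  "class_ring = \<lparr>carrier = UNIV, mult = (*), one = 1, zero = 0, add = (+)\<rparr>"


section \<open>The bilinear form and the algebra \<open>\<f>\<close>\<close>

definition wt :: "'i free_monoid \<Rightarrow> 'i \<Rightarrow> int" where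
  "wt w i = int (count_list (letters w) i)"

definition weight_part :: "('i \<Rightarrow> int) \<Rightarrow> 'i free_alg set" where
  "weight_part a = {x. \<forall>w\<in>Poly_Mapping.keys x. wt w = a}"

text \<open>The tensor square of the free algebra is the free module on pairs of words.\<close>

type_synonym 'i tensor2 = "('i free_monoid \<times> 'i free_monoid) \<Rightarrow>\<^sub>0 qpi"

definition tens :: "'i free_alg \<Rightarrow> 'i free_alg \<Rightarrow> 'i tensor2" where
  "tens x y = (\<Sum>v\<in>Poly_Mapping.keys x. \<Sum>w\<in>Poly_Mapping.keys y.
     Poly_Mapping.single (v, w) (Poly_Mapping.lookup x v * Poly_Mapping.lookup y w))"

definition tens_mult ::
    "('i::finite, 'y, 'x) root_data \<Rightarrow> 'i tensor2 \<Rightarrow> 'i tensor2 \<Rightarrow> 'i tensor2" where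
  "tens_mult D s t = (\<Sum>(v1, v2)\<in>Poly_Mapping.keys s. \<Sum>(w1, w2)\<in>Poly_Mapping.keys t.
     Poly_Mapping.single (v1 + w1, v2 + w2)
       (Poly_Mapping.lookup s (v1, v2) * Poly_Mapping.lookup t (w1, w2) *
        q_elt powi zdot D (wt v2) (wt w1) *
        pi_elt powi (zpar D (wt v2) * zpar D (wt w1))))"

primrec coprod_word :: "('i::finite, 'y, 'x) root_data \<Rightarrow> 'i list \<Rightarrow> 'i tensor2" where
  "coprod_word D [] = tens 1 1"
| "coprod_word D (i # is) =
     tens_mult D (tens (gen i) 1 + tens 1 (gen i)) (coprod_word D is)"

definition coprod :: "('i::finite, 'y, 'x) root_data \<Rightarrow> 'i free_alg \<Rightarrow> 'i tensor2" where
  "coprod D x = (\<Sum>w\<in>Poly_Mapping.keys x.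
     Poly_Mapping.map ((*) (Poly_Mapping.lookup x w)) (coprod_word D (letters w)))"

definition tens_form ::
    "('i free_alg \<Rightarrow> 'i free_alg \<Rightarrow> qpi) \<Rightarrow> 'i tensor2 \<Rightarrow> 'i tensor2 \<Rightarrow> qpi" where
  "tens_form B s t = (\<Sum>(v1, v2)\<in>Poly_Mapping.keys s. \<Sum>(w1, w2)\<in>Poly_Mapping.keys t.
     Poly_Mapping.lookup s (v1, v2) * Poly_Mapping.lookup t (w1, w2) *
     B (Poly_Mapping.single v1 1) (Poly_Mapping.single w1 1) *
     B (Poly_Mapping.single v2 1) (Poly_Mapping.single w2 1))"

definition is_free_form ::
    "('i::finite, 'y, 'x) root_data \<Rightarrow> ('i free_alg \<Rightarrow> 'i free_alg \<Rightarrow> qpi) \<Rightarrow> bool" where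
  "is_free_form D B \<longleftrightarrow>
     (\<forall>x x' y. B (x + x') y = B x y + B x' y) \<and>
     (\<forall>x y y'. B x (y + y') = B x y + B x y') \<and>
     (\<forall>c x y. B (const c * x) y = c * B x y) \<and>
     (\<forall>c x y. B x (const c * y) = c * B x y) \<and>
     B 1 1 = 1 \<and>
     (\<forall>i j. B (gen i) (gen j) = (if i = j then inverse (1 - pi_i D i * q_i D i powi (- 2)) else 0)) \<and>
     (\<forall>x y y'. B x (y * y') = tens_form B (coprod D x) (tens y y')) \<and>
     (\<forall>x x' y. B (x * x') y = tens_form B (tens x x') (coprod D y))"

definition free_form ::
    "('i::finite, 'y, 'x) root_data \<Rightarrow> 'i free_alg \<Rightarrow> 'i free_alg \<Rightarrow> qpi" where
  "free_form D = (THE B. is_free_form D B)"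

definition radical :: "('i::finite, 'y, 'x) root_data \<Rightarrow> 'i free_alg set" where
  "radical D = {x. \<forall>y. free_form D x y = 0}"

definition f_alg :: "('i::finite, 'y, 'x) root_data \<Rightarrow> 'i free_alg set ring" where
  "f_alg D = class_ring Quot radical D"

definition f_cls :: "('i::finite, 'y, 'x) root_data \<Rightarrow> 'i free_alg \<Rightarrow> 'i free_alg set" where
  "f_cls D x = radical D +>\<^bsub>class_ring\<^esub> x"

definition f_weight :: "('i::finite, 'y, 'x) root_data \<Rightarrow> ('i \<Rightarrow> int) \<Rightarrow> 'i free_alg set set" where
  "f_weight D a = f_cls D ` weight_part a"


section \<open>The quantum covering group\<close>

datatype ('i, 'y) u_gen = GE 'i | GF 'i | GJ 'y | GK 'y

type_synonym ('i, 'y) u_elt = "('i, 'y) u_gen free_alg set"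

definition u_relators ::
    "('i::finite, 'y::ab_group_add, 'x) root_data \<Rightarrow> ('i, 'y) u_gen free_alg set" where
  "u_relators D = (let E = \<lambda>i. gen (GE i); F = \<lambda>i. gen (GF i); J = \<lambda>m. gen (GJ m); K = \<lambda>m. gen (GK m);
       h = coroot D; e = \<lambda>m i. pairing D m (root D i) in
     {K 0 - 1} \<union> {K m * K m' - K (m + m') |m m'. True} \<union>
     {J (m + m) - 1 |m. True} \<union> {J m * J m' - J (m + m') |m m'. True} \<union>
     {J m * K m' - K m' * J m |m m'. True} \<union>
     {K m * E i - const (q_elt powi e m i) * E i * K m |m i. True} \<union>
     {J m * E i - const (pi_elt powi e m i) * E i * J m |m i. True} \<union>
     {K m * F i - const (q_elt powi (- e m i)) * F i * K m |m i. True} \<union>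
     {J m * F i - const (pi_elt powi (- e m i)) * F i * J m |m i. True} \<union>
     {E i * F j - const (pi_elt powi (par D i * par D j)) * F j * E i
        - (if i = j then const (1 / (pi_i D i * q_i D i - q_i D i powi (- 1))) *
             (J (zscale (dd D i) (h i)) * K (zscale (dd D i) (h i)) - K (zscale (- dd D i) (h i)))
           else 0) |i j. True} \<union>
     subst_gen GE ` radical D \<union> subst_gen GF ` radical D)"

definition u_ideal ::
    "('i::finite, 'y::ab_group_add, 'x) root_data \<Rightarrow> ('i, 'y) u_gen free_alg set" where
  "u_ideal D = Idl\<^bsub>class_ring\<^esub> (u_relators D)"

definition u_alg :: "('i::finite, 'y::ab_group_add, 'x) root_data \<Rightarrow> ('i, 'y) u_elt ring" where
  "u_alg D = class_ring Quot u_ideal D"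

definition u_cls ::
    "('i::finite, 'y::ab_group_add, 'x) root_data \<Rightarrow> ('i, 'y) u_gen free_alg \<Rightarrow> ('i, 'y) u_elt" where
  "u_cls D x = u_ideal D +>\<^bsub>class_ring\<^esub> x"

text \<open>The homomorphism \<open>x \<mapsto> x\<^sup>+\<close>. The set below is a singleton, because \<^const>\<open>u_relators\<close>
  contains the image of the radical.\<close>

definition f_plus ::
    "('i::finite, 'y::ab_group_add, 'x) root_data \<Rightarrow> 'i free_alg set \<Rightarrow> ('i, 'y) u_elt" where
  "f_plus D A = the_elem ((\<lambda>x. u_cls D (subst_gen GE x)) ` A)"

definition gen_odd :: "('i, 'y, 'x) root_data \<Rightarrow> ('i, 'y) u_gen \<Rightarrow> bool" where
  "gen_odd D g \<longleftrightarrow> (\<exists>i\<in>odd_part D. g = GE i \<or> g = GF i)"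

text \<open>\<open>u_part D False\<close> and \<open>u_part D True\<close> are the even and the odd part.\<close>

definition u_part ::
    "('i::finite, 'y::ab_group_add, 'x) root_data \<Rightarrow> bool \<Rightarrow> ('i, 'y) u_elt set" where
  "u_part D b = u_cls D ` {x. \<forall>w\<in>Poly_Mapping.keys x.
     odd (length (filter (gen_odd D) (letters w))) = b}"


section \<open>Modules over a noncommutative ring\<close>

text \<open>The locale \<open>module\<close> of HOL-Algebra requires a commutative base ring. Its record type and
  its locale \<^locale>\<open>submodule\<close> do not, and are reused.\<close>

locale left_module = R?: ring R + M?: abelian_group M for R (structure) and M (structure) +
  assumes "\<lbrakk>a \<in> carrier R; x \<in> carrier M\<rbrakk> \<Longrightarrow> a \<odot>\<^bsub>M\<^esub> x \<in> carrier M"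
    and "\<lbrakk>a \<in> carrier R; b \<in> carrier R; x \<in> carrier M\<rbrakk> \<Longrightarrow>
      (a \<oplus> b) \<odot>\<^bsub>M\<^esub> x = a \<odot>\<^bsub>M\<^esub> x \<oplus>\<^bsub>M\<^esub> b \<odot>\<^bsub>M\<^esub> x"
    and "\<lbrakk>a \<in> carrier R; x \<in> carrier M; y \<in> carrier M\<rbrakk> \<Longrightarrow>
      a \<odot>\<^bsub>M\<^esub> (x \<oplus>\<^bsub>M\<^esub> y) = a \<odot>\<^bsub>M\<^esub> x \<oplus>\<^bsub>M\<^esub> a \<odot>\<^bsub>M\<^esub> y"
    and "\<lbrakk>a \<in> carrier R; b \<in> carrier R; x \<in> carrier M\<rbrakk> \<Longrightarrow>
      (a \<otimes> b) \<odot>\<^bsub>M\<^esub> x = a \<odot>\<^bsub>M\<^esub> (b \<odot>\<^bsub>M\<^esub> x)"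
    and "x \<in> carrier M \<Longrightarrow> \<one> \<odot>\<^bsub>M\<^esub> x = x"

definition quot_module :: "('r, 'm) module \<Rightarrow> 'm set \<Rightarrow> ('r, 'm set) module" where
  "quot_module M N = \<lparr>carrier = a_rcosets\<^bsub>M\<^esub> N, mult = undefined, one = undefined,
     zero = N, add = set_add M, smult = \<lambda>r A. (\<Union>a\<in>A. N +>\<^bsub>M\<^esub> (r \<odot>\<^bsub>M\<^esub> a))\<rparr>"

definition module_isomorphic :: "'r ring \<Rightarrow> ('r, 'm) module \<Rightarrow> ('r, 'n) module \<Rightarrow> bool" where
  "module_isomorphic R M N \<longleftrightarrow> (\<exists>h. bij_betw h (carrier M) (carrier N) \<and>
     (\<forall>x\<in>carrier M. \<forall>y\<in>carrier M. h (x \<oplus>\<^bsub>M\<^esub> y) = h x \<oplus>\<^bsub>N\<^esub> h y) \<and>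
     (\<forall>r\<in>carrier R. \<forall>x\<in>carrier M. h (r \<odot>\<^bsub>M\<^esub> x) = r \<odot>\<^bsub>N\<^esub> h x))"

text \<open>\<open>M\<close> is the internal direct sum of the subgroups \<open>N k\<close>, \<open>k \<in> S\<close>.\<close>

definition internal_direct_sum :: "('r, 'm) module \<Rightarrow> 'k set \<Rightarrow> ('k \<Rightarrow> 'm set) \<Rightarrow> bool" where
  "internal_direct_sum M S N \<longleftrightarrow>
     (\<forall>k\<in>S. additive_subgroup (N k) M) \<and>
     (\<forall>m\<in>carrier M. \<exists>!c. (\<forall>k\<in>S. c k \<in> N k) \<and> (\<forall>k. k \<notin> S \<longrightarrow> c k = \<zero>\<^bsub>M\<^esub>) \<and>
        finite {k. c k \<noteq> \<zero>\<^bsub>M\<^esub>} \<and> m = (\<Oplus>\<^bsub>M\<^esub>k\<in>{k. c k \<noteq> \<zero>\<^bsub>M\<^esub>}. c k))"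


section \<open>Categories of modules\<close>

definition weight_space ::
    "('i::finite, 'y::ab_group_add, 'x) root_data \<Rightarrow> (('i, 'y) u_elt, 'm) module \<Rightarrow> 'x \<Rightarrow> 'm set" where
  "weight_space D M l = {m \<in> carrier M. \<forall>\<mu>.
     u_cls D (gen (GK \<mu>)) \<odot>\<^bsub>M\<^esub> m = u_cls D (const (q_elt powi pairing D \<mu> l)) \<odot>\<^bsub>M\<^esub> m \<and>
     u_cls D (gen (GJ \<mu>)) \<odot>\<^bsub>M\<^esub> m = u_cls D (const (pi_elt powi pairing D \<mu> l)) \<odot>\<^bsub>M\<^esub> m}"

text \<open>\<open>G False\<close> and \<open>G True\<close> are the even and the odd part of the module.\<close>

definition in_C ::
    "('i::finite, 'y::ab_group_add, 'x) root_data \<Rightarrow> (('i, 'y) u_elt, 'm) module \<Rightarrow> bool" where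
  "in_C D M \<longleftrightarrow> left_module (u_alg D) M \<and>
     internal_direct_sum M UNIV (weight_space D M) \<and>
     (\<exists>G :: bool \<Rightarrow> 'm set. internal_direct_sum M UNIV G \<and>
        (\<forall>a b. \<forall>u\<in>u_part D a. \<forall>m\<in>G b. u \<odot>\<^bsub>M\<^esub> m \<in> G (a \<noteq> b)) \<and>
        (\<forall>l. \<forall>m\<in>weight_space D M l. \<exists>x\<in>weight_space D M l \<inter> G False.
           \<exists>y\<in>weight_space D M l \<inter> G True. m = x \<oplus>\<^bsub>M\<^esub> y))"

definition in_O ::
    "('i::finite, 'y::ab_group_add, 'x) root_data \<Rightarrow> (('i, 'y) u_elt, 'm) module \<Rightarrow> bool" where
  "in_O D M \<longleftrightarrow> in_C D M \<and>
     (\<forall>m\<in>carrier M. \<exists>n::nat. \<forall>a. int n \<le> height a \<longrightarrow>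
        (\<forall>x\<in>f_weight D a. f_plus D x \<odot>\<^bsub>M\<^esub> m = \<zero>\<^bsub>M\<^esub>))"

definition divided_power ::
    "('i::finite, 'y::ab_group_add, 'x) root_data \<Rightarrow> ('i \<Rightarrow> ('i, 'y) u_gen) \<Rightarrow> 'i \<Rightarrow> nat \<Rightarrow> ('i, 'y) u_elt" where
  "divided_power D g i n = u_cls D (const (1 / qfact D i n) * gen (g i) ^ n)"

definition integrable_module ::
    "('i::finite, 'y::ab_group_add, 'x) root_data \<Rightarrow> (('i, 'y) u_elt, 'm) module \<Rightarrow> bool" where
  "integrable_module D M \<longleftrightarrow>
     (\<forall>m\<in>carrier M. \<forall>i. \<exists>n0\<ge>1. \<forall>n\<ge>n0.
        divided_power D GE i n \<odot>\<^bsub>M\<^esub> m = \<zero>\<^bsub>M\<^esub> \<and> divided_power D GF i n \<odot>\<^bsub>M\<^esub> m = \<zero>\<^bsub>M\<^esub>)"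

definition in_O_int ::
    "('i::finite, 'y::ab_group_add, 'x) root_data \<Rightarrow> (('i, 'y) u_elt, 'm) module \<Rightarrow> bool" where
  "in_O_int D M \<longleftrightarrow> in_O D M \<and> integrable_module D M"

text \<open>Every submodule \<open>N\<close> of an object of \<open>\<O>\<^sub>i\<^sub>n\<^sub>t\<close> is the sum of its weight spaces, and the
  weights provide a compatible grading of \<open>N\<close> (by parity on each coset of \<open>\<int>[I]\<close> in \<open>X\<close>), so
  all submodules are objects.\<close>

definition simple_in_O_int ::
    "('i::finite, 'y::ab_group_add, 'x) root_data \<Rightarrow> (('i, 'y) u_elt, 'm) module \<Rightarrow> bool" where
  "simple_in_O_int D M \<longleftrightarrow> in_O_int D M \<and> carrier M \<noteq> {\<zero>\<^bsub>M\<^esub>} \<and>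
     (\<forall>N. submodule N (u_alg D) M \<longrightarrow> N = {\<zero>\<^bsub>M\<^esub>} \<or> N = carrier M)"

definition pi_plus_part ::
    "('i::finite, 'y::ab_group_add, 'x) root_data \<Rightarrow> (('i, 'y) u_elt, 'm) module \<Rightarrow> (('i, 'y) u_elt, 'm) module" where
  "pi_plus_part D M = M\<lparr>carrier := (\<lambda>m. u_cls D (const (pi_elt + 1)) \<odot>\<^bsub>M\<^esub> m) ` carrier M\<rparr>"

definition pi_minus_part ::
    "('i::finite, 'y::ab_group_add, 'x) root_data \<Rightarrow> (('i, 'y) u_elt, 'm) module \<Rightarrow> (('i, 'y) u_elt, 'm) module" where
  "pi_minus_part D M = M\<lparr>carrier := (\<lambda>m. u_cls D (const (pi_elt - 1)) \<odot>\<^bsub>M\<^esub> m) ` carrier M\<rparr>"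


section \<open>Verma modules and the modules \<open>V(\<lambda>)\<close>\<close>

definition f_module ::
    "('i::finite, 'y, 'x) root_data \<Rightarrow> ('r \<Rightarrow> 'i free_alg set \<Rightarrow> 'i free_alg set) \<Rightarrow> ('r, 'i free_alg set) module" where
  "f_module D act = \<lparr>carrier = carrier (f_alg D), mult = mult (f_alg D), one = one (f_alg D),
     zero = zero (f_alg D), add = add (f_alg D), smult = act\<rparr>"

definition is_verma_action ::
    "('i::finite, 'y::ab_group_add, 'x::ab_group_add) root_data \<Rightarrow> 'x \<Rightarrow>
     (('i, 'y) u_elt \<Rightarrow> 'i free_alg set \<Rightarrow> 'i free_alg set) \<Rightarrow> bool" where
  "is_verma_action D l act \<longleftrightarrow>
     left_module (u_alg D) (f_module D act) \<and>
     (\<forall>c. \<forall>y\<in>carrier (f_alg D). act (u_cls D (const c)) y = f_cls D (const c) \<otimes>\<^bsub>f_alg D\<^esub> y) \<and>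
     (\<forall>a. \<forall>y\<in>f_weight D a. \<forall>\<mu>.
        act (u_cls D (gen (GK \<mu>))) y =
          f_cls D (const (q_elt powi pairing D \<mu> (l - zroot D a))) \<otimes>\<^bsub>f_alg D\<^esub> y \<and>
        act (u_cls D (gen (GJ \<mu>))) y =
          f_cls D (const (pi_elt powi pairing D \<mu> (l - zroot D a))) \<otimes>\<^bsub>f_alg D\<^esub> y) \<and>
     (\<forall>i. \<forall>y\<in>carrier (f_alg D). act (u_cls D (gen (GF i))) y = f_cls D (gen i) \<otimes>\<^bsub>f_alg D\<^esub> y) \<and>
     (\<forall>i. act (u_cls D (gen (GE i))) \<one>\<^bsub>f_alg D\<^esub> = \<zero>\<^bsub>f_alg D\<^esub>)"

text \<open>The action is unique on the carriers; its values elsewhere are irrelevant.\<close>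

definition verma ::
    "('i::finite, 'y::ab_group_add, 'x::ab_group_add) root_data \<Rightarrow> 'x \<Rightarrow>
     (('i, 'y) u_elt, 'i free_alg set) module" where
  "verma D l = f_module D (SOME act. is_verma_action D l act)"

definition T_ideal ::
    "('i::finite, 'y, 'x) root_data \<Rightarrow> 'x \<Rightarrow> 'i free_alg set set" where
  "T_ideal D l = \<Inter>{H. additive_subgroup H (f_alg D) \<and>
     (\<forall>r\<in>carrier (f_alg D). \<forall>x\<in>H. r \<otimes>\<^bsub>f_alg D\<^esub> x \<in> H) \<and>
     (\<forall>i. f_cls D (gen i ^ (nat (pairing D (coroot D i) l) + 1)) \<in> H)}"

definition V_module ::
    "('i::finite, 'y::ab_group_add, 'x::ab_group_add) root_data \<Rightarrow> 'x \<Rightarrow>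
     (('i, 'y) u_elt, 'i free_alg set set) module" where
  "V_module D l = quot_module (verma D l) (T_ideal D l)"

abbreviation V_plus where "V_plus D l \<equiv> pi_plus_part D (V_module D l)"
abbreviation V_minus where "V_minus D l \<equiv> pi_minus_part D (V_module D l)"

end

theory Submission imports Defs begin

text \<open>
  The relation \<open>E\<^sub>i y\<^sup>- v = (D y)\<^sup>- v\<close> for a singular vector \<open>v\<close>, with an explicit skew derivation \<open>D\<close>
  that preserves the radical of the form, gives the Verma modules, and shows that every vector of
  weight \<open>\<lambda>\<close> killed by all \<open>E\<^sub>i\<close> and \<open>F\<^sub>i\<close>-powers of exponent \<open>\<langle>i,\<lambda>\<rangle> + 1\<close> generates a quotient of \<open>V(\<lambda>)\<close>.

  The form on a weight space of \<open>'\<f>\<close> may be degenerate, but its Gram matrix has a generalised inverse,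
  from which a quantum Casimir operator is built. Multiplied by a scalar \<open>\<gamma>(\<mu>)\<close> on the weight space
  \<open>\<mu>\<close>, it commutes with all \<open>E\<^sub>i\<close> and \<open>F\<^sub>i\<close>, and it acts on the module generated by a singular vector of
  weight \<open>\<mu>\<close> by \<open>\<gamma>(\<mu>)\<close>. If \<open>\<mu> < \<lambda>\<close> are both dominant, then \<open>\<gamma>(\<mu>) - \<gamma>(\<lambda>)\<close> is a unit. Hence a nonzero
  submodule of a highest weight module in \<open>\<O>\<^sub>i\<^sub>n\<^sub>t\<close>, which always contains a singular vector, contains a
  nonzero multiple \<open>c v\<close> of the generator; on the summands \<open>V(\<lambda>)\<^sub>\<plusminus>\<close> the ground ring acts through a
  field, so that \<open>v\<close> is a multiple of \<open>c v\<close>.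

  For complete reducibility, let \<open>M'\<close> be the sum of a maximal independent family of simple
  submodules generated by singular eigenvectors of \<open>\<pi>\<close>; it contains all singular vectors. If \<open>M' \<noteq> M\<close>,
  some \<open>m \<notin> M'\<close> of weight \<open>\<mu>\<close> satisfies \<open>E\<^sub>i m \<in> M'\<close> for all \<open>i\<close>. Then \<open>\<mu>\<close> is dominant, and a product of
  factors \<open>\<Omega> - \<gamma>(\<lambda>)\<close> over the highest weights \<open>\<lambda> > \<mu>\<close> that occur in the \<open>E\<^sub>i m\<close> turns \<open>m\<close> into a singular
  vector, which lies in \<open>M'\<close>, but is a unit multiple of \<open>m\<close> modulo \<open>M'\<close>.
\<close>

section \<open>The ground ring\<close>

text \<open>Two obstacles shape the proof. The algebra f is known only as a quotient by the radical
  of a form, with no basis at hand, so all computations are done with words of the free algebra, by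
  operators that are shown to preserve the radical. The ground ring has zero divisors, so cancelling
  a scalar needs a unit, or a vector on which pi acts by a sign. The units that occur are built from
  monomials in pi and q, from differences of two such monomials with distinct exponents of q, and
  from 2. The Casimir operator is an infinite sum. Only its truncations lie in the algebra, which is
  why bounds \<open>n\<close> beyond which words in the E kill a vector appear everywhere. Its
  coefficients depend on the weight of the vector acted on, so it is a family of elements indexed by
  weights, and commuting with E_i means passing from the index \<open>\<mu>\<close> to
  \<open>\<mu> + root D i\<close>. Objects of O may have weight spaces of infinite rank. The
  argument therefore avoids characters and duality: eigenvalues of the Casimir operator separate
  highest weights, and Zorn's lemma supplies the family of simple submodules.\<close>

type_synonym qfield = "rat poly fract"

text \<open>The specialisations \<open>\<pi> = 1\<close> and \<open>\<pi> = -1\<close> together identify the ring with \<open>\<rat>(q) \<times> \<rat>(q)\<close>.\<close>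

definition ev_plus :: "qpi \<Rightarrow> qfield" where "ev_plus x = poly (rep_qpi x) 1"
definition ev_minus :: "qpi \<Rightarrow> qfield" where "ev_minus x = poly (rep_qpi x) (-1)"

lemma ev_abs:
  "ev_plus (abs_qpi p) = poly p 1" "ev_minus (abs_qpi p) = poly p (-1)"
proof -
  have "abs_qpi (rep_qpi (abs_qpi p)) = abs_qpi p" by (rule Quotient_abs_rep[OF Quotient_qpi])
  then have "[:-1, 0, 1:] dvd rep_qpi (abs_qpi p) - p" by (simp add: qpi.abs_eq_iff)
  then obtain k where k: "rep_qpi (abs_qpi p) - p = [:-1, 0, 1:] * k" by (auto simp: dvd_def)
  have "poly (rep_qpi (abs_qpi p) - p) 1 = 0" "poly (rep_qpi (abs_qpi p) - p) (-1) = 0"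
    unfolding k poly_mult by simp_all
  then show "ev_plus (abs_qpi p) = poly p 1" "ev_minus (abs_qpi p) = poly p (-1)"
    by (simp_all add: ev_plus_def ev_minus_def)
qed

lemma abs_qpi_cases: obtains p where "x = abs_qpi p"
  by (metis Quotient_abs_rep[OF Quotient_qpi])

lemmas qpi_abs_eqs = zero_qpi.abs_eq one_qpi.abs_eq plus_qpi.abs_eq minus_qpi.abs_eq
  uminus_qpi.abs_eq times_qpi.abs_eq

lemma ev_plus_simps [simp]:
  "ev_plus 0 = 0" "ev_plus 1 = 1" "ev_plus (x + y) = ev_plus x + ev_plus y"
  "ev_plus (x - y) = ev_plus x - ev_plus y" "ev_plus (- x) = - ev_plus x"
  "ev_plus (x * y) = ev_plus x * ev_plus y" "ev_plus pi_elt = 1"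
  by (cases x rule: abs_qpi_cases; cases y rule: abs_qpi_cases; simp add: qpi_abs_eqs ev_abs pi_elt_def)+

lemma ev_minus_simps [simp]:
  "ev_minus 0 = 0" "ev_minus 1 = 1" "ev_minus (x + y) = ev_minus x + ev_minus y"
  "ev_minus (x - y) = ev_minus x - ev_minus y" "ev_minus (- x) = - ev_minus x"
  "ev_minus (x * y) = ev_minus x * ev_minus y" "ev_minus pi_elt = - 1"
  by (cases x rule: abs_qpi_cases; cases y rule: abs_qpi_cases; simp add: qpi_abs_eqs ev_abs pi_elt_def)+

definition q_var :: qfield where "q_var = Fract [:0, 1:] 1"

lemma ev_q_elt [simp]: "ev_plus q_elt = q_var" "ev_minus q_elt = q_var"
  by (simp_all add: q_var_def q_elt_def ev_abs)

lemma ev_power [simp]: "ev_plus (x ^ n) = ev_plus x ^ n" "ev_minus (x ^ n) = ev_minus x ^ n"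
  by (induction n) simp_all

lemma ev_sum: "ev_plus (sum f A) = (\<Sum>a\<in>A. ev_plus (f a))" "ev_minus (sum f A) = (\<Sum>a\<in>A. ev_minus (f a))"
  by (induction A rule: infinite_finite_induct) simp_all

lemma two_neq_zero_qfield: "(1 :: qfield) + 1 \<noteq> 0"
  by (simp add: One_fract_def Zero_fract_def eq_fract)

lemma minus_one_neq_one_qfield: "(- 1 :: qfield) \<noteq> 1" "(1 :: qfield) \<noteq> - 1"
  using two_neq_zero_qfield by (metis add.commute add_cancel_right_right eq_neg_iff_add_eq_0)+

text \<open>A difference of representatives that vanishes at 1 and at -1 is divisible by X - 1 and
  by X + 1. The factors can be split off one after the other because 2 is invertible.\<close>

lemma qpi_eqI:
  assumes "ev_plus x = ev_plus y" "ev_minus x = ev_minus y"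
  shows "x = y"
proof -
  obtain p r where pr: "x = abs_qpi p" "y = abs_qpi r" by (metis abs_qpi_cases)
  have *: "poly p 1 = poly r 1" "poly p (-1) = poly r (-1)"
    using assms by (simp_all add: pr ev_abs)
  from * have "poly (p - r) 1 = 0" by simp
  then obtain s where s: "p - r = [:-1, 1:] * s" by (metis dvd_def poly_eq_0_iff_dvd)
  have "poly (p - r) (-1) = 0" using * by simp
  then have "(-1 - 1) * poly s (-1) = 0" by (simp add: s)
  then have "poly s (-1) = 0" using two_neq_zero_qfield
    by (metis diff_minus_eq_add minus_diff_eq mult_eq_0_iff neg_equal_0_iff_equal uminus_add_conv_diff)
  then obtain t where t: "s = [:1, 1:] * t" by (metis dvd_def minus_minus poly_eq_0_iff_dvd)
  have "p - r = [:-1, 0, 1:] * t" by (simp only: s t mult.assoc[symmetric]) simp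
  then show "x = y" unfolding pr qpi.abs_eq_iff by (metis dvd_triv_left)
qed

lemma qpi_eq_iff: "x = y \<longleftrightarrow> ev_plus x = ev_plus y \<and> ev_minus x = ev_minus y"
  using qpi_eqI by blast

text \<open>The Chinese remainder theorem made explicit: a linear polynomial \<open>[:u, v:]\<close>
  interpolates the prescribed values at 1 and -1.\<close>

lemma ev_surj: "\<exists>x. ev_plus x = a \<and> ev_minus x = b"
proof -
  obtain u v where uv: "u + v = a" "u - v = b"
  proof
    show "(a + b) / (1+1) + (a - b) / (1+1) = a" "(a + b) / (1+1) - (a - b) / (1+1) = b"
      using two_neq_zero_qfield
      by (simp_all add: field_simps flip: add_divide_distrib diff_divide_distrib)
  qed
  then show ?thesis by (intro exI[of _ "abs_qpi [:u, v:]"]) (simp add: ev_abs)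
qed

text \<open>Both components are fields, so invertibility can be tested after each specialisation of
  pi. Later invertibility claims reduce to this test.\<close>

lemma unit_qpi_iff: "x dvd 1 \<longleftrightarrow> ev_plus x \<noteq> 0 \<and> ev_minus x \<noteq> 0" for x :: qpi
proof
  assume "x dvd 1"
  then obtain y where "1 = x * y" by (auto simp: dvd_def)
  then have "ev_plus x * ev_plus y = 1" "ev_minus x * ev_minus y = 1" by (metis ev_plus_simps ev_minus_simps)+
  then show "ev_plus x \<noteq> 0 \<and> ev_minus x \<noteq> 0" by auto
next
  assume *: "ev_plus x \<noteq> 0 \<and> ev_minus x \<noteq> 0"
  obtain y where "ev_plus y = inverse (ev_plus x)" "ev_minus y = inverse (ev_minus x)"
    using ev_surj by metis
  then have "x * y = 1" using * by (intro qpi_eqI) simp_all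
  then show "x dvd 1" by (metis dvd_triv_left)
qed

lemma unit_inverse_qpi: "x * inverse x = 1" if "x dvd 1" for x :: qpi
proof -
  obtain y where y: "x * y = 1" using \<open>x dvd 1\<close> by (metis dvd_def)
  have "z = y" if "x * z = 1" for z using that y by (metis mult.assoc mult.commute mult_1)
  then have "(THE y. x * y = 1) = y" using y by blast
  then show ?thesis using y \<open>x dvd 1\<close> by (simp add: inverse_qpi_def)
qed

lemma ev_inverse:
  assumes "x dvd 1"
  shows "ev_plus (inverse x) = inverse (ev_plus x)" "ev_minus (inverse x) = inverse (ev_minus x)"
proof -
  have "ev_plus x * ev_plus (inverse x) = 1" "ev_minus x * ev_minus (inverse x) = 1"
    using unit_inverse_qpi[OF assms] by (metis ev_plus_simps ev_minus_simps)+
  then show "ev_plus (inverse x) = inverse (ev_plus x)" "ev_minus (inverse x) = inverse (ev_minus x)"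
    by (simp_all add: inverse_unique)
qed

lemma q_var_power: "q_var ^ n = Fract (monom 1 n) 1"
  by (induction n) (simp_all add: q_var_def One_fract_def monom_Suc monom_0 one_pCons)

lemma q_var_nonzero [simp]: "q_var \<noteq> 0"
  by (simp add: q_var_def Zero_fract_def eq_fract)

lemma q_var_powi_eq_one: "q_var powi a = 1 \<Longrightarrow> a = 0"
proof -
  have *: "n = 0" if "q_var ^ n = 1" for n :: nat
  proof -
    have "monom (1 :: rat) n = 1"
      using that by (simp add: q_var_power One_fract_def eq_fract)
    then have "degree (monom (1 :: rat) n) = 0" by simp
    then show ?thesis by (simp add: degree_monom_eq)
  qed
  assume "q_var powi a = 1"
  then show "a = 0"
    using *[of "nat a"] *[of "nat (-a)"]
    by (cases "a \<ge> 0") (auto simp: power_int_def power_inverse)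
qed

text \<open>Squaring removes the signs \<open>s\<close> and \<open>t\<close> and leaves an equation
  between powers of the transcendental element q.\<close>

lemma q_var_powi_neq:
  assumes "a \<noteq> b" "s * s = 1" "t * t = 1"
  shows "s * q_var powi a \<noteq> t * q_var powi b"
proof
  assume "s * q_var powi a = t * q_var powi b"
  then have "(s * q_var powi a) * (s * q_var powi a) = (t * q_var powi b) * (t * q_var powi b)" by simp
  moreover have "q_var powi (c + c) = q_var powi c * q_var powi c" for c
    by (rule power_int_add) simp
  ultimately have "(s * s) * q_var powi (a + a) = (t * t) * q_var powi (b + b)"
    by (simp only: mult_ac)
  then have "q_var powi (a + a) = q_var powi (b + b)" using assms by simp
  then have "q_var powi ((a + a) - (b + b)) = 1" by (simp add: power_int_diff)
  then show False using q_var_powi_eq_one assms by fastforce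
qed

lemma q_elt_unit: "q_elt dvd 1" and pi_elt_unit: "pi_elt dvd 1"
  by (simp_all add: unit_qpi_iff)

lemma ev_powi [simp]:
  "ev_plus (q_elt powi a) = q_var powi a" "ev_minus (q_elt powi a) = q_var powi a"
  "ev_plus (pi_elt powi a) = 1" "ev_minus (pi_elt powi a) = (- 1) powi a"
  by (auto simp: power_int_def ev_inverse[OF q_elt_unit] ev_inverse[OF pi_elt_unit])

lemma q_powi_add: "q_elt powi (a + b) = q_elt powi a * q_elt powi b"
  by (rule qpi_eqI) (simp_all add: power_int_add)

lemma pi_powi_add: "pi_elt powi (a + b) = pi_elt powi a * pi_elt powi b"
  by (rule qpi_eqI) (simp_all add: power_int_add)

lemma minus_one_powi_even: "(- 1 :: 'a::division_ring) powi a = (if even a then 1 else - 1)"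
  by (cases "a \<ge> 0") (auto simp: power_int_def even_nat_iff)

lemma pi_powi_cong: "pi_elt powi a = pi_elt powi b" if "even (a - b)"
  using that by (intro qpi_eqI) (auto simp: minus_one_powi_even)

lemma pi_powi_mult_self [simp]: "pi_elt powi a * pi_elt powi a = 1"
  by (rule qpi_eqI) (simp_all add: minus_one_powi_even)

lemma pi_powi_minus [simp]: "pi_elt powi (- a) = pi_elt powi a"
  by (rule pi_powi_cong) simp

lemma pi_powi_even: "even a \<Longrightarrow> pi_elt powi a = 1"
  using pi_powi_cong[of a 0] by simp

text \<open>The source of nearly all units below: after either specialisation of pi, two signed
  powers of q with different exponents remain different.\<close>

lemma unit_diff:
  assumes "a \<noteq> b"
  shows "(pi_elt powi s * q_elt powi a - pi_elt powi t * q_elt powi b) dvd 1"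
  using q_var_powi_neq[OF assms, of 1 1] q_var_powi_neq[OF assms, of "(-1) powi s" "(-1) powi t"]
  by (simp add: unit_qpi_iff minus_one_powi_even)

lemma q_powi_unit: "q_elt powi a dvd 1" and pi_powi_unit: "pi_elt powi a dvd 1"
  by (auto simp: unit_qpi_iff minus_one_powi_even)

lemma q_pi_powi_power: "(pi_elt powi a) ^ n = pi_elt powi (a * int n)" "(q_elt powi a) ^ n = q_elt powi (a * int n)"
  by (rule qpi_eqI; simp add: power_int_power')+

text \<open>A negative outer exponent involves \<open>inverse\<close>, which is a true inverse only
  on units, so the inverse of a monomial is identified first.\<close>

lemma q_powi_powi: "(q_elt powi a) powi b = q_elt powi (a * b)"
proof -
  have inv: "inverse (q_elt powi a) = q_elt powi (- a)"
  proof -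
    have "q_elt powi a * q_elt powi (- a) = 1" by (simp flip: q_powi_add)
    moreover have "q_elt powi a * inverse (q_elt powi a) = 1" by (rule unit_inverse_qpi[OF q_powi_unit])
    ultimately show ?thesis by (metis mult.assoc mult.commute mult_1)
  qed
  show ?thesis
  proof (cases "b \<ge> 0")
    case True
    then show ?thesis using q_pi_powi_power(2)[of a "nat b"] by (simp add: power_int_def)
  next
    case False
    then have "(q_elt powi a) powi b = (inverse (q_elt powi a)) ^ nat (- b)"
      by (simp only: power_int_def if_False)
    also have "\<dots> = q_elt powi (- a * int (nat (- b)))" by (simp only: inv q_pi_powi_power)
    finally show ?thesis using False by simp
  qed
qed

section \<open>Linear algebra in free algebras\<close>

definition mon :: "'g list \<Rightarrow> 'g free_alg" where
  "mon w = Poly_Mapping.single (FM w) 1"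

lemma mon_Nil: "mon [] = 1"
  by (simp add: mon_def flip: zero_free_monoid_def)

lemma mon_append: "mon (u @ v) = mon u * mon v"
  by (simp add: mon_def mult_single plus_free_monoid_def)

lemma gen_eq_mon: "gen g = mon [g]"
  by (simp add: gen_def mon_def)

lemma mon_Cons: "mon (g # w) = gen g * mon w"
  using mon_append[of "[g]" w] by (simp add: gen_eq_mon)

lemma const_simps:
  "const 0 = 0" "const 1 = 1" "const (a + b) = const a + const b"
  "const (a - b) = const a - const b" "const (- a) = - const a" "const (a * b) = const a * const b"
  by (simp_all add: const_def single_add single_diff single_uminus mult_single)

lemma lookup_const_mult [simp]:
  "Poly_Mapping.lookup (const c * x) w = c * Poly_Mapping.lookup x w"
proof -
  have "const c * x = Poly_Mapping.map ((*) c) x"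
    by (simp add: const_def mult_map_scale_conv_mult)
  then show ?thesis by (simp add: Poly_Mapping.map.rep_eq when_def)
qed

lemma const_mult_mon: "const c * mon w = Poly_Mapping.single (FM w) c"
  by (simp add: const_def mon_def mult_single)

lemma poly_mapping_eq_sum_single: "x = (\<Sum>w\<in>Poly_Mapping.keys x. Poly_Mapping.single w (Poly_Mapping.lookup x w))"
  by (rule poly_mapping_eqI) (auto simp: lookup_sum lookup_single when_def in_keys_iff sum.delta)

lemma free_alg_expand: "x = (\<Sum>w\<in>Poly_Mapping.keys x. const (Poly_Mapping.lookup x w) * mon (letters w))"
  using poly_mapping_eq_sum_single[of x] by (simp add: const_mult_mon)

lemma free_induct [case_names mon add]:
  assumes "\<And>c w. P (const c * mon w)" "\<And>x y. P x \<Longrightarrow> P y \<Longrightarrow> P (x + y)"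
  shows "P x"
proof -
  have "P 0" using assms(1)[of 0] by (simp add: const_simps)
  have "P (\<Sum>w\<in>A. const (Poly_Mapping.lookup x w) * mon (letters w))" for A
    by (induction A rule: infinite_finite_induct) (auto simp: \<open>P 0\<close> intro: assms)
  then show ?thesis using free_alg_expand[of x] by metis
qed

lemma const_comm: "x * const c = const c * x"
proof (induction x rule: free_induct)
  case (mon d w)
  have "const d * mon w * const c = const (d * c) * mon w"
    by (simp add: mult.assoc const_mult_mon) (simp add: const_def mult_single)
  also have "\<dots> = const (c * d) * mon w" by (simp only: mult.commute)
  finally show ?case by (simp only: const_simps mult.assoc)
qed (simp add: algebra_simps)

lemma const_left_comm: "x * (const c * y) = const c * (x * y)"
  by (metis const_comm mult.assoc)

lemmas const_norm = const_left_comm[of "mon _"] const_left_comm[of "gen _"]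

lemma const_const: "const a * (const b * y) = const (a * b) * y"
  by (simp add: const_simps mult.assoc)

text \<open>Scalars enter through left multiplication by \<open>const\<close>, so linearity over the
  ground ring is additivity plus compatibility with \<open>const\<close>. Such maps are compared on
  words only, by \<open>qlin_eqI\<close> and \<open>qfun_eqI\<close>.\<close>

definition qlin :: "('g free_alg \<Rightarrow> 'h free_alg) \<Rightarrow> bool" where
  "qlin f \<longleftrightarrow> (\<forall>x y. f (x + y) = f x + f y) \<and> (\<forall>c x. f (const c * x) = const c * f x)"

definition qfun :: "('g free_alg \<Rightarrow> qpi) \<Rightarrow> bool" where
  "qfun f \<longleftrightarrow> (\<forall>x y. f (x + y) = f x + f y) \<and> (\<forall>c x. f (const c * x) = c * f x)"

lemma qlin_add: "qlin f \<Longrightarrow> f (x + y) = f x + f y"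
  and qlin_const: "qlin f \<Longrightarrow> f (const c * x) = const c * f x"
  by (auto simp: qlin_def)

lemma qfun_add: "qfun f \<Longrightarrow> f (x + y) = f x + f y"
  and qfun_const: "qfun f \<Longrightarrow> f (const c * x) = c * f x"
  by (auto simp: qfun_def)

lemma qlin_0: "qlin f \<Longrightarrow> f 0 = 0"
  using qlin_const[of f 0 0] by (simp add: const_simps)

lemma qfun_0: "qfun f \<Longrightarrow> f 0 = 0"
  using qfun_const[of f 0 0] by (simp add: const_simps)

lemma qlin_diff: "qlin f \<Longrightarrow> f (x - y) = f x - f y"
  using qlin_add[of f "x - y" y] by simp

lemma qfun_diff: "qfun f \<Longrightarrow> f (x - y) = f x - f y"
  using qfun_add[of f "x - y" y] by simp

lemma qlin_sum: "qlin f \<Longrightarrow> f (sum g A) = (\<Sum>a\<in>A. f (g a))"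
  by (induction A rule: infinite_finite_induct) (auto simp: qlin_0 qlin_add)

lemma qfun_sum: "qfun f \<Longrightarrow> f (sum g A) = (\<Sum>a\<in>A. f (g a))"
  by (induction A rule: infinite_finite_induct) (auto simp: qfun_0 qfun_add)

lemma qlin_eqI:
  assumes "qlin f" "qlin g" "\<And>w. f (mon w) = g (mon w)"
  shows "f x = g x"
  by (induction x rule: free_induct) (simp_all add: assms qlin_add qlin_const)

lemma qfun_eqI:
  assumes "qfun f" "qfun g" "\<And>w. f (mon w) = g (mon w)"
  shows "f x = g x"
  by (induction x rule: free_induct) (simp_all add: assms qfun_add qfun_const)

lemma qlin_id: "qlin (\<lambda>x. x)" and qlin_zero: "qlin (\<lambda>x. 0)" and qfun_zero: "qfun (\<lambda>x. 0)"
  by (simp_all add: qlin_def qfun_def)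

lemma qlin_plus: "qlin f \<Longrightarrow> qlin g \<Longrightarrow> qlin (\<lambda>x. f x + g x)"
  by (simp add: qlin_def distrib_left right_diff_distrib)

lemma qlin_minus: "qlin f \<Longrightarrow> qlin g \<Longrightarrow> qlin (\<lambda>x. f x - g x)"
  by (simp add: qlin_def distrib_left right_diff_distrib)

lemma qlin_mult_left: "qlin f \<Longrightarrow> qlin (\<lambda>x. z * f x)"
  by (simp add: qlin_def distrib_left const_left_comm[of z])

lemma qlin_mult_right: "qlin f \<Longrightarrow> qlin (\<lambda>x. f x * z)"
  by (simp add: qlin_def distrib_right mult.assoc)

lemma qlin_compose: "qlin g \<Longrightarrow> qlin f \<Longrightarrow> qlin (\<lambda>x. g (f x))"
  by (simp add: qlin_def)

lemma qfun_compose: "qfun g \<Longrightarrow> qlin f \<Longrightarrow> qfun (\<lambda>x. g (f x))"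
  by (simp add: qlin_def qfun_def)

lemma qfun_mult: "qfun f \<Longrightarrow> qfun (\<lambda>x. c * f x)"
  by (simp add: qfun_def algebra_simps)

lemma qfun_mult_right: "qfun f \<Longrightarrow> qfun (\<lambda>x. f x * c)"
  by (simp add: qfun_def algebra_simps)

lemma qfun_plus: "qfun f \<Longrightarrow> qfun g \<Longrightarrow> qfun (\<lambda>x. f x + g x)"
  by (simp add: qfun_def algebra_simps)

lemma qfun_lookup: "qfun (\<lambda>x. Poly_Mapping.lookup x w)"
  by (simp add: qfun_def lookup_add)

lemmas qlin_intros = qlin_id qlin_zero qfun_zero qlin_plus qlin_minus qlin_mult_left qlin_mult_right
  qfun_mult qfun_mult_right qfun_plus qfun_lookup

text \<open>Linear extension from the basis of words. The scalar-valued variant \<open>plin\<close>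
  allows any index type, so it also evaluates functionals on the tensor square, whose basis consists
  of pairs of words.\<close>

definition lin :: "('g list \<Rightarrow> 'h free_alg) \<Rightarrow> 'g free_alg \<Rightarrow> 'h free_alg" where
  "lin f x = (\<Sum>w\<in>Poly_Mapping.keys x. const (Poly_Mapping.lookup x w) * f (letters w))"

definition plin :: "('k \<Rightarrow> qpi) \<Rightarrow> ('k \<Rightarrow>\<^sub>0 qpi) \<Rightarrow> qpi" where
  "plin f x = (\<Sum>w\<in>Poly_Mapping.keys x. Poly_Mapping.lookup x w * f w)"

lemma lin_superset:
  assumes "finite S" "Poly_Mapping.keys x \<subseteq> S"
  shows "lin f x = (\<Sum>w\<in>S. const (Poly_Mapping.lookup x w) * f (letters w))"
  unfolding lin_def using assms
  by (intro sum.mono_neutral_left) (auto simp: in_keys_iff const_simps)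

lemma plin_superset:
  assumes "finite S" "Poly_Mapping.keys x \<subseteq> S"
  shows "plin f x = (\<Sum>w\<in>S. Poly_Mapping.lookup x w * f w)"
  unfolding plin_def using assms
  by (intro sum.mono_neutral_left) (auto simp: in_keys_iff)

lemma qlin_lin: "qlin (lin f)"
  unfolding qlin_def
proof (intro conjI allI)
  fix x y :: "'a free_alg" and c
  let ?S = "Poly_Mapping.keys x \<union> Poly_Mapping.keys y"
  have S: "finite ?S" by simp
  show "lin f (x + y) = lin f x + lin f y"
    unfolding lin_superset[OF S keys_add] lin_superset[OF S Un_upper1] lin_superset[OF S Un_upper2]
    by (simp add: lookup_add const_simps distrib_right sum.distrib)
  have "lin f (const c * x) = (\<Sum>w\<in>Poly_Mapping.keys x. const (Poly_Mapping.lookup (const c * x) w) * f (letters w))"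
    by (intro lin_superset) (auto simp: in_keys_iff)
  then show "lin f (const c * x) = const c * lin f x"
    by (simp add: lin_def const_simps sum_distrib_left mult.assoc)
qed

lemma plin_add: "plin f (x + y) = plin f x + plin f y"
proof -
  let ?S = "Poly_Mapping.keys x \<union> Poly_Mapping.keys y"
  have S: "finite ?S" by simp
  show ?thesis
    unfolding plin_superset[OF S keys_add] plin_superset[OF S Un_upper1] plin_superset[OF S Un_upper2]
    by (simp add: lookup_add distrib_right sum.distrib)
qed

lemma plin_single [simp]: "plin f (Poly_Mapping.single k c) = c * f k"
  by (cases "c = 0") (simp_all add: plin_def)

lemma plin_zero [simp]: "plin f 0 = 0" by (simp add: plin_def)

lemma plin_sum: "plin f (sum g A) = (\<Sum>a\<in>A. plin f (g a))"
  by (induction A rule: infinite_finite_induct) (simp_all add: plin_add)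

lemma plin_map: "plin f (Poly_Mapping.map ((*) c) x) = c * plin f x"
proof -
  have l: "Poly_Mapping.lookup (Poly_Mapping.map ((*) c) x) w = c * Poly_Mapping.lookup x w" for w
    by (simp add: Poly_Mapping.map.rep_eq when_def)
  have "plin f (Poly_Mapping.map ((*) c) x) =
      (\<Sum>w\<in>Poly_Mapping.keys x. Poly_Mapping.lookup (Poly_Mapping.map ((*) c) x) w * f w)"
    by (intro plin_superset) (auto simp: in_keys_iff l)
  then show ?thesis by (simp add: l plin_def sum_distrib_left mult.assoc)
qed

lemma plin_cmult: "plin (\<lambda>k. c * f k) x = c * plin f x"
  by (simp add: plin_def sum_distrib_left mult_ac)

lemma plin_plus: "plin (\<lambda>k. f k + g k) x = plin f x + plin g x"
  by (simp add: plin_def sum.distrib algebra_simps)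

lemma qfun_plin: "qfun (plin f)"
  unfolding qfun_def using plin_map[of f]
  by (auto simp: plin_add const_def mult_map_scale_conv_mult)

lemma lin_mon [simp]: "lin f (mon w) = f w"
  by (simp add: lin_def mon_def const_simps)

lemma plin_mon [simp]: "plin f (mon w) = f (FM w)"
  by (simp add: mon_def)

section \<open>Words and weights\<close>

definition dotl :: "('i::finite, 'y, 'x) root_data \<Rightarrow> 'i list \<Rightarrow> 'i list \<Rightarrow> int" where
  "dotl D u v = zdot D (wt (FM u)) (wt (FM v))"

definition parl :: "('i::finite, 'y, 'x) root_data \<Rightarrow> 'i list \<Rightarrow> int" where
  "parl D u = zpar D (wt (FM u))"

text \<open>The factor with which the multiplication of the tensor square exchanges the words
  \<open>u\<close> and \<open>v\<close>.\<close>

definition xi :: "('i::finite, 'y, 'x) root_data \<Rightarrow> 'i list \<Rightarrow> 'i list \<Rightarrow> qpi" where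
  "xi D u v = q_elt powi dotl D u v * pi_elt powi (parl D u * parl D v)"

lemma wt_append: "wt (FM (u @ v)) = (\<lambda>i. wt (FM u) i + wt (FM v) i)"
  by (simp add: wt_def fun_eq_iff)

lemma wt_Nil: "wt (FM []) = (\<lambda>i. 0)"
  by (simp add: wt_def fun_eq_iff)

lemma dotl_Nil [simp]: "dotl D [] v = 0" "dotl D u [] = 0"
  by (simp_all add: dotl_def zdot_def wt_Nil)

lemma parl_Nil [simp]: "parl D [] = 0"
  by (simp add: parl_def zpar_def wt_Nil)

lemma dotl_append: "dotl D (u @ u') v = dotl D u v + dotl D u' v" "dotl D v (u @ u') = dotl D v u + dotl D v u'"
  by (simp_all add: dotl_def zdot_def wt_append algebra_simps sum.distrib)

lemma parl_append: "parl D (u @ v) = parl D u + parl D v"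
  by (simp add: parl_def zpar_def wt_append algebra_simps sum.distrib)

lemma wt_single: "wt (FM [i]) j = (if i = j then 1 else 0)"
  by (simp add: wt_def)

lemma sum_delta_mult: "(\<Sum>l\<in>UNIV. (if i = l then 1 else 0) * f l) = f i" for f :: "'a::finite \<Rightarrow> int"
proof -
  have "(\<Sum>l\<in>UNIV. (if i = l then 1 else 0) * f l) = (\<Sum>l\<in>UNIV. if l = i then f l else 0)"
    by (intro sum.cong) auto
  then show ?thesis by simp
qed

lemma dotl_single [simp]: "dotl D [i] [j] = dot D i j"
  by (simp add: dotl_def zdot_def wt_single mult.assoc sum_delta_mult flip: sum_distrib_left)

lemma parl_single: "parl D [i] = par D i"
  by (simp add: parl_def zpar_def wt_single sum_delta_mult)

lemma parl_Cons [simp]: "parl D (i # w) = par D i + parl D w"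
  using parl_append[of D "[i]" w] by (simp add: parl_single)

lemma dotl_Cons: "dotl D (i # w) v = dotl D [i] v + dotl D w v" "dotl D v (i # w) = dotl D v [i] + dotl D v w"
  using dotl_append(1)[of D "[i]" w v] dotl_append(2)[of D v "[i]" w] by simp_all

lemma xi_Nil [simp]: "xi D [] v = 1" "xi D u [] = 1"
  by (simp_all add: xi_def)

lemma xi_append: "xi D (u @ u') v = xi D u v * xi D u' v" "xi D v (u @ u') = xi D v u * xi D v u'"
  by (simp_all add: xi_def dotl_append parl_append q_powi_add pi_powi_add algebra_simps)

text \<open>The \<open>NO_MATCH\<close> guard keeps the rewriting from looping on one-letter
  words.\<close>

lemma xi_Cons: "NO_MATCH [] w \<Longrightarrow> xi D (i # w) v = xi D [i] v * xi D w v"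
    "NO_MATCH [] w \<Longrightarrow> xi D v (i # w) = xi D v [i] * xi D v w"
  using xi_append(1)[of D "[i]" w v] xi_append(2)[of D v "[i]" w] by simp_all

lemma dotl_wt_cong: "wt (FM u) = wt (FM u') \<Longrightarrow> dotl D u v = dotl D u' v" "wt (FM u) = wt (FM u') \<Longrightarrow> dotl D v u = dotl D v u'"
  by (simp_all add: dotl_def)

lemma parl_wt_cong: "wt (FM u) = wt (FM u') \<Longrightarrow> parl D u = parl D u'"
  by (simp add: parl_def)

lemma xi_wt_cong: "wt (FM u) = wt (FM u') \<Longrightarrow> xi D u v = xi D u' v" "wt (FM u) = wt (FM u') \<Longrightarrow> xi D v u = xi D v u'"
  by (simp_all add: xi_def dotl_def parl_def)

lemma weight_part_add: "x \<in> weight_part a \<Longrightarrow> y \<in> weight_part a \<Longrightarrow> x + y \<in> weight_part a"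
  using keys_add[of x y] by (auto simp: weight_part_def)

lemma weight_part_const: "x \<in> weight_part a \<Longrightarrow> const c * x \<in> weight_part a"
  by (auto simp: weight_part_def in_keys_iff)

lemma weight_part_0 [simp]: "0 \<in> weight_part a" by (simp add: weight_part_def)

lemma weight_part_mon: "mon w \<in> weight_part (wt (FM w))"
  by (simp add: weight_part_def mon_def)

lemma weight_part_sum: "(\<And>k. k \<in> A \<Longrightarrow> f k \<in> weight_part a) \<Longrightarrow> sum f A \<in> weight_part a"
  by (induction A rule: infinite_finite_induct) (auto intro: weight_part_add)

lemma weight_part_mult:
  assumes "x \<in> weight_part a" "y \<in> weight_part b"
  shows "x * y \<in> weight_part (\<lambda>i. a i + b i)"
  using assms keys_mult[of x y] by (force simp: weight_part_def wt_def plus_free_monoid_def)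

lemma weight_part_lin:
  assumes "x \<in> weight_part a" "\<And>w. wt (FM w) = a \<Longrightarrow> f w \<in> weight_part b"
  shows "lin f x \<in> weight_part b"
  unfolding lin_def using assms
  by (intro weight_part_sum weight_part_const) (force simp: weight_part_def)

text \<open>The diagonal operator with eigenvalue \<open>g a\<close> on weight \<open>a\<close>.
  Coefficients that depend on the weight are written in this way so that they apply to inhomogeneous
  elements too.\<close>

definition scal :: "(('i \<Rightarrow> int) \<Rightarrow> qpi) \<Rightarrow> 'i free_alg \<Rightarrow> 'i free_alg" where
  "scal g = lin (\<lambda>w. const (g (wt (FM w))) * mon w)"

lemma scal_mon [simp]: "scal g (mon w) = const (g (wt (FM w))) * mon w"
  by (simp add: scal_def)

lemma qlin_scal: "qlin (scal g)" by (simp add: scal_def qlin_lin)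

lemma scal_weight_part: "x \<in> weight_part a \<Longrightarrow> scal g x = const (g a) * x"
proof -
  assume "x \<in> weight_part a"
  then have "scal g x = (\<Sum>w\<in>Poly_Mapping.keys x. const (g a) * (const (Poly_Mapping.lookup x w) * mon (letters w)))"
    unfolding scal_def lin_def
    by (intro sum.cong) (auto simp: weight_part_def intro: const_left_comm)
  then show ?thesis by (simp only: sum_distrib_left[symmetric] free_alg_expand[symmetric])
qed

section \<open>Skew derivations and the bilinear form\<close>

text \<open>The components of \<open>r(x)\<close> in \<open>\<theta>\<^sub>i \<otimes> '\<f>\<close> and \<open>'\<f> \<otimes> \<theta>\<^sub>i\<close> are \<open>\<theta>\<^sub>i \<otimes> dl x\<close> and \<open>dr x \<otimes> \<theta>\<^sub>i\<close>.\<close>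

primrec dlw :: "('i::finite, 'y, 'x) root_data \<Rightarrow> 'i \<Rightarrow> 'i list \<Rightarrow> 'i free_alg" where
  "dlw D i [] = 0"
| "dlw D i (j # w) = (if i = j then mon w else 0) + const (xi D [i] [j]) * (gen j * dlw D i w)"

primrec drw :: "('i::finite, 'y, 'x) root_data \<Rightarrow> 'i \<Rightarrow> 'i list \<Rightarrow> 'i free_alg" where
  "drw D i [] = 0"
| "drw D i (j # w) = (if i = j then const (xi D [i] w) * mon w else 0) + gen j * drw D i w"

definition dl where "dl D i = lin (dlw D i)"
definition dr where "dr D i = lin (drw D i)"

lemma qlin_dl: "qlin (dl D i)" and qlin_dr: "qlin (dr D i)"
  by (simp_all add: dl_def dr_def qlin_lin)

lemmas dl_add = qlin_add[OF qlin_dl] and dl_const = qlin_const[OF qlin_dl]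
  and dr_add = qlin_add[OF qlin_dr] and dr_const = qlin_const[OF qlin_dr]

lemma dl_mon: "dl D i (mon w) = dlw D i w" and dr_mon: "dr D i (mon w) = drw D i w"
  by (simp_all add: dl_def dr_def)

lemma dl_one [simp]: "dl D i 1 = 0" and dr_one [simp]: "dr D i 1 = 0"
  using dl_mon[of D i "[]"] dr_mon[of D i "[]"] by (simp_all add: mon_Nil)

lemma dl_gen_mult: "dl D i (gen j * x) = (if i = j then x else 0) + const (xi D [i] [j]) * (gen j * dl D i x)"
proof (rule qlin_eqI[of "\<lambda>x. dl D i (gen j * x)" "\<lambda>x. (if i = j then x else 0) + const (xi D [i] [j]) * (gen j * dl D i x)"])
  show "qlin (\<lambda>x. dl D i (gen j * x))"
    by (intro qlin_compose[OF qlin_dl] qlin_intros)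
  have "qlin (\<lambda>x. if i = j then x else 0)" by (cases "i = j") (simp_all add: qlin_intros)
  then show "qlin (\<lambda>x. (if i = j then x else 0) + const (xi D [i] [j]) * (gen j * dl D i x))"
    by (intro qlin_plus qlin_mult_left qlin_dl)
qed (simp add: dl_mon flip: mon_Cons)

lemma dr_gen_mult: "dr D i (gen j * x) = (if i = j then scal (\<lambda>a. q_elt powi zdot D (wt (FM [i])) a * pi_elt powi (zpar D (wt (FM [i])) * zpar D a)) x else 0) + gen j * dr D i x"
proof (rule qlin_eqI[of "\<lambda>x. dr D i (gen j * x)" "\<lambda>x. (if i = j then scal _ x else 0) + gen j * dr D i x"])
  let ?f = "\<lambda>a. q_elt powi zdot D (wt (FM [i])) a * pi_elt powi (zpar D (wt (FM [i])) * zpar D a)"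
  show "qlin (\<lambda>x. dr D i (gen j * x))"
    by (intro qlin_compose[OF qlin_dr] qlin_intros)
  have "qlin (\<lambda>x. if i = j then scal ?f x else 0)" by (cases "i = j") (simp_all add: qlin_intros qlin_scal)
  then show "qlin (\<lambda>x. (if i = j then scal ?f x else 0) + gen j * dr D i x)"
    by (intro qlin_plus qlin_mult_left qlin_dr)
  show "dr D i (gen j * mon w) = (if i = j then scal ?f (mon w) else 0) + gen j * dr D i (mon w)" for w
    by (simp add: dr_mon xi_def dotl_def parl_def flip: mon_Cons)
qed

text \<open>Skew Leibniz rule, by induction over the letters of \<open>u\<close>: the braiding
  factors picked up letter by letter multiply to that of the whole word.\<close>

lemma dl_mon_mult: "dl D i (mon u * x) = dl D i (mon u) * x + const (xi D [i] u) * (mon u * dl D i x)"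
proof (induction u)
  case (Cons j u)
  have "dl D i (mon (j # u) * x) = (if i = j then mon u * x else 0)
      + const (xi D [i] [j]) * (gen j * (dl D i (mon u) * x + const (xi D [i] u) * (mon u * dl D i x)))"
    by (simp add: mon_Cons mult.assoc dl_gen_mult Cons)
  moreover have "dl D i (mon (j # u)) * x = (if i = j then mon u * x else 0) + const (xi D [i] [j]) * (gen j * (dl D i (mon u) * x))"
    by (simp add: mon_Cons dl_gen_mult distrib_right mult.assoc)
  moreover have "const (xi D [i] (j # u)) * (mon (j # u) * dl D i x)
      = const (xi D [i] [j]) * (gen j * (const (xi D [i] u) * (mon u * dl D i x)))"
    by (simp add: mon_Cons mult.assoc const_norm const_const xi_Cons(2)[of u])
  ultimately show ?case by (simp add: distrib_left)
qed (simp add: mon_Nil const_simps)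

lemma weight_part_gen: "gen j \<in> weight_part (wt (FM [j]))"
  by (simp add: gen_eq_mon weight_part_mon)

lemma wt_Cons: "wt (FM (j # w)) = (\<lambda>k. wt (FM [j]) k + wt (FM w) k)"
  using wt_append[of "[j]" w] by simp

lemma dlw_weight: "dlw D i w \<in> weight_part (\<lambda>k. wt (FM w) k - wt (FM [i]) k)"
proof (induction w)
  case (Cons j w)
  have "gen j * dlw D i w \<in> weight_part (\<lambda>k. wt (FM [j]) k + (wt (FM w) k - wt (FM [i]) k))"
    by (rule weight_part_mult[OF weight_part_gen Cons])
  also have "(\<lambda>k. wt (FM [j]) k + (wt (FM w) k - wt (FM [i]) k)) = (\<lambda>k. wt (FM (j # w)) k - wt (FM [i]) k)"
    by (subst wt_Cons) (simp add: algebra_simps)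
  finally show ?case
    using weight_part_mon[of w] wt_Cons[of j w]
    by (auto intro!: weight_part_add weight_part_const)
qed simp

lemma drw_weight: "drw D i w \<in> weight_part (\<lambda>k. wt (FM w) k - wt (FM [i]) k)"
proof (induction w)
  case (Cons j w)
  have "gen j * drw D i w \<in> weight_part (\<lambda>k. wt (FM [j]) k + (wt (FM w) k - wt (FM [i]) k))"
    by (rule weight_part_mult[OF weight_part_gen Cons])
  also have "(\<lambda>k. wt (FM [j]) k + (wt (FM w) k - wt (FM [i]) k)) = (\<lambda>k. wt (FM (j # w)) k - wt (FM [i]) k)"
    by (subst wt_Cons) (simp add: algebra_simps)
  finally show ?case
    using weight_part_mon[of w] wt_Cons[of j w]
    by (auto intro!: weight_part_add weight_part_const)
qed simp

definition cc :: "('i::finite, 'y, 'x) root_data \<Rightarrow> 'i \<Rightarrow> qpi" where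
  "cc D i = inverse (1 - pi_i D i * q_i D i powi (- 2))"

text \<open>The adjunction between left multiplication by a generator and \<open>dl\<close>, turned
  into a recursion. It constructs the form outright; the characterising properties are derived
  afterwards.\<close>

primrec bword :: "('i::finite, 'y, 'x) root_data \<Rightarrow> 'i list \<Rightarrow> 'i free_alg \<Rightarrow> qpi" where
  "bword D [] y = Poly_Mapping.lookup y 0"
| "bword D (i # w) y = cc D i * bword D w (dl D i y)"

definition bform :: "('i::finite, 'y, 'x) root_data \<Rightarrow> 'i free_alg \<Rightarrow> 'i free_alg \<Rightarrow> qpi" where
  "bform D x y = plin (\<lambda>w. bword D (letters w) y) x"

lemma qfun_bword: "qfun (bword D w)"
proof (induction w)
  case (Cons i w)
  have "qfun (\<lambda>y. cc D i * bword D w (dl D i y))" by (intro qfun_mult qfun_compose[OF Cons] qlin_dl)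
  then show ?case by (simp add: qfun_def)
qed (simp add: qfun_def lookup_add)

lemma qfun_bform1: "qfun (\<lambda>x. bform D x y)"
  by (simp add: bform_def qfun_plin)

lemma qfun_bform2: "qfun (bform D x)"
  unfolding bform_def qfun_def
  by (simp add: qfun_add[OF qfun_bword] qfun_const[OF qfun_bword] plin_plus plin_cmult distrib_left)

lemmas bform_lin = qfun_add[OF qfun_bform1] qfun_add[OF qfun_bform2] qfun_const[OF qfun_bform1]
  qfun_const[OF qfun_bform2] qfun_0[OF qfun_bform1] qfun_0[OF qfun_bform2]

lemma bform_mon: "bform D (mon w) y = bword D w y"
  by (simp add: bform_def)

lemma bform_one: "bform D 1 y = Poly_Mapping.lookup y 0"
  using bform_mon[of D "[]"] by (simp add: mon_Nil)

lemma bform_gen_mult: "bform D (gen i * x) y = cc D i * bform D x (dl D i y)"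
  by (rule qfun_eqI[of "\<lambda>x. bform D (gen i * x) y" "\<lambda>x. cc D i * bform D x (dl D i y)"])
     (auto intro!: qfun_mult qfun_bform1 qfun_compose[OF qfun_bform1] qlin_intros
       simp: bform_mon simp flip: mon_Cons)

lemma lookup_gen_mult_0 [simp]: "Poly_Mapping.lookup (gen i * x) 0 = 0"
proof (rule qfun_eqI[of "\<lambda>x. Poly_Mapping.lookup (gen i * x) 0" "\<lambda>x. 0"])
  show "qfun (\<lambda>x. Poly_Mapping.lookup (gen i * x) 0)" by (intro qfun_compose[OF qfun_lookup] qlin_intros)
  show "Poly_Mapping.lookup (gen i * mon w) 0 = 0" for w
    unfolding mon_Cons[symmetric] by (simp add: mon_def lookup_single when_def zero_free_monoid_def)
qed (simp add: qfun_zero)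

lemma bform_one_right: "bform D x 1 = Poly_Mapping.lookup x 0"
proof (rule qfun_eqI[OF qfun_bform1 qfun_lookup])
  show "bform D (mon w) 1 = Poly_Mapping.lookup (mon w) 0" for w
    by (cases w) (simp_all add: mon_Nil bform_one mon_Cons bform_gen_mult bform_lin)
qed

locale datum =
  fixes D :: "('i::finite, 'y::ab_group_add, 'x::ab_group_add) root_data"
  assumes super_cartan: "super_cartan_datum D"
    and root_datum: "root_datum D"
    and parity_compat: "parity_compatible D"
begin

lemma dot_sym: "dot D i j = dot D j i"
  using super_cartan by (simp add: super_cartan_datum_def)

lemma zdot_sym: "zdot D a b = zdot D b a"
  unfolding zdot_def by (subst sum.swap) (simp add: dot_sym mult_ac)

lemma dotl_sym: "dotl D u v = dotl D v u"
  by (simp add: dotl_def zdot_sym)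

lemma xi_sym: "xi D u v = xi D v u"
  by (simp add: xi_def dotl_sym mult.commute)

text \<open>The form is defined by removing letters from the first argument. Removing them from the
  second is possible because \<open>xi\<close> is symmetric: taking off \<open>j\<close> on one side
  and \<open>i\<close> on the other gives the same factor in either order. Symmetry of the form
  follows.\<close>

lemma bform_mult_gen: "bform D x (gen i * y) = cc D i * bform D (dl D i x) y"
proof -
  have "bform D (mon w) (gen i * y) = cc D i * bform D (dl D i (mon w)) y" for w y
  proof (induction w arbitrary: y)
    case (Cons j w)
    have "bform D (mon (j # w)) (gen i * y)
        = cc D j * ((if i = j then bform D (mon w) y else 0) + xi D [i] [j] * (cc D i * bform D (dl D i (mon w)) (dl D j y)))"
      using xi_sym[of "[i]" "[j]"] by (auto simp: mon_Cons bform_gen_mult dl_gen_mult bform_lin Cons)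
    moreover have "bform D (dl D i (mon (j # w))) y
        = (if i = j then bform D (mon w) y else 0) + xi D [i] [j] * (cc D j * bform D (dl D i (mon w)) (dl D j y))"
      by (auto simp: mon_Cons dl_gen_mult bform_lin bform_gen_mult)
    ultimately show ?case by (auto simp: algebra_simps)
  qed (simp add: mon_Nil bform_one bform_lin)
  then show ?thesis
    using qfun_eqI[OF qfun_bform1 qfun_mult[OF qfun_compose[OF qfun_bform1 qlin_dl]]] by metis
qed

lemma bform_sym: "bform D x y = bform D y x"
proof -
  have "bform D (mon w) y = bform D y (mon w)" for w y
    by (induction w arbitrary: y)
      (simp_all add: mon_Nil bform_one bform_one_right mon_Cons bform_gen_mult bform_mult_gen)
  then show ?thesis using qfun_eqI[OF qfun_bform1 qfun_bform2] by metis
qed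

text \<open>The derivative \<open>dlw D i w\<close> has the weight of \<open>w\<close> lowered by
  \<open>i\<close>; the factor \<open>xi D [i] [j]\<close> makes up for the missing letter.\<close>

lemma scal_dl: "const (xi D [i] [j]) * scal (\<lambda>a. q_elt powi zdot D (wt (FM [j])) a * pi_elt powi (zpar D (wt (FM [j])) * zpar D a)) (dlw D i w) = const (xi D [j] w) * dlw D i w"
proof -
  let ?f = "\<lambda>a. q_elt powi zdot D (wt (FM [j])) a * pi_elt powi (zpar D (wt (FM [j])) * zpar D a)"
  let ?a = "\<lambda>k. wt (FM w) k - wt (FM [i]) k"
  have "zdot D (wt (FM [j])) ?a = dotl D [j] w - dot D j i"
    by (simp add: zdot_def dotl_def sum_subtractf right_diff_distrib left_diff_distrib flip: dotl_single[of D j i])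
  moreover have "zpar D ?a = parl D w - par D i"
    by (simp add: zpar_def parl_def sum_subtractf left_diff_distrib flip: parl_single[of D i])
  moreover have "zpar D (wt (FM [j])) = par D j" by (simp add: parl_single flip: parl_def)
  ultimately have "?f ?a * xi D [i] [j] = q_elt powi (dotl D [j] w - dot D j i + dot D j i)
     * (pi_elt powi (par D j * (parl D w - par D i) + par D j * par D i))"
    by (simp only: xi_def q_powi_add pi_powi_add parl_single dotl_single dot_sym[of i j] mult_ac)
  also have "\<dots> = xi D [j] w" by (simp add: xi_def parl_single algebra_simps)
  finally have "xi D [i] [j] * ?f ?a = xi D [j] w" by (simp add: mult.commute)
  then show ?thesis by (simp add: scal_weight_part[OF dlw_weight] const_const)
qed

text \<open>A trace of coassociativity: a letter removed on the left and one removed on the right do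
  not interfere. It transports the recursion for the form from left to right multiplication.\<close>

lemma dl_dr_commute: "dl D i (dr D j x) = dr D j (dl D i x)"
proof (rule qlin_eqI[OF qlin_compose[OF qlin_dl qlin_dr] qlin_compose[OF qlin_dr qlin_dl]])
  show "dl D i (dr D j (mon w)) = dr D j (dl D i (mon w))" for w
  proof (induction w)
    case (Cons k w)
    have 1: "dl D i (dr D j (mon (k # w))) = (if j = k then const (xi D [j] w) * dlw D i w else 0)
        + ((if i = k then drw D j w else 0) + const (xi D [i] [k]) * (gen k * dl D i (dr D j (mon w))))"
      by (auto simp: dl_mon dr_mon dl_add dl_const dl_gen_mult qlin_0[OF qlin_dl])
    have 2: "dr D j (dl D i (mon (k # w))) = (if i = k then drw D j w else 0)
        + const (xi D [i] [k]) * ((if j = k then scal (\<lambda>a. q_elt powi zdot D (wt (FM [j])) a * pi_elt powi (zpar D (wt (FM [j])) * zpar D a)) (dlw D i w) else 0) + gen k * dr D j (dl D i (mon w)))"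
      by (auto simp: dl_mon dr_mon dr_add dr_const dr_gen_mult qlin_0[OF qlin_dr])
    show ?case unfolding 1 2 Cons by (cases "j = k") (auto simp: distrib_left scal_dl)
  qed (simp add: mon_Nil qlin_0[OF qlin_dl] qlin_0[OF qlin_dr])
qed

lemma bform_mult_gen_left: "bform D (x * gen i) y = cc D i * bform D x (dr D i y)"
proof -
  have "bform D (mon w * gen i) y = cc D i * bform D (mon w) (dr D i y)" for w y
  proof (induction w arbitrary: y)
    case (Cons j w)
    then show ?case by (simp add: mon_Cons mult.assoc bform_gen_mult dl_dr_commute)
  next
    case Nil
    have "Poly_Mapping.lookup (dl D i y) 0 = Poly_Mapping.lookup (dr D i y) 0"
    proof (rule qfun_eqI[OF qfun_compose[OF qfun_lookup qlin_dl] qfun_compose[OF qfun_lookup qlin_dr]])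
      show "Poly_Mapping.lookup (dl D i (mon w)) 0 = Poly_Mapping.lookup (dr D i (mon w)) 0" for w
        unfolding dl_mon dr_mon
        by (cases w) (auto simp: lookup_add mon_def lookup_single zero_free_monoid_def when_def
            lookup_gen_mult_0[unfolded zero_free_monoid_def])
    qed
    then show ?case
      using bform_gen_mult[of D i 1 y] by (simp add: mon_Nil bform_one)
  qed
  then show ?thesis
    using qfun_eqI[OF qfun_compose[OF qfun_bform1 qlin_mult_right[OF qlin_id]] qfun_mult[OF qfun_bform1]] by metis
qed

lemma bform_weight:
  assumes "wt (FM u) \<noteq> wt (FM v)"
  shows "bform D (mon u) (mon v) = 0"
proof -
  have "bform D (mon u) y = 0" if "y \<in> weight_part b" "b \<noteq> wt (FM u)" for y b
    using that
  proof (induction u arbitrary: y b)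
    case Nil
    then show ?case by (force simp: mon_Nil bform_one weight_part_def in_keys_iff zero_free_monoid_def)
  next
    case (Cons i u)
    have "dl D i y \<in> weight_part (\<lambda>k. b k - wt (FM [i]) k)"
      unfolding dl_def using Cons.prems(1) by (rule weight_part_lin) (use dlw_weight in blast)
    moreover have "(\<lambda>k. b k - wt (FM [i]) k) \<noteq> wt (FM u)"
    proof
      assume *: "(\<lambda>k. b k - wt (FM [i]) k) = wt (FM u)"
      have "b = wt (FM (i # u))" by (simp only: wt_Cons[of i u] *[symmetric]) auto
      then show False using Cons.prems by simp
    qed
    ultimately show ?case by (simp add: mon_Cons bform_gen_mult Cons.IH)
  qed
  then show ?thesis using weight_part_mon assms by metis
qed

end

section \<open>Compatibility of the form with the coproduct, and its uniqueness\<close>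

lemma plin_cong: "(\<And>k. f k = g k) \<Longrightarrow> plin f x = plin g x"
  by (simp add: plin_def)

lemma qfun_plin_param: "(\<And>k. qfun (\<lambda>x. f x k)) \<Longrightarrow> qfun (\<lambda>x. plin (f x) t)"
  unfolding qfun_def plin_plus[symmetric] plin_cmult[symmetric] by (auto intro!: plin_cong)

lemma plin_tens: "plin f (tens x y) = plin (\<lambda>v. plin (\<lambda>w. f (v, w)) y) x"
  by (simp add: tens_def plin_sum plin_def[of _ x] plin_def[of _ y] sum_distrib_left mult.assoc)

lemma tens_form_eq: "tens_form B s t =
  plin (\<lambda>(v1, v2). plin (\<lambda>(w1, w2). B (mon (letters v1)) (mon (letters w1)) * B (mon (letters v2)) (mon (letters w2))) t) s"
  by (simp add: tens_form_def plin_def mon_def sum_distrib_left case_prod_beta mult.assoc)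

text \<open>Only functionals of the product are computed, which avoids determining the support of a
  product in the tensor square. The factor \<open>xi\<close> arises when the letter destined for the
  second slot passes \<open>w1\<close>.\<close>

lemma plin_tens_mult_gen:
  "plin f (tens_mult D (tens (gen i) 1 + tens 1 (gen i)) t) =
   plin (\<lambda>(w1, w2). f (FM [i] + w1, w2) + xi D [i] (letters w1) * f (w1, FM [i] + w2)) t"
proof -
  have k: "FM [i] \<noteq> 0" by (simp add: zero_free_monoid_def)
  have t1: "tens (gen i) 1 = Poly_Mapping.single (FM [i], 0) 1" "tens 1 (gen i) = Poly_Mapping.single (0, FM [i]) 1"
    by (simp_all add: tens_def gen_def)
  let ?s = "tens (gen i) 1 + tens 1 (gen i)"
  have keys: "Poly_Mapping.keys ?s = {(FM [i], 0), (0, FM [i])}"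
    using k by (auto simp: t1 in_keys_iff lookup_add lookup_single when_def split: if_splits)
  have l: "Poly_Mapping.lookup ?s (FM [i], 0) = 1" "Poly_Mapping.lookup ?s (0, FM [i]) = 1"
    using k by (auto simp: t1 lookup_add lookup_single when_def)
  have wt0: "wt 0 = (\<lambda>i. 0)" by (simp add: wt_def zero_free_monoid_def fun_eq_iff)
  have z: "zdot D (wt 0) a = 0" "zpar D (wt 0) = 0" for a by (simp_all add: wt0 zdot_def zpar_def)
  have "tens_mult D ?s t = (\<Sum>(w1, w2)\<in>Poly_Mapping.keys t.
      Poly_Mapping.single (FM [i] + w1, w2) (Poly_Mapping.lookup t (w1, w2)))
    + (\<Sum>(w1, w2)\<in>Poly_Mapping.keys t.
      Poly_Mapping.single (w1, FM [i] + w2) (Poly_Mapping.lookup t (w1, w2) * xi D [i] (letters w1)))"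
    unfolding tens_mult_def keys using k
    by (simp add: l z xi_def dotl_def parl_def case_prod_beta mult.assoc)
  then show ?thesis
    by (simp add: plin_add plin_sum case_prod_beta plin_def[of _ t] distrib_left sum.distrib mult.assoc)
qed

lemma plin_coprod_Cons:
  "plin f (coprod_word D (i # is)) =
   plin (\<lambda>(w1, w2). f (FM [i] + w1, w2) + xi D [i] (letters w1) * f (w1, FM [i] + w2)) (coprod_word D is)"
  by (simp add: plin_tens_mult_gen)

lemma plin_coprod_Nil: "plin f (coprod_word D []) = f (0, 0)"
  by (simp add: tens_def)

lemma coprod_mon: "coprod D (mon w) = coprod_word D w"
proof -
  have "Poly_Mapping.map ((*) 1) t = t" for t :: "'a tensor2"
    by (rule poly_mapping_eqI) (simp add: Poly_Mapping.map.rep_eq when_def)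
  then show ?thesis by (simp add: coprod_def mon_def)
qed

lemma plin_coprod: "plin f (coprod D x) = plin (\<lambda>w. plin f (coprod_word D (letters w))) x"
  by (simp add: coprod_def plin_sum plin_map plin_def[of _ x])

lemma tens_form_tens_right: "tens_form B s (tens (mon u) (mon v)) =
  plin (\<lambda>(v1, v2). B (mon (letters v1)) (mon u) * B (mon (letters v2)) (mon v)) s"
  by (simp add: tens_form_eq plin_tens)

lemma tens_form_tens_left: "tens_form B (tens (mon u) (mon v)) t =
  plin (\<lambda>(w1, w2). B (mon u) (mon (letters w1)) * B (mon v) (mon (letters w2))) t"
  by (simp add: tens_form_eq plin_tens)

context datum begin

text \<open>Induction on \<open>w\<close>. Its first letter turns into a skew derivation of the
  product on one side, split in two by the Leibniz rule, and into the leading factor of the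
  coproduct on the other side, which splits in the same way.\<close>

lemma bform_mult_mon: "bform D (mon u * mon v) (mon w) = tens_form (bform D) (tens (mon u) (mon v)) (coprod D (mon w))"
proof -
  let ?B = "bform D"
  have lem: "bform D (mon u * mon v) (mon w) =
      plin (\<lambda>(w1, w2). ?B (mon u) (mon (letters w1)) * ?B (mon v) (mon (letters w2))) (coprod_word D w)" for u v
  proof (induction w arbitrary: u v)
    case Nil
    have "Poly_Mapping.lookup (mon u * mon v) 0 = Poly_Mapping.lookup (mon u) 0 * Poly_Mapping.lookup (mon v) 0"
      unfolding mon_append[symmetric]
      by (simp add: mon_def lookup_single when_def zero_free_monoid_def)
    then show ?case
      by (simp add: plin_coprod_Nil del: coprod_word.simps)
         (simp add: mon_Nil bform_one_right zero_free_monoid_def)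
  next
    case (Cons i w)
    let ?P = "\<lambda>x y. plin (\<lambda>(w1, w2). ?B x (mon (letters w1)) * ?B y (mon (letters w2))) (coprod_word D w)"
    \<comment> \<open>The induction hypothesis concerns words, whereas \<open>dl D i (mon u)\<close>
      is a combination of words, hence this bilinear extension.\<close>
    have IH: "?B (x * y) (mon w) = ?P x y" for x y
    proof -
      have "?B (x * mon v) (mon w) = ?P x (mon v)" for x v
      proof (rule qfun_eqI[of "\<lambda>x. ?B (x * mon v) (mon w)" "\<lambda>x. ?P x (mon v)"])
        show "qfun (\<lambda>x. ?B (x * mon v) (mon w))" by (intro qfun_compose[OF qfun_bform1] qlin_intros)
        show "qfun (\<lambda>x. ?P x (mon v))"
          by (rule qfun_plin_param) (simp add: case_prod_beta qfun_mult_right qfun_bform1)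
      qed (use Cons in simp)
      note x = this
      show ?thesis
      proof (rule qfun_eqI[of "\<lambda>y. ?B (x * y) (mon w)" "\<lambda>y. ?P x y"])
        show "qfun (\<lambda>y. ?B (x * y) (mon w))" by (intro qfun_compose[OF qfun_bform1] qlin_intros)
        show "qfun (\<lambda>y. ?P x y)"
          by (rule qfun_plin_param) (simp add: case_prod_beta qfun_mult qfun_bform1)
      qed (rule x)
    qed
    have "?B (mon u * mon v) (mon (i # w)) = cc D i * ?B (dl D i (mon u * mon v)) (mon w)"
      by (simp add: mon_Cons bform_mult_gen)
    also have "\<dots> = cc D i * (?P (dl D i (mon u)) (mon v) + xi D [i] u * ?P (mon u) (dl D i (mon v)))"
      by (simp add: dl_mon_mult bform_lin IH)
    also have "\<dots> = plin (\<lambda>(w1, w2). ?B (mon u) (mon (letters (FM [i] + w1))) * ?B (mon v) (mon (letters w2))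
        + xi D [i] (letters w1) * (?B (mon u) (mon (letters w1)) * ?B (mon v) (mon (letters (FM [i] + w2))))) (coprod_word D w)"
      unfolding distrib_left plin_cmult[symmetric] plin_plus[symmetric] case_prod_beta
    proof (rule plin_cong)
      fix k :: "'i free_monoid \<times> 'i free_monoid"
      obtain w1 w2 where k: "k = (FM w1, FM w2)" by (metis free_monoid.exhaust prod.exhaust)
      \<comment> \<open>The Leibniz rule yields the braiding factor with \<open>u\<close>, the
        coproduct that with \<open>w1\<close>. They can differ only for different weights, and then
        the form vanishes.\<close>
      have x: "xi D [i] u * (?B (mon u) (mon w1) * z) = xi D [i] w1 * (?B (mon u) (mon w1) * z)" for z
        by (cases "wt (FM u) = wt (FM w1)") (auto simp: bform_weight dest: xi_wt_cong(2)[of u w1 D "[i]"])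
      show "cc D i * (?B (dl D i (mon u)) (mon (letters (fst k))) * ?B (mon v) (mon (letters (snd k)))) +
            cc D i * (xi D [i] u * (?B (mon u) (mon (letters (fst k))) * ?B (dl D i (mon v)) (mon (letters (snd k))))) =
          ?B (mon u) (mon (letters (FM [i] + fst k))) * ?B (mon v) (mon (letters (snd k))) +
          xi D [i] (letters (fst k)) * (?B (mon u) (mon (letters (fst k))) * ?B (mon v) (mon (letters (FM [i] + snd k))))"
        using x[of "cc D i * ?B (dl D i (mon v)) (mon w2)"]
        by (simp add: k plus_free_monoid_def mon_Cons bform_mult_gen mult_ac)
    qed
    also have "\<dots> = plin (\<lambda>(w1, w2). ?B (mon u) (mon (letters w1)) * ?B (mon v) (mon (letters w2))) (coprod_word D (i # w))"
      unfolding plin_coprod_Cons by (simp add: case_prod_beta)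
    finally show ?case .
  qed
  show ?thesis by (simp add: tens_form_tens_left coprod_mon lem)
qed

lemma tens_form_qfun1: "qfun (\<lambda>x. tens_form B (tens x y) t)" "qfun (\<lambda>x. tens_form B (tens y x) t)"
  unfolding tens_form_eq plin_tens
  by (auto intro: qfun_plin qfun_plin_param)

lemma tens_form_qfun3: "qfun (\<lambda>x. tens_form B s (coprod D x))" "qfun (\<lambda>x. tens_form B (coprod D x) t)"
  unfolding tens_form_eq plin_coprod
  by (auto intro!: qfun_plin qfun_plin_param simp: case_prod_beta)

lemma tens_form_swap:
  assumes "\<And>x y. B x y = B y x"
  shows "tens_form B s t = tens_form B t s"
proof -
  have "tens_form B s t = (\<Sum>v\<in>Poly_Mapping.keys s. \<Sum>w\<in>Poly_Mapping.keys t. Poly_Mapping.lookup s v * (Poly_Mapping.lookup t w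
      * (B (mon (letters (fst v))) (mon (letters (fst w))) * B (mon (letters (snd v))) (mon (letters (snd w))))))" for s t
    by (simp add: tens_form_eq plin_def sum_distrib_left case_prod_beta)
  note * = this
  show ?thesis unfolding *[of s t] *[of t s]
    by (subst sum.swap, intro sum.cong refl, subst (1 2) assms) (simp only: mult.left_commute)
qed

lemma is_free_form_bform: "is_free_form D (bform D)"
proof -
  have m: "bform D (x * x') y = tens_form (bform D) (tens x x') (coprod D y)" for x x' y
  proof -
    have 1: "bform D (mon u * mon v) y = tens_form (bform D) (tens (mon u) (mon v)) (coprod D y)" for u v
      by (rule qfun_eqI[OF qfun_bform2 tens_form_qfun3(1)]) (rule bform_mult_mon)
    have 2: "bform D (x * mon v) y = tens_form (bform D) (tens x (mon v)) (coprod D y)" for v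
      by (rule qfun_eqI[OF qfun_compose[OF qfun_bform1 qlin_mult_right[OF qlin_id]] tens_form_qfun1(1)]) (rule 1)
    show ?thesis
      by (rule qfun_eqI[OF qfun_compose[OF qfun_bform1 qlin_mult_left[OF qlin_id]] tens_form_qfun1(2)]) (rule 2)
  qed
  have "bform D x (y * y') = tens_form (bform D) (coprod D x) (tens y y')" for x y y'
    using m[of y y' x] tens_form_swap[OF bform_sym] by (simp add: bform_sym)
  moreover have "bform D (gen i) (gen j) = (if i = j then cc D i else 0)" for i j
    using bform_gen_mult[of D i 1 "gen j"] dl_gen_mult[of D i j 1]
    by (simp add: bform_lin bform_one)
  ultimately show ?thesis
    unfolding is_free_form_def by (simp add: bform_lin m bform_one cc_def)
qed

text \<open>\<open>free_form\<close> is a definite description, so the axioms have to force all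
  values. The coproducts of 1 and of a generator settle the pairings with these elements; a longer
  word is split after its first letter.\<close>

lemma free_form_unique:
  assumes "is_free_form D B"
  shows "B = bform D"
proof -
  have q1: "qfun (\<lambda>x. B x y)" and q2: "qfun (B x)" for x y
    using assms by (auto simp: is_free_form_def qfun_def)
  have one: "B 1 1 = 1" and gg: "B (gen i) (gen j) = (if i = j then cc D i else 0)"
    and r: "B x (y * y') = tens_form B (coprod D x) (tens y y')"
    and l: "B (x * x') y = tens_form B (tens x x') (coprod D y)" for i j x y x' y'
    using assms by (auto simp: is_free_form_def cc_def)
  have r1: "B 1 (mon u * mon v) = B 1 (mon u) * B 1 (mon v)" for u v
    using coprod_mon[of D "[]"]
    by (simp add: r tens_form_tens_right plin_coprod_Nil mon_Nil zero_free_monoid_def del: coprod_word.simps)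
  have rg: "B (gen i) (mon u * mon v) = B (gen i) (mon u) * B 1 (mon v) + B 1 (mon u) * B (gen i) (mon v)" for i u v
    using coprod_mon[of D "[i]"]
    by (simp add: r tens_form_tens_right plin_coprod_Nil plin_coprod_Cons mon_Nil
        gen_eq_mon zero_free_monoid_def plus_free_monoid_def del: coprod_word.simps)
  have l1: "B (mon u * mon v) 1 = B (mon u) 1 * B (mon v) 1" for u v
    using coprod_mon[of D "[]"]
    by (simp add: l tens_form_tens_left plin_coprod_Nil mon_Nil zero_free_monoid_def del: coprod_word.simps)
  have lg: "B (mon u * mon v) (gen i) = B (mon u) (gen i) * B (mon v) 1 + B (mon u) 1 * B (mon v) (gen i)" for i u v
    using coprod_mon[of D "[i]"]
    by (simp add: l tens_form_tens_left plin_coprod_Nil plin_coprod_Cons mon_Nil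
        gen_eq_mon zero_free_monoid_def plus_free_monoid_def del: coprod_word.simps)
  \<comment> \<open>The product of 1 with itself gives \<open>b = b + b\<close> for
    \<open>b = B 1 (gen i)\<close>.\<close>
  have B1g: "B 1 (gen i) = 0" for i
    using lg[of "[]" "[]" i] by (simp add: mon_Nil one)
  have Bg1: "B (gen i) 1 = 0" for i
    using rg[of i "[]" "[]"] by (simp add: mon_Nil one)
  have B1: "B 1 (mon w) = bform D 1 (mon w)" for w
  proof (induction w)
    case (Cons i w)
    then show ?case using r1[of "[i]" w] B1g[of i]
      by (simp add: mon_Cons bform_one gen_eq_mon[symmetric] mon_Nil)
  qed (simp add: mon_Nil one bform_one)
  have Bg: "B (gen i) (mon w) = bform D (gen i) (mon w)" for i w
  proof (induction w)
    case (Cons j w)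
    have "bform D (gen i) (gen j * mon w) = cc D i * (if i = j then Poly_Mapping.lookup (mon w) 0 else 0)"
      using bform_gen_mult[of D i 1 "gen j * mon w"]
      by (simp add: dl_gen_mult bform_lin bform_one lookup_add)
    then show ?case using rg[of i "[j]" w] gg[of i j] B1g[of j] B1[of w]
      by (simp add: mon_Cons bform_one mon_Nil)
  next
    case Nil
    show ?case using Bg1 by (simp add: mon_Nil bform_one_right)  (metis lookup_gen_mult_0 mult.right_neutral)
  qed
  have "B (mon u) (mon w) = bform D (mon u) (mon w)" for u w
  proof (induction u arbitrary: w)
    case Nil
    then show ?case by (simp add: mon_Nil B1)
  next
    case (Cons i u)
    have "B (mon (i # u)) (mon w) = tens_form B (tens (mon [i]) (mon u)) (coprod D (mon w))"
      using l[of "mon [i]" "mon u"] by (simp add: mon_append[symmetric])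
    also have "\<dots> = tens_form (bform D) (tens (mon [i]) (mon u)) (coprod D (mon w))"
      using Bg by (simp add: tens_form_tens_left Cons gen_eq_mon)
    also have "\<dots> = bform D (mon (i # u)) (mon w)"
      using bform_mult_mon[of "[i]" u w] by (simp add: mon_append[symmetric])
    finally show ?case .
  qed
  then have "B (mon u) y = bform D (mon u) y" for u y using qfun_eqI[OF q2 qfun_bform2] by metis
  then have "B x y = bform D x y" for x y using qfun_eqI[OF q1 qfun_bform1] by metis
  then show ?thesis by blast
qed

lemma free_form_eq: "free_form D = bform D"
  unfolding free_form_def using is_free_form_bform free_form_unique by blast

lemma radical_iff: "x \<in> radical D \<longleftrightarrow> (\<forall>y. bform D x y = 0)"
  by (simp add: radical_def free_form_eq)

lemma radical_iff_mon: "x \<in> radical D \<longleftrightarrow> (\<forall>w. bform D x (mon w) = 0)"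
  unfolding radical_iff using qfun_eqI[OF qfun_bform2 qfun_zero] by metis

lemma radical_0 [simp]: "0 \<in> radical D"
  and radical_add: "x \<in> radical D \<Longrightarrow> y \<in> radical D \<Longrightarrow> x + y \<in> radical D"
  and radical_const: "x \<in> radical D \<Longrightarrow> const c * x \<in> radical D"
  by (simp_all add: radical_iff bform_lin)

end

context datum begin

lemma dd_pos: "dd D i > 0" and dot_diag: "dot D i i = 2 * dd D i"
  using super_cartan by (auto simp: super_cartan_datum_def dd_def)

lemma q_i_powi: "q_i D i powi a = q_elt powi (dd D i * a)"
  by (simp add: q_i_def q_powi_powi)

lemma cc_inverse: "cc D i * (1 - pi_elt powi par D i * q_elt powi (- 2 * dd D i)) = 1"
proof -
  have u: "(1 - pi_elt powi par D i * q_elt powi (- 2 * dd D i)) dvd 1"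
    using unit_diff[of 0 "- 2 * dd D i" 0 "par D i"] dd_pos[of i] by simp
  show ?thesis using unit_inverse_qpi[OF u] by (simp add: cc_def q_i_powi pi_i_def mult_ac)
qed

lemma cc_cancel: "cc D i * x = 0 \<Longrightarrow> x = 0"
  by (metis cc_inverse mult.commute mult.left_commute mult_zero_right mult_1)

section \<open>The radical\<close>

lemma radical_lookup_0: "x \<in> radical D \<Longrightarrow> Poly_Mapping.lookup x 0 = 0"
  using radical_iff[of x] bform_one_right[of D x] by simp

text \<open>The derivations are adjoint to multiplication by generators up to the factor
  \<open>cc\<close>, which can be cancelled.\<close>

lemma radical_dl: "x \<in> radical D \<Longrightarrow> dl D i x \<in> radical D"
  unfolding radical_iff using bform_mult_gen[of x i] cc_cancel by metis

lemma radical_dr: "x \<in> radical D \<Longrightarrow> dr D i x \<in> radical D"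
  unfolding radical_iff using bform_mult_gen_left[of _ i x] cc_cancel bform_sym by metis

lemma radical_uminus: "x \<in> radical D \<Longrightarrow> - x \<in> radical D"
  using radical_const[of x "-1"] by (simp add: const_simps)

lemma radical_diff: "x \<in> radical D \<Longrightarrow> y \<in> radical D \<Longrightarrow> x - y \<in> radical D"
  using radical_add radical_uminus by fastforce

lemma radical_mult_left: "x \<in> radical D \<Longrightarrow> z * x \<in> radical D"
proof (induction z rule: free_induct)
  case (mon c w)
  have "mon w * x \<in> radical D"
    using \<open>x \<in> radical D\<close>
    by (induction w) (auto simp: mon_Nil mon_Cons mult.assoc radical_iff bform_gen_mult bform_lin)
  then show ?case by (simp add: mult.assoc radical_const)
qed (simp add: distrib_right radical_add)

lemma radical_mult_right: "x \<in> radical D \<Longrightarrow> x * z \<in> radical D"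
proof (induction z rule: free_induct)
  case (mon c w)
  have "x * mon w \<in> radical D"
  proof (induction w rule: rev_induct)
    case (snoc i w)
    then show ?case
      by (simp add: mon_append gen_eq_mon[symmetric] mult.assoc[symmetric] radical_iff bform_mult_gen_left)
  qed (simp add: mon_Nil mon)
  then show ?case by (simp add: const_left_comm[of x] radical_const)
qed (simp add: distrib_left radical_add)

lemma bform_scal: "bform D (scal g x) y = bform D x (scal g y)"
proof -
  have 1: "bform D (scal g (mon u)) (mon v) = bform D (mon u) (scal g (mon v))" for u v
    by (cases "wt (FM u) = wt (FM v)") (simp_all add: bform_lin bform_weight)
  have 2: "bform D (scal g (mon u)) y = bform D (mon u) (scal g y)" for u
    by (rule qfun_eqI[OF qfun_bform2 qfun_compose[OF qfun_bform2 qlin_scal]]) (rule 1)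
  show ?thesis
    by (rule qfun_eqI[OF qfun_compose[OF qfun_bform1 qlin_scal] qfun_bform1]) (rule 2)
qed

lemma radical_scal: "x \<in> radical D \<Longrightarrow> scal g x \<in> radical D"
  by (simp add: radical_iff bform_scal)

text \<open>Pairing with a word that ends in \<open>i\<close> is, up to \<open>cc D i\<close>,
  pairing \<open>dr D i x\<close> with the shorter word. Only the empty word needs the constant
  term.\<close>

lemma radicalI_dr:
  assumes "\<And>i. dr D i x \<in> radical D" "Poly_Mapping.lookup x 0 = 0"
  shows "x \<in> radical D"
  unfolding radical_iff_mon
proof
  show "bform D x (mon w) = 0" for w
  proof (cases w rule: rev_cases)
    case (snoc u i)
    have "bform D x (mon w) = bform D (mon u * gen i) x"
      unfolding snoc mon_append gen_eq_mon by (rule bform_sym)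
    also have "\<dots> = cc D i * bform D (dr D i x) (mon u)"
      unfolding bform_mult_gen_left by (subst bform_sym) simp
    finally show ?thesis using assms(1) by (simp add: radical_iff)
  qed (simp add: mon_Nil bform_one_right assms)
qed

lemma dr_mult_gen: "dr D i (x * gen k) = (if i = k then x else 0) + const (xi D [i] [k]) * (dr D i x * gen k)"
proof (rule qlin_eqI[of "\<lambda>x. dr D i (x * gen k)" "\<lambda>x. (if i = k then x else 0) + const (xi D [i] [k]) * (dr D i x * gen k)"])
  show "qlin (\<lambda>x. dr D i (x * gen k))"
    by (intro qlin_compose[OF qlin_dr] qlin_intros)
  have "qlin (\<lambda>x. if i = k then x else 0)" by (cases "i = k") (simp_all add: qlin_intros)
  then show "qlin (\<lambda>x. (if i = k then x else 0) + const (xi D [i] [k]) * (dr D i x * gen k))"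
    by (intro qlin_plus qlin_mult_left qlin_mult_right qlin_dr)
  show "dr D i (mon w * gen k) = (if i = k then mon w else 0) + const (xi D [i] [k]) * (dr D i (mon w) * gen k)" for w
  proof (induction w)
    case (Cons j w)
    have 1: "dr D i (mon (j # w) * gen k) = (if i = j then const (xi D [i] [k] * xi D [i] w) * (mon w * gen k) else 0) + gen j * dr D i (mon w * gen k)"
      by (simp add: gen_eq_mon mon_append[symmetric] dr_mon xi_append mult.commute)
    have 2: "dr D i (mon (j # w)) = (if i = j then const (xi D [i] w) * mon w else 0) + gen j * dr D i (mon w)"
      by (simp add: dr_mon)
    show ?case unfolding 1 Cons unfolding 2
      by (simp add: distrib_left distrib_right mon_Cons mult.assoc const_norm const_const)
  qed (simp add: mon_Nil gen_eq_mon dr_mon const_simps(2))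
qed

end

section \<open>Quantum Serre relations\<close>

text \<open>Iterated skew commutators of \<open>\<theta>\<^sub>i\<close> with \<open>\<theta>\<^sub>j\<close>. At the step \<open>1 - \<langle>i,j'\<rangle>\<close> all right skew derivations
  vanish, which puts the element into the radical.\<close>

primrec serre_elt :: "('i::finite, 'y, 'x) root_data \<Rightarrow> 'i \<Rightarrow> 'i \<Rightarrow> nat \<Rightarrow> 'i free_alg" where
  "serre_elt D i j 0 = gen j"
| "serre_elt D i j (Suc m) = gen i * serre_elt D i j m -
     const (q_elt powi (- (dot D i j + int m * dot D i i)) * pi_elt powi (par D i * par D j + int m * par D i))
       * (serre_elt D i j m * gen i)"

context datum begin

lemma par_sq: "par D i * par D i = par D i" by (simp add: par_def)

lemma xi_replicate: "xi D [i] (replicate m i @ [j]) = q_elt powi (dot D i j + int m * dot D i i) * pi_elt powi (par D i * par D j + int m * par D i)"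
proof (induction m)
  case (Suc m)
  have "xi D [i] (replicate (Suc m) i @ [j]) = xi D [i] [i] * xi D [i] (replicate m i @ [j])"
    by (simp add: xi_Cons)
  also have "\<dots> = q_elt powi (dot D i i + (dot D i j + int m * dot D i i)) * pi_elt powi (par D i + (par D i * par D j + int m * par D i))"
    unfolding Suc q_powi_add pi_powi_add by (simp add: xi_def par_sq mult_ac)
  finally show ?case by (simp add: algebra_simps)
qed (simp add: xi_def)

lemma serre_weight: "serre_elt D i j m \<in> weight_part (wt (FM (replicate m i @ [j])))"
proof (induction m)
  case (Suc m)
  have "gen i * serre_elt D i j m \<in> weight_part (wt (FM (replicate (Suc m) i @ [j])))"
    using weight_part_mult[OF weight_part_gen Suc, of i] wt_Cons[of i "replicate m i @ [j]"] by simp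
  moreover have "serre_elt D i j m * gen i \<in> weight_part (wt (FM (replicate (Suc m) i @ [j])))"
    using weight_part_mult[OF Suc weight_part_gen, of i] wt_Cons[of i "replicate m i @ [j]"] by (simp add: add.commute)
  then have "(- const (q_elt powi (- (dot D i j + int m * dot D i i)) * pi_elt powi (par D i * par D j + int m * par D i)))
       * (serre_elt D i j m * gen i) \<in> weight_part (wt (FM (replicate (Suc m) i @ [j])))"
    by (metis const_simps(5) weight_part_const)
  ultimately show ?case using weight_part_add by fastforce
qed (simp add: weight_part_gen)

lemma dr_serre_other:
  assumes "l \<noteq> i" "l \<noteq> j"
  shows "dr D l (serre_elt D i j m) = 0"
proof (induction m)
  case 0
  then show ?case using dr_gen_mult[of D l j 1] assms by simp
next
  case (Suc m)
  then show ?case using assms by (simp add: qlin_diff[OF qlin_dr] dr_const dr_gen_mult dr_mult_gen)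
qed

text \<open>The first coefficient in \<open>serre_elt\<close> is inverse to the braiding factor of
  \<open>j\<close> with \<open>i\<close>, so the two terms cancel at the first commutator; later
  commutators with \<open>gen i\<close> preserve the zero.\<close>

lemma dr_serre_j:
  assumes "i \<noteq> j"
  shows "dr D j (serre_elt D i j (Suc m)) = 0"
proof (induction m)
  case 0
  have 1: "dr D j (gen j) = 1" using drw.simps(2)[of D j j "[]"] dr_mon[of D j "[j]"]
    by (simp add: gen_eq_mon mon_Nil const_simps)
  have "q_elt powi (- dot D i j) * pi_elt powi (par D i * par D j) * xi D [j] [i]
      = q_elt powi (- dot D i j + dot D i j) * pi_elt powi (par D i * par D j + par D i * par D j)"
    unfolding q_powi_add pi_powi_add by (simp add: xi_def dot_sym[of j i] mult_ac)
  then have "q_elt powi (- dot D i j) * pi_elt powi (par D i * par D j) * xi D [j] [i] = 1"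
    by (simp add: pi_powi_even)
  moreover have "dr D j (gen j * gen i) = const (xi D [j] [i]) * gen i" "dr D j (gen i * gen j) = gen i"
    using dr_mult_gen[of j "gen j" i] dr_gen_mult[of D j i "gen j"] assms 1 by simp_all
  ultimately show ?case
    by (simp add: qlin_diff[OF qlin_dr] dr_const const_const const_simps(2))
next
  case (Suc m)
  then show ?case using assms
    by (simp add: qlin_diff[OF qlin_dr] dr_const dr_gen_mult dr_mult_gen del: serre_elt.simps(2)
        add: serre_elt.simps(2)[of _ _ _ "Suc _"])
qed

abbreviation "serre_up i j k \<equiv> q_elt powi (dot D i j + int k * dot D i i) * pi_elt powi (par D i * par D j + int k * par D i)"
abbreviation "serre_dn i j k \<equiv> q_elt powi (- (dot D i j + int k * dot D i i)) * pi_elt powi (par D i * par D j + int k * par D i)"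

text \<open>Each commutator contributes one summand of the scalar. The remaining terms reproduce the
  commutator of the predecessor, since the factor \<open>xi D [i] [i]\<close> turns the coefficient
  of step \<open>Suc m\<close> into that of step \<open>m\<close>.\<close>

lemma dr_serre_i:
  assumes "i \<noteq> j"
  shows "dr D i (serre_elt D i j (Suc m)) = const (\<Sum>k<Suc m. serre_up i j k - serre_dn i j k) * serre_elt D i j m"
proof (induction m)
  have step: "dr D i (serre_elt D i j (Suc m)) = const (serre_up i j m - serre_dn i j m) * serre_elt D i j m
     + (gen i * dr D i (serre_elt D i j m) - const (serre_dn i j m * xi D [i] [i]) * (dr D i (serre_elt D i j m) * gen i))" for m
  proof -
    let ?f = "\<lambda>a. q_elt powi zdot D (wt (FM [i])) a * pi_elt powi (zpar D (wt (FM [i])) * zpar D a)"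
    have "scal ?f (serre_elt D i j m) = const (?f (wt (FM (replicate m i @ [j])))) * serre_elt D i j m"
      by (rule scal_weight_part[OF serre_weight])
    also have "?f (wt (FM (replicate m i @ [j]))) = serre_up i j m"
      using xi_replicate[of i m j] by (simp add: xi_def dotl_def parl_def)
    finally have s: "scal ?f (serre_elt D i j m) = const (serre_up i j m) * serre_elt D i j m" .
    have "dr D i (serre_elt D i j (Suc m)) = (scal ?f (serre_elt D i j m) + gen i * dr D i (serre_elt D i j m))
        - const (serre_dn i j m) * (serre_elt D i j m + const (xi D [i] [i]) * (dr D i (serre_elt D i j m) * gen i))"
      by (simp add: qlin_diff[OF qlin_dr] dr_const dr_gen_mult dr_mult_gen)
    then show ?thesis unfolding s
      by (simp add: const_simps(4) distrib_left left_diff_distrib const_const algebra_simps)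
  qed
  {
    case 0
    have "dr D i (gen j) = 0" using dr_gen_mult[of D i j 1] assms by simp
    then show ?case using step[of 0] by simp
  next
    case (Suc m)
    have d: "serre_dn i j (Suc m) * xi D [i] [i] = serre_dn i j m"
    proof -
      have "serre_dn i j (Suc m) * xi D [i] [i] =
          q_elt powi (- (dot D i j + int (Suc m) * dot D i i) + dot D i i) * pi_elt powi ((par D i * par D j + int (Suc m) * par D i) + par D i)"
        unfolding q_powi_add pi_powi_add by (simp add: xi_def par_sq mult_ac)
      also have "\<dots> = serre_dn i j m"
        by (intro arg_cong2[of _ _ _ _ "(*)"] pi_powi_cong arg_cong[of _ _ "\<lambda>a. q_elt powi a"]) (simp_all add: algebra_simps)
      finally show ?thesis .
    qed
    let ?a = "\<Sum>k<Suc m. serre_up i j k - serre_dn i j k"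
    have aux: "gen i * (const a * x) - const c * (const a * x * gen i) = const a * (gen i * x - const c * (x * gen i))" for a c x
      by (simp add: const_norm const_const mult.assoc right_diff_distrib mult.commute[of a c])
    have "gen i * (const ?a * serre_elt D i j m) - const (serre_dn i j m) * (const ?a * serre_elt D i j m * gen i)
        = const ?a * serre_elt D i j (Suc m)"
      unfolding serre_elt.simps by (rule aux)
    then show ?case
      unfolding step[of "Suc m"] d Suc sum.lessThan_Suc[of _ "Suc m"] const_simps(3)
      by (simp add: distrib_right add.commute del: sum.lessThan_Suc serre_elt.simps)
  }
qed

text \<open>For n = -<i,j'> the values of \<open>serre_up\<close> and \<open>serre_dn\<close> below
  \<open>Suc n\<close> are the same in opposite order, so the scalar in \<open>dr_serre_i\<close>
  vanishes and \<open>radicalI_dr\<close> applies.\<close>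

lemma serre_radical:
  assumes "i \<noteq> j"
  shows "\<exists>N. serre_elt D i j N \<in> radical D"
proof -
  have dv: "dot D i i dvd 2 * dot D i j" and neg: "2 * dot D i j div dot D i i \<le> 0"
    and ev: "i \<in> odd_part D \<Longrightarrow> even (2 * dot D i j div dot D i i)"
    using super_cartan assms by (auto simp: super_cartan_datum_def)
  define n where "n = nat (- (2 * dot D i j div dot D i i))"
  have n': "2 * dot D i j div dot D i i = - int n" using neg by (simp add: n_def)
  have n: "2 * dot D i j = - dot D i i * int n"
    using dvd_mult_div_cancel[OF dv] unfolding n' by simp
  \<comment> \<open>The condition of the super Cartan datum on odd \<open>i\<close> makes the
    exponents of pi agree modulo 2 under the reversal of the order.\<close>
  have "i \<in> odd_part D \<Longrightarrow> even (int n)" using ev unfolding n' by simp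
  then have even: "even (int n * par D i)" by (auto simp: par_def)
  have up: "serre_up i j (Suc n - Suc k) = serre_dn i j k" if "k < Suc n" for k
  proof (intro arg_cong2[of _ _ _ _ "(*)"] pi_powi_cong arg_cong[of _ _ "\<lambda>a. q_elt powi a"])
    have k: "int (Suc n - Suc k) = int n - int k" using that by auto
    show "dot D i j + int (Suc n - Suc k) * dot D i i = - (dot D i j + int k * dot D i i)"
      using n unfolding k by (simp add: algebra_simps)
    show "even (par D i * par D j + int (Suc n - Suc k) * par D i - (par D i * par D j + int k * par D i))"
      using even unfolding k by (simp add: algebra_simps)
  qed
  have "(\<Sum>k<Suc n. serre_up i j k) = (\<Sum>k<Suc n. serre_up i j (Suc n - Suc k))"
    by (rule sum.nat_diff_reindex[symmetric])
  also have "\<dots> = (\<Sum>k<Suc n. serre_dn i j k)" by (intro sum.cong refl up) simp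
  finally have 0: "(\<Sum>k<Suc n. serre_up i j k - serre_dn i j k) = 0" by (simp only: sum_subtractf diff_self)
  have "serre_elt D i j (Suc n) \<in> radical D"
  proof (rule radicalI_dr)
    show "dr D l (serre_elt D i j (Suc n)) \<in> radical D" for l
    proof -
      have "dr D i (serre_elt D i j (Suc n)) = 0"
        unfolding dr_serre_i[OF assms] 0 by (simp add: const_simps)
      then show ?thesis
        using dr_serre_other[of l i j "Suc n"] dr_serre_j[OF assms] by (cases "l = i"; cases "l = j"; simp)
    qed
    have "wt (FM []) \<noteq> wt (FM (replicate (Suc n) i @ [j]))"
    proof
      assume "wt (FM []) = wt (FM (replicate (Suc n) i @ [j]))"
      then have "wt (FM []) j = wt (FM (replicate (Suc n) i @ [j])) j" by simp
      then show False by (simp add: wt_def split: if_splits)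
    qed
    then show "Poly_Mapping.lookup (serre_elt D i j (Suc n)) 0 = 0"
      using serre_weight[of i j "Suc n"] by (force simp: weight_part_def in_keys_iff zero_free_monoid_def)
  qed
  then show ?thesis by blast
qed

end

section \<open>Quotients of free algebras\<close>

lemma class_ring_simps [simp]:
  "carrier class_ring = UNIV" "mult class_ring = (*)" "one class_ring = 1"
  "zero class_ring = 0" "add class_ring = (+)"
  by (simp_all add: class_ring_def)

lemma ring_class_ring: "ring class_ring"
proof (rule ringI)
  show "abelian_group class_ring"
    by (rule abelian_groupI) (auto simp: add.assoc add.commute intro: exI[of _ "- _"])
  show "monoid class_ring" by (rule monoidI) (auto simp: mult.assoc)
qed (auto simp: algebra_simps)

lemma class_ring_a_inv: "\<ominus>\<^bsub>class_ring\<^esub> x = - x"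
proof -
  interpret ring class_ring by (rule ring_class_ring)
  show ?thesis by (rule minus_equality) auto
qed

lemma class_ring_idealI:
  fixes I :: "'a::ring_1 set"
  assumes "0 \<in> I" "\<And>x y. x \<in> I \<Longrightarrow> y \<in> I \<Longrightarrow> x + y \<in> I"
    and "\<And>x z. x \<in> I \<Longrightarrow> z * x \<in> I" "\<And>x z. x \<in> I \<Longrightarrow> x * z \<in> I"
  shows "ideal I class_ring"
proof -
  interpret ring class_ring by (rule ring_class_ring)
  have "- x \<in> I" if "x \<in> I" for x
    using assms(3)[OF that, of "-1"] by simp
  then have "subgroup I (add_monoid class_ring)"
    using assms add.subgroupI[of I] by (auto simp: class_ring_a_inv)
  then show ?thesis using assms by (intro idealI ring_class_ring) auto
qed

lemma class_coset: "I +>\<^bsub>class_ring\<^esub> x = (\<lambda>a. a + x) ` I"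
  by (auto simp: a_r_coset_def r_coset_def)

context
  fixes I :: "'a::ring_1 set"
  assumes I: "ideal I class_ring"
begin

lemma class_ideal_closed:
  "0 \<in> I" "x \<in> I \<Longrightarrow> y \<in> I \<Longrightarrow> x + y \<in> I" "x \<in> I \<Longrightarrow> - x \<in> I" "x \<in> I \<Longrightarrow> y \<in> I \<Longrightarrow> x - y \<in> I"
  "x \<in> I \<Longrightarrow> z * x \<in> I" "x \<in> I \<Longrightarrow> x * z \<in> I"
proof -
  interpret ideal I class_ring by (rule I)
  show 0: "0 \<in> I" using additive_subgroup.zero_closed[OF is_additive_subgroup] by simp
  show add: "x \<in> I \<Longrightarrow> y \<in> I \<Longrightarrow> x + y \<in> I" for x y
    using additive_subgroup.a_closed[OF is_additive_subgroup, of x y] by simp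
  show mult: "x \<in> I \<Longrightarrow> z * x \<in> I" for x z using I_l_closed by simp
  show "x \<in> I \<Longrightarrow> x * z \<in> I" using I_r_closed by simp
  show m: "x \<in> I \<Longrightarrow> - x \<in> I" for x using mult[of x "-1"] by simp
  show "x \<in> I \<Longrightarrow> y \<in> I \<Longrightarrow> x - y \<in> I" using add m by fastforce
qed

lemma class_coset_eq_iff: "I +>\<^bsub>class_ring\<^esub> x = I +>\<^bsub>class_ring\<^esub> y \<longleftrightarrow> x - y \<in> I"
proof
  assume "I +>\<^bsub>class_ring\<^esub> x = I +>\<^bsub>class_ring\<^esub> y"
  then have "0 + x \<in> (\<lambda>a. a + y) ` I" using class_ideal_closed(1) by (auto simp: class_coset)
  then show "x - y \<in> I" by auto
next
  assume *: "x - y \<in> I"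
  have "(\<lambda>a. a + (x - y)) ` I = I"
  proof
    show "I \<subseteq> (\<lambda>a. a + (x - y)) ` I"
    proof
      fix a assume "a \<in> I"
      then have "a - (x - y) \<in> I" using * by (rule class_ideal_closed(4))
      then show "a \<in> (\<lambda>a. a + (x - y)) ` I" by (rule rev_image_eqI) simp
    qed
  qed (use * class_ideal_closed(2) in auto)
  then have "(\<lambda>a. a + y) ` I = (\<lambda>a. a + y) ` (\<lambda>a. a + (x - y)) ` I" by simp
  then show "I +>\<^bsub>class_ring\<^esub> x = I +>\<^bsub>class_ring\<^esub> y"
    unfolding class_coset image_image by simp
qed

lemma class_quot_simps:
  "carrier (class_ring Quot I) = range (\<lambda>x. I +>\<^bsub>class_ring\<^esub> x)"
  "(I +>\<^bsub>class_ring\<^esub> x) \<otimes>\<^bsub>class_ring Quot I\<^esub> (I +>\<^bsub>class_ring\<^esub> y) = I +>\<^bsub>class_ring\<^esub> (x * y)"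
  "(I +>\<^bsub>class_ring\<^esub> x) \<oplus>\<^bsub>class_ring Quot I\<^esub> (I +>\<^bsub>class_ring\<^esub> y) = I +>\<^bsub>class_ring\<^esub> (x + y)"
  "\<one>\<^bsub>class_ring Quot I\<^esub> = I +>\<^bsub>class_ring\<^esub> 1"
  "\<zero>\<^bsub>class_ring Quot I\<^esub> = I +>\<^bsub>class_ring\<^esub> 0"
proof -
  interpret ideal I class_ring by (rule I)
  show "carrier (class_ring Quot I) = range (\<lambda>x. I +>\<^bsub>class_ring\<^esub> x)"
    by (auto simp: FactRing_def A_RCOSETS_def RCOSETS_def a_r_coset_def)
  show "(I +>\<^bsub>class_ring\<^esub> x) \<otimes>\<^bsub>class_ring Quot I\<^esub> (I +>\<^bsub>class_ring\<^esub> y) = I +>\<^bsub>class_ring\<^esub> (x * y)"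
    using ring_hom_mult[OF rcos_ring_hom, of x y] by simp
  show "(I +>\<^bsub>class_ring\<^esub> x) \<oplus>\<^bsub>class_ring Quot I\<^esub> (I +>\<^bsub>class_ring\<^esub> y) = I +>\<^bsub>class_ring\<^esub> (x + y)"
    using ring_hom_add[OF rcos_ring_hom, of x y] by simp
  show "\<one>\<^bsub>class_ring Quot I\<^esub> = I +>\<^bsub>class_ring\<^esub> 1"
    by (simp add: FactRing_def)
  show "\<zero>\<^bsub>class_ring Quot I\<^esub> = I +>\<^bsub>class_ring\<^esub> 0"
    by (simp add: FactRing_def class_coset)
qed

end

section \<open>The quantum covering group\<close>

lemma ideal_u_ideal: "ideal (u_ideal D) class_ring"
  unfolding u_ideal_def by (rule ring.genideal_ideal[OF ring_class_ring]) simp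

lemma u_relators_subset: "u_relators D \<subseteq> u_ideal D"
  unfolding u_ideal_def by (rule ring.genideal_self[OF ring_class_ring]) simp

lemma u_ideal_minimal: "ideal I class_ring \<Longrightarrow> u_relators D \<subseteq> I \<Longrightarrow> u_ideal D \<subseteq> I"
  unfolding u_ideal_def by (rule ring.genideal_minimal[OF ring_class_ring])

lemma ring_u_alg: "ring (u_alg D)"
  unfolding u_alg_def by (rule ideal.quotient_is_ring[OF ideal_u_ideal])

lemma u_cls_eq_iff: "u_cls D x = u_cls D y \<longleftrightarrow> x - y \<in> u_ideal D"
  unfolding u_cls_def by (rule class_coset_eq_iff[OF ideal_u_ideal])

lemma u_alg_simps:
  "carrier (u_alg D) = range (u_cls D)"
  "u_cls D x \<otimes>\<^bsub>u_alg D\<^esub> u_cls D y = u_cls D (x * y)"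
  "u_cls D x \<oplus>\<^bsub>u_alg D\<^esub> u_cls D y = u_cls D (x + y)"
  "\<one>\<^bsub>u_alg D\<^esub> = u_cls D 1"
  "\<zero>\<^bsub>u_alg D\<^esub> = u_cls D 0"
  using class_quot_simps[OF ideal_u_ideal[of D]]
  by (simp_all add: u_alg_def u_cls_def[abs_def])

text \<open>Serves Verma modules and the modules V alike: the carrier is the image of a group of
  representatives under a class map, and the module laws are inherited from an action of the free
  algebra on representatives.\<close>

lemma left_moduleI_surj:
  fixes ext :: "('i::finite, 'y::ab_group_add) u_gen free_alg \<Rightarrow> 'v::ab_group_add \<Rightarrow> 'v"
  assumes surj: "carrier M = range f"
    and add: "\<And>a b. f (a + b) = f a \<oplus>\<^bsub>M\<^esub> f b" and zero: "f 0 = \<zero>\<^bsub>M\<^esub>"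
    and act: "\<And>x a. u_cls D x \<odot>\<^bsub>M\<^esub> f a = f (ext x a)"
    and ext: "\<And>x y a. ext (x + y) a = ext x a + ext y a" "\<And>x a b. ext x (a + b) = ext x a + ext x b"
      "\<And>x y a. ext (x * y) a = ext x (ext y a)" "\<And>a. ext 1 a = a"
  shows "left_module (u_alg D) M"
proof -
  have ag: "abelian_group M"
  proof (rule abelian_groupI)
    show "\<exists>y\<in>carrier M. y \<oplus>\<^bsub>M\<^esub> x = \<zero>\<^bsub>M\<^esub>" if x: "x \<in> carrier M" for x
    proof -
      obtain a where a: "x = f a" using x surj by auto
      have "f (- a) \<oplus>\<^bsub>M\<^esub> x = \<zero>\<^bsub>M\<^esub>" by (simp add: a zero flip: add)
      then show ?thesis using surj by auto
    qed
  qed (auto simp: surj zero[symmetric] add[symmetric] add_ac)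
  have "left_module_axioms (u_alg D) M"
    by (rule left_module_axioms.intro)
      (auto simp: u_alg_simps surj act ext add[symmetric])
  then show ?thesis using ag ring_u_alg by (simp add: left_module_def)
qed

locale umod = datum D + LM: left_module "u_alg D" M
  for D :: "('i::finite, 'y::ab_group_add, 'x::ab_group_add) root_data"
    and M :: "(('i, 'y) u_elt, 'm) module" (structure)
begin

text \<open>Elements of the quantum group are always given by representatives in the free algebra,
  so that identities there apply to vectors without any handling of cosets.\<close>

definition app :: "('i, 'y) u_gen free_alg \<Rightarrow> 'm \<Rightarrow> 'm" (infixr \<open>\<cdot>\<close> 75) where
  "x \<cdot> m = u_cls D x \<odot> m"

lemma u_cls_carrier [simp]: "u_cls D x \<in> carrier (u_alg D)"
  by (simp add: u_alg_simps)

lemma app_closed [simp]: "m \<in> carrier M \<Longrightarrow> x \<cdot> m \<in> carrier M"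
  unfolding app_def using left_module.axioms(3)[OF LM.left_module_axioms] by (simp add: left_module_axioms_def)

lemma app_plus: "m \<in> carrier M \<Longrightarrow> (x + y) \<cdot> m = x \<cdot> m \<oplus> y \<cdot> m"
  and app_add: "m \<in> carrier M \<Longrightarrow> n \<in> carrier M \<Longrightarrow> x \<cdot> (m \<oplus> n) = x \<cdot> m \<oplus> x \<cdot> n"
  and app_mult: "m \<in> carrier M \<Longrightarrow> (x * y) \<cdot> m = x \<cdot> (y \<cdot> m)"
  and app_one: "m \<in> carrier M \<Longrightarrow> 1 \<cdot> m = m"
  unfolding app_def using left_module.axioms(3)[OF LM.left_module_axioms]
  by (simp_all add: left_module_axioms_def flip: u_alg_simps(2-5))

lemma app_0 [simp]: "m \<in> carrier M \<Longrightarrow> 0 \<cdot> m = \<zero>"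
  using app_plus[of m 0 0] by (simp add: LM.M.add.l_cancel_one)

lemma app_zero [simp]: "x \<cdot> \<zero> = \<zero>"
  using app_add[of \<zero> \<zero> x] by (simp add: LM.M.add.l_cancel_one)

lemma app_uminus: "m \<in> carrier M \<Longrightarrow> (- x) \<cdot> m = \<ominus> (x \<cdot> m)"
  using app_plus[of m "- x" x] by (simp add: LM.M.minus_equality)

lemma app_diff: "m \<in> carrier M \<Longrightarrow> (x - y) \<cdot> m = x \<cdot> m \<ominus> y \<cdot> m"
  using app_plus[of m x "- y"] by (simp add: app_uminus a_minus_def)

lemma app_a_inv: "m \<in> carrier M \<Longrightarrow> x \<cdot> (\<ominus> m) = \<ominus> (x \<cdot> m)"
  using app_add[of "\<ominus> m" m x] by (simp add: LM.M.minus_equality LM.M.l_neg)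

lemma app_finsum:
  assumes "\<And>a. a \<in> A \<Longrightarrow> c a \<in> carrier M"
  shows "x \<cdot> (\<Oplus>a\<in>A. c a) = (\<Oplus>a\<in>A. x \<cdot> c a)"
  using assms
proof (induction A rule: infinite_finite_induct)
  case (insert a F)
  then show ?case by (simp add: LM.M.finsum_insert Pi_iff app_add LM.M.finsum_closed)
qed auto

lemma app_sum: "m \<in> carrier M \<Longrightarrow> (sum f A) \<cdot> m = (\<Oplus>a\<in>A. f a \<cdot> m)"
proof (induction A rule: infinite_finite_induct)
  case (insert a F)
  then show ?case by (simp add: LM.M.finsum_insert Pi_iff app_plus)
qed auto

lemma app_eqI: "x - y \<in> u_ideal D \<Longrightarrow> x \<cdot> m = y \<cdot> m"
  unfolding app_def by (simp add: u_cls_eq_iff[THEN iffD2])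

lemma app_eq_iff: "m \<in> carrier M \<Longrightarrow> x \<cdot> m = y \<cdot> m \<longleftrightarrow> (x - y) \<cdot> m = \<zero>"
  using LM.M.minus_equality[of "x \<cdot> m" "\<ominus> (y \<cdot> m)"]
  by (auto simp: app_diff a_minus_def LM.M.r_neg)

lemma app_const_comm: "m \<in> carrier M \<Longrightarrow> x \<cdot> const c \<cdot> m = const c \<cdot> x \<cdot> m"
  by (metis app_mult const_comm)

end

section \<open>Weights in the root datum\<close>

text \<open>Monomials in pi and q. The first exponent counts only modulo 2, and
  \<open>qp_cong\<close> uses this to discard even contributions.\<close>

definition qp :: "int \<Rightarrow> int \<Rightarrow> qpi" where
  "qp a b = pi_elt powi a * q_elt powi b"

lemma qp_mult: "qp a b * qp c d = qp (a + c) (b + d)"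
  by (simp add: qp_def pi_powi_add q_powi_add mult_ac)

lemma qp_cong: "even (a - a') \<Longrightarrow> b = b' \<Longrightarrow> qp a b = qp a' b'"
  by (metis qp_def pi_powi_cong)

lemma qp_0 [simp]: "qp 0 0 = 1" by (simp add: qp_def)

lemma qp_one: "even a \<Longrightarrow> b = 0 \<Longrightarrow> qp a b = 1"
  using qp_cong[of a 0 b 0] by simp

lemma qp_unit: "qp a b dvd 1"
  by (simp add: qp_def unit_qpi_iff minus_one_powi_even)

lemma qp_diff_unit: "b \<noteq> d \<Longrightarrow> (qp a b - qp c d) dvd 1"
  by (simp add: qp_def unit_diff)

lemma xi_qp: "xi D u v = qp (parl D u * parl D v) (dotl D u v)"
  by (simp add: xi_def qp_def mult.commute)

definition wX :: "('i::finite, 'y, 'x::ab_group_add) root_data \<Rightarrow> 'i list \<Rightarrow> 'x" where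
  "wX D w = zroot D (wt (FM w))"

context datum begin

abbreviation pr :: "'y \<Rightarrow> 'x \<Rightarrow> int" where "pr \<equiv> pairing D"
abbreviation cr :: "'i \<Rightarrow> 'x \<Rightarrow> int" where "cr i \<equiv> pairing D (coroot D i)"

lemma pr_additive: "additive (pr \<mu>)" "additive (\<lambda>\<mu>. pr \<mu> l)"
  using root_datum by (auto simp: root_datum_def perfect_pairing_def)

lemma pr_add [simp]: "pr \<mu> (l + l') = pr \<mu> l + pr \<mu> l'" "pr (\<mu> + \<mu>') l = pr \<mu> l + pr \<mu>' l"
  "pr \<mu> 0 = 0" "pr 0 l = 0" "pr \<mu> (- l) = - pr \<mu> l" "pr (- \<mu>) l = - pr \<mu> l"
  "pr \<mu> (l - l') = pr \<mu> l - pr \<mu> l'"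
  using additive.add[OF pr_additive(1)] additive.add[OF pr_additive(2)]
    additive.zero[OF pr_additive(1)] additive.zero[OF pr_additive(2)]
    additive.minus[OF pr_additive(1)] additive.minus[OF pr_additive(2)]
    additive.diff[OF pr_additive(1)]
  by auto

lemma pr_zscale [simp]: "pr \<mu> (zscale k l) = k * pr \<mu> l" "pr (zscale k \<mu>) l = k * pr \<mu> l"
proof -
  have 1: "pr \<mu> (((+) l ^^ n) 0) = int n * pr \<mu> l" for n by (induction n) (simp_all add: algebra_simps)
  have 2: "pr (((+) \<mu> ^^ n) 0) l = int n * pr \<mu> l" for n by (induction n) (simp_all add: algebra_simps)
  show "pr \<mu> (zscale k l) = k * pr \<mu> l" "pr (zscale k \<mu>) l = k * pr \<mu> l"
    by (simp_all add: zscale_def 1 2)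
qed

text \<open>Perfectness embeds X into the homomorphisms from Y to the integers, so identities in X
  are verified after pairing.\<close>

lemma pr_eqI: "(\<And>\<mu>. pr \<mu> l = pr \<mu> l') \<Longrightarrow> l = l'"
proof -
  assume "\<And>\<mu>. pr \<mu> l = pr \<mu> l'"
  then have "(\<lambda>x y. pr y x) l = (\<lambda>x y. pr y x) l'" by auto
  moreover have "inj (\<lambda>x y. pr y x)" using root_datum by (simp add: root_datum_def perfect_pairing_def bij_betw_def)
  ultimately show ?thesis by (rule injD[rotated])
qed

lemma pr_separate: "l \<noteq> l' \<Longrightarrow> \<exists>\<mu>. pr \<mu> l \<noteq> pr \<mu> l'"
  using pr_eqI by blast

lemma module_zscale: "Modules.module (zscale :: int \<Rightarrow> 'x \<Rightarrow> 'x)"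
  by unfold_locales (rule pr_eqI; simp add: algebra_simps)+

lemma pr_sum: "pr \<mu> (sum f A) = (\<Sum>a\<in>A. pr \<mu> (f a))"
  by (induction A rule: infinite_finite_induct) auto

lemma pr_zroot: "pr \<mu> (zroot D a) = (\<Sum>i\<in>UNIV. a i * pr \<mu> (root D i))"
  by (simp add: zroot_def pr_sum)

lemma wX_Nil [simp]: "wX D [] = 0"
  by (rule pr_eqI) (simp add: wX_def pr_zroot wt_Nil)

lemma wX_append: "wX D (u @ v) = wX D u + wX D v"
  by (rule pr_eqI) (simp add: wX_def pr_zroot wt_append distrib_right sum.distrib)

lemma wX_single: "wX D [i] = root D i"
  by (rule pr_eqI) (simp add: wX_def pr_zroot wt_single sum_delta_mult)

lemma wX_Cons [simp]: "wX D (i # w) = root D i + wX D w"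
  using wX_append[of "[i]" w] by (simp add: wX_single)

lemma zroot_inj: "zroot D a = zroot D b \<Longrightarrow> a = b"
proof -
  assume eq: "zroot D a = zroot D b"
  interpret Z: Modules.module "zscale :: int \<Rightarrow> 'x \<Rightarrow> 'x" by (rule module_zscale)
  have inj: "inj (root D)" and ind: "\<not> Z.dependent (range (root D))"
    using root_datum by (auto simp: root_datum_def)
  let ?u = "\<lambda>v. a (inv_into UNIV (root D) v) - b (inv_into UNIV (root D) v)"
  have "(\<Sum>v\<in>range (root D). zscale (?u v) v) = (\<Sum>i\<in>UNIV. zscale (a i - b i) (root D i))"
    using inj by (simp add: sum.reindex)
  also have "\<dots> = zroot D a - zroot D b"
    by (simp add: zroot_def Z.scale_left_diff_distrib sum_subtractf)
  also have "\<dots> = 0" using eq by simp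
  finally have "?u (root D i) = 0" for i
    by (intro Z.independentD[OF ind, where t = "range (root D)" and u = ?u]) auto
  then show ?thesis using inj by auto
qed

lemma wX_eq_iff: "wX D u = wX D v \<longleftrightarrow> wt (FM u) = wt (FM v)"
  using zroot_inj by (auto simp: wX_def)

lemma cr_root: "dd D i * cr i (root D j) = dot D i j"
proof -
  have "cr i (root D j) * dot D i i = 2 * dot D i j"
    using root_datum by (simp add: root_datum_def)
  then show ?thesis using dot_diag[of i] by (simp add: mult.commute)
qed

lemma cr_root_self [simp]: "cr i (root D i) = 2"
  using cr_root[of i i] dot_diag[of i] dd_pos[of i] by simp

text \<open>The condition on odd \<open>i\<close> in the super Cartan datum. It makes exponents of
  pi of the form \<open>par D i * cr i \<mu>\<close> constant modulo 2 on cosets of the root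
  lattice.\<close>

lemma cr_root_even: "even (par D i * cr i (root D j))"
proof (cases "i \<in> odd_part D")
  case True
  have "2 * dot D i j = dot D i i * cr i (root D j)"
    using cr_root[of i j] dot_diag[of i] by simp
  then have "2 * dot D i j div dot D i i = cr i (root D j)" using dot_diag[of i] dd_pos[of i] by simp
  moreover have "even (2 * dot D i j div dot D i i)"
    using super_cartan True by (simp add: super_cartan_datum_def)
  ultimately show ?thesis by simp
qed (simp add: par_def)

lemma cr_wX: "dd D i * cr i (wX D w) = dotl D [i] w"
  by (induction w) (simp_all add: distrib_left cr_root dotl_Cons(2)[of D "[i]"])

lemma cr_wX_even: "even (par D i * cr i (wX D w))"
proof (induction w)
  case (Cons j w)
  then show ?case using cr_root_even[of i j] by (simp add: distrib_left)
qed simp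

text \<open>The left term is the exponent of pi with which J at d_i i acts, the right one the
  exponent occurring in a quantum integer; parity compatibility identifies them.\<close>

lemma parity_dd: "even (dd D i * cr i l - par D i * cr i l)"
  using parity_compat by (simp add: parity_compatible_def left_diff_distrib)

definition kk :: "'i \<Rightarrow> qpi" where
  "kk i = inverse (pi_i D i * q_i D i - q_i D i powi (- 1))"

text \<open>The quantum integer \<open>[h]\<^sub>i\<close>, for \<open>h\<close> of either sign.\<close>

definition br :: "'i \<Rightarrow> int \<Rightarrow> qpi" where
  "br i h = kk i * (qp (par D i * h) (dd D i * h) - qp 0 (- dd D i * h))"

lemma kk_denom: "pi_i D i * q_i D i - q_i D i powi (- 1) = qp (par D i) (dd D i) - qp 0 (- dd D i)"
proof -
  have "q_i D i powi (- 1) = q_elt powi (- dd D i)" using q_i_powi[of i "- 1"] by simp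
  then show ?thesis by (simp only: qp_def pi_i_def q_i_def power_int_0_right mult_1)
qed

lemma kk_unit: "kk i * (qp (par D i) (dd D i) - qp 0 (- dd D i)) = 1"
  unfolding kk_def kk_denom
  using unit_inverse_qpi[OF qp_diff_unit[of "dd D i" "- dd D i" "par D i" 0]] dd_pos[of i]
  by (simp add: mult.commute)

lemma br_unit: "h \<noteq> 0 \<Longrightarrow> br i h dvd 1"
proof -
  assume "h \<noteq> 0"
  then have "(qp (par D i * h) (dd D i * h) - qp 0 (- dd D i * h)) dvd 1"
    using dd_pos[of i] by (intro qp_diff_unit) auto
  moreover have "kk i dvd 1" using kk_unit by (metis dvd_triv_left)
  ultimately show ?thesis unfolding br_def by (metis mult_1 mult_dvd_mono)
qed

end

lemma subst_gen_eq: "subst_gen h = lin (\<lambda>w. mon (map h w))"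
  by (rule ext) (simp add: subst_gen_def lin_def const_mult_mon)

lemma qlin_subst_gen: "qlin (subst_gen h)" by (simp add: subst_gen_eq qlin_lin)

lemma subst_gen_mon [simp]: "subst_gen h (mon w) = mon (map h w)" by (simp add: subst_gen_eq)

lemma subst_gen_1 [simp]: "subst_gen h 1 = 1" using subst_gen_mon[of h "[]"] by (simp add: mon_Nil)

lemma subst_gen_gen [simp]: "subst_gen h (gen g) = gen (h g)" by (simp add: gen_eq_mon)

lemma subst_gen_mult: "subst_gen h (x * y) = subst_gen h x * subst_gen h y"
proof -
  have 1: "subst_gen h (mon u * y) = subst_gen h (mon u) * subst_gen h y" for u
    by (rule qlin_eqI[OF qlin_compose[OF qlin_subst_gen qlin_mult_left[OF qlin_id]] qlin_mult_left[OF qlin_subst_gen]])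
       (simp add: mon_append flip: mon_append)
  show ?thesis
    by (rule qlin_eqI[OF qlin_compose[OF qlin_subst_gen qlin_mult_right[OF qlin_id]] qlin_mult_right[OF qlin_subst_gen]])
       (rule 1)
qed

lemmas subst_gen_lin = qlin_add[OF qlin_subst_gen] qlin_const[OF qlin_subst_gen] qlin_diff[OF qlin_subst_gen]
  qlin_0[OF qlin_subst_gen] qlin_sum[OF qlin_subst_gen]

abbreviation gE :: "'i \<Rightarrow> ('i, 'y) u_gen free_alg" where "gE i \<equiv> gen (GE i)"
abbreviation gF :: "'i \<Rightarrow> ('i, 'y) u_gen free_alg" where "gF i \<equiv> gen (GF i)"
abbreviation gJ :: "'y \<Rightarrow> ('i, 'y) u_gen free_alg" where "gJ \<mu> \<equiv> gen (GJ \<mu>)"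
abbreviation gK :: "'y \<Rightarrow> ('i, 'y) u_gen free_alg" where "gK \<mu> \<equiv> gen (GK \<mu>)"
abbreviation up :: "'i free_alg \<Rightarrow> ('i, 'y) u_gen free_alg" where "up \<equiv> subst_gen GE"
abbreviation dn :: "'i free_alg \<Rightarrow> ('i, 'y) u_gen free_alg" where "dn \<equiv> subst_gen GF"

context datum begin

lemma u_relations:
  "gK \<mu> * gE i - const (qp 0 (pr \<mu> (root D i))) * gE i * gK \<mu> \<in> u_ideal D"
  "gJ \<mu> * gE i - const (qp (pr \<mu> (root D i)) 0) * gE i * gJ \<mu> \<in> u_ideal D"
  "gK \<mu> * gF i - const (qp 0 (- pr \<mu> (root D i))) * gF i * gK \<mu> \<in> u_ideal D"
  "gJ \<mu> * gF i - const (qp (- pr \<mu> (root D i)) 0) * gF i * gJ \<mu> \<in> u_ideal D"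
  "gE i * gF j - const (qp (par D i * par D j) 0) * gF j * gE i
        - (if i = j then const (kk i) *
             (gJ (zscale (dd D i) (coroot D i)) * gK (zscale (dd D i) (coroot D i)) - gK (zscale (- dd D i) (coroot D i)))
           else 0) \<in> u_ideal D"
  "x \<in> radical D \<Longrightarrow> up x \<in> u_ideal D" "x \<in> radical D \<Longrightarrow> dn x \<in> u_ideal D"
proof -
  have kk: "1 / (pi_i D i * q_i D i - q_i D i powi (- 1)) = kk i"
    by (simp add: divide_qpi_def kk_def)
  show "gE i * gF j - const (qp (par D i * par D j) 0) * gF j * gE i
        - (if i = j then const (kk i) *
             (gJ (zscale (dd D i) (coroot D i)) * gK (zscale (dd D i) (coroot D i)) - gK (zscale (- dd D i) (coroot D i)))
           else 0) \<in> u_ideal D"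
    unfolding kk[symmetric]
    by (rule subsetD[OF u_relators_subset]) (auto simp: u_relators_def Let_def qp_def)
qed (rule subsetD[OF u_relators_subset], auto simp: u_relators_def Let_def qp_def)+

end

section \<open>Weight vectors and commutation of generators\<close>

context umod begin

abbreviation wsp :: "'x \<Rightarrow> 'm set" where "wsp l \<equiv> weight_space D M l"

lemma wsp_iff: "m \<in> wsp l \<longleftrightarrow> m \<in> carrier M \<and> (\<forall>\<mu>. gK \<mu> \<cdot> m = const (qp 0 (pr \<mu> l)) \<cdot> m \<and> gJ \<mu> \<cdot> m = const (qp (pr \<mu> l) 0) \<cdot> m)"
  by (simp add: weight_space_def app_def qp_def)

lemma wsp_carrier: "m \<in> wsp l \<Longrightarrow> m \<in> carrier M" by (simp add: wsp_iff)

lemma wsp_zero [simp]: "\<zero> \<in> wsp l" by (simp add: wsp_iff)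

lemma wsp_add: "m \<in> wsp l \<Longrightarrow> n \<in> wsp l \<Longrightarrow> m \<oplus> n \<in> wsp l"
  by (simp add: wsp_iff app_add)

lemma wsp_const: "m \<in> wsp l \<Longrightarrow> const c \<cdot> m \<in> wsp l"
  by (simp add: wsp_iff app_const_comm[of _ "gK _"] app_const_comm[of _ "gJ _"])
     (metis app_const_comm)

lemma app_const_const: "m \<in> carrier M \<Longrightarrow> const a \<cdot> const b \<cdot> m = const (a * b) \<cdot> m"
  by (simp add: const_simps app_mult)

lemma wsp_gE: "m \<in> wsp l \<Longrightarrow> gE i \<cdot> m \<in> wsp (l + root D i)"
proof -
  assume m: "m \<in> wsp l"
  then have c: "m \<in> carrier M" by (rule wsp_carrier)
  have "gK \<mu> \<cdot> gE i \<cdot> m = const (qp 0 (pr \<mu> (l + root D i))) \<cdot> gE i \<cdot> m" for \<mu>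
  proof -
    have "gK \<mu> \<cdot> gE i \<cdot> m = const (qp 0 (pr \<mu> (root D i))) \<cdot> gE i \<cdot> gK \<mu> \<cdot> m"
      using app_eqI[OF u_relations(1)[of \<mu> i], of m] c by (simp add: app_mult)
    also have "\<dots> = const (qp 0 (pr \<mu> (root D i))) \<cdot> const (qp 0 (pr \<mu> l)) \<cdot> gE i \<cdot> m"
      using m c by (simp add: wsp_iff app_const_comm[of _ "gen _"])
    finally show ?thesis using c by (simp add: app_const_const qp_mult add.commute)
  qed
  moreover have "gJ \<mu> \<cdot> gE i \<cdot> m = const (qp (pr \<mu> (l + root D i)) 0) \<cdot> gE i \<cdot> m" for \<mu>
  proof -
    have "gJ \<mu> \<cdot> gE i \<cdot> m = const (qp (pr \<mu> (root D i)) 0) \<cdot> gE i \<cdot> gJ \<mu> \<cdot> m"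
      using app_eqI[OF u_relations(2)[of \<mu> i], of m] c by (simp add: app_mult)
    also have "\<dots> = const (qp (pr \<mu> (root D i)) 0) \<cdot> const (qp (pr \<mu> l) 0) \<cdot> gE i \<cdot> m"
      using m c by (simp add: wsp_iff app_const_comm[of _ "gen _"])
    finally show ?thesis using c by (simp add: app_const_const qp_mult add.commute)
  qed
  ultimately show ?thesis using c by (simp add: wsp_iff)
qed

lemma wsp_gF: "m \<in> wsp l \<Longrightarrow> gF i \<cdot> m \<in> wsp (l - root D i)"
proof -
  assume m: "m \<in> wsp l"
  then have c: "m \<in> carrier M" by (rule wsp_carrier)
  have "gK \<mu> \<cdot> gF i \<cdot> m = const (qp 0 (pr \<mu> (l - root D i))) \<cdot> gF i \<cdot> m" for \<mu>
  proof -
    have "gK \<mu> \<cdot> gF i \<cdot> m = const (qp 0 (- pr \<mu> (root D i))) \<cdot> gF i \<cdot> gK \<mu> \<cdot> m"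
      using app_eqI[OF u_relations(3)[of \<mu> i], of m] c by (simp add: app_mult)
    also have "\<dots> = const (qp 0 (- pr \<mu> (root D i))) \<cdot> const (qp 0 (pr \<mu> l)) \<cdot> gF i \<cdot> m"
      using m c by (simp add: wsp_iff app_const_comm[of _ "gen _"])
    finally show ?thesis using c by (simp add: app_const_const qp_mult)
  qed
  moreover have "gJ \<mu> \<cdot> gF i \<cdot> m = const (qp (pr \<mu> (l - root D i)) 0) \<cdot> gF i \<cdot> m" for \<mu>
  proof -
    have "gJ \<mu> \<cdot> gF i \<cdot> m = const (qp (- pr \<mu> (root D i)) 0) \<cdot> gF i \<cdot> gJ \<mu> \<cdot> m"
      using app_eqI[OF u_relations(4)[of \<mu> i], of m] c by (simp add: app_mult)
    also have "\<dots> = const (qp (- pr \<mu> (root D i)) 0) \<cdot> const (qp (pr \<mu> l) 0) \<cdot> gF i \<cdot> m"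
      using m c by (simp add: wsp_iff app_const_comm[of _ "gen _"])
    finally show ?thesis using c by (simp add: app_const_const qp_mult)
  qed
  ultimately show ?thesis using c by (simp add: wsp_iff)
qed

lemma wsp_up: "m \<in> wsp l \<Longrightarrow> up (mon w) \<cdot> m \<in> wsp (l + wX D w)"
proof (induction w)
  case (Cons i w)
  have "gE i \<cdot> up (mon w) \<cdot> m \<in> wsp (l + wX D w + root D i)" by (rule wsp_gE[OF Cons.IH[OF Cons.prems]])
  then show ?case using wsp_carrier[OF Cons.prems] by (simp add: mon_Cons[of "GE _"] app_mult add_ac)
qed (simp add: mon_Nil app_one wsp_carrier)

lemma wsp_dn: "m \<in> wsp l \<Longrightarrow> dn (mon w) \<cdot> m \<in> wsp (l - wX D w)"
proof (induction w)
  case (Cons i w)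
  have "gF i \<cdot> dn (mon w) \<cdot> m \<in> wsp (l - wX D w - root D i)" by (rule wsp_gF[OF Cons.IH[OF Cons.prems]])
  then show ?case using wsp_carrier[OF Cons.prems] by (simp add: mon_Cons[of "GF _"] app_mult diff_diff_eq add_ac)
qed (simp add: mon_Nil app_one wsp_carrier)

text \<open>On a weight vector the elements J and K act by scalars, which combine to the quantum
  integer of \<open>cr i l\<close>; \<open>parity_dd\<close> makes the powers of pi match.\<close>

lemma app_EF:
  assumes m: "m \<in> wsp l"
  shows "gE i \<cdot> gF j \<cdot> m = (const (qp (par D i * par D j) 0) * gF j * gE i + const (if i = j then br i (cr i l) else 0)) \<cdot> m"
proof -
  have c: "m \<in> carrier M" using m by (rule wsp_carrier)
  let ?z = "zscale (dd D i) (coroot D i)" and ?z' = "zscale (- dd D i) (coroot D i)"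
  have "gE i \<cdot> gF j \<cdot> m = (const (qp (par D i * par D j) 0) * gF j * gE i +
      (if i = j then const (kk i) * (gJ ?z * gK ?z - gK ?z') else 0)) \<cdot> m"
    using app_eqI[of "gE i * gF j" "const (qp (par D i * par D j) 0) * gF j * gE i +
      (if i = j then const (kk i) * (gJ ?z * gK ?z - gK ?z') else 0)" m] u_relations(5)[of i j] c
    by (simp only: app_mult diff_diff_eq)
  also have "\<dots> = (const (qp (par D i * par D j) 0) * gF j * gE i) \<cdot> m \<oplus>
      (if i = j then const (kk i) \<cdot> (gJ ?z \<cdot> gK ?z \<cdot> m \<ominus> gK ?z' \<cdot> m) else \<zero>)"
    using c by (simp add: app_plus app_diff app_mult)
  also have "gK ?z \<cdot> m = const (qp 0 (dd D i * cr i l)) \<cdot> m" using m by (simp add: wsp_iff)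
  also have "gJ ?z \<cdot> const (qp 0 (dd D i * cr i l)) \<cdot> m = const (qp 0 (dd D i * cr i l)) \<cdot> const (qp (dd D i * cr i l) 0) \<cdot> m"
    using m c by (simp add: wsp_iff app_const_comm[of _ "gen _"])
  also have "\<dots> = const (qp (par D i * cr i l) (dd D i * cr i l)) \<cdot> m"
    using c qp_cong[OF parity_dd refl, of i l] by (simp add: app_const_const qp_mult)
  also have "gK ?z' \<cdot> m = const (qp 0 (- dd D i * cr i l)) \<cdot> m" using m by (simp add: wsp_iff)
  also have "const (kk i) \<cdot> (const (qp (par D i * cr i l) (dd D i * cr i l)) \<cdot> m \<ominus> const (qp 0 (- dd D i * cr i l)) \<cdot> m) = const (br i (cr i l)) \<cdot> m"
    using c by (simp only: br_def const_simps app_mult app_diff app_closed)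
  finally show ?thesis using c by (simp add: app_plus const_simps)
qed

lemma app_lin_eqI:
  assumes "qlin f" "qlin g" "m \<in> carrier M" "\<And>w. f (mon w) \<cdot> m = g (mon w) \<cdot> m"
  shows "f x \<cdot> m = g x \<cdot> m"
proof (induction x rule: free_induct)
  case (mon c w)
  show ?case using assms(3,4) by (simp add: qlin_const[OF assms(1)] qlin_const[OF assms(2)] app_mult)
next
  case (add x y)
  then show ?case using assms(3) by (simp add: qlin_add[OF assms(1)] qlin_add[OF assms(2)] app_plus)
qed

lemma app_radical: "x \<in> radical D \<Longrightarrow> m \<in> carrier M \<Longrightarrow> up x \<cdot> m = \<zero>" "x \<in> radical D \<Longrightarrow> m \<in> carrier M \<Longrightarrow> dn x \<cdot> m = \<zero>"
  using app_eqI[of "up x" 0] app_eqI[of "dn x" 0] u_relations(6,7)[of x] by simp_all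

end

section \<open>Moving a generator through a word\<close>

context datum begin

text \<open>What is left when E_i moves right through a word in the F on a vector of weight
  \<open>l\<close>, apart from the term in which it reaches the vector. \<open>Gw\<close> plays this
  role for F_j moving left through a word in the E.\<close>

primrec Ew :: "'i \<Rightarrow> 'x \<Rightarrow> 'i list \<Rightarrow> 'i free_alg" where
  "Ew i l [] = 0"
| "Ew i l (j # w) = const (qp (par D i * par D j) 0) * (gen j * Ew i l w)
     + (if i = j then const (br i (cr i (l - wX D w))) * mon w else 0)"

definition Eop :: "'i \<Rightarrow> 'x \<Rightarrow> 'i free_alg \<Rightarrow> 'i free_alg" where "Eop i l = lin (Ew i l)"

primrec Gw :: "'i \<Rightarrow> 'x \<Rightarrow> 'i list \<Rightarrow> 'i free_alg" where
  "Gw j l [] = 0"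
| "Gw j l (i # w) = gen i * Gw j l w
     + (if i = j then const (qp (par D j * parl D w) 0 * br j (cr j (l + wX D w))) * mon w else 0)"

definition Gop :: "'i \<Rightarrow> 'x \<Rightarrow> 'i free_alg \<Rightarrow> 'i free_alg" where "Gop j l = lin (Gw j l)"

lemma qlin_Eop: "qlin (Eop i l)" and qlin_Gop: "qlin (Gop i l)"
  by (simp_all add: Eop_def Gop_def qlin_lin)

lemma br_wX: "br i (cr i l + e * cr i (wX D w)) = kk i * (qp (par D i * cr i l) (dd D i * cr i l + e * dotl D [i] w) - qp 0 (- dd D i * cr i l - e * dotl D [i] w))"
proof -
  have d: "dd D i * (e * cr i (wX D w)) = e * dotl D [i] w" using cr_wX[of i w] by (metis mult.left_commute)
  have "even (par D i * (e * cr i (wX D w)))" using cr_wX_even[of i w] by auto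
  then have p: "qp (par D i * (cr i l + e * cr i (wX D w))) b = qp (par D i * cr i l) b" for b
    by (intro qp_cong) (simp_all add: distrib_left)
  show ?thesis unfolding br_def p unfolding mult_minus_left distrib_left d by simp
qed

text \<open>The recursion unfolds to a combination of the two skew derivations, one for each term of
  the quantum integer. This closed form is what shows that E_i respects the radical.\<close>

lemma Ew_eq: "Ew i l w = const (kk i * qp (par D i * cr i l) (dd D i * cr i l + 2 * dd D i - dotl D [i] w)) * dlw D i w
   - const (kk i * qp (par D i + par D i * parl D w) (- dd D i * cr i l)) * drw D i w"
proof (induction w)
  case (Cons j w)
  let ?a = "\<lambda>w. kk i * qp (par D i * cr i l) (dd D i * cr i l + 2 * dd D i - dotl D [i] w)"
  let ?b = "\<lambda>w. kk i * qp (par D i + par D i * parl D w) (- dd D i * cr i l)"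
  have a: "?a (j # w) * xi D [i] [j] = qp (par D i * par D j) 0 * ?a w"
    unfolding xi_qp mult.left_commute[of "qp _ _" "kk i"] mult.assoc[of "kk i"] qp_mult
    by (rule arg_cong[of _ _ "\<lambda>x. kk i * x"], rule qp_cong) (simp_all add: parl_single dotl_Cons(2)[of D "[i]"])
  have b: "?b (j # w) = qp (par D i * par D j) 0 * ?b w"
    unfolding mult.left_commute[of "qp _ _" "kk i"] qp_mult
    by (rule arg_cong[of _ _ "\<lambda>x. kk i * x"], rule qp_cong) (simp_all add: algebra_simps)
  have d: "?a (i # w) - ?b (i # w) * xi D [i] w = br i (cr i (l - wX D w))"
  proof -
    have "?a (i # w) = kk i * qp (par D i * cr i l) (dd D i * cr i l - dotl D [i] w)"
      by (simp add: dotl_Cons(2)[of D "[i]"] dot_diag)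
    moreover have "?b (i # w) * xi D [i] w = kk i * qp 0 (- dd D i * cr i l + dotl D [i] w)"
      unfolding xi_qp mult.assoc qp_mult
      by (rule arg_cong[of _ _ "\<lambda>x. kk i * x"], rule qp_cong) (simp_all add: parl_single distrib_left par_sq)
    ultimately show ?thesis using br_wX[of i l "-1" w] by (simp add: right_diff_distrib)
  qed
  have "const (?a (j # w)) * dlw D i (j # w) - const (?b (j # w)) * drw D i (j # w)
     = const (?a (j # w) * xi D [i] [j]) * (gen j * dlw D i w) - const (?b (j # w)) * (gen j * drw D i w)
       + (if i = j then const (?a (i # w) - ?b (i # w) * xi D [i] w) * mon w else 0)"
    by (auto simp: distrib_left const_const const_simps(4) left_diff_distrib)
  also have "\<dots> = const (qp (par D i * par D j) 0) * (gen j * Ew i l w) + (if i = j then const (br i (cr i (l - wX D w))) * mon w else 0)"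
    unfolding a b d Cons by (simp add: right_diff_distrib const_norm const_const)
  finally show ?case by simp
qed simp

lemma Gw_eq: "Gw j l w = const (kk j * qp (par D j * cr j l) (dd D j * cr j l)) * drw D j w
   - const (kk j * qp (par D j + par D j * parl D w) (2 * dd D j - dd D j * cr j l - dotl D [j] w)) * dlw D j w"
proof (induction w)
  case (Cons i w)
  let ?a = "kk j * qp (par D j * cr j l) (dd D j * cr j l)"
  let ?b = "\<lambda>w. kk j * qp (par D j + par D j * parl D w) (2 * dd D j - dd D j * cr j l - dotl D [j] w)"
  have b: "?b (i # w) * xi D [j] [i] = ?b w"
    unfolding xi_qp mult.assoc qp_mult
    by (rule arg_cong[of _ _ "\<lambda>x. kk j * x"], rule qp_cong) (simp_all add: parl_single dotl_Cons(2)[of D "[j]"] algebra_simps)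
  have d: "?a * xi D [j] w - ?b (j # w) = qp (par D j * parl D w) 0 * br j (cr j (l + wX D w))"
  proof -
    have "?a * xi D [j] w = kk j * (qp (par D j * parl D w) 0 * qp (par D j * cr j l) (dd D j * cr j l + dotl D [j] w))"
      unfolding xi_qp mult.assoc qp_mult by (simp add: parl_single add.commute)
    moreover have "?b (j # w) = kk j * (qp (par D j * parl D w) 0 * qp 0 (- dd D j * cr j l - dotl D [j] w))"
      unfolding qp_mult
      by (rule arg_cong[of _ _ "\<lambda>x. kk j * x"], rule qp_cong) (simp_all add: dot_diag dotl_Cons(2)[of D "[j]"] distrib_left par_sq)
    ultimately show ?thesis using br_wX[of j l 1 w]
      by (simp only: mult_1 pr_add right_diff_distrib mult.left_commute[of "qp _ _" "kk j"])
  qed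
  have "const ?a * drw D j (i # w) - const (?b (i # w)) * dlw D j (i # w)
     = const ?a * (gen i * drw D j w) - const (?b (i # w) * xi D [j] [i]) * (gen i * dlw D j w)
       + (if i = j then const (?a * xi D [j] w - ?b (j # w)) * mon w else 0)"
    by (auto simp: distrib_left const_const const_simps(4) left_diff_distrib)
  also have "\<dots> = gen i * Gw j l w + (if i = j then const (qp (par D j * parl D w) 0 * br j (cr j (l + wX D w))) * mon w else 0)"
    unfolding b d Cons by (simp add: right_diff_distrib const_norm)
  finally show ?case by simp
qed simp

end

lemma (in datum) Eop_1: "Eop i l 1 = 0" and Gop_1: "Gop i l 1 = 0"
  using lin_mon[of "Ew i l" "[]"] lin_mon[of "Gw i l" "[]"] by (simp_all add: Eop_def Gop_def mon_Nil)

lemma subst_gen_const [simp]: "subst_gen h (const c) = const c"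
  using subst_gen_lin(2)[of h c 1] by simp

lemma scal_1: "scal g 1 = const (g (\<lambda>i. 0))"
  using scal_mon[of g "[]"] by (simp add: mon_Nil wt_Nil)

context umod begin

text \<open>Each letter passed contributes a sign and, if it is F_i, a quantum integer at the weight
  reached so far. The signs collect in the \<open>scal\<close> factor, the quantum integers in
  \<open>Eop\<close>.\<close>

lemma gE_dn:
  assumes m: "m \<in> wsp l"
  shows "(gE i * dn y) \<cdot> m = (dn (scal (\<lambda>a. qp (par D i * zpar D a) 0) y) * gE i + dn (Eop i l y)) \<cdot> m"
proof (rule app_lin_eqI[OF _ _ wsp_carrier[OF m], where f = "\<lambda>y. gE i * dn y" and x = y and
    g = "\<lambda>y. dn (scal (\<lambda>a. qp (par D i * zpar D a) 0) y) * gE i + dn (Eop i l y)"])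
  show "qlin (\<lambda>y. gE i * dn y)" by (intro qlin_mult_left qlin_subst_gen)
  show "qlin (\<lambda>y. dn (scal (\<lambda>a. qp (par D i * zpar D a) 0) y) * gE i + dn (Eop i l y))"
    by (intro qlin_plus qlin_mult_right qlin_compose[OF qlin_subst_gen] qlin_scal qlin_Eop)
  have c: "m \<in> carrier M" using m by (rule wsp_carrier)
  show "(gE i * dn (mon w)) \<cdot> m = (dn (scal (\<lambda>a. qp (par D i * zpar D a) 0) (mon w)) * gE i + dn (Eop i l (mon w))) \<cdot> m" for w
  proof (induction w)
    case Nil
    then show ?case by (simp add: mon_Nil subst_gen_lin Eop_1 scal_1 zpar_def const_simps(2))
  next
    case (Cons j w)
    let ?X = "dn (scal (\<lambda>a. qp (par D i * zpar D a) 0) (mon w)) * gE i + dn (Eop i l (mon w))"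
    let ?b = "const (if i = j then br i (cr i (l - wX D w)) else 0)"
    have "(gE i * dn (mon (j # w))) \<cdot> m = gE i \<cdot> gF j \<cdot> dn (mon w) \<cdot> m"
      using c by (simp add: mon_Cons[of "GF _"] app_mult)
    also have "\<dots> = (const (qp (par D i * par D j) 0) * gF j) \<cdot> (gE i * dn (mon w)) \<cdot> m \<oplus> ?b \<cdot> dn (mon w) \<cdot> m"
      using c app_EF[OF wsp_dn[OF m, of w], of i j] by (simp add: app_plus app_mult)
    also have "\<dots> = ((const (qp (par D i * par D j) 0) * gF j) * ?X + ?b * dn (mon w)) \<cdot> m"
      unfolding Cons using c by (simp only: app_plus app_mult app_closed)
    also have "(const (qp (par D i * par D j) 0) * gF j) * ?X + ?b * dn (mon w)
        = dn (scal (\<lambda>a. qp (par D i * zpar D a) 0) (mon (j # w))) * gE i + dn (Eop i l (mon (j # w)))"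
    proof -
      have z: "zpar D (wt (FM (j # w))) = par D j + zpar D (wt (FM w))"
        using parl_Cons[of D j w] by (simp add: parl_def)
      show ?thesis
        by (auto simp: Eop_def subst_gen_lin subst_gen_mult z distrib_left mon_Cons[of "GF _"] mult.assoc const_norm
           const_const qp_mult add_ac const_simps(1))
    qed
    finally show ?case .
  qed
qed

lemma up_gF:
  assumes m: "m \<in> wsp l"
  shows "(up x * gF j) \<cdot> m = (gF j * up (scal (\<lambda>a. qp (par D j * zpar D a) 0) x) + up (Gop j l x)) \<cdot> m"
proof (rule app_lin_eqI[OF _ _ wsp_carrier[OF m], where f = "\<lambda>x. up x * gF j" and x = x and
    g = "\<lambda>x. gF j * up (scal (\<lambda>a. qp (par D j * zpar D a) 0) x) + up (Gop j l x)"])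
  show "qlin (\<lambda>x. up x * gF j)" by (intro qlin_mult_right qlin_subst_gen)
  show "qlin (\<lambda>x. gF j * up (scal (\<lambda>a. qp (par D j * zpar D a) 0) x) + up (Gop j l x))"
    by (intro qlin_plus qlin_mult_left qlin_compose[OF qlin_subst_gen] qlin_scal qlin_Gop)
  have c: "m \<in> carrier M" using m by (rule wsp_carrier)
  show "(up (mon w) * gF j) \<cdot> m = (gF j * up (scal (\<lambda>a. qp (par D j * zpar D a) 0) (mon w)) + up (Gop j l (mon w))) \<cdot> m" for w
  proof (induction w)
    case Nil
    then show ?case by (simp add: mon_Nil subst_gen_lin Gop_1 scal_1 zpar_def const_simps(2))
  next
    case (Cons i w)
    let ?p = "qp (par D j * parl D w) 0"
    let ?b = "if i = j then br j (cr j (l + wX D w)) else 0"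
    have "(up (mon (i # w)) * gF j) \<cdot> m = gE i \<cdot> (up (mon w) * gF j) \<cdot> m"
      using c by (simp add: mon_Cons[of "GE _"] app_mult)
    also have "\<dots> = gE i \<cdot> gF j \<cdot> const ?p \<cdot> up (mon w) \<cdot> m \<oplus> gE i \<cdot> up (Gop j l (mon w)) \<cdot> m"
      unfolding Cons using c by (simp add: app_plus app_mult app_add subst_gen_lin parl_def)
    also have "gE i \<cdot> gF j \<cdot> const ?p \<cdot> up (mon w) \<cdot> m
       = (const (qp (par D i * par D j) 0) * gF j * gE i + const ?b) \<cdot> const ?p \<cdot> up (mon w) \<cdot> m"
      using app_EF[OF wsp_const[OF wsp_up[OF m, of w]], of i j] by auto
    finally have "(up (mon (i # w)) * gF j) \<cdot> m = ((const (qp (par D i * par D j) 0) * gF j * gE i + const ?b) * (const ?p * up (mon w))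
       + gE i * up (Gop j l (mon w))) \<cdot> m"
      using c by (simp only: app_plus app_mult app_closed)
    also have "(const (qp (par D i * par D j) 0) * gF j * gE i + const ?b) * (const ?p * up (mon w))
       + gE i * up (Gop j l (mon w)) = gF j * up (scal (\<lambda>a. qp (par D j * zpar D a) 0) (mon (i # w))) + up (Gop j l (mon (i # w)))"
    proof -
      have z: "zpar D (wt (FM (i # w))) = par D i + parl D w"
        using parl_Cons[of D i w] by (simp add: parl_def)
      show ?thesis
        by (auto simp: Gop_def subst_gen_lin subst_gen_mult z distrib_left distrib_right mon_Cons[of "GE _"] mult.assoc const_norm
           const_const qp_mult add_ac const_simps(1) mult.commute[of "par D i"] mult.commute[of "br _ _"])
    qed
    finally show ?case .
  qed
qed

definition sing :: "'x \<Rightarrow> 'm \<Rightarrow> bool" where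
  "sing l v \<longleftrightarrow> v \<in> wsp l \<and> (\<forall>i. gE i \<cdot> v = \<zero>)"

lemma sing_wsp: "sing l v \<Longrightarrow> v \<in> wsp l" and sing_carrier: "sing l v \<Longrightarrow> v \<in> carrier M"
  and sing_gE: "sing l v \<Longrightarrow> gE i \<cdot> v = \<zero>"
  by (auto simp: sing_def wsp_carrier)

lemma sing_gE_dn: "sing l v \<Longrightarrow> gE i \<cdot> dn y \<cdot> v = dn (Eop i l y) \<cdot> v"
  using gE_dn[of v l i y] sing_carrier[of l v] by (simp add: sing_def app_plus app_mult)

end

context datum begin

section \<open>Verma modules\<close>

primrec gact :: "'x \<Rightarrow> ('i, 'y) u_gen \<Rightarrow> 'i free_alg \<Rightarrow> 'i free_alg" where
  "gact l (GE i) y = Eop i l y"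
| "gact l (GF i) y = gen i * y"
| "gact l (GK \<mu>) y = scal (\<lambda>a. qp 0 (pr \<mu> (l - zroot D a))) y"
| "gact l (GJ \<mu>) y = scal (\<lambda>a. qp (pr \<mu> (l - zroot D a)) 0) y"

primrec wact :: "'x \<Rightarrow> ('i, 'y) u_gen list \<Rightarrow> 'i free_alg \<Rightarrow> 'i free_alg" where
  "wact l [] y = y"
| "wact l (g # w) y = gact l g (wact l w y)"

text \<open>An action of the free algebra on generators, defined before passing to f. That the
  defining relations of the quantum group hold modulo the radical is
  \<open>vact_u_ideal\<close>.\<close>

definition vact :: "'x \<Rightarrow> ('i, 'y) u_gen free_alg \<Rightarrow> 'i free_alg \<Rightarrow> 'i free_alg" where
  "vact l x y = lin (\<lambda>w. wact l w y) x"

lemma qlin_gact: "qlin (gact l g)"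
  by (cases g) (auto simp: qlin_def qlin_add[OF qlin_Eop] qlin_const[OF qlin_Eop] qlin_add[OF qlin_scal]
      qlin_const[OF qlin_scal] distrib_left const_norm)

lemma qlin_wact: "qlin (wact l w)"
  by (induction w) (simp_all add: qlin_id qlin_compose[OF qlin_gact])

lemma qlin_vact: "qlin (\<lambda>x. vact l x y)"
  by (simp add: vact_def qlin_lin)

lemma vact_mon [simp]: "vact l (mon w) y = wact l w y"
  by (simp add: vact_def)

lemmas vact_lin = qlin_add[OF qlin_vact] qlin_const[OF qlin_vact] qlin_diff[OF qlin_vact] qlin_0[OF qlin_vact]

lemma qlin_vact2: "qlin (vact l x)"
proof (induction x rule: free_induct)
  case (mon c w)
  then show ?case using qlin_mult_left[OF qlin_wact] by (simp add: vact_lin)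
next
  case (add x y)
  have "vact l (x + y) = (\<lambda>z. vact l x z + vact l y z)" by (simp add: fun_eq_iff vact_lin)
  then show ?case using qlin_plus[OF add] by simp
qed

lemmas vact_lin2 = qlin_add[OF qlin_vact2] qlin_const[OF qlin_vact2] qlin_diff[OF qlin_vact2] qlin_0[OF qlin_vact2]

lemma vact_1 [simp]: "vact l 1 y = y"
  using vact_mon[of l "[]" y] by (simp add: mon_Nil)

lemma vact_gen [simp]: "vact l (gen g) y = gact l g y"
  using vact_mon[of l "[g]" y] by (simp add: gen_eq_mon)

lemma vact_const [simp]: "vact l (const c) y = const c * y"
  using vact_lin(2)[of l c 1 y] by simp

lemma wact_append: "wact l (u @ v) y = wact l u (wact l v y)"
  by (induction u) simp_all

lemma vact_mult: "vact l (x * z) y = vact l x (vact l z y)"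
proof -
  have 1: "vact l (mon u * z) y = vact l (mon u) (vact l z y)" for u
  proof (rule qlin_eqI[OF qlin_compose[OF qlin_vact qlin_mult_left[OF qlin_id]] qlin_compose[OF qlin_vact2 qlin_vact]])
    show "vact l (mon u * mon w) y = vact l (mon u) (vact l (mon w) y)" for w
      by (simp add: wact_append flip: mon_append)
  qed
  show ?thesis
    by (rule qlin_eqI[OF qlin_compose[OF qlin_vact qlin_mult_right[OF qlin_id]] qlin_vact]) (rule 1)
qed

lemma vact_dn: "vact l (dn x) y = x * y"
proof (rule qlin_eqI[OF qlin_compose[OF qlin_vact qlin_subst_gen] qlin_mult_right[OF qlin_id]])
  have "wact l (map GF w) y = mon w * y" for w
    by (induction w) (simp_all add: mon_Nil mon_Cons mult.assoc)
  then show "vact l (dn (mon w)) y = mon w * y" for w by simp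
qed

lemma Eop_radical: "y \<in> radical D \<Longrightarrow> Eop i l y \<in> radical D"
proof -
  assume y: "y \<in> radical D"
  have "Eop i l y = dl D i (scal (\<lambda>a. kk i * qp (par D i * cr i l) (dd D i * cr i l + 2 * dd D i - zdot D (wt (FM [i])) a)) y)
     - dr D i (scal (\<lambda>a. kk i * qp (par D i + par D i * zpar D a) (- dd D i * cr i l)) y)"
    by (rule qlin_eqI[OF qlin_Eop qlin_minus[OF qlin_compose[OF qlin_dl qlin_scal] qlin_compose[OF qlin_dr qlin_scal]]])
       (simp add: Eop_def Ew_eq dl_const dr_const dl_mon dr_mon dotl_def parl_def)
  then show ?thesis using y by (simp add: radical_diff radical_dl radical_dr radical_scal)
qed

lemma Gop_radical: "x \<in> radical D \<Longrightarrow> Gop i l x \<in> radical D"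
proof -
  assume y: "x \<in> radical D"
  have "Gop i l x = dr D i (scal (\<lambda>a. kk i * qp (par D i * cr i l) (dd D i * cr i l)) x)
     - dl D i (scal (\<lambda>a. kk i * qp (par D i + par D i * zpar D a) (2 * dd D i - dd D i * cr i l - zdot D (wt (FM [i])) a)) x)"
    by (rule qlin_eqI[OF qlin_Gop qlin_minus[OF qlin_compose[OF qlin_dr qlin_scal] qlin_compose[OF qlin_dl qlin_scal]]])
       (simp add: Gop_def Gw_eq dl_const dr_const dl_mon dr_mon dotl_def parl_def)
  then show ?thesis using y by (simp add: radical_diff radical_dl radical_dr radical_scal)
qed

lemma vact_radical: "y \<in> radical D \<Longrightarrow> vact l x y \<in> radical D"
proof (induction x rule: free_induct)
  case (mon c w)
  have "wact l w y \<in> radical D"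
  proof (induction w)
    case (Cons g w)
    then show ?case by (cases g) (simp_all add: Eop_radical radical_mult_left radical_scal)
  qed (simp add: mon)
  then show ?case by (simp add: vact_lin radical_const)
qed (simp add: vact_lin radical_add)

end

lemma scal_scal: "scal g (scal h y) = scal (\<lambda>a. g a * h a) y"
  by (rule qlin_eqI[OF qlin_compose[OF qlin_scal qlin_scal] qlin_scal])
     (simp add: qlin_const[OF qlin_scal] const_const mult.commute)

lemma scal_id: "(\<And>a. g a = 1) \<Longrightarrow> scal g y = y"
  by (rule qlin_eqI[OF qlin_scal qlin_id]) (simp add: const_simps)

lemma weight_part_diff: "x \<in> weight_part a \<Longrightarrow> y \<in> weight_part a \<Longrightarrow> x - y \<in> weight_part a"
  using weight_part_add[of x a "const (- 1) * y"] weight_part_const[of y a "- 1"] by (simp add: const_simps)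

context datum begin

lemma Eop_weight: "x \<in> weight_part a \<Longrightarrow> Eop i l x \<in> weight_part (\<lambda>k. a k - wt (FM [i]) k)"
  unfolding Eop_def
proof (rule weight_part_lin)
  fix w assume "wt (FM w) = a"
  then show "Ew i l w \<in> weight_part (\<lambda>k. a k - wt (FM [i]) k)"
    using dlw_weight[of D i w] drw_weight[of D i w]
    unfolding Ew_eq by (auto intro!: weight_part_diff weight_part_const)
qed

lemma Eop_gen_mult: "Eop i l (gen j * x) = const (qp (par D i * par D j) 0) * (gen j * Eop i l x)
     + (if i = j then scal (\<lambda>a. br i (cr i (l - zroot D a))) x else 0)"
proof (rule qlin_eqI[of "\<lambda>x. Eop i l (gen j * x)" "\<lambda>x. const (qp (par D i * par D j) 0) * (gen j * Eop i l x)
     + (if i = j then scal (\<lambda>a. br i (cr i (l - zroot D a))) x else 0)"])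
  show "qlin (\<lambda>x. Eop i l (gen j * x))" by (intro qlin_compose[OF qlin_Eop] qlin_mult_left qlin_id)
  have "qlin (\<lambda>x. if i = j then scal (\<lambda>a. br i (cr i (l - zroot D a))) x else 0)"
    by (cases "i = j") (simp_all add: qlin_scal qlin_zero)
  then show "qlin (\<lambda>x. const (qp (par D i * par D j) 0) * (gen j * Eop i l x)
     + (if i = j then scal (\<lambda>a. br i (cr i (l - zroot D a))) x else 0))"
    by (intro qlin_plus qlin_mult_left qlin_Eop)
  show "Eop i l (gen j * mon w) = const (qp (par D i * par D j) 0) * (gen j * Eop i l (mon w))
     + (if i = j then scal (\<lambda>a. br i (cr i (l - zroot D a))) (mon w) else 0)" for w
    by (simp add: Eop_def wX_def flip: mon_Cons)
qed

lemma zroot_diff: "zroot D (\<lambda>k. a k - b k) = zroot D a - zroot D b"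
  by (rule pr_eqI) (simp add: pr_zroot left_diff_distrib sum_subtractf)

lemma zroot_single: "zroot D (wt (FM [i])) = root D i"
  using wX_single[of i] by (simp add: wX_def)

lemma up_weight: "vact l (up (mon w)) (mon u) \<in> weight_part (\<lambda>k. wt (FM u) k - wt (FM w) k)"
proof (induction w)
  case (Cons i w)
  have "(\<lambda>k. wt (FM u) k - wt (FM w) k - wt (FM [i]) k) = (\<lambda>k. wt (FM u) k - wt (FM (i # w)) k)"
    by (subst wt_Cons[of i w]) (simp add: fun_eq_iff)
  then show ?case using Eop_weight[OF Cons, of i l] by simp
qed (simp add: wt_Nil weight_part_mon)

text \<open>The counterpart of \<open>up_gF\<close> in the model; that lemma presupposes a module
  over the quantum group, which is only being constructed here.\<close>

lemma vact_up_gen_mult_mon: "vact l (up (mon w)) (gen j * mon u) =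
   gen j * vact l (up (scal (\<lambda>a. qp (par D j * zpar D a) 0) (mon w))) (mon u) + vact l (up (Gop j (l - wX D u) (mon w))) (mon u)"
proof (induction w)
  case (Cons i w)
  let ?X = "vact l (up (mon w)) (mon u)" and ?p = "qp (par D j * parl D w) 0"
  have "vact l (up (mon (i # w))) (gen j * mon u) = Eop i l (vact l (up (mon w)) (gen j * mon u))"
    by simp
  also have "\<dots> = const ?p * Eop i l (gen j * ?X) + Eop i l (vact l (up (Gop j (l - wX D u) (mon w))) (mon u))"
    unfolding Cons by (simp add: qlin_add[OF qlin_Eop] qlin_const[OF qlin_Eop] subst_gen_lin vact_lin const_norm parl_def)
  also have "Eop i l (gen j * ?X) = const (qp (par D i * par D j) 0) * (gen j * Eop i l ?X)
     + (if i = j then const (br j (cr j (l - wX D u + wX D w))) * ?X else 0)"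
    unfolding Eop_gen_mult scal_weight_part[OF up_weight] by (simp add: zroot_diff wX_def algebra_simps)
  finally show ?case
    by (auto simp: Gop_def subst_gen_lin subst_gen_mult vact_mult vact_lin distrib_left const_const qp_mult const_norm
        parl_def[symmetric] add_ac mult.commute[of "par D i"])
qed (simp add: mon_Nil scal_1 zpar_def Gop_1 subst_gen_lin vact_lin const_simps(2))

lemma vact_up_gen_mult: "vact l (up x) (gen j * mon u) =
   gen j * vact l (up (scal (\<lambda>a. qp (par D j * zpar D a) 0) x)) (mon u) + vact l (up (Gop j (l - wX D u) x)) (mon u)"
proof (rule qlin_eqI[of "\<lambda>x. vact l (up x) (gen j * mon u)" "\<lambda>x. gen j * vact l (up (scal (\<lambda>a. qp (par D j * zpar D a) 0) x)) (mon u) + vact l (up (Gop j (l - wX D u) x)) (mon u)"])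
qed (intro vact_up_gen_mult_mon qlin_plus qlin_mult_left qlin_compose[OF qlin_vact] qlin_compose[OF qlin_subst_gen] qlin_scal qlin_Gop qlin_subst_gen)+

lemma vact_up_1: "vact l (up x) 1 = const (Poly_Mapping.lookup x 0)"
proof (rule qlin_eqI[OF qlin_compose[OF qlin_vact qlin_subst_gen]])
  show "qlin (\<lambda>x. const (Poly_Mapping.lookup x 0))"
    by (simp add: qlin_def lookup_add const_simps)
  show "vact l (up (mon w)) 1 = const (Poly_Mapping.lookup (mon w) 0)" for w
  proof (induction w)
    case (Cons i w)
    have "Eop i l (const c) = 0" for c using qlin_const[OF qlin_Eop, of i l c 1] by (simp add: Eop_1)
    then have "Eop i l (vact l (up (mon w)) 1) = 0" unfolding Cons by simp
    then show ?case by (simp add: mon_Cons[of i w] const_simps del: vact_gen) (simp flip: mon_Cons)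
  qed (simp add: mon_Nil const_simps)
qed

text \<open>Induction on a word for all \<open>x\<close> at once: passing its first letter replaces
  \<open>x\<close> by its images under \<open>scal\<close> and \<open>Gop\<close>, which stay in the
  radical. Applied to 1, only the constant term of \<open>x\<close> survives, and it is
  zero.\<close>

lemma vact_up_radical: "x \<in> radical D \<Longrightarrow> vact l (up x) y = 0"
proof -
  have 1: "vact l (up x) (mon u) = 0" if "x \<in> radical D" for x u
    using that
  proof (induction u arbitrary: x)
    case (Cons j u)
    then show ?case
      unfolding mon_Cons vact_up_gen_mult by (simp add: radical_scal Gop_radical)
  qed (simp add: mon_Nil vact_up_1 radical_lookup_0 const_simps)
  assume "x \<in> radical D"
  then show ?thesis using qlin_eqI[OF qlin_vact2 qlin_zero, of l "up x"] 1 by simp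
qed

text \<open>The elements that map the whole free algebra into the radical form a two-sided ideal, so
  the relators decide.\<close>

lemma vact_u_ideal: "x \<in> u_ideal D \<Longrightarrow> vact l x y \<in> radical D"
proof -
  let ?I = "{x. \<forall>y. vact l x y \<in> radical D}"
  have "ideal ?I class_ring"
    by (rule class_ring_idealI) (auto simp: vact_lin radical_add vact_mult vact_radical)
  moreover have "x \<in> ?I" if "x \<in> u_relators D" for x
  proof -
    have z: "zscale 1 l = l" for l :: 'x by (rule pr_eqI) simp
    \<comment> \<open>Here \<open>g\<close> stands for the scalar by which K or J acts as a function
      of the weight, so both kinds of relations with E_i are covered at once.\<close>
    have KE: "scal (\<lambda>a. g (l - zroot D a)) (Eop i l y) = const c * Eop i l (scal (\<lambda>a. g (l - zroot D a)) y)"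
      if g: "\<And>n. g (n + root D i) = c * g n" for g i c y
    proof (rule qlin_eqI[OF qlin_compose[OF qlin_scal qlin_Eop] qlin_mult_left[OF qlin_compose[OF qlin_Eop qlin_scal]]])
      fix w
      have "g (l - zroot D (\<lambda>k. wt (FM w) k - wt (FM [i]) k)) = c * g (l - zroot D (wt (FM w)))"
        using g[of "l - zroot D (wt (FM w))"] by (simp add: zroot_diff zroot_single algebra_simps)
      then show "scal (\<lambda>a. g (l - zroot D a)) (Eop i l (mon w)) = const c * Eop i l (scal (\<lambda>a. g (l - zroot D a)) (mon w))"
        by (simp add: scal_weight_part[OF Eop_weight[OF weight_part_mon]] qlin_const[OF qlin_Eop] const_const)
    qed
    have KF: "scal (\<lambda>a. g (l - zroot D a)) (gen i * y) = const c * (gen i * scal (\<lambda>a. g (l - zroot D a)) y)"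
      if g: "\<And>n. g (n - root D i) = c * g n" for g i c y
    proof (rule qlin_eqI[OF qlin_compose[OF qlin_scal qlin_mult_left[OF qlin_id]] qlin_mult_left[OF qlin_mult_left[OF qlin_scal]]])
      fix w
      have "g (l - zroot D (wt (FM (i # w)))) = c * g (l - zroot D (wt (FM w)))"
        using g[of "l - zroot D (wt (FM w))"] wX_Cons[of i w] unfolding wX_def by (simp add: algebra_simps)
      then show "scal (\<lambda>a. g (l - zroot D a)) (gen i * mon w) = const c * (gen i * scal (\<lambda>a. g (l - zroot D a)) (mon w))"
        by (simp add: const_norm const_const flip: mon_Cons)
    qed
    have EF: "vact l (gE i * gF j - const (qp (par D i * par D j) 0) * gF j * gE i
        - (if i = j then const (kk i) * (gJ (zscale (dd D i) (coroot D i)) * gK (zscale (dd D i) (coroot D i))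
             - gK (zscale (- dd D i) (coroot D i))) else 0)) y = 0" for i j y
    proof -
      have "scal (\<lambda>a. br i (cr i (l - zroot D a))) y =
         const (kk i) * (scal (\<lambda>a. qp (dd D i * cr i (l - zroot D a)) 0) (scal (\<lambda>a. qp 0 (dd D i * cr i (l - zroot D a))) y)
            - scal (\<lambda>a. qp 0 (- dd D i * cr i (l - zroot D a))) y)"
      proof (rule qlin_eqI[OF qlin_scal qlin_mult_left[OF qlin_minus[OF qlin_compose[OF qlin_scal qlin_scal] qlin_scal]]])
        fix w
        have "qp (dd D i * cr i m) 0 * qp 0 (dd D i * cr i m) = qp (par D i * cr i m) (dd D i * cr i m)" for m
          unfolding qp_mult by (rule qp_cong) (simp_all only: add_0_right add_0_left parity_dd)
        note this[of "l - zroot D (wt (FM w))"]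
        then show "scal (\<lambda>a. br i (cr i (l - zroot D a))) (mon w) = const (kk i) * (scal (\<lambda>a. qp (dd D i * cr i (l - zroot D a)) 0) (scal (\<lambda>a. qp 0 (dd D i * cr i (l - zroot D a))) (mon w))
            - scal (\<lambda>a. qp 0 (- dd D i * cr i (l - zroot D a))) (mon w))"
          unfolding scal_scal by (simp add: br_def const_simps mult.assoc left_diff_distrib right_diff_distrib)
      qed
      then show ?thesis by (auto simp: vact_lin vact_mult Eop_gen_mult right_diff_distrib)
    qed
    show ?thesis
      using that unfolding u_relators_def Let_def
    proof (elim UnE)
      assume "x \<in> {gK m * gE i - const (q_elt powi pr m (root D i)) * gE i * gK m |m i. True}"
      then obtain m i where x: "x = gK m * gE i - const (q_elt powi pr m (root D i)) * gE i * gK m" by blast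
      show ?thesis
        using KE[of "\<lambda>n. qp 0 (pr m n)" i "qp 0 (pr m (root D i))"]
        by (simp add: x vact_lin vact_mult qp_mult add.commute) (simp add: qp_def)
    next
      assume "x \<in> {gJ m * gE i - const (pi_elt powi pr m (root D i)) * gE i * gJ m |m i. True}"
      then obtain m i where x: "x = gJ m * gE i - const (pi_elt powi pr m (root D i)) * gE i * gJ m" by blast
      show ?thesis
        using KE[of "\<lambda>n. qp (pr m n) 0" i "qp (pr m (root D i)) 0"]
        by (simp add: x vact_lin vact_mult qp_mult add.commute) (simp add: qp_def)
    next
      assume "x \<in> {gK m * gF i - const (q_elt powi (- pr m (root D i))) * gF i * gK m |m i. True}"
      then obtain m i where x: "x = gK m * gF i - const (q_elt powi (- pr m (root D i))) * gF i * gK m" by blast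
      show ?thesis
        using KF[of "\<lambda>n. qp 0 (pr m n)" i "qp 0 (- pr m (root D i))"]
        by (simp add: x vact_lin vact_mult qp_mult) (simp add: qp_def)
    next
      assume "x \<in> {gJ m * gF i - const (pi_elt powi (- pr m (root D i))) * gF i * gJ m |m i. True}"
      then obtain m i where x: "x = gJ m * gF i - const (pi_elt powi (- pr m (root D i))) * gF i * gJ m" by blast
      show ?thesis
        using KF[of "\<lambda>n. qp (pr m n) 0" i "qp (- pr m (root D i)) 0"]
        by (simp add: x vact_lin vact_mult qp_mult) (simp add: qp_def)
    next
      assume "x \<in> {gE i * gF j - const (pi_elt powi (par D i * par D j)) * gF j * gE i
        - (if i = j then const (1 / (pi_i D i * q_i D i - q_i D i powi (- 1))) *
             (gJ (zscale (dd D i) (coroot D i)) * gK (zscale (dd D i) (coroot D i)) - gK (zscale (- dd D i) (coroot D i)))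
           else 0) |i j. True}"
      then obtain i j where x: "x = gE i * gF j - const (pi_elt powi (par D i * par D j)) * gF j * gE i
        - (if i = j then const (1 / (pi_i D i * q_i D i - q_i D i powi (- 1))) *
             (gJ (zscale (dd D i) (coroot D i)) * gK (zscale (dd D i) (coroot D i)) - gK (zscale (- dd D i) (coroot D i)))
           else 0)" by blast
      have kk: "1 / (pi_i D i * q_i D i - q_i D i powi (- 1)) = kk i" by (simp add: divide_qpi_def kk_def)
      have q: "pi_elt powi a = qp a 0" for a by (simp add: qp_def)
      show ?thesis unfolding x mem_Collect_eq kk q EF by simp
    qed (auto simp: vact_lin vact_mult scal_scal scal_id qp_mult qp_one add.commute add_diff_add vact_up_radical vact_dn radical_mult_right)
  qed
  ultimately have "u_ideal D \<subseteq> ?I" by (intro u_ideal_minimal) auto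
  then show "x \<in> u_ideal D \<Longrightarrow> vact l x y \<in> radical D" by auto
qed

end

section \<open>The Verma action on cosets\<close>

context datum begin

lemma ideal_radical: "ideal (radical D) class_ring"
  by (rule class_ring_idealI) (auto intro: radical_add radical_mult_left radical_mult_right)

lemma f_cls_eq_iff: "f_cls D x = f_cls D y \<longleftrightarrow> x - y \<in> radical D"
  unfolding f_cls_def by (rule class_coset_eq_iff[OF ideal_radical])

lemma f_alg_simps:
  "carrier (f_alg D) = range (f_cls D)"
  "f_cls D x \<otimes>\<^bsub>f_alg D\<^esub> f_cls D y = f_cls D (x * y)"
  "f_cls D x \<oplus>\<^bsub>f_alg D\<^esub> f_cls D y = f_cls D (x + y)"
  "\<one>\<^bsub>f_alg D\<^esub> = f_cls D 1"
  "\<zero>\<^bsub>f_alg D\<^esub> = f_cls D 0"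
  using class_quot_simps[OF ideal_radical]
  by (simp_all add: f_alg_def f_cls_def[abs_def])

lemma f_module_simps [simp]:
  "carrier (f_module D act) = carrier (f_alg D)" "add (f_module D act) = add (f_alg D)"
  "zero (f_module D act) = zero (f_alg D)" "smult (f_module D act) = act"
  by (simp_all add: f_module_def)

definition f_act :: "'x \<Rightarrow> ('i, 'y) u_elt \<Rightarrow> 'i free_alg set \<Rightarrow> 'i free_alg set" where
  "f_act l A Y = f_cls D (vact l (SOME x. u_cls D x = A) (SOME y. f_cls D y = Y))"

lemma f_act_cls: "f_act l (u_cls D x) (f_cls D y) = f_cls D (vact l x y)"
proof -
  define x' y' where "x' = (SOME x'. u_cls D x' = u_cls D x)" and "y' = (SOME y'. f_cls D y' = f_cls D y)"
  have "u_cls D x' = u_cls D x" unfolding x'_def by (rule someI) simp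
  moreover have "f_cls D y' = f_cls D y" unfolding y'_def by (rule someI) simp
  ultimately have "vact l (x' - x) y' \<in> radical D" "vact l x (y' - y) \<in> radical D"
    by (auto simp: u_cls_eq_iff f_cls_eq_iff intro: vact_u_ideal vact_radical)
  then have "vact l (x' - x) y' + vact l x (y' - y) \<in> radical D" by (rule radical_add)
  then have "f_cls D (vact l x' y') = f_cls D (vact l x y)"
    unfolding f_cls_eq_iff by (simp add: vact_lin vact_lin2)
  then show ?thesis by (simp only: f_act_def x'_def y'_def)
qed

lemma is_verma_action_f_act: "is_verma_action D l (f_act l)"
  unfolding is_verma_action_def
proof (intro conjI allI ballI)
  show "left_module (u_alg D) (f_module D (f_act l))"
    by (rule left_moduleI_surj[of _ "f_cls D" D "vact l"])
       (simp_all add: f_alg_simps f_act_cls vact_lin vact_lin2 vact_mult)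
  show "f_act l (u_cls D (const c)) y = f_cls D (const c) \<otimes>\<^bsub>f_alg D\<^esub> y" if "y \<in> carrier (f_alg D)" for c y
    using that by (auto simp: f_alg_simps f_act_cls)
  show "f_act l (u_cls D (gF i)) y = f_cls D (gen i) \<otimes>\<^bsub>f_alg D\<^esub> y" if "y \<in> carrier (f_alg D)" for i y
    using that by (auto simp: f_alg_simps f_act_cls)
  show "f_act l (u_cls D (gE i)) \<one>\<^bsub>f_alg D\<^esub> = \<zero>\<^bsub>f_alg D\<^esub>" for i
    by (simp add: f_alg_simps f_act_cls Eop_1)
  show "f_act l (u_cls D (gK \<mu>)) y = f_cls D (const (q_elt powi pr \<mu> (l - zroot D a))) \<otimes>\<^bsub>f_alg D\<^esub> y"
       "f_act l (u_cls D (gJ \<mu>)) y = f_cls D (const (pi_elt powi pr \<mu> (l - zroot D a))) \<otimes>\<^bsub>f_alg D\<^esub> y"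
    if y: "y \<in> f_weight D a" for a y \<mu>
  proof -
    obtain x where x: "x \<in> weight_part a" "y = f_cls D x" using y by (auto simp: f_weight_def)
    show "f_act l (u_cls D (gK \<mu>)) y = f_cls D (const (q_elt powi pr \<mu> (l - zroot D a))) \<otimes>\<^bsub>f_alg D\<^esub> y"
       "f_act l (u_cls D (gJ \<mu>)) y = f_cls D (const (pi_elt powi pr \<mu> (l - zroot D a))) \<otimes>\<^bsub>f_alg D\<^esub> y"
      by (simp_all add: x(2) f_alg_simps f_act_cls scal_weight_part[OF x(1)] qp_def)
  qed
qed

definition vv where "vv l = (SOME act. is_verma_action D l act)"

lemma verma_eq: "verma D l = f_module D (vv l)"
  by (simp add: verma_def vv_def)

lemma vv: "is_verma_action D l (vv l)"
  unfolding vv_def by (rule someI[of _ "f_act l"]) (rule is_verma_action_f_act)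

lemma umod_verma: "umod D (verma D l)"
  unfolding umod_def verma_eq using vv[of l] datum_axioms by (simp add: is_verma_action_def)

end

context umod begin

lemma app_dn_gen: "sing l v \<Longrightarrow> gen g \<cdot> dn y \<cdot> v = dn (gact l g y) \<cdot> v"
proof -
  assume s: "sing l v"
  have c: "v \<in> carrier M" using s by (rule sing_carrier)
  have w: "dn (mon w) \<cdot> v \<in> wsp (l - wX D w)" for w using wsp_dn[OF sing_wsp[OF s]] .
  have e: "(gen g * dn y) \<cdot> v = dn (gact l g y) \<cdot> v"
  proof (rule app_lin_eqI[OF qlin_mult_left[OF qlin_subst_gen] qlin_compose[OF qlin_subst_gen qlin_gact] c])
    show "(gen g * dn (mon w)) \<cdot> v = dn (gact l g (mon w)) \<cdot> v" for w
    proof (cases g)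
      case (GE i)
      then show ?thesis using sing_gE_dn[OF s, of i "mon w"] c by (simp only: app_mult gact.simps)
    next
      case (GF i)
      then show ?thesis by (simp add: subst_gen_mult)
    next
      case (GK \<mu>)
      then show ?thesis using w[of w] c by (simp add: wsp_iff wX_def subst_gen_lin subst_gen_mult app_mult)
    next
      case (GJ \<mu>)
      then show ?thesis using w[of w] c by (simp add: wsp_iff wX_def subst_gen_lin subst_gen_mult app_mult)
    qed
  qed
  then show ?thesis using c by (simp add: app_mult)
qed

text \<open>Over any singular vector the algebra acts on words in the F by the formula of the model.
  This yields the uniqueness of the Verma action, the invariance of the ideal T, and the maps out of
  V.\<close>

lemma app_dn: "sing l v \<Longrightarrow> x \<cdot> dn y \<cdot> v = dn (vact l x y) \<cdot> v"
proof (induction x rule: free_induct)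
  case (mon c w)
  have c: "v \<in> carrier M" using mon by (rule sing_carrier)
  have "mon w \<cdot> dn y \<cdot> v = dn (wact l w y) \<cdot> v"
    by (induction w) (simp_all add: mon_Nil app_one c mon_Cons app_mult app_dn_gen[OF mon])
  then show ?case by (simp add: vact_lin app_mult c subst_gen_lin subst_gen_mult)
next
  case (add x z)
  then show ?case by (simp add: vact_lin app_plus sing_carrier subst_gen_lin)
qed

end

context datum begin

lemma verma_simps:
  "carrier (verma D l) = range (f_cls D)" "f_cls D x \<oplus>\<^bsub>verma D l\<^esub> f_cls D y = f_cls D (x + y)"
  "\<zero>\<^bsub>verma D l\<^esub> = f_cls D 0"
  by (simp_all add: verma_eq f_alg_simps)

text \<open>The action in \<open>verma\<close> is an arbitrary one satisfying
  \<open>is_verma_action\<close>. The axioms make the class of 1 singular and a generator, and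
  \<open>app_dn\<close> then determines the rest.\<close>

lemma verma_act: "u_cls D x \<odot>\<^bsub>verma D l\<^esub> f_cls D y = f_cls D (vact l x y)"
proof -
  interpret V: umod D "verma D l" by (rule umod_verma)
  have cl: "f_cls D y \<in> carrier (f_alg D)" for y by (simp add: f_alg_simps)
  have va: "vv l (u_cls D (const c)) (f_cls D y) = f_cls D (const c * y)"
    "vv l (u_cls D (gF i)) (f_cls D y) = f_cls D (gen i * y)"
    "vv l (u_cls D (gE i)) (f_cls D 1) = f_cls D 0" for c y i
    using vv[of l] cl by (simp_all add: is_verma_action_def f_alg_simps)
  have one: "f_cls D 1 \<in> f_weight D (\<lambda>i. 0)"
    using weight_part_mon[of "[]"] by (auto simp: f_weight_def mon_Nil wt_Nil)
  have z0: "zroot D (\<lambda>i. 0) = 0" using wX_Nil by (simp add: wX_def wt_Nil)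
  have vk: "vv l (u_cls D (gK \<mu>)) (f_cls D 1) = f_cls D (const (qp 0 (pr \<mu> l)))"
    "vv l (u_cls D (gJ \<mu>)) (f_cls D 1) = f_cls D (const (qp (pr \<mu> l) 0))" for \<mu>
    using vv[of l] one z0 by (simp_all add: is_verma_action_def f_alg_simps qp_def)
  let ?v = "f_cls D 1"
  have s: "V.sing l ?v"
    unfolding V.sing_def V.wsp_iff V.app_def
    using va(1)[of _ 1] va(3) vk by (simp add: verma_eq f_alg_simps)
  have dn1: "V.app (dn (mon w)) ?v = f_cls D (mon w)" for w
  proof (induction w)
    case Nil
    then show ?case using V.app_one[OF V.sing_carrier[OF s]] by (simp add: mon_Nil)
  next
    case (Cons i w)
    have "V.app (dn (mon (i # w))) ?v = V.app (gF i) (V.app (dn (mon w)) ?v)"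
      using V.sing_carrier[OF s] by (simp add: mon_Cons[of "GF _"] V.app_mult)
    also have "\<dots> = f_cls D (mon (i # w))" unfolding Cons unfolding V.app_def by (simp add: verma_eq va mon_Cons)
    finally show ?case .
  qed
  have dn: "V.app (dn y) ?v = f_cls D y" for y
  proof (induction y rule: free_induct)
    case (mon c w)
    have "V.app (dn (const c * mon w)) ?v = V.app (const c) (V.app (dn (mon w)) ?v)"
      using V.sing_carrier[OF s] by (simp add: subst_gen_lin V.app_mult)
    then show ?case unfolding dn1 unfolding V.app_def by (simp add: verma_eq va)
  next
    case (add x y)
    then show ?case using V.sing_carrier[OF s] by (simp add: subst_gen_lin V.app_plus verma_simps)
  qed
  show ?thesis using V.app_dn[OF s, of x y] by (simp add: dn V.app_def[symmetric])
qed

section \<open>Singular powers and the modules V\<close>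

lemma replicate_weight: "parl D (replicate n i) = int n * par D i" "dotl D [i] (replicate n i) = 2 * int n * dd D i"
  by (induction n) (simp_all add: algebra_simps dotl_Cons(2)[of D "[i]"] dot_diag)

text \<open>The quantum integer of n + 1 up to a power of q, as a geometric sum with ratio
  \<open>xi D [i] [i]\<close>.\<close>

definition geo :: "'i \<Rightarrow> nat \<Rightarrow> qpi" where "geo i n = (\<Sum>k\<le>n. qp (int k * par D i) (2 * int k * dd D i))"

lemma xi_replicate_self: "xi D [i] (replicate n i) = qp (int n * par D i) (2 * int n * dd D i)"
  by (simp add: xi_qp replicate_weight parl_single par_sq mult.left_commute[of "par D i"])

lemma dlw_replicate: "dlw D i (replicate (Suc n) i) = const (geo i n) * mon (replicate n i)"
proof (induction n)
  case (Suc n)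
  have "geo i (Suc n) = 1 + qp (par D i) (2 * dd D i) * geo i n"
    unfolding geo_def sum.atMost_Suc_shift by (simp add: sum_distrib_left qp_mult algebra_simps)
  moreover have "xi D [i] [i] = qp (par D i) (2 * dd D i)" using xi_replicate_self[of i 1] by simp
  ultimately show ?case using Suc
    by (simp add: const_simps(2,3) distrib_right const_const mon_Cons const_norm)
qed (simp add: geo_def mon_Nil const_simps)

lemma drw_replicate: "drw D i (replicate (Suc n) i) = const (geo i n) * mon (replicate n i)"
proof (induction n)
  case (Suc n)
  have "drw D i (replicate (Suc (Suc n)) i) = const (xi D [i] (replicate (Suc n) i)) * mon (replicate (Suc n) i) + gen i * drw D i (replicate (Suc n) i)"
    by simp
  then show ?case unfolding Suc xi_replicate_self
    by (simp add: geo_def const_simps(3) distrib_right mon_Cons const_norm add.commute)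
qed (simp add: geo_def mon_Nil const_simps)

lemma geo_unit: "geo i n dvd 1"
proof -
  have "geo i n * (qp (par D i) (2 * dd D i) - 1) = qp (int (Suc n) * par D i) (2 * int (Suc n) * dd D i) - 1"
  proof (induction n)
    case (Suc n)
    have "geo i (Suc n) * (qp (par D i) (2 * dd D i) - 1) = geo i n * (qp (par D i) (2 * dd D i) - 1)
       + qp (int (Suc n) * par D i) (2 * int (Suc n) * dd D i) * (qp (par D i) (2 * dd D i) - 1)"
      by (simp add: geo_def distrib_right)
    then show ?case unfolding Suc by (simp add: right_diff_distrib qp_mult algebra_simps)
  qed (simp add: geo_def)
  moreover have "(qp (int (Suc n) * par D i) (2 * int (Suc n) * dd D i) - qp 0 0) dvd 1"
    using dd_pos[of i] by (intro qp_diff_unit) simp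
  ultimately show ?thesis by (metis dvd_mult_left qp_0)
qed

text \<open>The coefficient of F_i^n v in E_i F_i^(n+1) v for a singular v with <i,l> = h. It equals
  pi_i^n [n+1]_i [h-n]_i.\<close>

definition ecoef :: "'i \<Rightarrow> int \<Rightarrow> nat \<Rightarrow> qpi" where
  "ecoef i h n = kk i * (qp (par D i * h) (dd D i * h - 2 * int n * dd D i) - qp (int n * par D i) (- dd D i * h)) * geo i n"

lemma Ew_replicate: "Ew j l (replicate (Suc n) i) = (if j = i then const (ecoef i (cr i l) n) * mon (replicate n i) else 0)"
proof (cases "j = i")
  case True
  have p: "qp (par D i + par D i * (int (Suc n) * par D i)) b = qp (int n * par D i) b" for b
    by (rule qp_cong) (simp_all add: algebra_simps par_sq mult.left_commute[of "par D i"])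
  have d: "dd D i * cr i l + 2 * dd D i - 2 * int (Suc n) * dd D i = dd D i * cr i l - 2 * int n * dd D i"
    by (simp add: algebra_simps)
  show ?thesis
    unfolding True Ew_eq dlw_replicate drw_replicate replicate_weight p d const_const
    by (simp add: ecoef_def left_diff_distrib right_diff_distrib const_simps(4) mult.assoc)
next
  case False
  have "Ew j l (replicate n i) = 0" for n
    using False by (induction n) simp_all
  then show ?thesis using False by simp
qed

text \<open>The exponents of q in the two terms of the difference coincide only for
  \<open>h = int n\<close>. This is what later forces <i,l> to be a natural number.\<close>

lemma ecoef_unit: "h \<noteq> int n \<Longrightarrow> ecoef i h n dvd 1"
proof -
  assume "h \<noteq> int n"
  then have "dd D i * h - 2 * int n * dd D i \<noteq> - dd D i * h" using dd_pos[of i]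
    by (auto simp: algebra_simps)
  then have "(qp (par D i * h) (dd D i * h - 2 * int n * dd D i) - qp (int n * par D i) (- dd D i * h)) dvd 1"
    by (rule qp_diff_unit)
  moreover have "kk i dvd 1" using kk_unit by (metis dvd_triv_left)
  moreover have "a * b * c dvd 1" if "a dvd 1" "b dvd 1" "c dvd 1" for a b c :: qpi
    using that by (metis mult_1 mult_dvd_mono)
  ultimately show ?thesis unfolding ecoef_def using geo_unit by blast
qed

lemma ecoef_zero: "ecoef i (int n) n = 0"
  by (simp add: ecoef_def mult.commute)

end

lemma gen_power: "gen i ^ n = mon (replicate n i)"
  by (induction n) (simp_all add: mon_Nil mon_Cons)

context umod begin

lemma gE_power:
  assumes "sing l v"
  shows "gE j \<cdot> dn (gen i ^ Suc n) \<cdot> v = (if j = i then const (ecoef i (cr i l) n) \<cdot> dn (gen i ^ n) \<cdot> v else \<zero>)"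
proof -
  have c: "v \<in> carrier M" using assms by (rule sing_carrier)
  have "gE j \<cdot> dn (gen i ^ Suc n) \<cdot> v = dn (Ew j l (replicate (Suc n) i)) \<cdot> v"
    unfolding gen_power sing_gE_dn[OF assms] by (simp only: Eop_def lin_mon)
  then show ?thesis unfolding Ew_replicate using c
    by (auto simp: gen_power subst_gen_lin app_mult)
qed

lemma sing_power:
  assumes "sing l v" "0 \<le> cr i l"
  shows "sing (l - wX D (replicate (Suc (nat (cr i l))) i)) (dn (gen i ^ Suc (nat (cr i l))) \<cdot> v)"
proof -
  have c: "v \<in> carrier M" using assms(1) by (rule sing_carrier)
  have "ecoef i (cr i l) (nat (cr i l)) = 0" using ecoef_zero[of i "nat (cr i l)"] assms by simp
  then have "gE j \<cdot> dn (gen i ^ Suc (nat (cr i l))) \<cdot> v = \<zero>" for j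
    unfolding gE_power[OF assms(1)] using c by (simp add: const_simps(1))
  moreover have "dn (gen i ^ Suc (nat (cr i l))) \<cdot> v \<in> wsp (l - wX D (replicate (Suc (nat (cr i l))) i))"
    unfolding gen_power by (rule wsp_dn[OF sing_wsp[OF assms(1)]])
  ultimately show ?thesis by (simp add: sing_def)
qed

end

section \<open>The left ideal T and the quotient V\<close>

context datum begin

definition hgt :: "'x \<Rightarrow> 'i \<Rightarrow> nat" where "hgt l i = Suc (nat (cr i l))"

text \<open>The preimage of T in the free algebra. One left multiple for each \<open>i\<close>
  suffices, since multiples of the same generator add up to a single one.\<close>

definition Lid :: "'x \<Rightarrow> 'i free_alg set" where
  "Lid l = {y. \<exists>c. y - (\<Sum>i\<in>UNIV. c i * gen i ^ hgt l i) \<in> radical D}"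

lemma ring_f_alg: "ring (f_alg D)"
  unfolding f_alg_def by (rule ideal.quotient_is_ring[OF ideal_radical])

lemma f_alg_minus: "\<ominus>\<^bsub>f_alg D\<^esub> f_cls D x = f_cls D (- x)"
proof -
  interpret F: ring "f_alg D" by (rule ring_f_alg)
  show ?thesis by (rule F.minus_equality) (simp_all add: f_alg_simps)
qed

lemma f_subgroupI:
  assumes "0 \<in> L" "\<And>x y. x \<in> L \<Longrightarrow> y \<in> L \<Longrightarrow> x + y \<in> L" "\<And>x. x \<in> L \<Longrightarrow> - x \<in> L"
  shows "additive_subgroup (f_cls D ` L) (f_alg D)"
proof -
  interpret F: ring "f_alg D" by (rule ring_f_alg)
  show ?thesis
    using assms
    by (intro additive_subgroupI F.add.subgroupI)
       (auto simp: f_alg_simps f_alg_minus[unfolded a_inv_def] a_inv_def[symmetric] f_alg_minus)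
qed

lemma Lid_closed:
  "0 \<in> Lid l" "x \<in> Lid l \<Longrightarrow> y \<in> Lid l \<Longrightarrow> x + y \<in> Lid l" "x \<in> Lid l \<Longrightarrow> - x \<in> Lid l"
  "x \<in> Lid l \<Longrightarrow> z * x \<in> Lid l" "x \<in> radical D \<Longrightarrow> x \<in> Lid l" "gen i ^ hgt l i \<in> Lid l"
proof -
  let ?S = "\<lambda>c. \<Sum>i\<in>UNIV. c i * gen i ^ hgt l i"
  show r: "x \<in> Lid l" if "x \<in> radical D" for x
    using that by (auto simp: Lid_def intro!: exI[of _ "\<lambda>i. 0"])
  show "0 \<in> Lid l" by (rule r) simp
  show "x + y \<in> Lid l" if xy: "x \<in> Lid l" "y \<in> Lid l" for x y
  proof -
    obtain c d where cd: "x - ?S c \<in> radical D" "y - ?S d \<in> radical D" using xy by (auto simp: Lid_def)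
    have eq: "(x + y) - ?S (\<lambda>i. c i + d i) = (x - ?S c) + (y - ?S d)"
      by (simp add: distrib_right sum.distrib)
    have "(x + y) - ?S (\<lambda>i. c i + d i) \<in> radical D" unfolding eq by (rule radical_add[OF cd])
    then show ?thesis unfolding Lid_def by (intro CollectI exI[of _ "\<lambda>i. c i + d i"])
  qed
  show m: "z * x \<in> Lid l" if x: "x \<in> Lid l" for x z
  proof -
    obtain c where c: "x - ?S c \<in> radical D" using x by (auto simp: Lid_def)
    have eq: "z * x - ?S (\<lambda>i. z * c i) = z * (x - ?S c)"
      by (simp add: right_diff_distrib sum_distrib_left mult.assoc)
    have "z * x - ?S (\<lambda>i. z * c i) \<in> radical D" unfolding eq by (rule radical_mult_left[OF c])
    then show ?thesis unfolding Lid_def by (intro CollectI exI[of _ "\<lambda>i. z * c i"])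
  qed
  show "x \<in> Lid l \<Longrightarrow> - x \<in> Lid l" for x using m[of x "- 1"] by simp
  have "?S (\<lambda>j. if j = i then 1 else 0) = gen i ^ hgt l i" for i
  proof -
    have "?S (\<lambda>j. if j = i then 1 else 0) = (\<Sum>j\<in>UNIV. if j = i then gen j ^ hgt l j else 0)"
      by (intro sum.cong) auto
    then show ?thesis by simp
  qed
  then show "gen i ^ hgt l i \<in> Lid l" for i
    unfolding Lid_def by (intro CollectI exI[of _ "\<lambda>j. if j = i then 1 else 0"]) (simp only: diff_self radical_0)
qed

lemma Lid_diff: "x \<in> Lid l \<Longrightarrow> y \<in> Lid l \<Longrightarrow> x - y \<in> Lid l"
  using Lid_closed(2)[of x l "- y"] Lid_closed(3) by simp

lemma T_ideal_eq: "T_ideal D l = f_cls D ` Lid l"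
proof
  have "\<forall>r\<in>carrier (f_alg D). \<forall>x\<in>f_cls D ` Lid l. r \<otimes>\<^bsub>f_alg D\<^esub> x \<in> f_cls D ` Lid l"
    by (auto simp: f_alg_simps intro: Lid_closed)
  moreover have "f_cls D (gen i ^ (nat (pairing D (coroot D i) l) + 1)) \<in> f_cls D ` Lid l" for i
    using Lid_closed(6)[of i l] by (simp add: hgt_def)
  ultimately show "T_ideal D l \<subseteq> f_cls D ` Lid l"
    unfolding T_ideal_def using f_subgroupI[OF Lid_closed(1-3)] by (intro Inter_lower) auto
  show "f_cls D ` Lid l \<subseteq> T_ideal D l"
    unfolding T_ideal_def
  proof (intro Inter_greatest subsetI)
    fix H Y
    assume "H \<in> {H. additive_subgroup H (f_alg D) \<and>
        (\<forall>r\<in>carrier (f_alg D). \<forall>x\<in>H. r \<otimes>\<^bsub>f_alg D\<^esub> x \<in> H) \<and>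
        (\<forall>i. f_cls D (gen i ^ (nat (cr i l) + 1)) \<in> H)}" and Y: "Y \<in> f_cls D ` Lid l"
    then have H: "additive_subgroup H (f_alg D)" and mult: "\<And>c x. f_cls D x \<in> H \<Longrightarrow> f_cls D (c * x) \<in> H"
      and g: "\<And>i. f_cls D (gen i ^ hgt l i) \<in> H"
      by (auto simp: f_alg_simps hgt_def) (metis f_alg_simps(2) rangeI)
    obtain c where c: "Y = f_cls D (\<Sum>i\<in>UNIV. c i * gen i ^ hgt l i)"
      using Y f_cls_eq_iff by (auto simp: Lid_def)
    have "f_cls D (\<Sum>i\<in>A. c i * gen i ^ hgt l i) \<in> H" if "finite A" for A
      using that
    proof (induction A)
      case empty
      then show ?case using additive_subgroup.zero_closed[OF H] by (simp add: f_alg_simps)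
    next
      case (insert a A)
      then show ?case using additive_subgroup.a_closed[OF H mult[OF g] insert.IH, of "c a" a]
        by (simp add: f_alg_simps)
    qed
    then show "Y \<in> H" by (simp add: c)
  qed
qed

lemma verma_sing:
  "umod.sing D (verma D l) l (f_cls D 1)" "umod.app D (verma D l) (dn y) (f_cls D 1) = f_cls D y"
proof -
  interpret V: umod D "verma D l" by (rule umod_verma)
  have z0: "zroot D (\<lambda>i. 0) = 0" using wX_Nil by (simp add: wX_def wt_Nil)
  show "V.sing l (f_cls D 1)"
    unfolding V.sing_def V.wsp_iff V.app_def by (simp add: verma_act verma_simps Eop_1 scal_1 z0)
  show "V.app (dn y) (f_cls D 1) = f_cls D y" by (simp add: V.app_def verma_act vact_dn)
qed

text \<open>The generators of T are singular vectors of the Verma module. Applying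
  \<open>app_dn\<close> over each of them rewrites the action on a left multiple as a left multiple
  again, with the action taken at the lower weight.\<close>

lemma Lid_vact:
  assumes "l \<in> dominant D" "y \<in> Lid l"
  shows "vact l x y \<in> Lid l"
proof -
  interpret V: umod D "verma D l" by (rule umod_verma)
  obtain c where c: "y - (\<Sum>i\<in>UNIV. c i * gen i ^ hgt l i) \<in> radical D" using assms by (auto simp: Lid_def)
  have 1: "vact l x (c i * gen i ^ hgt l i) \<in> Lid l" for i
  proof -
    let ?v = "f_cls D 1" and ?l = "l - wX D (replicate (hgt l i) i)"
    let ?s = "V.app (dn (gen i ^ hgt l i)) ?v"
    have s: "V.sing ?l ?s"
      using V.sing_power[OF verma_sing(1), of i] assms by (simp add: hgt_def dominant_def)
    have d: "V.app (dn (y * gen i ^ hgt l i)) ?v = V.app (dn y) ?s" for y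
      using V.sing_carrier[OF verma_sing(1)] by (simp add: subst_gen_mult V.app_mult)
    have "f_cls D (vact l x (c i * gen i ^ hgt l i)) = V.app x (V.app (dn (c i)) ?s)"
      using V.app_dn[OF verma_sing(1)] by (simp add: verma_sing(2) vact_dn flip: d)
    also have "\<dots> = f_cls D (vact ?l x (c i) * gen i ^ hgt l i)"
      unfolding V.app_dn[OF s] unfolding d[symmetric] by (rule verma_sing(2))
    finally have "vact l x (c i * gen i ^ hgt l i) - vact ?l x (c i) * gen i ^ hgt l i \<in> Lid l"
      unfolding f_cls_eq_iff by (rule Lid_closed)
    from Lid_closed(2)[OF this Lid_closed(4)[OF Lid_closed(6)], of "vact ?l x (c i)" i] show ?thesis by simp
  qed
  have "vact l x (\<Sum>i\<in>A. c i * gen i ^ hgt l i) \<in> Lid l" for A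
    by (induction A rule: infinite_finite_induct) (simp_all add: vact_lin2 1 Lid_closed)
  moreover have "vact l x (y - (\<Sum>i\<in>UNIV. c i * gen i ^ hgt l i)) \<in> Lid l"
    using vact_radical[OF c] by (rule Lid_closed)
  ultimately have "vact l x (y - (\<Sum>i\<in>UNIV. c i * gen i ^ hgt l i)) + vact l x (\<Sum>i\<in>UNIV. c i * gen i ^ hgt l i) \<in> Lid l"
    by (intro Lid_closed(2))
  then show ?thesis by (simp flip: vact_lin2(1))
qed

text \<open>An element of V is a set of cosets, each of them a set of elements of the free algebra;
  this reaches it directly from a representative.\<close>

definition vcls :: "'x \<Rightarrow> 'i free_alg \<Rightarrow> 'i free_alg set set" where
  "vcls l y = f_cls D ` {z. z - y \<in> Lid l}"

lemma vcls_eq: "vcls l x = vcls l y \<longleftrightarrow> x - y \<in> Lid l"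
proof
  assume "vcls l x = vcls l y"
  moreover have "f_cls D x \<in> vcls l x" using Lid_closed(1) by (auto simp: vcls_def)
  ultimately obtain z where z: "f_cls D x = f_cls D z" "z - y \<in> Lid l" by (auto simp: vcls_def)
  then have "x - z \<in> Lid l" unfolding f_cls_eq_iff by (intro Lid_closed(5))
  then have "(x - z) + (z - y) \<in> Lid l" using z(2) by (rule Lid_closed(2))
  then show "x - y \<in> Lid l" by simp
next
  assume *: "x - y \<in> Lid l"
  have "z - x \<in> Lid l \<longleftrightarrow> z - y \<in> Lid l" for z
    using Lid_closed(2)[OF _ *, of "z - x"] Lid_diff[OF _ *, of "z - y"] by auto
  then show "vcls l x = vcls l y" by (simp add: vcls_def)
qed

lemma verma_coset: "T_ideal D l +>\<^bsub>verma D l\<^esub> f_cls D y = vcls l y"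
proof -
  have "T_ideal D l +>\<^bsub>verma D l\<^esub> f_cls D y = (\<lambda>t. f_cls D (t + y)) ` Lid l"
    by (auto simp: a_r_coset_def r_coset_def T_ideal_eq verma_simps)
  also have "\<dots> = f_cls D ` (\<lambda>t. t + y) ` Lid l" by (simp add: image_image)
  also have "(\<lambda>t. t + y) ` Lid l = {z. z - y \<in> Lid l}"
    by (auto intro: rev_image_eqI[of "_ - y"])
  finally show ?thesis by (simp add: vcls_def)
qed

lemma V_simps:
  "carrier (V_module D l) = range (vcls l)" "vcls l x \<oplus>\<^bsub>V_module D l\<^esub> vcls l y = vcls l (x + y)"
  "\<zero>\<^bsub>V_module D l\<^esub> = vcls l 0"
  "l \<in> dominant D \<Longrightarrow> u_cls D u \<odot>\<^bsub>V_module D l\<^esub> vcls l y = vcls l (vact l u y)"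
proof -
  have "a_rcosets\<^bsub>verma D l\<^esub> (T_ideal D l) = (\<lambda>a. T_ideal D l +>\<^bsub>verma D l\<^esub> a) ` carrier (verma D l)"
    by (auto simp: A_RCOSETS_def RCOSETS_def a_r_coset_def)
  then show "carrier (V_module D l) = range (vcls l)"
    by (simp add: V_module_def quot_module_def verma_simps verma_coset image_image)
  show "\<zero>\<^bsub>V_module D l\<^esub> = vcls l 0"
    by (simp add: V_module_def quot_module_def T_ideal_eq vcls_def)
  show "vcls l x \<oplus>\<^bsub>V_module D l\<^esub> vcls l y = vcls l (x + y)"
  proof -
    have "vcls l x \<oplus>\<^bsub>V_module D l\<^esub> vcls l y = (\<Union>a\<in>{z. z - x \<in> Lid l}. \<Union>b\<in>{z. z - y \<in> Lid l}. {f_cls D (a + b)})"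
      by (auto simp: V_module_def quot_module_def set_add_def set_mult_def vcls_def verma_simps)
    also have "\<dots> = f_cls D ` {z. z - (x + y) \<in> Lid l}"
    proof -
      have ab: "a + b - (x + y) \<in> Lid l" if "a - x \<in> Lid l" "b - y \<in> Lid l" for a b
        using Lid_closed(2)[OF that] by (simp add: add_diff_add)
      have z: "z = (z - y) + y \<and> (z - y) - x \<in> Lid l \<and> y - y \<in> Lid l" if "z - (x + y) \<in> Lid l" for z
        using that Lid_closed(1)[of l] by (simp add: diff_diff_eq add.commute)
      show ?thesis
      proof (intro equalityI subsetI)
        fix t assume "t \<in> f_cls D ` {z. z - (x + y) \<in> Lid l}"
        then obtain z' where z': "t = f_cls D z'" "z' - (x + y) \<in> Lid l" by auto
        show "t \<in> (\<Union>a\<in>{z. z - x \<in> Lid l}. \<Union>b\<in>{z. z - y \<in> Lid l}. {f_cls D (a + b)})"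
          using z[OF z'(2)] unfolding z'(1) by (intro UN_I[of "z' - y"] UN_I[of y]) auto
      qed (use ab in auto)
    qed
    finally show ?thesis by (simp add: vcls_def)
  qed
  show "u_cls D u \<odot>\<^bsub>V_module D l\<^esub> vcls l y = vcls l (vact l u y)" if l: "l \<in> dominant D"
  proof -
    have "u_cls D u \<odot>\<^bsub>V_module D l\<^esub> vcls l y = (\<Union>z\<in>{z. z - y \<in> Lid l}. vcls l (vact l u z))"
      by (simp add: V_module_def quot_module_def vcls_def[of _ y] verma_act verma_coset)
    also have "\<dots> = (\<Union>z\<in>{z. z - y \<in> Lid l}. vcls l (vact l u y))"
      using Lid_vact[OF l] by (intro SUP_cong refl) (auto simp: vcls_eq simp flip: vact_lin2(3))
    also have "\<dots> = vcls l (vact l u y)"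
    proof -
      have "y \<in> {z. z - y \<in> Lid l}" using Lid_closed(1)[of l] by simp
      then have "{z. z - y \<in> Lid l} \<noteq> {}" by blast
      then show ?thesis by (simp only: UN_constant if_False)
    qed
    finally show ?thesis .
  qed
qed

lemma umod_V: "l \<in> dominant D \<Longrightarrow> umod D (V_module D l)"
  unfolding umod_def using datum_axioms
  by (auto intro!: left_moduleI_surj[of _ "vcls l" D "vact l"] simp: V_simps vact_lin vact_lin2 vact_mult)

lemma V_sing:
  assumes "l \<in> dominant D"
  shows "umod.sing D (V_module D l) l (vcls l 1)" "umod.app D (V_module D l) (dn y) (vcls l 1) = vcls l y"
proof -
  interpret V: umod D "V_module D l" by (rule umod_V[OF assms])
  have z0: "zroot D (\<lambda>i. 0) = 0" using wX_Nil by (simp add: wX_def wt_Nil)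
  show "V.sing l (vcls l 1)"
    unfolding V.sing_def V.wsp_iff V.app_def by (simp add: V_simps assms Eop_1 scal_1 z0)
  show "V.app (dn y) (vcls l 1) = vcls l y" by (simp add: V.app_def V_simps assms vact_dn)
qed

text \<open>Elements of \<open>Lid\<close> have no constant term, since radical elements have none
  and every generator is a positive power. Hence scalars act faithfully on the generator of V, and
  both of its parts are nonzero.\<close>

lemma vcls_const_zero: "vcls l (const c) = vcls l 0 \<Longrightarrow> c = 0"
proof -
  assume "vcls l (const c) = vcls l 0"
  then have "const c \<in> Lid l" by (simp add: vcls_eq)
  then obtain d where "const c - (\<Sum>i\<in>UNIV. d i * gen i ^ hgt l i) \<in> radical D" by (auto simp: Lid_def)
  then have 0: "Poly_Mapping.lookup (const c - (\<Sum>i\<in>UNIV. d i * gen i ^ hgt l i)) 0 = 0" by (rule radical_lookup_0)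
  have "Poly_Mapping.lookup (x * gen i) 0 = 0" for x and i :: 'i
  proof (rule qfun_eqI[OF qfun_compose[OF qfun_lookup qlin_mult_right[OF qlin_id]] qfun_zero])
    show "Poly_Mapping.lookup (mon w * gen i) 0 = 0" for w
      unfolding gen_eq_mon mon_append[symmetric] by (simp add: mon_def lookup_single zero_free_monoid_def)
  qed
  then have "Poly_Mapping.lookup (d i * gen i ^ hgt l i) 0 = 0" for i
    by (simp add: hgt_def power_Suc2 flip: mult.assoc del: power_Suc)
  then show "c = 0" using 0 by (simp add: lookup_minus lookup_sum const_def)
qed

end

text \<open>The source of the maps out of V: all relations imposed on its generator hold for a
  vector killed by the stated powers.\<close>

lemma (in umod) Lid_app:
  assumes "m \<in> carrier M" "\<And>i. dn (gen i ^ hgt l i) \<cdot> m = \<zero>" "y \<in> Lid l"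
  shows "dn y \<cdot> m = \<zero>"
proof -
  obtain c where c: "y - (\<Sum>i\<in>UNIV. c i * gen i ^ hgt l i) \<in> radical D" using assms by (auto simp: Lid_def)
  have "dn (\<Sum>i\<in>A. c i * gen i ^ hgt l i) \<cdot> m = \<zero>" for A
    by (induction A rule: infinite_finite_induct) (simp_all add: subst_gen_lin subst_gen_mult app_plus app_mult assms)
  moreover have "dn y \<cdot> m = dn (y - (\<Sum>i\<in>UNIV. c i * gen i ^ hgt l i)) \<cdot> m \<oplus> dn (\<Sum>i\<in>UNIV. c i * gen i ^ hgt l i) \<cdot> m"
    using assms(1) by (simp add: subst_gen_lin flip: app_plus)
  ultimately show ?thesis using app_radical(2)[OF c assms(1)] by simp
qed

section \<open>Generalised inverses of matrices\<close>

text \<open>A linear map f over a field has a right inverse g on its range, so f g f = f. Here f has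
  matrix \<open>G\<close>, and \<open>A\<close> is read off from g; vectors are finitely supported
  functions.\<close>

lemma field_generalised_inverse:
  fixes G :: "'w \<Rightarrow> 'w \<Rightarrow> 'k::field"
  assumes W: "finite W"
  shows "\<exists>A. \<forall>u\<in>W. \<forall>x\<in>W. (\<Sum>v\<in>W. \<Sum>w\<in>W. G u v * (A v w * G w x)) = G u x"
proof -
  let ?s = "\<lambda>c::'k. Poly_Mapping.map ((*) c) :: ('w \<Rightarrow>\<^sub>0 'k) \<Rightarrow> _"
  have l: "Poly_Mapping.lookup (?s c x) k = c * Poly_Mapping.lookup x k" for c x k
    by (simp add: Poly_Mapping.map.rep_eq when_def)
  have vs: "vector_space ?s"
    by unfold_locales (rule poly_mapping_eqI; simp add: l lookup_add algebra_simps)+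
  interpret P: vector_space_pair ?s ?s by (intro vector_space_pair.intro vs)
  define f where "f x = (\<Sum>v\<in>W. Poly_Mapping.single v (\<Sum>w\<in>W. G v w * Poly_Mapping.lookup x w))" for x
  have lf: "Poly_Mapping.lookup (f x) u = (\<Sum>w\<in>W. G u w * Poly_Mapping.lookup x w)" if "u \<in> W" for x u
    using W that by (simp add: f_def lookup_sum lookup_single when_def)
  have lf0: "Poly_Mapping.lookup (f x) u = 0" if "u \<notin> W" for x u
    unfolding f_def lookup_sum lookup_single when_def
    by (rule sum.neutral) (use that in auto)
  have "Vector_Spaces.linear ?s ?s f"
    unfolding Vector_Spaces.linear_iff
  proof (intro conjI allI vs)
    show "f (x + y) = f x + f y" for x y
      by (rule poly_mapping_eqI, case_tac "k \<in> W") (simp_all add: lf lf0 lookup_add distrib_left sum.distrib)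
    show "f (?s c x) = ?s c (f x)" for c x
      by (rule poly_mapping_eqI, case_tac "k \<in> W") (simp_all add: lf lf0 l sum_distrib_left mult_ac)
  qed
  then obtain g where g: "Vector_Spaces.linear ?s ?s g" and fg: "\<And>x. f (g (f x)) = f x"
    using P.linear_exists_right_inverse_on[of f UNIV] by (auto simp: P.vs1.subspace_UNIV)
  have gadd: "g (x + y) = g x + g y" and gs: "g (?s c x) = ?s c (g x)" for x y c
    using g by (auto simp: Vector_Spaces.linear_iff)
  have g0: "g 0 = 0" using gadd[of 0 0] by simp
  have gsum: "g (sum h B) = (\<Sum>b\<in>B. g (h b))" for h and B :: "'w set"
    by (induction B rule: infinite_finite_induct) (simp_all add: gadd g0)
  define A where "A v w = Poly_Mapping.lookup (g (Poly_Mapping.single w 1)) v" for v w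
  have "(\<Sum>v\<in>W. \<Sum>w\<in>W. G u v * (A v w * G w x)) = G u x" if "u \<in> W" "x \<in> W" for u x
  proof -
    have lx: "Poly_Mapping.lookup (f (Poly_Mapping.single x 1)) u = G u x" if "u \<in> W" for u
      using W that \<open>x \<in> W\<close> by (simp add: lf lookup_single when_def if_distrib cong: if_cong)
    have "f (Poly_Mapping.single x 1) = (\<Sum>w\<in>W. ?s (G w x) (Poly_Mapping.single w 1))"
    proof (rule poly_mapping_eqI)
      fix k show "Poly_Mapping.lookup (f (Poly_Mapping.single x 1)) k = Poly_Mapping.lookup (\<Sum>w\<in>W. ?s (G w x) (Poly_Mapping.single w 1)) k"
        using W by (cases "k \<in> W") (simp_all add: lx lf0 lookup_sum lookup_single when_def)
    qed
    then have "Poly_Mapping.lookup (g (f (Poly_Mapping.single x 1))) v = (\<Sum>w\<in>W. A v w * G w x)" for v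
      by (simp only: gsum gs lookup_sum l A_def mult.commute)
    then have "Poly_Mapping.lookup (f (g (f (Poly_Mapping.single x 1)))) u = (\<Sum>v\<in>W. \<Sum>w\<in>W. G u v * (A v w * G w x))"
      by (simp add: lf that sum_distrib_left)
    then show ?thesis by (simp add: fg lx that)
  qed
  then show ?thesis by blast
qed

text \<open>Solved in each of the two component fields and glued by \<open>ev_surj\<close>.\<close>

lemma qpi_generalised_inverse:
  fixes G :: "'w \<Rightarrow> 'w \<Rightarrow> qpi"
  assumes W: "finite W"
  shows "\<exists>A. \<forall>u\<in>W. \<forall>x\<in>W. (\<Sum>v\<in>W. \<Sum>w\<in>W. G u v * (A v w * G w x)) = G u x"
proof -
  obtain A1 where A1: "\<forall>u\<in>W. \<forall>x\<in>W. (\<Sum>v\<in>W. \<Sum>w\<in>W. ev_plus (G u v) * (A1 v w * ev_plus (G w x))) = ev_plus (G u x)"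
    using field_generalised_inverse[OF W, of "\<lambda>u v. ev_plus (G u v)"] by (elim exE)
  obtain A2 where A2: "\<forall>u\<in>W. \<forall>x\<in>W. (\<Sum>v\<in>W. \<Sum>w\<in>W. ev_minus (G u v) * (A2 v w * ev_minus (G w x))) = ev_minus (G u x)"
    using field_generalised_inverse[OF W, of "\<lambda>u v. ev_minus (G u v)"] by (elim exE)
  have "\<exists>a. ev_plus a = A1 v w \<and> ev_minus a = A2 v w" for v w by (rule ev_surj)
  then obtain A where "\<And>v w. ev_plus (A v w) = A1 v w" "\<And>v w. ev_minus (A v w) = A2 v w" by metis
  then show ?thesis using A1 A2 by (intro exI[of _ A]) (simp add: qpi_eq_iff ev_sum)
qed

section \<open>The canonical element\<close>

lemma length_wt: "height (wt (FM w)) = int (length w)"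
proof (induction w)
  case (Cons i w)
  have "height (wt (FM (i # w))) = (\<Sum>k\<in>UNIV. wt (FM [i]) k) + height (wt (FM w))"
    unfolding height_def by (subst wt_Cons) (simp add: sum.distrib)
  moreover have "(\<Sum>k\<in>UNIV. wt (FM [i]) k) = 1"
    using sum_delta_mult[of i "\<lambda>_. 1"] by (simp add: wt_single)
  ultimately show ?case using Cons by simp
qed (simp add: height_def wt_Nil)

definition words :: "nat \<Rightarrow> 'i list set" where "words k = {w. length w = k}"

lemma finite_words: "finite (words k :: 'i::finite list set)"
  using finite_lists_length_eq[of "UNIV :: 'i set" k] by (simp add: words_def)

text \<open>Grading by length instead of weight: there are finitely many words of each length, and
  all weights of equal height share one index set.\<close>

definition lenpart :: "nat \<Rightarrow> 'i free_alg set" where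
  "lenpart k = {x. \<forall>w\<in>Poly_Mapping.keys x. length (letters w) = k}"

lemma lenpart_mon: "mon w \<in> lenpart (length w)" by (simp add: lenpart_def mon_def)

lemma lenpart_words: "w \<in> words k \<Longrightarrow> mon w \<in> lenpart k" by (auto simp: words_def lenpart_mon)

lemma lenpart_weight: "x \<in> weight_part a \<Longrightarrow> height a = int k \<Longrightarrow> x \<in> lenpart k"
proof -
  assume x: "x \<in> weight_part a" and a: "height a = int k"
  have "length (letters w) = k" if w: "w \<in> Poly_Mapping.keys x" for w
  proof -
    have "wt (FM (letters w)) = a" using x w by (simp add: weight_part_def)
    then have "int (length (letters w)) = int k" using length_wt[of "letters w"] a by simp
    then show ?thesis by simp
  qed
  then show ?thesis by (simp add: lenpart_def)
qed

lemma lenpart_expand: "x \<in> lenpart k \<Longrightarrow> x = (\<Sum>w\<in>words k. const (Poly_Mapping.lookup x (FM w)) * mon w)" for x :: "'i::finite free_alg"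
proof -
  assume x: "x \<in> lenpart k"
  have "x = (\<Sum>w\<in>Poly_Mapping.keys x. const (Poly_Mapping.lookup x w) * mon (letters w))" by (rule free_alg_expand)
  also have "\<dots> = (\<Sum>w\<in>FM ` words k. const (Poly_Mapping.lookup x w) * mon (letters w))"
  proof (rule sum.mono_neutral_left)
    show "Poly_Mapping.keys x \<subseteq> FM ` words k"
    proof
      fix w assume "w \<in> Poly_Mapping.keys x"
      then have "letters w \<in> words k" using x by (auto simp: lenpart_def words_def)
      then show "w \<in> FM ` words k" by (metis free_monoid.collapse imageI)
    qed
  qed (auto simp: finite_words in_keys_iff const_simps)
  also have "\<dots> = (\<Sum>w\<in>words k. const (Poly_Mapping.lookup x (FM w)) * mon w)"
    by (subst sum.reindex) (auto simp: inj_on_def)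
  finally show ?thesis .
qed

context datum begin

text \<open>Only \<open>G A G = G\<close> is required, since the Gram matrix \<open>G\<close> of the words of length \<open>k\<close> is singular as soon
  as the radical is nonzero in that degree.\<close>

definition gram_inv :: "nat \<Rightarrow> ('i list \<Rightarrow> 'i list \<Rightarrow> qpi) \<Rightarrow> bool" where
  "gram_inv k A \<longleftrightarrow> (\<forall>u\<in>words k. \<forall>x\<in>words k. (\<Sum>v\<in>words k. \<Sum>w\<in>words k.
     bform D (mon u) (mon v) * (A v w * bform D (mon w) (mon x))) = bform D (mon u) (mon x)) \<and>
     (\<forall>v w. wt (FM v) \<noteq> wt (FM w) \<longrightarrow> A v w = 0)"

text \<open>Entries between different weights may be replaced by zero, because the Gram matrix is
  block diagonal with respect to the weights.\<close>

lemma gram_inv_exists: "\<exists>A. gram_inv k A"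
proof -
  obtain A where A: "\<forall>u\<in>words k. \<forall>x\<in>words k. (\<Sum>v\<in>words k. \<Sum>w\<in>words k.
     bform D (mon u) (mon v) * (A v w * bform D (mon w) (mon x))) = bform D (mon u) (mon x)"
    using qpi_generalised_inverse[OF finite_words, of k "\<lambda>u v. bform D (mon u) (mon v)"] by (elim exE)
  let ?A = "\<lambda>v w. if wt (FM v) = wt (FM w) then A v w else 0"
  have "(\<Sum>v\<in>words k. \<Sum>w\<in>words k. bform D (mon u) (mon v) * (?A v w * bform D (mon w) (mon x))) = bform D (mon u) (mon x)"
    if "u \<in> words k" "x \<in> words k" for u x
  proof (cases "wt (FM u) = wt (FM x)")
    case True
    have "(\<Sum>v\<in>words k. \<Sum>w\<in>words k. bform D (mon u) (mon v) * (?A v w * bform D (mon w) (mon x)))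
       = (\<Sum>v\<in>words k. \<Sum>w\<in>words k. bform D (mon u) (mon v) * (A v w * bform D (mon w) (mon x)))"
    proof (intro sum.cong refl)
      fix v w
      show "bform D (mon u) (mon v) * (?A v w * bform D (mon w) (mon x)) = bform D (mon u) (mon v) * (A v w * bform D (mon w) (mon x))"
        using bform_weight[of u v] bform_weight[of w x] True
        by (cases "wt (FM u) = wt (FM v)"; cases "wt (FM w) = wt (FM x)") simp_all
    qed
    then show ?thesis using A that by simp
  next
    case False
    have "bform D (mon u) (mon v) * (?A v w * bform D (mon w) (mon x)) = 0" for v w
      using bform_weight[of u v] bform_weight[of w x] False
      by (cases "wt (FM u) = wt (FM v)"; cases "wt (FM w) = wt (FM x)") simp_all
    then show ?thesis using bform_weight[OF False] by simp
  qed
  then show ?thesis by (intro exI[of _ ?A]) (simp add: gram_inv_def)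
qed

lemma gram_inv_transpose: "gram_inv k A \<Longrightarrow> gram_inv k (\<lambda>v w. A w v)"
  unfolding gram_inv_def
proof (elim conjE, intro conjI ballI)
  fix u x :: "'i list"
  assume A: "\<forall>u\<in>words k. \<forall>x\<in>words k. (\<Sum>v\<in>words k. \<Sum>w\<in>words k.
     bform D (mon u) (mon v) * (A v w * bform D (mon w) (mon x))) = bform D (mon u) (mon x)"
    and ux: "u \<in> words k" "x \<in> words k"
  have "(\<Sum>v\<in>words k. \<Sum>w\<in>words k. bform D (mon u) (mon v) * (A w v * bform D (mon w) (mon x)))
      = (\<Sum>w\<in>words k. \<Sum>v\<in>words k. bform D (mon x) (mon w) * (A w v * bform D (mon v) (mon u)))"
    by (subst sum.swap) (simp add: bform_sym[of "mon u"] bform_sym[of "mon x"] mult_ac)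
  also have "\<dots> = bform D (mon u) (mon x)" using A ux by (simp add: bform_sym[of "mon u"])
  finally show "(\<Sum>v\<in>words k. \<Sum>w\<in>words k. bform D (mon u) (mon v) * (A w v * bform D (mon w) (mon x))) = bform D (mon u) (mon x)" .
qed auto

text \<open>The reproducing property of the canonical element. Pairing with a word turns it into
  \<open>G A G = G\<close>, and pairings detect elements exactly modulo the radical.\<close>

lemma gram_inv_expand:
  assumes A: "gram_inv k A" and x: "x \<in> lenpart k"
  shows "(\<Sum>v\<in>words k. \<Sum>w\<in>words k. const (A v w * bform D (mon w) x) * mon v) - x \<in> radical D"
  unfolding radical_iff_mon
proof
  fix u
  have "bform D (\<Sum>v\<in>words k. \<Sum>w\<in>words k. const (A v w * bform D (mon w) x) * mon v) (mon u) = bform D x (mon u)"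
  proof (cases "u \<in> words k")
    case True
    let ?c = "\<lambda>y. Poly_Mapping.lookup x (FM y)"
    have bx: "bform D z x = (\<Sum>y\<in>words k. ?c y * bform D z (mon y))" for z
      by (subst lenpart_expand[OF x]) (simp add: qfun_sum[OF qfun_bform2] bform_lin)
    have "bform D (\<Sum>v\<in>words k. \<Sum>w\<in>words k. const (A v w * bform D (mon w) x) * mon v) (mon u)
      = (\<Sum>v\<in>words k. \<Sum>w\<in>words k. A v w * bform D (mon w) x * bform D (mon u) (mon v))"
      by (simp add: qfun_sum[OF qfun_bform1] bform_lin bform_sym[of _ "mon u"])
    also have "\<dots> = (\<Sum>v\<in>words k. \<Sum>w\<in>words k. \<Sum>y\<in>words k. ?c y * (bform D (mon u) (mon v) * (A v w * bform D (mon w) (mon y))))"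
      by (simp add: bx sum_distrib_left sum_distrib_right mult_ac)
    also have "\<dots> = (\<Sum>v\<in>words k. \<Sum>y\<in>words k. \<Sum>w\<in>words k. ?c y * (bform D (mon u) (mon v) * (A v w * bform D (mon w) (mon y))))"
      by (intro sum.cong refl sum.swap)
    also have "\<dots> = (\<Sum>y\<in>words k. \<Sum>v\<in>words k. \<Sum>w\<in>words k. ?c y * (bform D (mon u) (mon v) * (A v w * bform D (mon w) (mon y))))"
      by (rule sum.swap)
    also have "\<dots> = (\<Sum>y\<in>words k. ?c y * bform D (mon u) (mon y))"
      using A True by (simp add: gram_inv_def flip: sum_distrib_left)
    finally show ?thesis by (simp add: bx bform_sym[of x])
  next
    case False
    have 0: "bform D y (mon u) = 0" if "y \<in> lenpart k" for y
    proof -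
      have "bform D (mon w) (mon u) = 0" if "w \<in> words k" for w
        using that False length_wt[of w] length_wt[of u] by (intro bform_weight) (auto simp: words_def)
      then show ?thesis by (subst lenpart_expand[OF \<open>y \<in> lenpart k\<close>]) (simp add: qfun_sum[OF qfun_bform1] bform_lin)
    qed
    show ?thesis by (simp add: 0[OF x] 0[OF lenpart_words] qfun_sum[OF qfun_bform1] bform_lin)
  qed
  then show "bform D ((\<Sum>v\<in>words k. \<Sum>w\<in>words k. const (A v w * bform D (mon w) x) * mon v) - x) (mon u) = 0"
    by (simp add: qfun_diff[OF qfun_bform1])
qed

text \<open>The element \<open>\<Sum> A v w (v \<otimes> w)\<close> of \<open>\<f> \<otimes> \<f>\<close> is dual to the form, so an operator on one tensor factor
  can be moved to its adjoint on the other factor. Here \<open>\<beta>\<close> is a bilinear map that vanishes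
  on the radical modulo \<open>Z\<close>.\<close>

lemma gram_inv_adjoint:
  fixes \<beta> :: "'i free_alg \<Rightarrow> 'i free_alg \<Rightarrow> 'g free_alg"
  assumes A: "gram_inv (Suc k) A" and A': "gram_inv k A'"
    and d: "\<And>x. x \<in> lenpart (Suc k) \<Longrightarrow> d x \<in> lenpart k" and s: "\<And>x. x \<in> lenpart k \<Longrightarrow> s x \<in> lenpart (Suc k)"
    and adj: "\<And>x y. bform D y (d x) = c * bform D (s y) x"
    and q: "\<And>y. qlin (\<lambda>x. \<beta> x y)" "\<And>x. qlin (\<beta> x)"
    and Z: "0 \<in> Z" "\<And>x y. x \<in> Z \<Longrightarrow> y \<in> Z \<Longrightarrow> x + y \<in> Z" "\<And>c x. x \<in> Z \<Longrightarrow> const c * x \<in> Z"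
    and rad: "\<And>x y. x \<in> radical D \<Longrightarrow> \<beta> x y \<in> Z" "\<And>x y. x \<in> radical D \<Longrightarrow> \<beta> y x \<in> Z"
  shows "(\<Sum>v\<in>words (Suc k). \<Sum>w\<in>words (Suc k). const (A v w) * \<beta> (d (mon v)) (mon w))
       - const c * (\<Sum>v\<in>words k. \<Sum>w\<in>words k. const (A' v w) * \<beta> (mon v) (s (mon w))) \<in> Z"
proof -
  let ?W = "words (Suc k)" and ?V = "words k"
  have Zm: "- x \<in> Z" if "x \<in> Z" for x using Z(3)[OF that, of "- 1"] by (simp add: const_simps)
  have Zs: "sum f B \<in> Z" if "\<And>b. b \<in> B \<Longrightarrow> f b \<in> Z" for f and B :: "'i list set"
    using that by (induction B rule: infinite_finite_induct) (auto intro: Z)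
  \<comment> \<open>\<open>?e v\<close> and \<open>?f w'\<close> are the reproducing expansions of
    \<open>d (mon v)\<close> and \<open>s (mon w')\<close>. Once they are inserted, adjointness
    makes both sides the same fourfold sum.\<close>
  let ?e = "\<lambda>v. \<Sum>v'\<in>?V. \<Sum>w'\<in>?V. const (A' v' w' * bform D (mon w') (d (mon v))) * mon v'"
  let ?f = "\<lambda>w'. \<Sum>w\<in>?W. \<Sum>v\<in>?W. const (A v w * bform D (mon v) (s (mon w'))) * mon w"
  have 1: "(\<Sum>v\<in>?W. \<Sum>w\<in>?W. const (A v w) * \<beta> (?e v - d (mon v)) (mon w)) \<in> Z"
    by (intro Zs Z(3) rad gram_inv_expand[OF A'] d lenpart_words)
  have 2: "(\<Sum>v'\<in>?V. \<Sum>w'\<in>?V. const (c * A' v' w') * \<beta> (mon v') (?f w' - s (mon w'))) \<in> Z"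
    by (intro Zs Z(3) rad gram_inv_expand[OF gram_inv_transpose[OF A]] s lenpart_words)
  have "(\<Sum>v\<in>?W. \<Sum>w\<in>?W. const (A v w) * \<beta> (?e v) (mon w)) =
     (\<Sum>v\<in>?W. \<Sum>w\<in>?W. \<Sum>v'\<in>?V. \<Sum>w'\<in>?V. const (A v w * (A' v' w' * (c * bform D (s (mon w')) (mon v)))) * \<beta> (mon v') (mon w))"
    by (simp add: qlin_sum[OF q(1)] qlin_const[OF q(1)] adj sum_distrib_left const_const)
  also have "\<dots> = (\<Sum>v'\<in>?V. \<Sum>w'\<in>?V. \<Sum>w\<in>?W. \<Sum>v\<in>?W. const (A v w * (A' v' w' * (c * bform D (s (mon w')) (mon v)))) * \<beta> (mon v') (mon w))"
    unfolding sum.cartesian_product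
    by (rule sum.reindex_bij_witness[of _ "\<lambda>(v', w', w, v). (v, w, v', w')" "\<lambda>(v, w, v', w'). (v', w', w, v)"]) auto
  also have "\<dots> = (\<Sum>v'\<in>?V. \<Sum>w'\<in>?V. const (c * A' v' w') * \<beta> (mon v') (?f w'))"
    by (simp add: qlin_sum[OF q(2)] qlin_const[OF q(2)] sum_distrib_left const_const bform_sym[of "s _"] mult_ac)
  finally have eq: "(\<Sum>v\<in>?W. \<Sum>w\<in>?W. const (A v w) * \<beta> (?e v) (mon w)) = (\<Sum>v'\<in>?V. \<Sum>w'\<in>?V. const (c * A' v' w') * \<beta> (mon v') (?f w'))" .
  have "(\<Sum>v\<in>?W. \<Sum>w\<in>?W. const (A v w) * \<beta> (d (mon v)) (mon w)) - (\<Sum>v\<in>?V. \<Sum>w\<in>?V. const (c * A' v w) * \<beta> (mon v) (s (mon w)))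
     = - (\<Sum>v\<in>?W. \<Sum>w\<in>?W. const (A v w) * \<beta> (?e v - d (mon v)) (mon w))
       + (\<Sum>v'\<in>?V. \<Sum>w'\<in>?V. const (c * A' v' w') * \<beta> (mon v') (?f w' - s (mon w')))"
    unfolding qlin_diff[OF q(1)] qlin_diff[OF q(2)] right_diff_distrib sum_subtractf eq by simp
  also have "\<dots> \<in> Z" by (intro Z(2) Zm 1 2)
  finally show ?thesis by (simp add: sum_distrib_left const_const)
qed

end

section \<open>The quantum Casimir operator\<close>

lemma lenpart_lin:
  fixes x :: "'i::finite free_alg" and f :: "'i free_alg \<Rightarrow> 'j free_alg"
  assumes "qlin f" "x \<in> lenpart k" "\<And>w. w \<in> words k \<Longrightarrow> f (mon w) \<in> lenpart j"
  shows "f x \<in> lenpart j"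
proof -
  have add: "a + b \<in> lenpart j" if "a \<in> lenpart j" "b \<in> lenpart j" for a b :: "'j free_alg"
    using that keys_add[of a b] by (auto simp: lenpart_def)
  have const: "const c * a \<in> lenpart j" if "a \<in> lenpart j" for a :: "'j free_alg" and c
    using that by (auto simp: lenpart_def in_keys_iff)
  have "(\<Sum>w\<in>B. const (Poly_Mapping.lookup x (FM w)) * f (mon w)) \<in> lenpart j" if "B \<subseteq> words k" for B
    using that
  proof (induction B rule: infinite_finite_induct)
    case (insert b B)
    then show ?case using add[OF const[OF assms(3)]] by simp
  qed (simp_all add: lenpart_def)
  then have "f (\<Sum>w\<in>words k. const (Poly_Mapping.lookup x (FM w)) * mon w) \<in> lenpart j"
    by (simp add: qlin_sum[OF assms(1)] qlin_const[OF assms(1)])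
  then show ?thesis using lenpart_expand[OF assms(2)] by simp
qed

lemma wt_snoc: "wt (FM (w @ [i])) = wt (FM (i # w))"
  by (simp add: wt_def fun_eq_iff)

context datum begin

definition cas_inv :: "nat \<Rightarrow> 'i list \<Rightarrow> 'i list \<Rightarrow> qpi" where
  "cas_inv k = (SOME A. gram_inv k A)"

lemma gram_inv_cas: "gram_inv k (cas_inv k)"
  unfolding cas_inv_def using gram_inv_exists by (rule someI_ex)

text \<open>A function of two words evaluated on the canonical element in degree
  \<open>k\<close>.\<close>

definition casum :: "nat \<Rightarrow> ('i list \<Rightarrow> 'i list \<Rightarrow> 'g free_alg) \<Rightarrow> 'g free_alg" where
  "casum k f = (\<Sum>v\<in>words k. \<Sum>w\<in>words k. const (cas_inv k v w) * f v w)"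

lemma casum_term_cong:
  assumes "wt (FM v) = wt (FM w) \<Longrightarrow> x = y"
  shows "const (cas_inv k v w) * x = const (cas_inv k v w) * y"
  using gram_inv_cas[of k] assms by (cases "wt (FM v) = wt (FM w)") (auto simp: gram_inv_def const_simps)

lemma casum_cong: "(\<And>v w. wt (FM v) = wt (FM w) \<Longrightarrow> f v w = g v w) \<Longrightarrow> casum k f = casum k g"
  unfolding casum_def by (intro sum.cong refl casum_term_cong)

lemma casum_const: "casum k (\<lambda>v w. const c * f v w) = const c * casum k f"
  by (simp add: casum_def sum_distrib_left const_left_comm[of "const _"] const_const mult.commute)

lemma casum_minus: "casum k (\<lambda>v w. - f v w) = - casum k f"
  by (simp add: casum_def sum_negf)

lemma casum_mult_right: "casum k (\<lambda>v w. f v w * z) = casum k f * z"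
  by (simp add: casum_def sum_distrib_right mult.assoc)

lemma casum_mult_left: "casum k (\<lambda>v w. z * f v w) = z * casum k f"
  by (simp add: casum_def sum_distrib_left const_left_comm[of z])

lemma casum_0: "casum 0 f = const (cas_inv 0 [] []) * f [] []"
  by (simp add: casum_def words_def)

text \<open>The scalar that makes the sums below telescope. The division by \<open>2\<close> is exact.\<close>

definition cf :: "'x \<Rightarrow> ('i \<Rightarrow> int) \<Rightarrow> qpi" where
  "cf \<mu> a = (if even (height a) then 1 else - 1) *
     qp (zpar D a * (zpar D a - 1) div 2 + (\<Sum>i\<in>UNIV. a i * (par D i * (1 + cr i \<mu>))))
        (- (\<Sum>i\<in>UNIV. a i * (dd D i * (1 + cr i \<mu>))))"

lemma cf_Nil: "cf \<mu> (wt (FM [])) = 1"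
  by (simp add: cf_def wt_Nil height_def zpar_def)

lemma cf_Cons: "cf \<mu> (wt (FM (i # w))) =
   - (qp (par D i * parl D w + par D i * (1 + cr i \<mu>)) (- dd D i * (1 + cr i \<mu>)) * cf \<mu> (wt (FM w)))"
proof -
  let ?z = "parl D w" and ?p = "par D i"
  \<comment> \<open>The first part of the exponent of pi is a triangular number, so a further letter
    \<open>i\<close> adds p(i) times the parity of \<open>w\<close>. This is the source of the sign
    with which \<open>i\<close> and \<open>w\<close> commute.\<close>
  have tri: "(?p + ?z) * (?p + ?z - 1) div 2 = ?z * (?z - 1) div 2 + ?p * ?z"
  proof -
    have "?p = 0 \<or> ?p = 1" by (simp add: par_def)
    moreover have "(1 + ?z) * ?z div 2 = ?z * (?z - 1) div 2 + ?z"
    proof -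
      have "(1 + ?z) * ?z = ?z * (?z - 1) + 2 * ?z" by (simp add: algebra_simps)
      then show ?thesis by simp
    qed
    ultimately show ?thesis by auto
  qed
  have s: "(\<Sum>k\<in>UNIV. wt (FM (i # w)) k * f k) = f i + (\<Sum>k\<in>UNIV. wt (FM w) k * f k)" for f
    by (subst wt_Cons) (simp add: distrib_right sum.distrib wt_single sum_delta_mult)
  have "cf \<mu> (wt (FM (i # w))) = (if even (int (length (i # w))) then 1 else - 1) *
     qp ((?p + ?z) * (?p + ?z - 1) div 2 + (?p * (1 + cr i \<mu>) + (\<Sum>k\<in>UNIV. wt (FM w) k * (par D k * (1 + cr k \<mu>)))))
        (- (dd D i * (1 + cr i \<mu>) + (\<Sum>k\<in>UNIV. wt (FM w) k * (dd D k * (1 + cr k \<mu>)))))"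
    unfolding cf_def length_wt s using parl_Cons[of D i w] by (simp only: parl_def)
  also have "\<dots> = - (qp (?p * ?z + ?p * (1 + cr i \<mu>)) (- dd D i * (1 + cr i \<mu>)) * cf \<mu> (wt (FM w)))"
    unfolding cf_def length_wt tri parl_def[symmetric]
    by (auto simp: qp_mult intro!: qp_cong)
  finally show ?thesis .
qed

text \<open>Each letter \<open>j\<close> of \<open>w\<close> changes the exponent of q by d_j <j,i'>
  = i.j, which adds up to \<open>dotl D [i] w\<close>; the exponents of pi change by even
  numbers.\<close>

lemma cf_shift: "cf (\<mu> + root D i) (wt (FM w)) = qp 0 (- dotl D [i] w) * cf \<mu> (wt (FM w))"
proof (induction w)
  case (Cons j w)
  have e: "even (par D j * cr j (root D i))" by (rule cr_root_even)
  have d: "dd D j * cr j (root D i) = dot D i j" by (simp add: cr_root dot_sym[of i j])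
  have "qp (par D j * parl D w + par D j * (1 + cr j (\<mu> + root D i))) (- dd D j * (1 + cr j (\<mu> + root D i)))
    = qp 0 (- dot D i j) * qp (par D j * parl D w + par D j * (1 + cr j \<mu>)) (- dd D j * (1 + cr j \<mu>))"
    unfolding qp_mult using e by (intro qp_cong) (simp_all add: distrib_left d)
  then show ?case unfolding cf_Cons Cons
    by (simp add: dotl_Cons(2)[of D "[i]"] qp_mult mult.assoc mult.left_commute[of _ "qp 0 (- dotl D [i] w)"] algebra_simps)
qed (simp add: cf_Nil)

definition ci :: "'i \<Rightarrow> qpi" where "ci i = 1 - qp (par D i) (- 2 * dd D i)"

lemma cc_ci: "ci i * cc D i = 1"
  using cc_inverse[of i] by (simp add: ci_def qp_def mult.commute)

lemma kk_ci: "kk i * ci i = qp (par D i) (- dd D i)"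
proof -
  have "qp (par D i) (- dd D i) * (qp (par D i) (dd D i) - qp 0 (- dd D i)) = ci i"
    by (simp add: ci_def right_diff_distrib qp_mult qp_one)
  then have "kk i * ci i = qp (par D i) (- dd D i) * (kk i * (qp (par D i) (dd D i) - qp 0 (- dd D i)))"
    by (metis mult.left_commute)
  then show ?thesis by (simp add: kk_unit)
qed

lemma kk_ci_mult: "kk i * qp a b * ci i = qp (a + par D i) (b - dd D i)"
proof -
  have "kk i * qp a b * ci i = (kk i * ci i) * qp a b" by (simp only: mult_ac)
  then show ?thesis by (simp add: kk_ci qp_mult add.commute)
qed

lemma adj_dl: "bform D y (dl D i x) = ci i * bform D (gen i * y) x"
  using cc_ci[of i] by (simp add: bform_gen_mult flip: mult.assoc)

lemma adj_dr: "bform D y (dr D i x) = ci i * bform D (y * gen i) x"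
  using cc_ci[of i] by (simp add: bform_mult_gen_left flip: mult.assoc)

lemma lenpart_dl: "x \<in> lenpart (Suc k) \<Longrightarrow> dl D i x \<in> lenpart k"
  and lenpart_dr: "x \<in> lenpart (Suc k) \<Longrightarrow> dr D i x \<in> lenpart k"
proof -
  have h: "height (\<lambda>k. wt (FM w) k - wt (FM [i]) k) = int k" if "w \<in> words (Suc k)" for w
    using that length_wt[of w] length_wt[of "[i]"] by (simp add: height_def sum_subtractf words_def)
  show "x \<in> lenpart (Suc k) \<Longrightarrow> dl D i x \<in> lenpart k"
    by (erule lenpart_lin[OF qlin_dl]) (simp add: dl_mon lenpart_weight[OF dlw_weight h])
  show "x \<in> lenpart (Suc k) \<Longrightarrow> dr D i x \<in> lenpart k"
    by (erule lenpart_lin[OF qlin_dr]) (simp add: dr_mon lenpart_weight[OF drw_weight h])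
qed

lemma lenpart_scal: "x \<in> lenpart k \<Longrightarrow> scal g x \<in> lenpart k" for x :: "'i free_alg"
proof (erule lenpart_lin[OF qlin_scal])
  show "scal g (mon w) \<in> lenpart k" if "w \<in> words k" for w
    unfolding scal_mon using that
    by (auto simp: lenpart_def words_def in_keys_iff mon_def lookup_single when_def split: if_splits)
qed

lemma lenpart_gen: "x \<in> lenpart k \<Longrightarrow> gen i * x \<in> lenpart (Suc k)" "x \<in> lenpart k \<Longrightarrow> x * gen i \<in> lenpart (Suc k)" for x :: "'i free_alg"
proof -
  have 1: "gen i * mon w \<in> lenpart (Suc k)" "mon w * gen i \<in> lenpart (Suc k)" if "w \<in> words k" for w :: "'i list"
    using that lenpart_mon[of "i # w"] lenpart_mon[of "w @ [i]"]
    by (auto simp: words_def mon_Cons mon_append mon_Nil)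
  show "x \<in> lenpart k \<Longrightarrow> gen i * x \<in> lenpart (Suc k)"
    by (rule lenpart_lin[of "\<lambda>x. gen i * x" x k "Suc k", OF qlin_mult_left[OF qlin_id]]) (auto simp: 1)
  show "x \<in> lenpart k \<Longrightarrow> x * gen i \<in> lenpart (Suc k)"
    by (rule lenpart_lin[of "\<lambda>x. x * gen i" x k "Suc k", OF qlin_mult_right[OF qlin_id]]) (auto simp: 1)
qed

lemmas u_ideal_closed = class_ideal_closed[OF ideal_u_ideal]

text \<open>The second form, with the operator on the other tensor factor, is the first one for the
  transposed matrix.\<close>

lemma casum_adjoint:
  assumes "\<And>x. x \<in> lenpart (Suc k) \<Longrightarrow> d x \<in> lenpart k" "\<And>x. x \<in> lenpart k \<Longrightarrow> s x \<in> lenpart (Suc k)"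
    and "\<And>x y. bform D y (d x) = c * bform D (s y) x"
    and "\<And>y. qlin (\<lambda>x. \<beta> x y)" "\<And>x. qlin (\<beta> x)"
    and "\<And>x y. x \<in> radical D \<Longrightarrow> \<beta> x y \<in> u_ideal D" "\<And>x y. x \<in> radical D \<Longrightarrow> \<beta> y x \<in> u_ideal D"
  shows "casum (Suc k) (\<lambda>v w. \<beta> (d (mon v)) (mon w)) - const c * casum k (\<lambda>v w. \<beta> (mon v) (s (mon w))) \<in> u_ideal D"
    and "casum (Suc k) (\<lambda>v w. \<beta> (d (mon w)) (mon v)) - const c * casum k (\<lambda>v w. \<beta> (mon w) (s (mon v))) \<in> u_ideal D"
proof -
  note * = u_ideal_closed(1,2,5)
  show "casum (Suc k) (\<lambda>v w. \<beta> (d (mon v)) (mon w)) - const c * casum k (\<lambda>v w. \<beta> (mon v) (s (mon w))) \<in> u_ideal D"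
    unfolding casum_def
    by (rule gram_inv_adjoint[OF gram_inv_cas gram_inv_cas, where s = s and d = d and \<beta> = \<beta>]) (use assms * in auto)
  have "(\<Sum>v\<in>words (Suc k). \<Sum>w\<in>words (Suc k). const (cas_inv (Suc k) w v) * \<beta> (d (mon v)) (mon w))
       - const c * (\<Sum>v\<in>words k. \<Sum>w\<in>words k. const (cas_inv k w v) * \<beta> (mon v) (s (mon w))) \<in> u_ideal D"
    by (rule gram_inv_adjoint[OF gram_inv_transpose[OF gram_inv_cas] gram_inv_transpose[OF gram_inv_cas], where s = s and d = d and \<beta> = \<beta>])
       (use assms * in auto)
  then show "casum (Suc k) (\<lambda>v w. \<beta> (d (mon w)) (mon v)) - const c * casum k (\<lambda>v w. \<beta> (mon w) (s (mon v))) \<in> u_ideal D"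
    unfolding casum_def
    by (subst sum.swap, subst (2) sum.swap)
qed

text \<open>The part in degree \<open>k\<close> of the Casimir operator on weight
  \<open>\<mu>\<close>. On a given vector of a module in O all parts of large degree vanish, so the
  truncation \<open>Om n\<close> equals the whole sum there once \<open>n\<close> is large.\<close>

definition Cas :: "nat \<Rightarrow> 'x \<Rightarrow> ('i, 'y) u_gen free_alg" where
  "Cas k \<mu> = casum k (\<lambda>v w. dn (mon v) * up (scal (cf \<mu>) (mon w)))"

definition Om :: "nat \<Rightarrow> 'x \<Rightarrow> ('i, 'y) u_gen free_alg" where
  "Om n \<mu> = (\<Sum>k\<le>n. Cas k \<mu>)"

lemma Gop_eq: "Gop j \<mu> x = const (kk j * qp (par D j * cr j \<mu>) (dd D j * cr j \<mu>)) * dr D j x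
   - dl D j (scal (\<lambda>a. kk j * qp (par D j + par D j * zpar D a) (2 * dd D j - dd D j * cr j \<mu> - zdot D (wt (FM [j])) a)) x)"
  by (rule qlin_eqI[OF qlin_Gop qlin_minus[OF qlin_mult_left[OF qlin_dr] qlin_compose[OF qlin_dl qlin_scal]]])
     (simp add: Gop_def Gw_eq dl_const dr_const dl_mon dr_mon dotl_def parl_def)

end

section \<open>Telescoping of the commutators with E and F\<close>

context datum begin

abbreviation upD :: "'i free_alg \<Rightarrow> ('i, 'y) u_gen free_alg" where "upD \<equiv> subst_gen GE"
abbreviation dnD :: "'i free_alg \<Rightarrow> ('i, 'y) u_gen free_alg" where "dnD \<equiv> subst_gen GF"

text \<open>Moving \<open>E\<^sub>i\<close> through the degree \<open>k\<close> part of the Casimir operator produces the sums \<open>HX\<close>, \<open>HY\<close> and \<open>HZ\<close>.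
  Those with \<open>HX\<close> in degree \<open>k\<close> and \<open>HY\<close> in degree \<open>k + 1\<close> cancel. The sums \<open>FX\<close>, \<open>FY\<close>, \<open>FZ\<close> play the same
  role for \<open>F\<^sub>j\<close>.\<close>

definition HX :: "nat \<Rightarrow> 'i \<Rightarrow> 'x \<Rightarrow> ('i, 'y) u_gen free_alg" where
  "HX k i \<mu> = casum k (\<lambda>v w. dnD (mon v) * (gE i * upD (scal (\<lambda>a. qp (par D i * zpar D a) 0 * cf \<mu> a) (mon w))))"
definition HY :: "nat \<Rightarrow> 'i \<Rightarrow> 'x \<Rightarrow> ('i, 'y) u_gen free_alg" where
  "HY k i \<mu> = casum k (\<lambda>v w. const (kk i * qp (par D i * cr i \<mu>) (dd D i * cr i \<mu> + 2 * dd D i)) * (dnD (dl D i (mon v)) * upD (scal (cf \<mu>) (mon w))))"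
definition HZ :: "nat \<Rightarrow> 'i \<Rightarrow> 'x \<Rightarrow> ('i, 'y) u_gen free_alg" where
  "HZ k i \<mu> = casum k (\<lambda>v w. dnD (dr D i (mon v)) * upD (scal (\<lambda>a. kk i * qp (par D i + par D i * zpar D a) (- dd D i * cr i \<mu> - zdot D (wt (FM [i])) a) * cf \<mu> a) (mon w)))"

lemma parl_wt: "zpar D (wt (FM w)) = parl D w" by (simp add: parl_def)
lemma dotl_wt: "zdot D (wt (FM u)) (wt (FM w)) = dotl D u w" by (simp add: dotl_def)

lemma dn_radical: "x \<in> radical D \<Longrightarrow> dnD x \<in> u_ideal D" and up_radical: "x \<in> radical D \<Longrightarrow> upD x \<in> u_ideal D"
  using u_relations(6,7) by auto

text \<open>\<open>dl D i\<close> on the first tensor factor is adjoint to left multiplication by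
  \<open>gen i\<close> on the second, which recreates the E_i in front of the word as in
  \<open>HX\<close>. The recursion \<open>cf_Cons\<close> is designed to make the coefficients
  opposite.\<close>

lemma HY_HX: "HY (Suc k) i \<mu> + HX k i \<mu> \<in> u_ideal D"
proof -
  let ?c = "kk i * qp (par D i * cr i \<mu>) (dd D i * cr i \<mu> + 2 * dd D i)"
  let ?b = "\<lambda>x y. const ?c * (dnD x * upD (scal (cf \<mu>) y))"
  have "casum (Suc k) (\<lambda>v w. ?b (dl D i (mon v)) (mon w)) - const (ci i) * casum k (\<lambda>v w. ?b (mon v) (gen i * mon w)) \<in> u_ideal D"
    by (rule casum_adjoint(1)[where d = "dl D i" and s = "\<lambda>x. gen i * x" and \<beta> = ?b])
       (auto intro!: lenpart_dl lenpart_gen adj_dl qlin_mult_left qlin_mult_right qlin_subst_gen qlin_compose[OF qlin_subst_gen] qlin_scal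
         intro: u_ideal_closed(5) u_ideal_closed(6) dn_radical up_radical radical_scal simp: mult.assoc)
  moreover have "const (ci i) * casum k (\<lambda>v w. ?b (mon v) (gen i * mon w)) = - HX k i \<mu>"
    unfolding HX_def casum_const[symmetric] casum_minus[symmetric]
  proof (rule casum_cong)
    fix v w :: "'i list"
    have "ci i * (?c * cf \<mu> (wt (FM (i # w)))) = - (qp (par D i * parl D w) 0 * cf \<mu> (wt (FM w)))"
    proof -
      have "ci i * (?c * cf \<mu> (wt (FM (i # w)))) = - ((kk i * qp (par D i * cr i \<mu>) (dd D i * cr i \<mu> + 2 * dd D i) * ci i) *
         qp (par D i * parl D w + par D i * (1 + cr i \<mu>)) (- dd D i * (1 + cr i \<mu>)) * cf \<mu> (wt (FM w)))"
        unfolding cf_Cons by (simp only: mult_ac mult_minus_right)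
      also have "\<dots> = - (qp (par D i * parl D w) 0 * cf \<mu> (wt (FM w)))"
        unfolding kk_ci_mult qp_mult by (rule arg_cong[of _ _ "\<lambda>x. - (x * cf \<mu> (wt (FM w)))"], rule qp_cong) (simp_all add: algebra_simps)
      finally show ?thesis .
    qed
    then have "const (ci i) * ?b (mon v) (mon (i # w)) = const (- (qp (par D i * parl D w) 0 * cf \<mu> (wt (FM w)))) * (dnD (mon v) * upD (mon (i # w)))"
      by (simp add: subst_gen_lin const_left_comm[of "mon _"] const_const mult.assoc)
    moreover have "dnD (mon v) * (gE i * upD (scal (\<lambda>a. qp (par D i * zpar D a) 0 * cf \<mu> a) (mon w)))
       = const (qp (par D i * parl D w) 0 * cf \<mu> (wt (FM w))) * (dnD (mon v) * upD (mon (i # w)))"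
      by (simp add: parl_wt subst_gen_lin const_norm mon_Cons[of "GE i"])
    ultimately show "const (ci i) * ?b (mon v) (gen i * mon w) = - (dnD (mon v) * (gE i * upD (scal (\<lambda>a. qp (par D i * zpar D a) 0 * cf \<mu> a) (mon w))))"
      by (simp only: const_simps(5) mult_minus_left mon_Cons[symmetric])
  qed
  ultimately show ?thesis by (simp add: HY_def)
qed

text \<open>The factor that appears when E_i passes from the operator for \<open>\<mu>\<close> to
  that for \<open>\<mu> + root D i\<close>; the scalars \<open>gam\<close> will absorb it.\<close>

definition tE :: "'i \<Rightarrow> 'x \<Rightarrow> qpi" where "tE i \<mu> = qp (par D i * cr i \<mu>) (- 2 * dd D i * cr i \<mu> - 4 * dd D i)"

text \<open>\<open>dr D i\<close> is adjoint to right multiplication, so E_i comes out on the far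
  right, where it meets the vector first and raises its weight; \<open>cf_shift\<close> adapts the
  coefficients to the new weight.\<close>

lemma HZ_Cas: "HZ (Suc k) i \<mu> + const (tE i \<mu>) * (Cas k (\<mu> + root D i) * gE i) \<in> u_ideal D"
proof -
  let ?z = "\<lambda>a. kk i * qp (par D i + par D i * zpar D a) (- dd D i * cr i \<mu> - zdot D (wt (FM [i])) a)"
  let ?b = "\<lambda>x y. dnD x * upD (scal (\<lambda>a. ?z a * cf \<mu> a) y)"
  have "casum (Suc k) (\<lambda>v w. ?b (dr D i (mon v)) (mon w)) - const (ci i) * casum k (\<lambda>v w. ?b (mon v) (mon w * gen i)) \<in> u_ideal D"
    by (rule casum_adjoint(1)[where d = "dr D i" and s = "\<lambda>x. x * gen i" and \<beta> = ?b])
       (auto intro!: lenpart_dr lenpart_gen adj_dr qlin_mult_left qlin_mult_right qlin_subst_gen qlin_compose[OF qlin_subst_gen] qlin_scal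
         intro: u_ideal_closed(5) u_ideal_closed(6) dn_radical up_radical radical_scal)
  moreover have "const (ci i) * casum k (\<lambda>v w. ?b (mon v) (mon w * gen i)) = - (const (tE i \<mu>) * (Cas k (\<mu> + root D i) * gE i))"
    unfolding Cas_def casum_const[symmetric] casum_mult_right[symmetric] casum_minus[symmetric]
  proof (rule casum_cong)
    fix v w :: "'i list"
    have co: "ci i * (?z (wt (FM (i # w))) * cf \<mu> (wt (FM (i # w)))) = - (tE i \<mu> * cf (\<mu> + root D i) (wt (FM w)))"
    proof -
      have "ci i * (?z (wt (FM (i # w))) * cf \<mu> (wt (FM (i # w)))) =
        - ((kk i * qp (par D i + par D i * parl D (i # w)) (- dd D i * cr i \<mu> - dotl D [i] (i # w)) * ci i) *
         qp (par D i * parl D w + par D i * (1 + cr i \<mu>)) (- dd D i * (1 + cr i \<mu>)) * cf \<mu> (wt (FM w)))"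
        unfolding cf_Cons parl_wt dotl_wt by (simp only: mult_ac mult_minus_right)
      also have "\<dots> = - (tE i \<mu> * qp 0 (- dotl D [i] w) * cf \<mu> (wt (FM w)))"
        unfolding kk_ci_mult qp_mult tE_def
        by (rule arg_cong[of _ _ "\<lambda>x. - (x * cf \<mu> (wt (FM w)))"], rule qp_cong)
           (simp_all add: algebra_simps dotl_Cons(2)[of D "[i]"] dot_diag par_sq)
      finally show ?thesis unfolding cf_shift by (simp only: mult_ac)
    qed
    have "const (ci i) * ?b (mon v) (mon (w @ [i])) = const (ci i * (?z (wt (FM (i # w))) * cf \<mu> (wt (FM (i # w))))) * (dnD (mon v) * upD (mon (w @ [i])))"
      unfolding scal_mon wt_snoc by (simp add: subst_gen_lin const_left_comm[of "mon _"] const_const)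
    note this[unfolded co]
    moreover have "const (tE i \<mu>) * (dnD (mon v) * upD (scal (cf (\<mu> + root D i)) (mon w)) * gE i)
       = const (tE i \<mu> * cf (\<mu> + root D i) (wt (FM w))) * (dnD (mon v) * upD (mon (w @ [i])))"
      by (simp add: subst_gen_lin const_norm const_const mon_append subst_gen_mult mult.assoc flip: gen_eq_mon)
    moreover have "mon w * gen i = mon (w @ [i])" by (simp add: mon_append gen_eq_mon)
    ultimately show "const (ci i) * ?b (mon v) (mon w * gen i) = - (const (tE i \<mu>) * (dnD (mon v) * upD (scal (cf (\<mu> + root D i)) (mon w)) * gE i))"
      by (simp only: const_simps(5) mult_minus_left)
  qed
  ultimately show ?thesis by (simp add: HZ_def)
qed

lemma HY_0: "HY 0 i \<mu> = 0" and HZ_0: "HZ 0 i \<mu> = 0"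
  by (simp_all add: HY_def HZ_def casum_0 mon_Nil subst_gen_lin)

text \<open>Truncation has two effects: the boundary term \<open>HX n\<close> is not cancelled, and
  the shifted parts reach only the degrees below \<open>n\<close>.\<close>

lemma E_telescope: "(\<Sum>k\<le>n. HX k i \<mu> + HY k i \<mu> - HZ k i \<mu>) - HX n i \<mu> - (\<Sum>k<n. const (tE i \<mu>) * (Cas k (\<mu> + root D i) * gE i)) \<in> u_ideal D"
proof (induction n)
  case (Suc n)
  have "(HY (Suc n) i \<mu> + HX n i \<mu>) - (HZ (Suc n) i \<mu> + const (tE i \<mu>) * (Cas n (\<mu> + root D i) * gE i)) \<in> u_ideal D"
    by (rule u_ideal_closed(4)[OF HY_HX HZ_Cas])
  from u_ideal_closed(2)[OF Suc this] show ?case by (simp add: algebra_simps)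
qed (simp add: HY_0 HZ_0 u_ideal_closed(1))

definition FX :: "nat \<Rightarrow> 'i \<Rightarrow> 'x \<Rightarrow> ('i, 'y) u_gen free_alg" where
  "FX k j \<mu> = casum k (\<lambda>v w. dnD (mon v) * (gF j * upD (scal (\<lambda>a. qp (par D j * zpar D a) 0 * cf (\<mu> - root D j) a) (mon w))))"
definition FY :: "nat \<Rightarrow> 'i \<Rightarrow> 'x \<Rightarrow> ('i, 'y) u_gen free_alg" where
  "FY k j \<mu> = casum k (\<lambda>v w. const (kk j * qp (par D j * cr j \<mu>) (dd D j * cr j \<mu>)) * (dnD (mon v) * upD (dr D j (scal (cf (\<mu> - root D j)) (mon w)))))"
definition FZ :: "nat \<Rightarrow> 'i \<Rightarrow> 'x \<Rightarrow> ('i, 'y) u_gen free_alg" where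
  "FZ k j \<mu> = casum k (\<lambda>v w. dnD (mon v) * upD (dl D j (scal (\<lambda>a. kk j * qp (par D j + par D j * zpar D a) (2 * dd D j - dd D j * cr j \<mu> - zdot D (wt (FM [j])) a) * cf (\<mu> - root D j) a) (mon w))))"

text \<open>For F_j the derivations hit the second tensor factor, hence the second form of the
  adjunction. Right multiplication on the first factor puts F_j between the two words, as in
  \<open>FX\<close>.\<close>

lemma FY_FX: "FY (Suc k) j \<mu> + FX k j \<mu> \<in> u_ideal D"
proof -
  let ?c = "kk j * qp (par D j * cr j \<mu>) (dd D j * cr j \<mu>)"
  let ?g = "cf (\<mu> - root D j)"
  let ?b = "\<lambda>x y. const ?c * (dnD y * upD x)"
  have "casum (Suc k) (\<lambda>v w. ?b (dr D j (scal ?g (mon w))) (mon v)) - const (ci j) * casum k (\<lambda>v w. ?b (mon w) (scal ?g (mon v * gen j))) \<in> u_ideal D"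
    by (rule casum_adjoint(2)[where d = "\<lambda>x. dr D j (scal ?g x)" and s = "\<lambda>x. scal ?g (x * gen j)" and \<beta> = ?b])
       (auto intro!: lenpart_dr lenpart_gen lenpart_scal qlin_mult_left qlin_mult_right qlin_subst_gen
         intro: u_ideal_closed(5) u_ideal_closed(6) dn_radical up_radical radical_scal simp: adj_dr bform_scal)
  moreover have "const (ci j) * casum k (\<lambda>v w. ?b (mon w) (scal ?g (mon v * gen j))) = - FX k j \<mu>"
    unfolding FX_def casum_const[symmetric] casum_minus[symmetric]
  proof (rule casum_cong)
    fix v w :: "'i list" assume vw: "wt (FM v) = wt (FM w)"
    have wt: "wt (FM (j # v)) = wt (FM (j # w))" using wt_Cons[of j v] wt_Cons[of j w] vw by simp
    have co: "ci j * (?c * ?g (wt (FM (j # w)))) = - (qp (par D j * parl D w) 0 * ?g (wt (FM w)))"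
    proof -
      have "ci j * (?c * ?g (wt (FM (j # w)))) = - ((kk j * qp (par D j * cr j \<mu>) (dd D j * cr j \<mu>) * ci j) *
         qp (par D j * parl D w + par D j * (1 + cr j (\<mu> - root D j))) (- dd D j * (1 + cr j (\<mu> - root D j))) * ?g (wt (FM w)))"
        unfolding cf_Cons by (simp only: mult_ac mult_minus_right)
      also have "\<dots> = - (qp (par D j * parl D w) 0 * ?g (wt (FM w)))"
        unfolding kk_ci_mult qp_mult by (rule arg_cong[of _ _ "\<lambda>x. - (x * ?g (wt (FM w)))"], rule qp_cong) (simp_all add: algebra_simps)
      finally show ?thesis .
    qed
    have "const (ci j) * ?b (mon w) (scal ?g (mon (v @ [j]))) = const (ci j * (?c * ?g (wt (FM (j # w))))) * (dnD (mon (v @ [j])) * upD (mon w))"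
      unfolding scal_mon wt_snoc wt by (simp add: subst_gen_lin const_const mult.assoc)
    note this[unfolded co]
    moreover have "dnD (mon v) * (gF j * upD (scal (\<lambda>a. qp (par D j * zpar D a) 0 * ?g a) (mon w)))
       = const (qp (par D j * parl D w) 0 * ?g (wt (FM w))) * (dnD (mon (v @ [j])) * upD (mon w))"
      by (simp add: parl_wt subst_gen_lin const_norm mon_append subst_gen_mult mult.assoc flip: gen_eq_mon)
    moreover have "mon v * gen j = mon (v @ [j])" by (simp add: mon_append gen_eq_mon)
    ultimately show "const (ci j) * ?b (mon w) (scal ?g (mon v * gen j)) = - (dnD (mon v) * (gF j * upD (scal (\<lambda>a. qp (par D j * zpar D a) 0 * ?g a) (mon w))))"
      by (simp only: const_simps(5) mult_minus_left)
  qed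
  ultimately show ?thesis by (simp add: FY_def)
qed

definition tF :: "'i \<Rightarrow> 'x \<Rightarrow> qpi" where "tF j \<mu> = qp (par D j * cr j \<mu>) (- 2 * dd D j * cr j \<mu>)"

lemma FZ_Cas: "FZ (Suc k) j \<mu> + const (tF j \<mu>) * (gF j * Cas k \<mu>) \<in> u_ideal D"
proof -
  let ?z = "\<lambda>a. kk j * qp (par D j + par D j * zpar D a) (2 * dd D j - dd D j * cr j \<mu> - zdot D (wt (FM [j])) a)"
  let ?g = "\<lambda>a. ?z a * cf (\<mu> - root D j) a"
  let ?b = "\<lambda>x y. dnD y * upD x"
  have "casum (Suc k) (\<lambda>v w. ?b (dl D j (scal ?g (mon w))) (mon v)) - const (ci j) * casum k (\<lambda>v w. ?b (mon w) (scal ?g (gen j * mon v))) \<in> u_ideal D"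
    by (rule casum_adjoint(2)[where d = "\<lambda>x. dl D j (scal ?g x)" and s = "\<lambda>x. scal ?g (gen j * x)" and \<beta> = ?b])
       (auto intro!: lenpart_dl lenpart_gen lenpart_scal qlin_mult_left qlin_mult_right qlin_subst_gen
         intro: u_ideal_closed(5) u_ideal_closed(6) dn_radical up_radical radical_scal simp: adj_dl bform_scal)
  moreover have "const (ci j) * casum k (\<lambda>v w. ?b (mon w) (scal ?g (gen j * mon v))) = - (const (tF j \<mu>) * (gF j * Cas k \<mu>))"
    unfolding Cas_def casum_mult_left[symmetric] casum_const[symmetric] casum_minus[symmetric]
  proof (rule casum_cong)
    fix v w :: "'i list" assume vw: "wt (FM v) = wt (FM w)"
    have wt: "wt (FM (j # v)) = wt (FM (j # w))" using wt_Cons[of j v] wt_Cons[of j w] vw by simp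
    have co: "ci j * ?g (wt (FM (j # w))) = - (tF j \<mu> * cf \<mu> (wt (FM w)))"
    proof -
      have "ci j * ?g (wt (FM (j # w))) =
        - ((kk j * qp (par D j + par D j * parl D (j # w)) (2 * dd D j - dd D j * cr j \<mu> - dotl D [j] (j # w)) * ci j) *
         qp (par D j * parl D w + par D j * (1 + cr j (\<mu> - root D j))) (- dd D j * (1 + cr j (\<mu> - root D j))) * cf (\<mu> - root D j) (wt (FM w)))"
        unfolding cf_Cons parl_wt dotl_wt by (simp only: mult_ac mult_minus_right)
      also have "\<dots> = - (tF j \<mu> * qp 0 (- dotl D [j] w) * cf (\<mu> - root D j) (wt (FM w)))"
        unfolding kk_ci_mult qp_mult tF_def
        by (rule arg_cong[of _ _ "\<lambda>x. - (x * cf (\<mu> - root D j) (wt (FM w)))"], rule qp_cong)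
           (simp_all add: algebra_simps dotl_Cons(2)[of D "[j]"] dot_diag par_sq)
      finally show ?thesis using cf_shift[of "\<mu> - root D j" j w] by (simp only: mult_ac diff_add_cancel)
    qed
    have "const (ci j) * ?b (mon w) (scal ?g (mon (j # v))) = const (ci j * ?g (wt (FM (j # w)))) * (dnD (mon (j # v)) * upD (mon w))"
      unfolding scal_mon wt by (simp add: subst_gen_lin const_const mult.assoc)
    note this[unfolded co]
    moreover have "const (tF j \<mu>) * (gF j * (dnD (mon v) * upD (scal (cf \<mu>) (mon w))))
       = const (tF j \<mu> * cf \<mu> (wt (FM w))) * (dnD (mon (j # v)) * upD (mon w))"
      by (simp add: subst_gen_lin const_norm const_const mon_Cons[of "GF j"] mult.assoc)
    ultimately show "const (ci j) * ?b (mon w) (scal ?g (gen j * mon v)) = - (const (tF j \<mu>) * (gF j * (dnD (mon v) * upD (scal (cf \<mu>) (mon w)))))"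
      by (simp only: const_simps(5) mult_minus_left mon_Cons[symmetric])
  qed
  ultimately show ?thesis by (simp add: FZ_def)
qed

lemma FY_0: "FY 0 j \<mu> = 0" and FZ_0: "FZ 0 j \<mu> = 0"
  by (simp_all add: FY_def FZ_def casum_0 mon_Nil subst_gen_lin scal_1 qlin_0[OF qlin_dl] qlin_0[OF qlin_dr])
     (use qlin_const[OF qlin_dl, of D j _ 1] qlin_const[OF qlin_dr, of D j _ 1] in \<open>simp_all add: subst_gen_lin\<close>)

lemma F_telescope: "(\<Sum>k\<le>n. FX k j \<mu> + FY k j \<mu> - FZ k j \<mu>) - FX n j \<mu> - (\<Sum>k<n. const (tF j \<mu>) * (gF j * Cas k \<mu>)) \<in> u_ideal D"
proof (induction n)
  case (Suc n)
  have "(FY (Suc n) j \<mu> + FX n j \<mu>) - (FZ (Suc n) j \<mu> + const (tF j \<mu>) * (gF j * Cas n \<mu>)) \<in> u_ideal D"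
    by (rule u_ideal_closed(4)[OF FY_FX FZ_Cas])
  from u_ideal_closed(2)[OF Suc this] show ?case by (simp add: algebra_simps)
qed (simp add: FY_0 FZ_0 u_ideal_closed(1))

end

context datum begin

lemma casum_add: "casum k (\<lambda>v w. f v w + g v w) = casum k f + casum k g"
  and casum_diff: "casum k (\<lambda>v w. f v w - g v w) = casum k f - casum k g"
  by (simp_all add: casum_def distrib_left right_diff_distrib sum.distrib sum_subtractf)

lemma Cas_0: "Cas 0 \<mu> = 1"
proof -
  have "cas_inv 0 [] [] = 1"
    using gram_inv_cas[of 0] by (simp add: gram_inv_def words_def mon_Nil bform_one)
  then show ?thesis by (simp add: Cas_def casum_0 mon_Nil scal_1 subst_gen_lin const_simps(2) cf_Nil)
qed

end

section \<open>The Casimir operator on a module\<close>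

context umod begin

lemma app_sum_cong:
  assumes "m \<in> carrier M" "\<And>a. a \<in> A \<Longrightarrow> f a \<cdot> m = g a \<cdot> m"
  shows "(sum f A) \<cdot> m = (sum g A) \<cdot> m"
  using assms(2) by (induction A rule: infinite_finite_induct) (simp_all add: app_plus assms(1))

lemma casum_app_cong:
  assumes "m \<in> carrier M" "\<And>v w. v \<in> words k \<Longrightarrow> w \<in> words k \<Longrightarrow> wt (FM v) = wt (FM w) \<Longrightarrow> f v w \<cdot> m = g v w \<cdot> m"
  shows "casum k f \<cdot> m = casum k g \<cdot> m"
  unfolding casum_def
proof (intro app_sum_cong assms(1))
  fix v w :: "'i list" assume "v \<in> words k" "w \<in> words k"
  then show "(const (cas_inv k v w) * f v w) \<cdot> m = (const (cas_inv k v w) * g v w) \<cdot> m"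
    using gram_inv_cas[of k] assms
    by (cases "wt (FM v) = wt (FM w)") (auto simp: gram_inv_def const_simps app_mult)
qed

lemma casum_app_zero:
  assumes "m \<in> carrier M" "\<And>v w. w \<in> words k \<Longrightarrow> f v w \<cdot> m = \<zero>"
  shows "casum k f \<cdot> m = \<zero>"
  using casum_app_cong[of m k f "\<lambda>v w. 0"] assms by (simp add: casum_def)

lemma gE_Cas:
  assumes m: "m \<in> wsp \<mu>"
  shows "(gE i * Cas k \<mu>) \<cdot> m = (HX k i \<mu> + HY k i \<mu> - HZ k i \<mu>) \<cdot> m"
  unfolding Cas_def HX_def HY_def HZ_def casum_mult_left[symmetric] casum_add[symmetric] casum_diff[symmetric]
proof (rule casum_app_cong)
  show c: "m \<in> carrier M" using m by (rule wsp_carrier)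
  fix v w :: "'i list" assume vw: "wt (FM v) = wt (FM w)"
  let ?U = "up (scal (cf \<mu>) (mon w))" and ?c = "cf \<mu> (wt (FM w))"
  have U: "?U = const ?c * up (mon w)" by (simp add: subst_gen_lin)
  have n: "?U \<cdot> m \<in> wsp (\<mu> + wX D w)"
    unfolding U using wsp_const[OF wsp_up[OF m]] c by (simp add: app_mult)
  have pv: "parl D v = parl D w" and dv: "dotl D [i] v = dotl D [i] w"
    using vw by (rule parl_wt_cong, rule dotl_wt_cong)
  \<comment> \<open>Words \<open>v\<close> and \<open>w\<close> have equal weight, so in the first
    coefficient the rise of the weight by \<open>w\<close> is undone by \<open>v\<close> and no
    dependence on \<open>w\<close> remains.\<close>
  have e: "Ew i (\<mu> + wX D w) v = const (kk i * qp (par D i * cr i \<mu>) (dd D i * cr i \<mu> + 2 * dd D i)) * dlw D i v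
     - const (kk i * qp (par D i + par D i * parl D w) (- dd D i * cr i \<mu> - dotl D [i] w)) * drw D i v"
  proof -
    have "qp (par D i * cr i (\<mu> + wX D w)) (dd D i * cr i (\<mu> + wX D w) + 2 * dd D i - dotl D [i] v)
      = qp (par D i * cr i \<mu>) (dd D i * cr i \<mu> + 2 * dd D i)"
      using cr_wX_even[of i w] cr_wX[of i w] by (intro qp_cong) (simp_all add: distrib_left dv)
    moreover have "- dd D i * cr i (\<mu> + wX D w) = - dd D i * cr i \<mu> - dotl D [i] w"
      using cr_wX[of i w] by (simp add: distrib_left)
    ultimately show ?thesis unfolding Ew_eq pv by simp
  qed
  have "(gE i * (dn (mon v) * ?U)) \<cdot> m = (gE i * dn (mon v)) \<cdot> ?U \<cdot> m"
    using c by (simp only: app_mult app_closed)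
  also have "\<dots> = (dn (scal (\<lambda>a. qp (par D i * zpar D a) 0) (mon v)) * gE i + dn (Ew i (\<mu> + wX D w) v)) \<cdot> ?U \<cdot> m"
    unfolding gE_dn[OF n] Eop_def lin_mon ..
  also have "\<dots> = ((dn (scal (\<lambda>a. qp (par D i * zpar D a) 0) (mon v)) * gE i + dn (Ew i (\<mu> + wX D w) v)) * ?U) \<cdot> m"
    using c by (simp only: app_mult app_closed)
  also have "(dn (scal (\<lambda>a. qp (par D i * zpar D a) 0) (mon v)) * gE i + dn (Ew i (\<mu> + wX D w) v)) * ?U
    = dn (mon v) * (gE i * up (scal (\<lambda>a. qp (par D i * zpar D a) 0 * cf \<mu> a) (mon w))) +
      const (kk i * qp (par D i * cr i \<mu>) (dd D i * cr i \<mu> + 2 * dd D i)) * (dn (dl D i (mon v)) * up (scal (cf \<mu>) (mon w))) -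
      dn (dr D i (mon v)) * up (scal (\<lambda>a. kk i * qp (par D i + par D i * zpar D a) (- dd D i * cr i \<mu> - zdot D (wt (FM [i])) a) * cf \<mu> a) (mon w))"
    unfolding e dl_mon dr_mon scal_mon parl_wt dotl_wt
    by (simp add: subst_gen_lin pv distrib_right left_diff_distrib mult.assoc const_norm const_const
        const_left_comm[of "dn _"])
  finally show "(gE i * (dn (mon v) * up (scal (cf \<mu>) (mon w)))) \<cdot> m = \<dots> \<cdot> m" .
qed

lemma Cas_gF:
  assumes m: "m \<in> wsp \<mu>"
  shows "(Cas k (\<mu> - root D j) * gF j) \<cdot> m = (FX k j \<mu> + FY k j \<mu> - FZ k j \<mu>) \<cdot> m"
  unfolding Cas_def FX_def FY_def FZ_def casum_mult_right[symmetric] casum_add[symmetric] casum_diff[symmetric]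
proof (rule casum_app_cong)
  show c: "m \<in> carrier M" using m by (rule wsp_carrier)
  fix v w :: "'i list"
  let ?x = "scal (cf (\<mu> - root D j)) (mon w)"
  have "(dn (mon v) * up ?x * gF j) \<cdot> m = dn (mon v) \<cdot> (up ?x * gF j) \<cdot> m"
    using c by (simp only: app_mult app_closed)
  also have "\<dots> = (dn (mon v) * (gF j * up (scal (\<lambda>a. qp (par D j * zpar D a) 0) ?x) + up (Gop j \<mu> ?x))) \<cdot> m"
    unfolding up_gF[OF m] using c by (simp only: app_mult app_closed)
  also have "dn (mon v) * (gF j * up (scal (\<lambda>a. qp (par D j * zpar D a) 0) ?x) + up (Gop j \<mu> ?x)) =
    dn (mon v) * (gF j * up (scal (\<lambda>a. qp (par D j * zpar D a) 0 * cf (\<mu> - root D j) a) (mon w))) +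
    const (kk j * qp (par D j * cr j \<mu>) (dd D j * cr j \<mu>)) * (dn (mon v) * up (dr D j (scal (cf (\<mu> - root D j)) (mon w)))) -
    dn (mon v) * up (dl D j (scal (\<lambda>a. kk j * qp (par D j + par D j * zpar D a) (2 * dd D j - dd D j * cr j \<mu> - zdot D (wt (FM [j])) a) * cf (\<mu> - root D j) a) (mon w)))"
    unfolding scal_scal Gop_eq subst_gen_lin distrib_left right_diff_distrib const_left_comm[of "dn _"] by (simp add: algebra_simps)
  finally show "(dn (mon v) * up (scal (cf (\<mu> - root D j)) (mon w)) * gF j) \<cdot> m = \<dots> \<cdot> m" .
qed

definition kills :: "nat \<Rightarrow> 'm \<Rightarrow> bool" where
  "kills n m \<longleftrightarrow> (\<forall>w. n \<le> length w \<longrightarrow> up (mon w) \<cdot> m = \<zero>)"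

lemma kills_mono: "kills n m \<Longrightarrow> n \<le> n' \<Longrightarrow> kills n' m"
  by (auto simp: kills_def)

lemma kills_gE: "kills n m \<Longrightarrow> m \<in> carrier M \<Longrightarrow> n \<le> Suc (length w) \<Longrightarrow> up (mon w) \<cdot> gE i \<cdot> m = \<zero>"
proof -
  assume *: "kills n m" "m \<in> carrier M" "n \<le> Suc (length w)"
  have "n \<le> length (w @ [i]) \<longrightarrow> up (mon (w @ [i])) \<cdot> m = \<zero>" using *(1) unfolding kills_def by blast
  then have "up (mon (w @ [i])) \<cdot> m = \<zero>" using *(3) by simp
  then show ?thesis using * by (simp add: mon_append app_mult subst_gen_mult flip: gen_eq_mon)
qed

text \<open>Both effects of truncation disappear under \<open>kills\<close>: the boundary term
  applies a word of length \<open>n\<close> to \<open>m\<close>, and the missing part in degree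
  \<open>n\<close> one of length \<open>n + 1\<close>.\<close>

lemma Om_gE:
  assumes m: "m \<in> wsp \<mu>" and k: "kills n m"
  shows "gE i \<cdot> Om n \<mu> \<cdot> m = const (tE i \<mu>) \<cdot> Om n (\<mu> + root D i) \<cdot> gE i \<cdot> m"
proof -
  have c: "m \<in> carrier M" using m by (rule wsp_carrier)
  have "gE i \<cdot> Om n \<mu> \<cdot> m = (\<Sum>k\<le>n. gE i * Cas k \<mu>) \<cdot> m"
    using c by (simp add: Om_def sum_distrib_left flip: app_mult)
  also have "\<dots> = (\<Sum>k\<le>n. HX k i \<mu> + HY k i \<mu> - HZ k i \<mu>) \<cdot> m"
    by (intro app_sum_cong c gE_Cas m)
  also have "\<dots> = (HX n i \<mu> + (\<Sum>k<n. const (tE i \<mu>) * (Cas k (\<mu> + root D i) * gE i))) \<cdot> m"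
    by (rule app_eqI) (use E_telescope[where n = n and i = i and \<mu> = \<mu>] in \<open>simp only: diff_diff_eq\<close>)
  also have "\<dots> = HX n i \<mu> \<cdot> m \<oplus> (\<Sum>k<n. const (tE i \<mu>) * (Cas k (\<mu> + root D i) * gE i)) \<cdot> m"
    using c by (rule app_plus)
  also have "HX n i \<mu> \<cdot> m = \<zero>"
    unfolding HX_def using c k
    by (intro casum_app_zero c) (simp add: app_mult subst_gen_lin kills_def words_def)
  also have "\<zero> \<oplus> (\<Sum>k<n. const (tE i \<mu>) * (Cas k (\<mu> + root D i) * gE i)) \<cdot> m
     = (\<Sum>k<n. const (tE i \<mu>) * (Cas k (\<mu> + root D i) * gE i)) \<cdot> m \<oplus> (const (tE i \<mu>) * (Cas n (\<mu> + root D i) * gE i)) \<cdot> m"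
  proof -
    have "Cas n (\<mu> + root D i) \<cdot> gE i \<cdot> m = \<zero>"
      unfolding Cas_def using c kills_gE[OF k c]
      by (intro casum_app_zero) (simp_all add: app_mult subst_gen_lin words_def)
    then show ?thesis using c by (simp add: app_mult)
  qed
  also have "\<dots> = (\<Sum>k\<le>n. const (tE i \<mu>) * (Cas k (\<mu> + root D i) * gE i)) \<cdot> m"
    using c by (simp add: lessThan_Suc_atMost[symmetric] app_plus LM.M.a_comm)
  also have "\<dots> = const (tE i \<mu>) \<cdot> Om n (\<mu> + root D i) \<cdot> gE i \<cdot> m"
    using c by (simp add: Om_def sum_distrib_left sum_distrib_right flip: app_mult)
  finally show ?thesis .
qed

lemma Om_gF:
  assumes m: "m \<in> wsp \<mu>" and k: "kills n m"
  shows "Om n (\<mu> - root D j) \<cdot> gF j \<cdot> m = const (tF j \<mu>) \<cdot> gF j \<cdot> Om n \<mu> \<cdot> m"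
proof -
  have c: "m \<in> carrier M" using m by (rule wsp_carrier)
  have "Om n (\<mu> - root D j) \<cdot> gF j \<cdot> m = (\<Sum>k\<le>n. Cas k (\<mu> - root D j) * gF j) \<cdot> m"
    using c by (simp add: Om_def sum_distrib_right flip: app_mult)
  also have "\<dots> = (\<Sum>k\<le>n. FX k j \<mu> + FY k j \<mu> - FZ k j \<mu>) \<cdot> m"
    by (intro app_sum_cong c Cas_gF m)
  also have "\<dots> = (FX n j \<mu> + (\<Sum>k<n. const (tF j \<mu>) * (gF j * Cas k \<mu>))) \<cdot> m"
    by (rule app_eqI) (use F_telescope[where n = n and j = j and \<mu> = \<mu>] in \<open>simp only: diff_diff_eq\<close>)
  also have "\<dots> = FX n j \<mu> \<cdot> m \<oplus> (\<Sum>k<n. const (tF j \<mu>) * (gF j * Cas k \<mu>)) \<cdot> m"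
    using c by (rule app_plus)
  also have "FX n j \<mu> \<cdot> m = \<zero>"
    unfolding FX_def using c k
    by (intro casum_app_zero c) (simp add: app_mult subst_gen_lin kills_def words_def)
  also have "\<zero> \<oplus> (\<Sum>k<n. const (tF j \<mu>) * (gF j * Cas k \<mu>)) \<cdot> m
     = (\<Sum>k<n. const (tF j \<mu>) * (gF j * Cas k \<mu>)) \<cdot> m \<oplus> (const (tF j \<mu>) * (gF j * Cas n \<mu>)) \<cdot> m"
  proof -
    have "Cas n \<mu> \<cdot> m = \<zero>"
      unfolding Cas_def using c k
      by (intro casum_app_zero) (simp_all add: app_mult subst_gen_lin words_def kills_def)
    then show ?thesis using c by (simp add: app_mult)
  qed
  also have "\<dots> = (\<Sum>k\<le>n. const (tF j \<mu>) * (gF j * Cas k \<mu>)) \<cdot> m"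
    using c by (simp add: lessThan_Suc_atMost[symmetric] app_plus LM.M.a_comm)
  also have "\<dots> = const (tF j \<mu>) \<cdot> gF j \<cdot> Om n \<mu> \<cdot> m"
    using c by (simp add: Om_def sum_distrib_left flip: app_mult)
  finally show ?thesis .
qed

end

section \<open>The normalising scalar\<close>

context datum begin

text \<open>The exponents in \<open>gam\<close> solve the recursion \<open>gam_step\<close>, started from an arbitrary representative of
  each coset of \<open>\<int>[I]\<close> in \<open>X\<close>.\<close>

definition rep :: "'x \<Rightarrow> 'x" where "rep \<mu> = (SOME r. \<exists>a. \<mu> = r + zroot D a)"

definition gam :: "'x \<Rightarrow> qpi" where
  "gam \<mu> = (let r = rep \<mu>; a = (THE a. \<mu> = r + zroot D a) in
     qp (\<Sum>i\<in>UNIV. a i * (par D i * cr i r)) (- (2 * (\<Sum>i\<in>UNIV. a i * (dd D i * cr i r)) + zdot D a a + (\<Sum>i\<in>UNIV. a i * dot D i i))))"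

text \<open>The exponent of q is quadratic in the coordinates \<open>a\<close>. Adding
  \<open>i\<close> to them produces an increment linear in \<open>a\<close>, which together with the
  pairing of \<open>i\<close> with the representative becomes an expression in <i,mu>.\<close>

lemma gam_step: "gam (\<mu> + root D i) = tE i \<mu> * gam \<mu>"
proof -
  have z0: "zroot D (\<lambda>i. 0) = 0" using wX_Nil by (simp add: wX_def wt_Nil)
  have zadd: "zroot D (\<lambda>k. a k + b k) = zroot D a + zroot D b" for a b
    by (rule pr_eqI) (simp add: pr_zroot distrib_right sum.distrib)
  have "\<exists>a. \<mu> = \<mu> + zroot D a" by (rule exI[of _ "\<lambda>i. 0"]) (simp add: z0)
  then have "\<exists>a. \<mu> = rep \<mu> + zroot D a" unfolding rep_def by (rule someI)
  then obtain a where a: "\<mu> = rep \<mu> + zroot D a" by blast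
  let ?e = "wt (FM [i])" and ?r = "rep \<mu>"
  \<comment> \<open>Both weights lie in one coset of the root lattice, so the choice in
    \<open>rep\<close> gives the same representative and only the coordinates change.\<close>
  have "(\<exists>a. \<mu> + root D i = r + zroot D a) \<longleftrightarrow> (\<exists>a. \<mu> = r + zroot D a)" for r
  proof
    assume "\<exists>a. \<mu> + root D i = r + zroot D a"
    then obtain b where "\<mu> + root D i = r + zroot D b" by blast
    then have "\<mu> = r + zroot D (\<lambda>k. b k - ?e k)" by (simp add: zroot_diff zroot_single algebra_simps)
    then show "\<exists>a. \<mu> = r + zroot D a" by blast
  next
    assume "\<exists>a. \<mu> = r + zroot D a"
    then obtain b where "\<mu> = r + zroot D b" by blast
    then have "\<mu> + root D i = r + zroot D (\<lambda>k. b k + ?e k)" by (simp add: zadd zroot_single algebra_simps)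
    then show "\<exists>a. \<mu> + root D i = r + zroot D a" by blast
  qed
  then have r: "rep (\<mu> + root D i) = ?r" by (simp add: rep_def)
  have a': "\<mu> + root D i = ?r + zroot D (\<lambda>k. a k + ?e k)" using a by (simp add: zadd zroot_single algebra_simps)
  have the: "(THE b. \<nu> = ?r + zroot D b) = c" if \<nu>: "\<nu> = ?r + zroot D c" for \<nu> c
  proof (rule the_equality, rule \<nu>)
    fix b assume "\<nu> = ?r + zroot D b"
    then have "zroot D b = zroot D c" using \<nu> by simp
    then show "b = c" by (rule zroot_inj)
  qed
  have se: "(\<Sum>k\<in>UNIV. ?e k * f k) = f i" for f :: "'i \<Rightarrow> int" by (simp add: wt_single sum_delta_mult)
  have za: "zdot D (\<lambda>k. a k + ?e k) (\<lambda>k. a k + ?e k) = zdot D a a + 2 * zdot D ?e a + dot D i i"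
  proof -
    have "zdot D (\<lambda>k. a k + ?e k) (\<lambda>k. a k + ?e k) = zdot D a a + zdot D ?e a + zdot D a ?e + zdot D ?e ?e"
    proof -
      have l: "zdot D (\<lambda>k. b k + c k) d = zdot D b d + zdot D c d" for b c d
        by (simp add: zdot_def distrib_right sum.distrib)
      have r: "zdot D d (\<lambda>k. b k + c k) = zdot D d b + zdot D d c" for b c d
        by (simp add: zdot_def distrib_right distrib_left sum.distrib)
      show ?thesis unfolding l[of a ?e] r[of _ a ?e] by simp
    qed
    moreover have "zdot D ?e ?e = dot D i i" using dotl_single[of D i i] by (simp only: dotl_def)
    ultimately show ?thesis by (simp add: zdot_sym[of a ?e])
  qed
  have cr: "dd D i * cr i \<mu> = dd D i * cr i ?r + zdot D ?e a"
  proof -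
    have "dd D i * cr i (zroot D a) = (\<Sum>j\<in>UNIV. a j * (dd D i * cr i (root D j)))"
      by (simp add: pr_zroot sum_distrib_left mult_ac)
    also have "\<dots> = (\<Sum>j\<in>UNIV. a j * dot D i j)" by (simp add: cr_root)
    also have "\<dots> = zdot D ?e a" by (simp add: zdot_def wt_single mult.assoc sum_delta_mult flip: sum_distrib_left)
    finally show ?thesis by (subst a) (simp add: distrib_left)
  qed
  have ev: "even (par D i * cr i ?r - par D i * cr i \<mu>)"
  proof -
    have "even (par D i * cr i (zroot D a))"
      using cr_root_even[of i] by (auto simp: pr_zroot sum_distrib_left mult.left_commute intro!: dvd_sum)
    then show ?thesis by (subst a) (simp add: distrib_left)
  qed
  have "gam (\<mu> + root D i) = qp ((\<Sum>k\<in>UNIV. a k * (par D k * cr k ?r)) + par D i * cr i ?r)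
     (- (2 * ((\<Sum>k\<in>UNIV. a k * (dd D k * cr k ?r)) + dd D i * cr i ?r) + (zdot D a a + 2 * zdot D ?e a + dot D i i) + ((\<Sum>k\<in>UNIV. a k * dot D k k) + dot D i i)))"
    unfolding gam_def Let_def r the[OF a'] za by (simp only: distrib_right sum.distrib se)
  moreover have "gam \<mu> = qp (\<Sum>k\<in>UNIV. a k * (par D k * cr k ?r))
     (- (2 * (\<Sum>k\<in>UNIV. a k * (dd D k * cr k ?r)) + zdot D a a + (\<Sum>k\<in>UNIV. a k * dot D k k)))"
    unfolding gam_def Let_def the[OF a] ..
  ultimately show ?thesis unfolding tE_def
    using cr ev by (simp only: qp_mult) (rule qp_cong, simp_all add: dot_diag)
qed

lemma gam_step_minus: "gam (\<mu> - root D j) * tF j \<mu> = gam \<mu>"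
proof -
  have "tE j (\<mu> - root D j) = tF j \<mu>" unfolding tE_def tF_def
    by (rule qp_cong) (simp_all add: algebra_simps)
  then show ?thesis using gam_step[of "\<mu> - root D j" j] by (simp add: mult.commute)
qed

lemma gam_unit: "gam \<mu> dvd 1"
  unfolding gam_def Let_def by (rule qp_unit)

definition OmG :: "nat \<Rightarrow> 'x \<Rightarrow> ('i, 'y) u_gen free_alg" where
  "OmG n \<mu> = const (gam \<mu>) * Om n \<mu>"

end

context umod begin

lemma OmG_gE:
  assumes m: "m \<in> wsp \<mu>" and k: "kills n m"
  shows "gE i \<cdot> OmG n \<mu> \<cdot> m = OmG n (\<mu> + root D i) \<cdot> gE i \<cdot> m"
proof -
  have c: "m \<in> carrier M" using m by (rule wsp_carrier)
  have "gE i \<cdot> OmG n \<mu> \<cdot> m = const (gam \<mu>) \<cdot> gE i \<cdot> Om n \<mu> \<cdot> m"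
    using c by (simp add: OmG_def app_mult app_const_comm[of _ "gen _"])
  then show ?thesis unfolding Om_gE[OF m k] using c
    by (simp add: OmG_def app_mult app_const_const gam_step mult.commute)
qed

lemma OmG_gF:
  assumes m: "m \<in> wsp \<mu>" and k: "kills n m"
  shows "OmG n (\<mu> - root D j) \<cdot> gF j \<cdot> m = gF j \<cdot> OmG n \<mu> \<cdot> m"
proof -
  have c: "m \<in> carrier M" using m by (rule wsp_carrier)
  have "OmG n (\<mu> - root D j) \<cdot> gF j \<cdot> m = const (gam (\<mu> - root D j) * tF j \<mu>) \<cdot> gF j \<cdot> Om n \<mu> \<cdot> m"
    using c by (simp add: OmG_def app_mult app_const_const Om_gF[OF m k])
  then show ?thesis unfolding gam_step_minus using c
    by (simp add: OmG_def app_mult app_const_comm[of _ "gen _"])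
qed

end

section \<open>Direct sums\<close>

text \<open>Finite families replace the finitely supported functions of
  \<open>internal_direct_sum\<close>, and existence is separated from uniqueness, which is the
  purpose of \<open>indep_sum\<close>.\<close>

definition spans_sum :: "('r, 'm, 'z) module_scheme \<Rightarrow> 'k set \<Rightarrow> ('k \<Rightarrow> 'm set) \<Rightarrow> 'm \<Rightarrow> bool" where
  "spans_sum M S N m \<longleftrightarrow> (\<exists>F c. finite F \<and> F \<subseteq> S \<and> (\<forall>k\<in>F. c k \<in> N k) \<and> m = (\<Oplus>\<^bsub>M\<^esub>k\<in>F. c k))"

definition indep_sum :: "('r, 'm, 'z) module_scheme \<Rightarrow> 'k set \<Rightarrow> ('k \<Rightarrow> 'm set) \<Rightarrow> bool" where
  "indep_sum M S N \<longleftrightarrow> (\<forall>F c. finite F \<longrightarrow> F \<subseteq> S \<longrightarrow> (\<forall>k\<in>F. c k \<in> N k) \<longrightarrow> (\<Oplus>\<^bsub>M\<^esub>k\<in>F. c k) = \<zero>\<^bsub>M\<^esub> \<longrightarrow>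
     (\<forall>k\<in>F. c k = \<zero>\<^bsub>M\<^esub>))"

context umod begin

lemma sub_carrier: "additive_subgroup N M \<Longrightarrow> x \<in> N \<Longrightarrow> x \<in> carrier M"
  using additive_subgroup.a_subset by blast

lemma finsum_support:
  assumes "finite F" "\<And>k. k \<in> F \<Longrightarrow> c k \<in> carrier M" "\<And>k. k \<notin> F \<Longrightarrow> c k = \<zero>"
  shows "(\<Oplus>k\<in>{k. c k \<noteq> \<zero>}. c k) = (\<Oplus>k\<in>F. c k)"
  using assms by (intro LM.M.add.finprod_mono_neutral_cong_left) auto

lemma internal_direct_sumI:
  assumes sub: "\<And>k. k \<in> S \<Longrightarrow> additive_subgroup (N k) M"
    and span: "\<And>m. m \<in> carrier M \<Longrightarrow> spans_sum M S N m" and ind: "indep_sum M S N"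
  shows "internal_direct_sum M S N"
  unfolding internal_direct_sum_def
proof (intro conjI ballI sub)
  fix m assume m: "m \<in> carrier M"
  obtain F c where F: "finite F" "F \<subseteq> S" "\<forall>k\<in>F. c k \<in> N k" "m = (\<Oplus>k\<in>F. c k)"
    using span[OF m] by (auto simp: spans_sum_def)
  let ?c = "\<lambda>k. if k \<in> F then c k else \<zero>"
  have cN: "c k \<in> carrier M" if "k \<in> F" for k using F that sub sub_carrier by blast
  have zN: "\<zero> \<in> N k" if "k \<in> S" for k using additive_subgroup.zero_closed[OF sub[OF that]] .
  show "\<exists>!c. (\<forall>k\<in>S. c k \<in> N k) \<and> (\<forall>k. k \<notin> S \<longrightarrow> c k = \<zero>) \<and>
        finite {k. c k \<noteq> \<zero>} \<and> m = (\<Oplus>k\<in>{k. c k \<noteq> \<zero>}. c k)"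
  proof (rule ex_ex1I)
    have "(\<Oplus>k\<in>{k. ?c k \<noteq> \<zero>}. ?c k) = (\<Oplus>k\<in>F. ?c k)"
      using F cN by (intro finsum_support) auto
    also have "\<dots> = (\<Oplus>k\<in>F. c k)" using cN by (intro LM.M.finsum_cong') auto
    finally have "m = (\<Oplus>k\<in>{k. ?c k \<noteq> \<zero>}. ?c k)" using F(4) by simp
    moreover have "finite {k. ?c k \<noteq> \<zero>}" using F(1) by (rule rev_finite_subset) auto
    ultimately show "\<exists>c. (\<forall>k\<in>S. c k \<in> N k) \<and> (\<forall>k. k \<notin> S \<longrightarrow> c k = \<zero>) \<and>
        finite {k. c k \<noteq> \<zero>} \<and> m = (\<Oplus>k\<in>{k. c k \<noteq> \<zero>}. c k)"
      using F(2,3) zN by (intro exI[of _ ?c]) auto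
  next
    fix c d
    assume c: "(\<forall>k\<in>S. c k \<in> N k) \<and> (\<forall>k. k \<notin> S \<longrightarrow> c k = \<zero>) \<and> finite {k. c k \<noteq> \<zero>} \<and> m = (\<Oplus>k\<in>{k. c k \<noteq> \<zero>}. c k)"
      and d: "(\<forall>k\<in>S. d k \<in> N k) \<and> (\<forall>k. k \<notin> S \<longrightarrow> d k = \<zero>) \<and> finite {k. d k \<noteq> \<zero>} \<and> m = (\<Oplus>k\<in>{k. d k \<noteq> \<zero>}. d k)"
    let ?F = "{k. c k \<noteq> \<zero>} \<union> {k. d k \<noteq> \<zero>}"
    have F: "finite ?F" "?F \<subseteq> S" using c d by auto
    have cc: "c k \<in> carrier M" "d k \<in> carrier M" for k
      using c d sub_carrier[OF sub, of k "c k"] sub_carrier[OF sub, of k "d k"] by (cases "k \<in> S"; simp)+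
    have "(\<Oplus>k\<in>?F. c k) = (\<Oplus>k\<in>{k. c k \<noteq> \<zero>}. c k)" "(\<Oplus>k\<in>?F. d k) = (\<Oplus>k\<in>{k. d k \<noteq> \<zero>}. d k)"
      by (rule finsum_support[OF F(1), symmetric]; use cc in blast)+
    moreover have "m = (\<Oplus>k\<in>{k. c k \<noteq> \<zero>}. c k)" "m = (\<Oplus>k\<in>{k. d k \<noteq> \<zero>}. d k)"
      using c d by blast+
    ultimately have "(\<Oplus>k\<in>?F. c k) = m" "(\<Oplus>k\<in>?F. d k) = m" by simp_all
    moreover have "(\<Oplus>k\<in>?F. c k \<oplus> \<ominus> d k) \<oplus> (\<Oplus>k\<in>?F. d k) = (\<Oplus>k\<in>?F. c k)"
      using cc by (subst LM.M.finsum_addf[symmetric]) (auto simp: LM.M.a_assoc LM.M.l_neg)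
    ultimately have "(\<Oplus>k\<in>?F. c k \<oplus> \<ominus> d k) \<oplus> m = m" by simp
    then have 0: "(\<Oplus>k\<in>?F. c k \<oplus> \<ominus> d k) = \<zero>"
      using m cc by (subst (asm) LM.M.add.r_cancel_one) auto
    have "c k \<oplus> \<ominus> d k \<in> N k" if "k \<in> ?F" for k
    proof -
      interpret additive_subgroup "N k" M using sub F(2) that by blast
      show ?thesis using c d F(2) that by (intro a_closed a_inv_closed) auto
    qed
    then have "c k \<oplus> \<ominus> d k = \<zero>" if "k \<in> ?F" for k
      using ind[unfolded indep_sum_def, rule_format, of ?F "\<lambda>k. c k \<oplus> \<ominus> d k"] F 0 that by blast
    then have "c k = d k" if "k \<in> ?F" for k
      using that cc[of k] LM.M.minus_equality[of "c k" "\<ominus> d k"] by simp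
    then show "c = d" by (intro ext) force
  qed
qed

lemma internal_direct_sum_spans: "internal_direct_sum M S N \<Longrightarrow> m \<in> carrier M \<Longrightarrow> spans_sum M S N m"
proof -
  assume "internal_direct_sum M S N" "m \<in> carrier M"
  then obtain c where "\<forall>k\<in>S. c k \<in> N k" "\<forall>k. k \<notin> S \<longrightarrow> c k = \<zero>" "finite {k. c k \<noteq> \<zero>}"
     "m = (\<Oplus>k\<in>{k. c k \<noteq> \<zero>}. c k)" unfolding internal_direct_sum_def by blast
  then show ?thesis unfolding spans_sum_def by (intro exI[of _ "{k. c k \<noteq> \<zero>}"] exI[of _ c]) auto
qed

lemma additive_subgroupI':
  assumes "N \<subseteq> carrier M" "\<zero> \<in> N" "\<And>x y. x \<in> N \<Longrightarrow> y \<in> N \<Longrightarrow> x \<oplus> y \<in> N" "\<And>c x. x \<in> N \<Longrightarrow> const c \<cdot> x \<in> N"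
  shows "additive_subgroup N M"
proof -
  have "\<ominus> x \<in> N" if "x \<in> N" for x
  proof -
    have "const (- 1) \<cdot> x = \<ominus> x" using assms(1) that by (auto simp: const_simps app_uminus app_one)
    then show ?thesis using assms(4)[OF that, of "- 1"] by simp
  qed
  then show ?thesis using assms by (intro additive_subgroupI LM.M.add.subgroupI) auto
qed

lemma wsp_subgroup: "additive_subgroup (wsp l) M"
  by (rule additive_subgroupI') (auto intro: wsp_add wsp_const wsp_carrier)

section \<open>Weight projections\<close>

lemma const_unit_cancel: "c dvd 1 \<Longrightarrow> m \<in> carrier M \<Longrightarrow> const (inverse c) \<cdot> const c \<cdot> m = m"
  using unit_inverse_qpi[of c] by (simp add: app_const_const const_simps app_one mult.commute)

text \<open>Interpolation: for each \<open>k\<close> in \<open>F\<close> some K separates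
  \<open>l\<close> from \<open>k\<close>, and the factor it gives is normalised by a difference of
  powers of q, a unit. As projections are given by algebra elements, submodules are closed under
  them.\<close>

lemma proj_exists:
  "finite F \<Longrightarrow> l \<notin> F \<Longrightarrow> \<exists>p. (\<forall>m\<in>wsp l. p \<cdot> m = m) \<and> (\<forall>l'\<in>F. \<forall>m\<in>wsp l'. p \<cdot> m = \<zero>)"
proof (induction F rule: finite_induct)
  case empty
  then show ?case using app_one wsp_carrier by (intro exI[of _ 1]) auto
next
  case (insert k F)
  then obtain p where "\<forall>m\<in>wsp l. p \<cdot> m = m" "\<forall>l'\<in>F. \<forall>m\<in>wsp l'. p \<cdot> m = \<zero>" by blast
  then have p: "\<And>m. m \<in> wsp l \<Longrightarrow> p \<cdot> m = m" "\<And>l' m. l' \<in> F \<Longrightarrow> m \<in> wsp l' \<Longrightarrow> p \<cdot> m = \<zero>" by blast+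
  obtain \<mu> where \<mu>: "pr \<mu> l \<noteq> pr \<mu> k" using pr_separate[of l k] insert.prems by auto
  let ?d = "\<lambda>n. qp 0 (pr \<mu> n) - qp 0 (pr \<mu> k)"
  let ?p = "const (inverse (?d l)) * (p * (gK \<mu> - const (qp 0 (pr \<mu> k))))"
  have a: "?p \<cdot> m = const (inverse (?d l)) \<cdot> p \<cdot> const (?d n) \<cdot> m" if "m \<in> wsp n" for m n
    using that wsp_carrier[OF that] by (simp add: app_mult app_diff wsp_iff const_simps)
  have u: "?d l dvd 1" using \<mu> by (rule qp_diff_unit)
  show ?case
  proof (intro exI[of _ ?p] conjI ballI)
    show "?p \<cdot> m = m" if "m \<in> wsp l" for m
      using a[OF that] p(1)[OF wsp_const[OF that]] const_unit_cancel[OF u wsp_carrier[OF that]] by simp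
    show "?p \<cdot> m = \<zero>" if "l' \<in> insert k F" "m \<in> wsp l'" for l' m
    proof (cases "l' = k")
      case True
      then show ?thesis unfolding a[OF that(2)] using wsp_carrier[OF that(2)] by (simp add: const_simps(1))
    next
      case False
      then have "l' \<in> F" using that by auto
      then show ?thesis unfolding a[OF that(2)] using p(2)[OF _ wsp_const[OF that(2)]] by simp
    qed
  qed
qed

lemma proj_finsum:
  assumes "finite F" "\<And>k. k \<in> F \<Longrightarrow> c k \<in> wsp k" "l \<in> F"
  shows "\<exists>p. p \<cdot> (\<Oplus>k\<in>F. c k) = c l"
proof -
  obtain p where "\<forall>m\<in>wsp l. p \<cdot> m = m" "\<forall>l'\<in>F - {l}. \<forall>m\<in>wsp l'. p \<cdot> m = \<zero>"
    using proj_exists[of "F - {l}" l] assms(1) by blast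
  then have p: "\<And>m. m \<in> wsp l \<Longrightarrow> p \<cdot> m = m" "\<And>l' m. l' \<in> F - {l} \<Longrightarrow> m \<in> wsp l' \<Longrightarrow> p \<cdot> m = \<zero>" by blast+
  have cc: "c k \<in> carrier M" if "k \<in> F" for k using assms that wsp_carrier by blast
  have "p \<cdot> (\<Oplus>k\<in>F. c k) = (\<Oplus>k\<in>F. p \<cdot> c k)" using cc by (rule app_finsum)
  also have "\<dots> = (\<Oplus>k\<in>F. if l = k then c k else \<zero>)"
    using p assms cc by (intro LM.M.finsum_cong') auto
  also have "\<dots> = c l" using assms cc by (intro LM.M.finsum_singleton) auto
  finally show ?thesis by blast
qed

lemma wsp_indep: "indep_sum M UNIV wsp"
  unfolding indep_sum_def
proof (intro allI impI ballI)
  fix F c l assume "finite F" "\<forall>k\<in>F. c k \<in> wsp k" "(\<Oplus>k\<in>F. c k) = \<zero>" "l \<in> F"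
  then show "c l = \<zero>" using proj_finsum[of F c l] by auto
qed

text \<open>If \<open>v\<close> has weight \<open>l\<close>, then \<open>ypart l \<mu> y\<close> picks the part of \<open>y\<close> that sends \<open>v\<close> to weight \<open>\<mu>\<close>.\<close>

definition ypart :: "'x \<Rightarrow> 'x \<Rightarrow> 'i free_alg \<Rightarrow> 'i free_alg" where
  "ypart l \<mu> = scal (\<lambda>a. if l - zroot D a = \<mu> then 1 else 0)"

lemma qlin_ypart: "qlin (ypart l \<mu>)" by (simp add: ypart_def qlin_scal)

lemma ypart_mon: "ypart l \<mu> (mon w) = (if l - wX D w = \<mu> then mon w else 0)"
  by (simp add: ypart_def wX_def const_simps)

lemma ypart_wsp: "v \<in> wsp l \<Longrightarrow> dn (ypart l \<mu> y) \<cdot> v \<in> wsp \<mu>"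
proof (induction y rule: free_induct)
  case (mon c w)
  then have "const c \<cdot> dn (mon w) \<cdot> v \<in> wsp (l - wX D w)" by (intro wsp_const wsp_dn)
  then show ?case using wsp_carrier[OF mon]
    by (auto simp: qlin_const[OF qlin_ypart] ypart_mon subst_gen_lin app_mult)
next
  case (add x y)
  then show ?case using wsp_carrier[of v l]
    by (simp add: qlin_add[OF qlin_ypart] subst_gen_lin app_plus wsp_add)
qed

lemma ypart_sum: "\<exists>L. finite L \<and> (\<forall>\<mu>. \<mu> \<notin> L \<longrightarrow> ypart l \<mu> y = 0) \<and> y = (\<Sum>\<mu>\<in>L. ypart l \<mu> y)"
proof -
  \<comment> \<open>The sum formula is claimed for all larger finite sets, so that the sets
    belonging to two summands can be united.\<close>
  have "\<exists>L. finite L \<and> (\<forall>\<mu>. \<mu> \<notin> L \<longrightarrow> ypart l \<mu> y = 0) \<and> (\<forall>L'. finite L' \<longrightarrow> L \<subseteq> L' \<longrightarrow> y = (\<Sum>\<mu>\<in>L'. ypart l \<mu> y))"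
  proof (induction y rule: free_induct)
    case (mon c w)
    have "ypart l \<mu> (const c * mon w) = (if l - wX D w = \<mu> then const c * mon w else 0)" for \<mu>
      by (simp add: qlin_const[OF qlin_ypart] ypart_mon)
    then show ?case by (intro exI[of _ "{l - wX D w}"]) (simp add: sum.delta)
  next
    case (add x y)
    then obtain L1 L2 where "finite L1" "\<forall>\<mu>. \<mu> \<notin> L1 \<longrightarrow> ypart l \<mu> x = 0" "\<forall>L'. finite L' \<longrightarrow> L1 \<subseteq> L' \<longrightarrow> x = (\<Sum>\<mu>\<in>L'. ypart l \<mu> x)"
      "finite L2" "\<forall>\<mu>. \<mu> \<notin> L2 \<longrightarrow> ypart l \<mu> y = 0" "\<forall>L'. finite L' \<longrightarrow> L2 \<subseteq> L' \<longrightarrow> y = (\<Sum>\<mu>\<in>L'. ypart l \<mu> y)" by auto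
    then show ?case
      by (intro exI[of _ "L1 \<union> L2"]) (auto simp: qlin_add[OF qlin_ypart] sum.distrib)
  qed
  then show ?thesis by blast
qed

lemma ypart_proj:
  assumes v: "v \<in> wsp l"
  shows "\<exists>p. p \<cdot> dn y \<cdot> v = dn (ypart l \<mu> y) \<cdot> v \<and> (\<forall>x\<in>wsp \<mu>. p \<cdot> x = x)"
proof -
  have c: "v \<in> carrier M" using v by (rule wsp_carrier)
  obtain L where L: "finite L" "\<forall>\<mu>. \<mu> \<notin> L \<longrightarrow> ypart l \<mu> y = 0" "y = (\<Sum>\<mu>\<in>L. ypart l \<mu> y)"
    using ypart_sum by blast
  obtain p where "\<forall>m\<in>wsp \<mu>. p \<cdot> m = m" "\<forall>l'\<in>L - {\<mu>}. \<forall>m\<in>wsp l'. p \<cdot> m = \<zero>"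
    using proj_exists[of "L - {\<mu>}" \<mu>] L(1) by blast
  then have p: "\<And>m. m \<in> wsp \<mu> \<Longrightarrow> p \<cdot> m = m" "\<And>l' m. l' \<in> L - {\<mu>} \<Longrightarrow> m \<in> wsp l' \<Longrightarrow> p \<cdot> m = \<zero>" by blast+
  have "p \<cdot> dn y \<cdot> v = (\<Sum>k\<in>L. p * dn (ypart l k y)) \<cdot> v"
    using c by (subst L(3)) (simp add: subst_gen_lin sum_distrib_left flip: app_mult)
  also have "\<dots> = (\<Sum>k\<in>L. if k = \<mu> then dn (ypart l \<mu> y) else 0) \<cdot> v"
    using p ypart_wsp[OF v] c by (intro app_sum_cong) (auto simp: app_mult)
  also have "\<dots> = dn (ypart l \<mu> y) \<cdot> v" using L(1,2) c by (auto simp: subst_gen_lin)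
  finally show ?thesis using p(1) by blast
qed

lemma ypart_eq: "v \<in> wsp l \<Longrightarrow> dn y \<cdot> v \<in> wsp \<mu> \<Longrightarrow> dn y \<cdot> v = dn (ypart l \<mu> y) \<cdot> v"
  using ypart_proj[of v l y \<mu>] by auto

lemma ypart_zero: "(\<And>\<mu>. dn (ypart l \<mu> y) \<cdot> v = \<zero>) \<Longrightarrow> v \<in> carrier M \<Longrightarrow> dn y \<cdot> v = \<zero>"
proof -
  assume *: "\<And>\<mu>. dn (ypart l \<mu> y) \<cdot> v = \<zero>" "v \<in> carrier M"
  obtain L where L: "y = (\<Sum>\<mu>\<in>L. ypart l \<mu> y)" using ypart_sum by blast
  have "(\<Sum>k\<in>L. dn (ypart l k y)) \<cdot> v = (\<Sum>k\<in>L. 0) \<cdot> v" using * by (intro app_sum_cong) auto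
  then show ?thesis using * by (subst L) (simp add: subst_gen_lin)
qed

section \<open>Integrability\<close>

definition Fnil :: "'i \<Rightarrow> 'm \<Rightarrow> bool" where "Fnil i m \<longleftrightarrow> (\<exists>n. gF i ^ n \<cdot> m = \<zero>)"

lemma gF_power_mono: "gF i ^ n \<cdot> m = \<zero> \<Longrightarrow> m \<in> carrier M \<Longrightarrow> n \<le> k \<Longrightarrow> gF i ^ k \<cdot> m = \<zero>"
proof -
  assume *: "gF i ^ n \<cdot> m = \<zero>" "m \<in> carrier M" "n \<le> k"
  then have "(gF i ^ k :: ('i, 'y) u_gen free_alg) = gF i ^ (k - n) * gF i ^ n" by (simp flip: power_add)
  then show ?thesis using * by (simp add: app_mult)
qed

lemma Fnil_add: "Fnil i m \<Longrightarrow> Fnil i n \<Longrightarrow> m \<in> carrier M \<Longrightarrow> n \<in> carrier M \<Longrightarrow> Fnil i (m \<oplus> n)"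
proof -
  assume *: "Fnil i m" "Fnil i n" "m \<in> carrier M" "n \<in> carrier M"
  then obtain a b where "gF i ^ a \<cdot> m = \<zero>" "gF i ^ b \<cdot> n = \<zero>" by (auto simp: Fnil_def)
  then have "gF i ^ max a b \<cdot> (m \<oplus> n) = \<zero>"
    using * gF_power_mono[of i a m "max a b"] gF_power_mono[of i b n "max a b"] by (simp add: app_add)
  then show ?thesis by (auto simp: Fnil_def)
qed

lemma Fnil_const: "Fnil i m \<Longrightarrow> m \<in> carrier M \<Longrightarrow> Fnil i (const c \<cdot> m)"
  unfolding Fnil_def using app_const_comm by (metis app_zero)

text \<open>Downward induction on \<open>k\<close> from the element in the radical, which acts by
  zero. Passing F_i across one commutator costs the next one, and an inner induction on the
  nilpotency exponent of \<open>m\<close> treats the term in which F_i reaches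
  \<open>m\<close>.\<close>

lemma Fnil_serre:
  assumes s: "serre_elt D i j N \<in> radical D"
  shows "k \<le> N \<Longrightarrow> m \<in> carrier M \<Longrightarrow> Fnil i m \<Longrightarrow> Fnil i (dn (serre_elt D i j k) \<cdot> m)"
proof (induction "N - k" arbitrary: k m)
  case 0
  then have "dn (serre_elt D i j k) \<cdot> m = \<zero>" using app_radical(2)[OF s] by simp
  then show ?case by (simp add: Fnil_def)
next
  case (Suc d)
  then have IH: "\<And>m. m \<in> carrier M \<Longrightarrow> Fnil i m \<Longrightarrow> Fnil i (dn (serre_elt D i j (Suc k)) \<cdot> m)"
  proof -
    have dk: "d = N - Suc k" "Suc k \<le> N" using Suc.hyps(2) Suc.prems(1) by arith+
    show "\<And>m. m \<in> carrier M \<Longrightarrow> Fnil i m \<Longrightarrow> Fnil i (dn (serre_elt D i j (Suc k)) \<cdot> m)"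
      by (rule Suc.hyps(1)[OF dk])
  qed
  obtain n where "gF i ^ n \<cdot> m = \<zero>" using Suc.prems by (auto simp: Fnil_def)
  then show ?case using Suc.prems(2)
  proof (induction n arbitrary: m)
    case 0
    then show ?case by (auto simp: Fnil_def app_one intro: exI[of _ 0])
  next
    case (Suc n)
    let ?s = "dnD (serre_elt D i j k)"
    let ?c = "q_elt powi (- (dot D i j + int k * dot D i i)) * pi_elt powi (par D i * par D j + int k * par D i)"
    have m: "Fnil i m" "m \<in> carrier M" unfolding Fnil_def using Suc.prems by blast+
    have "gF i ^ n \<cdot> gF i \<cdot> m = \<zero>" using Suc.prems by (simp add: app_mult power_Suc2 del: power_Suc)
    then have 1: "Fnil i (?s \<cdot> gF i \<cdot> m)" using Suc.IH[of "gF i \<cdot> m"] m by simp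
    have "gF i * ?s = dnD (serre_elt D i j (Suc k)) + const ?c * (?s * gF i)"
      by (simp add: subst_gen_lin subst_gen_mult)
    then have "gF i \<cdot> ?s \<cdot> m = dn (serre_elt D i j (Suc k)) \<cdot> m \<oplus> const ?c \<cdot> ?s \<cdot> gF i \<cdot> m"
      using m(2) by (simp add: app_plus flip: app_mult)
    then have "Fnil i (gF i \<cdot> ?s \<cdot> m)"
      using Fnil_add[OF IH[OF m(2,1)] Fnil_const[OF 1]] m(2) by simp
    then obtain a where "gF i ^ a \<cdot> gF i \<cdot> ?s \<cdot> m = \<zero>" by (auto simp: Fnil_def)
    then have "gF i ^ Suc a \<cdot> ?s \<cdot> m = \<zero>" using m(2) by (simp add: power_Suc2 app_mult del: power_Suc)
    then show ?case unfolding Fnil_def by blast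
  qed
qed

lemma Fnil_gF: "m \<in> carrier M \<Longrightarrow> Fnil i m \<Longrightarrow> Fnil i (gF j \<cdot> m)"
proof (cases "i = j")
  case True
  assume m: "m \<in> carrier M" "Fnil i m"
  then obtain a where "gF i ^ a \<cdot> m = \<zero>" by (auto simp: Fnil_def)
  then have "gF i ^ Suc a \<cdot> m = \<zero>" using m by (simp add: app_mult)
  then have "gF i ^ a \<cdot> gF j \<cdot> m = \<zero>" using m True by (simp add: power_Suc2 app_mult del: power_Suc)
  then show ?thesis by (auto simp: Fnil_def)
next
  case False
  assume m: "m \<in> carrier M" "Fnil i m"
  obtain N where "serre_elt D i j N \<in> radical D" using serre_radical[OF False] by blast
  from Fnil_serre[OF this, of 0 m] show ?thesis using m by simp
qed

lemma Fnil_dn: "v \<in> carrier M \<Longrightarrow> Fnil i v \<Longrightarrow> Fnil i (dn y \<cdot> v)"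
proof (induction y rule: free_induct)
  case (mon c w)
  have "Fnil i (dn (mon w) \<cdot> v)"
    by (induction w) (use mon in \<open>simp_all add: mon_Nil app_one mon_Cons[of "GF _"] app_mult Fnil_gF\<close>)
  then show ?case using mon by (simp add: subst_gen_lin app_mult Fnil_const)
next
  case (add x y)
  then show ?case by (simp add: subst_gen_lin app_plus Fnil_add)
qed

definition submod :: "'m set \<Rightarrow> bool" where
  "submod N \<longleftrightarrow> N \<subseteq> carrier M \<and> \<zero> \<in> N \<and> (\<forall>x\<in>N. \<forall>y\<in>N. x \<oplus> y \<in> N) \<and> (\<forall>u. \<forall>x\<in>N. u \<cdot> x \<in> N)"

lemma submodD: "submod N \<Longrightarrow> x \<in> N \<Longrightarrow> x \<in> carrier M" "submod N \<Longrightarrow> \<zero> \<in> N"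
  "submod N \<Longrightarrow> x \<in> N \<Longrightarrow> y \<in> N \<Longrightarrow> x \<oplus> y \<in> N" "submod N \<Longrightarrow> x \<in> N \<Longrightarrow> u \<cdot> x \<in> N"
  by (auto simp: submod_def)

lemma submod_subgroup: "submod N \<Longrightarrow> additive_subgroup N M"
  by (rule additive_subgroupI') (auto simp: submod_def)

lemma submod_iff: "submodule N (u_alg D) M \<longleftrightarrow> submod N"
proof
  assume "submodule N (u_alg D) M"
  then interpret S: submodule N "u_alg D" M .
  show "submod N"
    unfolding submod_def app_def using S.subset S.one_closed S.m_closed S.smult_closed[OF u_cls_carrier] by auto
next
  assume s: "submod N"
  then have "subgroup N (add_monoid M)" using additive_subgroup.a_subgroup[OF submod_subgroup] by blast
  moreover have "submodule_axioms N (u_alg D) M"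
    using s unfolding submod_def app_def submodule_axioms_def u_alg_simps by auto
  ultimately show "submodule N (u_alg D) M" by (rule submodule.intro)
qed

lemma submod_zero: "submod {\<zero>}" by (simp add: submod_def)

lemma submod_minus: "submod N \<Longrightarrow> x \<oplus> y \<in> N \<Longrightarrow> x \<in> N \<Longrightarrow> y \<in> carrier M \<Longrightarrow> y \<in> N"
proof -
  assume *: "submod N" "x \<oplus> y \<in> N" "x \<in> N" "y \<in> carrier M"
  have "(- 1) \<cdot> x \<oplus> (x \<oplus> y) \<in> N" by (rule submodD(3)[OF *(1) submodD(4)[OF *(1,3)] *(2)])
  moreover have eq: "(- 1) \<cdot> x \<oplus> (x \<oplus> y) = y"
    using * submodD(1)[OF *(1,3)] by (simp add: app_uminus app_one LM.M.a_assoc[symmetric] LM.M.l_neg)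
  ultimately show ?thesis unfolding eq by blast
qed

lemma submod_const_unit: "submod N \<Longrightarrow> const c \<cdot> x \<in> N \<Longrightarrow> c dvd 1 \<Longrightarrow> x \<in> carrier M \<Longrightarrow> x \<in> N"
  using submodD(4)[of N "const c \<cdot> x" "const (inverse c)"] const_unit_cancel[of c x] by simp

lemma dn_power: "dnD (gen i ^ n) = gF i ^ n"
  by (induction n) (simp_all add: subst_gen_mult)

text \<open>Rank one argument modulo \<open>Z\<close>. For the least \<open>k\<close> with F_i^k m
  in \<open>Z\<close>, applying E_i puts a multiple of F_i^(k-1) m into \<open>Z\<close>. Its
  coefficient \<open>ecoef\<close> is therefore not a unit, which happens only for <i,mu> = k -
  1.\<close>

lemma dominant_mod:
  assumes m: "m \<in> wsp \<mu>" "m \<notin> Z" and Z: "submod Z" and E: "gE i \<cdot> m \<in> Z" and F: "gF i ^ n \<cdot> m \<in> Z"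
  shows "0 \<le> cr i \<mu>" "gF i ^ hgt \<mu> i \<cdot> m \<in> Z"
proof -
  have c: "m \<in> carrier M" using m(1) by (rule wsp_carrier)
  define k where "k = (LEAST k. gF i ^ k \<cdot> m \<in> Z)"
  have k: "gF i ^ k \<cdot> m \<in> Z" unfolding k_def using F by (rule LeastI)
  have "k \<noteq> 0" using k m(2) c by (auto simp: app_one intro!: gr0I)
  then obtain r where r: "k = Suc r" by (cases k) auto
  then have nr: "gF i ^ r \<cdot> m \<notin> Z" using not_less_Least[of r "\<lambda>k. gF i ^ k \<cdot> m \<in> Z"] by (simp add: k_def)
  let ?y = "gen i ^ Suc r" and ?e = "ecoef i (cr i \<mu>) r"
  have "Eop i \<mu> ?y = const ?e * gen i ^ r"
    unfolding gen_power Eop_def lin_mon Ew_replicate by simp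
  then have "(gE i * dn ?y) \<cdot> m = dn (scal (\<lambda>a. qp (par D i * zpar D a) 0) ?y) \<cdot> gE i \<cdot> m \<oplus> const ?e \<cdot> gF i ^ r \<cdot> m"
    unfolding gE_dn[OF m(1)] using c by (simp add: app_plus app_mult subst_gen_lin dn_power del: power_Suc)
  moreover have "(gE i * dn ?y) \<cdot> m \<in> Z"
    using c k submodD(4)[OF Z] by (simp add: app_mult dn_power r del: power_Suc)
  ultimately have "const ?e \<cdot> gF i ^ r \<cdot> m \<in> Z"
    using submod_minus[OF Z _ submodD(4)[OF Z E]] c by simp
  then have "\<not> ?e dvd 1" using submod_const_unit[OF Z] nr c by auto
  then have "cr i \<mu> = int r" using ecoef_unit by blast
  then show "0 \<le> cr i \<mu>" "gF i ^ hgt \<mu> i \<cdot> m \<in> Z" using k r by (simp_all add: hgt_def)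
qed

end

section \<open>Integrability, the category O and parity in terms of words\<close>

context datum begin

lemma qint_br: "qint D i n = br i (int n)"
proof -
  have a: "(pi_i D i * q_i D i) ^ n = qp (par D i * int n) (dd D i * int n)"
    unfolding pi_i_def q_i_def power_mult_distrib q_pi_powi_power qp_def ..
  have b: "q_i D i powi (- int n) = qp 0 (- dd D i * int n)" by (simp add: q_i_powi qp_def)
  show ?thesis unfolding qint_def br_def divide_qpi_def a b kk_def by (simp only: mult.commute)
qed

lemma qfact_unit: "qfact D i n dvd 1"
proof (induction n)
  case (Suc n)
  have "qfact D i (Suc n) = qfact D i n * br i (int (Suc n))" by (simp add: qfact_def qint_br)
  moreover have "br i (int (Suc n)) dvd 1" by (rule br_unit) simp
  ultimately show ?case using Suc by (metis mult_1 mult_dvd_mono)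
qed (simp add: qfact_def)

lemma qfact_inv_unit: "1 / qfact D i n dvd 1"
  using unit_inverse_qpi[OF qfact_unit[of i n]] by (metis divide_qpi_def dvd_triv_right mult_1)

lemma f_plus_cls: "f_plus D (f_cls D x) = u_cls D (up x)"
proof -
  have "(\<lambda>x. u_cls D (up x)) ` (f_cls D x) = {u_cls D (up x)}"
  proof -
    have "u_cls D (up (r + x)) = u_cls D (up x)" if "r \<in> radical D" for r
      using up_radical[OF that] by (simp add: u_cls_eq_iff subst_gen_lin)
    then show ?thesis unfolding f_cls_def class_coset image_image
      by (auto intro!: rev_image_eqI[OF radical_0])
  qed
  then show ?thesis by (simp add: f_plus_def)
qed

end

context umod begin

lemma kills_app:
  assumes "kills n m" "m \<in> carrier M" "\<And>w. w \<in> Poly_Mapping.keys x \<Longrightarrow> n \<le> length (letters w)"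
  shows "up x \<cdot> m = \<zero>"
proof -
  have "up x \<cdot> m = (\<Sum>w\<in>Poly_Mapping.keys x. const (Poly_Mapping.lookup x w) * up (mon (letters w))) \<cdot> m"
    by (subst free_alg_expand[of x]) (simp add: subst_gen_lin)
  also have "\<dots> = (\<Sum>w\<in>Poly_Mapping.keys x. 0) \<cdot> m"
    using assms by (intro app_sum_cong) (auto simp: app_mult kills_def)
  finally show ?thesis using assms by simp
qed

lemma in_O_iff: "in_O D M \<longleftrightarrow> in_C D M \<and> (\<forall>m\<in>carrier M. \<exists>n. kills n m)"
proof -
  have "(\<exists>n::nat. \<forall>a. int n \<le> height a \<longrightarrow> (\<forall>x\<in>f_weight D a. f_plus D x \<odot> m = \<zero>)) \<longleftrightarrow> (\<exists>n. kills n m)"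
    if m: "m \<in> carrier M" for m
  proof
    assume "\<exists>n::nat. \<forall>a. int n \<le> height a \<longrightarrow> (\<forall>x\<in>f_weight D a. f_plus D x \<odot> m = \<zero>)"
    then obtain n :: nat where n: "\<And>a x. int n \<le> height a \<Longrightarrow> x \<in> f_weight D a \<Longrightarrow> f_plus D x \<odot> m = \<zero>" by blast
    have "up (mon w) \<cdot> m = \<zero>" if "n \<le> length w" for w
    proof -
      have "f_cls D (mon w) \<in> f_weight D (wt (FM w))" using weight_part_mon by (auto simp: f_weight_def)
      then have "f_plus D (f_cls D (mon w)) \<odot> m = \<zero>" using that by (intro n[of "wt (FM w)"]) (simp_all add: length_wt)
      then show ?thesis by (simp add: f_plus_cls app_def)
    qed
    then show "\<exists>n. kills n m" by (auto simp: kills_def)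
  next
    assume "\<exists>n. kills n m"
    then obtain n where n: "kills n m" by blast
    have "f_plus D x \<odot> m = \<zero>" if a: "int n \<le> height a" and xf: "x \<in> f_weight D a" for a x
    proof -
      obtain y where y: "y \<in> weight_part a" "x = f_cls D y" using xf by (auto simp: f_weight_def)
      have "n \<le> length (letters w)" if "w \<in> Poly_Mapping.keys y" for w
      proof -
        have "wt (FM (letters w)) = a" using y(1) that by (simp add: weight_part_def)
        then show ?thesis using length_wt[of "letters w"] a by simp
      qed
      then show ?thesis using kills_app[OF n m, of y] by (simp add: y(2) f_plus_cls app_def)
    qed
    then show "\<exists>n::nat. \<forall>a. int n \<le> height a \<longrightarrow> (\<forall>x\<in>f_weight D a. f_plus D x \<odot> m = \<zero>)" by blast
  qed
  then show ?thesis unfolding in_O_def by blast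
qed

text \<open>Quantum factorials are units, so divided powers can be traded for ordinary ones.\<close>

lemma divided_power_zero: "m \<in> carrier M \<Longrightarrow> divided_power D g i n \<odot> m = \<zero> \<longleftrightarrow> gen (g i) ^ n \<cdot> m = \<zero>"
proof -
  assume m: "m \<in> carrier M"
  have "divided_power D g i n \<odot> m = const (1 / qfact D i n) \<cdot> gen (g i) ^ n \<cdot> m"
    using m by (simp add: divided_power_def app_mult flip: app_def)
  then show ?thesis using const_unit_cancel[OF qfact_inv_unit[of i n], of "gen (g i) ^ n \<cdot> m"] m by auto
qed

lemma integrableI:
  assumes "\<And>m. m \<in> carrier M \<Longrightarrow> \<exists>n. kills n m" "\<And>m i. m \<in> carrier M \<Longrightarrow> Fnil i m"
  shows "integrable_module D M"
  unfolding integrable_module_def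
proof (intro ballI allI)
  fix m i assume m: "m \<in> carrier M"
  obtain a b where a: "kills a m" and b: "gF i ^ b \<cdot> m = \<zero>" using assms m by (metis Fnil_def)
  have p: "upD (gen i ^ n) = gE i ^ n" for n by (induction n) (simp_all add: subst_gen_mult)
  have "gE i ^ n \<cdot> m = \<zero>" if "a \<le> n" for n
  proof -
    have "up (mon (replicate n i)) \<cdot> m = \<zero>" using a that unfolding kills_def by (metis length_replicate)
    then show ?thesis unfolding p[symmetric] unfolding gen_power .
  qed
  moreover have "gF i ^ n \<cdot> m = \<zero>" if "b \<le> n" for n by (rule gF_power_mono[OF b m that])
  ultimately show "\<exists>n0\<ge>1. \<forall>n\<ge>n0. divided_power D GE i n \<odot> m = \<zero> \<and> divided_power D GF i n \<odot> m = \<zero>"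
    using m by (intro exI[of _ "Suc (max a b)"]) (simp add: divided_power_zero)
qed

lemma integrable_Fnil: "integrable_module D M \<Longrightarrow> m \<in> carrier M \<Longrightarrow> Fnil i m"
  unfolding integrable_module_def Fnil_def using divided_power_zero[of m GF i] by blast

lemma kills_gen_le: "kills n m \<Longrightarrow> kills k m' \<Longrightarrow> m \<in> carrier M \<Longrightarrow> m' \<in> carrier M \<Longrightarrow> kills (max n k) (m \<oplus> m')"
  by (simp add: kills_def app_add)

lemma kills_const: "kills n m \<Longrightarrow> m \<in> carrier M \<Longrightarrow> kills n (const c \<cdot> m)"
  by (simp add: kills_def app_const_comm[of _ "mon _"])

end

context datum begin

lemma weight_part_neg: "x \<in> weight_part a \<Longrightarrow> height a < 0 \<Longrightarrow> x = 0"
proof -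
  assume x: "x \<in> weight_part a" and a: "height a < 0"
  have "w \<notin> Poly_Mapping.keys x" for w
  proof
    assume "w \<in> Poly_Mapping.keys x"
    then have "wt (FM (letters w)) = a" using x by (simp add: weight_part_def)
    then show False using length_wt[of "letters w"] a by simp
  qed
  then show ?thesis by (metis (no_types, opaque_lifting) poly_mapping_eqI in_keys_iff lookup_zero)
qed

lemma vact_up_long: "length w < length u \<Longrightarrow> vact l (up (mon u)) (mon w) = 0"
  by (rule weight_part_neg[OF up_weight])
     (use length_wt[of u] length_wt[of w] in \<open>simp add: height_def sum_subtractf\<close>)

definition par_set :: "bool \<Rightarrow> 'i free_alg set" where
  "par_set b = {y. \<forall>w\<in>Poly_Mapping.keys y. odd (parl D (letters w)) = b}"

lemma par_set_add: "x \<in> par_set b \<Longrightarrow> y \<in> par_set b \<Longrightarrow> x + y \<in> par_set b"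
  using keys_add[of x y] by (auto simp: par_set_def)

lemma par_set_const: "x \<in> par_set b \<Longrightarrow> const c * x \<in> par_set b"
  by (auto simp: par_set_def in_keys_iff)

lemma par_set_0: "0 \<in> par_set b" by (simp add: par_set_def)

lemma par_set_mon: "odd (parl D w) = b \<Longrightarrow> mon w \<in> par_set b"
  by (simp add: par_set_def mon_def)

lemma par_set_weight: "x \<in> weight_part a \<Longrightarrow> odd (zpar D a) = b \<Longrightarrow> x \<in> par_set b"
proof -
  assume x: "x \<in> weight_part a" and a: "odd (zpar D a) = b"
  have "odd (parl D (letters w)) = b" if "w \<in> Poly_Mapping.keys x" for w
  proof -
    have "wt (FM (letters w)) = a" using x that by (simp add: weight_part_def)
    then show ?thesis using a by (simp add: parl_def)
  qed
  then show ?thesis by (simp add: par_set_def)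
qed

lemma par_set_expand:
  assumes "y \<in> par_set b" "\<And>w. odd (parl D w) = b \<Longrightarrow> f (mon w) \<in> par_set b'" "qlin f"
  shows "f y \<in> par_set b'"
proof -
  have "(\<Sum>w\<in>A. const (Poly_Mapping.lookup y w) * f (mon (letters w))) \<in> par_set b'" if "A \<subseteq> Poly_Mapping.keys y" for A
    using that
  proof (induction A rule: infinite_finite_induct)
    case (insert w A)
    then have "odd (parl D (letters w)) = b" using assms(1) by (auto simp: par_set_def)
    then show ?case using insert by (simp add: par_set_add par_set_const assms(2))
  qed (simp_all add: par_set_0)
  then have "f (\<Sum>w\<in>Poly_Mapping.keys y. const (Poly_Mapping.lookup y w) * mon (letters w)) \<in> par_set b'"
    by (simp add: qlin_sum[OF assms(3)] qlin_const[OF assms(3)])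
  then show ?thesis by (simp only: free_alg_expand[symmetric])
qed

lemma gact_par: "y \<in> par_set b \<Longrightarrow> gact l g y \<in> par_set (b \<noteq> gen_odd D g)"
proof (erule par_set_expand[OF _ _ qlin_gact])
  fix w assume w: "odd (parl D w) = b"
  have m: "mon w \<in> par_set b" using w by (rule par_set_mon)
  show "gact l g (mon w) \<in> par_set (b \<noteq> gen_odd D g)"
  proof (cases g)
    case (GE i)
    have "zpar D (\<lambda>k. wt (FM w) k - wt (FM [i]) k) = parl D w - par D i"
      by (simp add: zpar_def parl_def sum_subtractf left_diff_distrib flip: parl_single[of D i])
    moreover have "gen_odd D (GE i :: ('i, 'y) u_gen) \<longleftrightarrow> odd (par D i)" by (auto simp: gen_odd_def par_def)
    ultimately show ?thesis using par_set_weight[OF Eop_weight[OF weight_part_mon, of i l w]] w GE by auto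
  next
    case (GF i)
    have "gen_odd D (GF i :: ('i, 'y) u_gen) \<longleftrightarrow> odd (par D i)" by (auto simp: gen_odd_def par_def)
    then show ?thesis using par_set_mon[of "i # w" "odd (parl D (i # w))"] w GF
      by (cases b; cases "even (par D i)") (simp_all add: mon_Cons)
  qed (use m in \<open>simp_all add: gen_odd_def par_set_const\<close>)
qed

lemma vact_par:
  assumes "\<And>w. w \<in> Poly_Mapping.keys x \<Longrightarrow> odd (length (filter (gen_odd D) (letters w))) = a" "y \<in> par_set b"
  shows "vact l x y \<in> par_set (a \<noteq> b)"
proof -
  have w: "wact l w y \<in> par_set (odd (length (filter (gen_odd D) w)) \<noteq> b)" for w
  proof (induction w)
    case (Cons g w)
    then show ?case using gact_par[OF Cons, of l g] by (cases "gen_odd D g") (auto simp: if_distrib)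
  qed (simp add: assms)
  have "(\<Sum>w\<in>A. const (Poly_Mapping.lookup x w) * wact l (letters w) y) \<in> par_set (a \<noteq> b)" if "A \<subseteq> Poly_Mapping.keys x" for A
    using that
  proof (induction A rule: infinite_finite_induct)
    case (insert v A)
    then show ?case using w[of "letters v"] assms(1)[of v] by (simp add: par_set_add par_set_const)
  qed (simp_all add: par_set_0)
  then show ?thesis by (simp add: vact_def lin_def)
qed

definition ppart :: "bool \<Rightarrow> 'i free_alg \<Rightarrow> 'i free_alg" where
  "ppart b = scal (\<lambda>a. if odd (zpar D a) = b then 1 else 0)"

lemma qlin_ppart: "qlin (ppart b)" by (simp add: ppart_def qlin_scal)

lemma ppart_mon: "ppart b (mon w) = (if odd (parl D w) = b then mon w else 0)"
  by (simp add: ppart_def parl_wt const_simps)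

lemma ppart_sum: "y = ppart False y + ppart True y"
  by (rule qlin_eqI[OF qlin_id qlin_plus[OF qlin_ppart qlin_ppart]]) (simp add: ppart_mon)

lemma ppart_in: "ppart b y \<in> par_set b"
proof (induction y rule: free_induct)
  case (mon c w)
  show ?case using par_set_mon[of w b] by (simp add: qlin_const[OF qlin_ppart] ppart_mon par_set_const par_set_0)
qed (simp add: qlin_add[OF qlin_ppart] par_set_add)

lemma ppart_id: "y \<in> par_set b \<Longrightarrow> ppart b y = y"
proof -
  assume y: "y \<in> par_set b"
  have "ppart b y = (\<Sum>w\<in>Poly_Mapping.keys y. const (Poly_Mapping.lookup y w) * ppart b (mon (letters w)))"
    by (subst free_alg_expand[of y]) (simp add: qlin_sum[OF qlin_ppart] qlin_const[OF qlin_ppart])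
  also have "\<dots> = (\<Sum>w\<in>Poly_Mapping.keys y. const (Poly_Mapping.lookup y w) * mon (letters w))"
    using y by (intro sum.cong) (auto simp: ppart_mon par_set_def)
  finally show ?thesis by (simp only: free_alg_expand[symmetric])
qed

end

text \<open>By linear independence of the roots the weight \<open>\<mu>\<close> determines the
  element of the root lattice subtracted from \<open>l\<close>, and with it the parity.\<close>

lemma (in umod) ypart_ppart: "ypart l \<mu> (ppart False x) = 0 \<or> ypart l \<mu> (ppart True y) = 0"
proof (cases "\<exists>a. l - zroot D a = \<mu>")
  case True
  then obtain a where a: "l - zroot D a = \<mu>" by blast
  have u: "b = a" if "l - zroot D b = \<mu>" for b
  proof (rule zroot_inj)
    have "l - zroot D b = l - zroot D a" using that a by simp
    then show "zroot D b = zroot D a" by simp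
  qed
  have "ypart l \<mu> (ppart c z) = 0" if "odd (zpar D a) \<noteq> c" for c z
    by (rule qlin_eqI[OF qlin_compose[OF qlin_ypart qlin_ppart] qlin_zero])
       (use u that in \<open>auto simp: ppart_mon ypart_mon qlin_0[OF qlin_ypart] wX_def parl_def\<close>)
  then show ?thesis by (cases "odd (zpar D a)") auto
next
  case False
  have "ypart l \<mu> z = 0" for z
    by (rule qlin_eqI[OF qlin_ypart qlin_zero]) (use False in \<open>auto simp: ypart_mon wX_def\<close>)
  then show ?thesis by blast
qed

section \<open>Integrable highest weight modules\<close>

text \<open>A generator with the relations of V(l), so by \<open>Lid_app\<close> such a module is a
  quotient of V(l). The locale is later instantiated with cyclic submodules.\<close>

locale hw = umod D M for D :: "('i::finite, 'y::ab_group_add, 'x::ab_group_add) root_data"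
    and M :: "(('i, 'y) u_elt, 'm) module" (structure) +
  fixes l :: 'x and v :: 'm
  assumes sing_v: "sing l v"
    and gen_v: "carrier M = (\<lambda>y. dn y \<cdot> v) ` UNIV"
    and pow_v: "dn (gen i ^ hgt l i) \<cdot> v = \<zero>"
    and dom: "l \<in> dominant D"
begin

lemma v_carrier [simp]: "v \<in> carrier M" by (rule sing_carrier[OF sing_v])

lemma v_wsp: "v \<in> wsp l" by (rule sing_wsp[OF sing_v])

lemma hw_cases: "m \<in> carrier M \<Longrightarrow> (\<And>y. m = dn y \<cdot> v \<Longrightarrow> P) \<Longrightarrow> P"
  unfolding gen_v by blast

lemma hw_kills: "m \<in> carrier M \<Longrightarrow> \<exists>n. kills n m"
proof (erule hw_cases)
  fix y assume m: "m = dn y \<cdot> v"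
  have "\<exists>n. kills n (dn y \<cdot> v)"
  proof (induction y rule: free_induct)
    case (mon c w)
    have "kills (Suc (length w)) (dn (mon w) \<cdot> v)"
      unfolding kills_def app_dn[OF sing_v] by (auto simp: vact_up_long subst_gen_lin Suc_le_eq simp del: subst_gen_mon)
    then have "kills (Suc (length w)) (const c \<cdot> dn (mon w) \<cdot> v)" by (rule kills_const) simp
    then show ?case by (auto simp: subst_gen_lin app_mult)
  next
    case (add x y)
    then obtain a b where "kills a (dn x \<cdot> v)" "kills b (dn y \<cdot> v)" by blast
    then have "kills (max a b) (dn x \<cdot> v \<oplus> dn y \<cdot> v)" by (rule kills_gen_le) simp_all
    then show ?case by (auto simp: subst_gen_lin app_plus)
  qed
  then show ?thesis by (simp add: m)
qed

lemma hw_Fnil: "m \<in> carrier M \<Longrightarrow> Fnil i m"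
proof (erule hw_cases)
  fix y assume m: "m = dn y \<cdot> v"
  have "Fnil i v" unfolding Fnil_def using pow_v[of i] unfolding dn_power by blast
  then show ?thesis unfolding m by (intro Fnil_dn) simp_all
qed

definition gr :: "bool \<Rightarrow> 'm set" where "gr b = (\<lambda>y. dn y \<cdot> v) ` par_set b"

lemma weights_sum: "internal_direct_sum M UNIV wsp"
proof (rule internal_direct_sumI[OF wsp_subgroup _ wsp_indep])
  fix m assume "m \<in> carrier M"
  then obtain y where y: "m = dn y \<cdot> v" by (rule hw_cases)
  obtain L where L: "finite L" "y = (\<Sum>\<mu>\<in>L. ypart l \<mu> y)" using ypart_sum by blast
  have "m = (\<Oplus>\<mu>\<in>L. dn (ypart l \<mu> y) \<cdot> v)"
    unfolding y by (subst L(2)) (simp add: subst_gen_lin app_sum)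
  then show "spans_sum M UNIV wsp m"
    unfolding spans_sum_def using L(1) ypart_wsp[OF v_wsp]
    by (intro exI[of _ L] exI[of _ "\<lambda>\<mu>. dn (ypart l \<mu> y) \<cdot> v"]) auto
qed

lemma gr_subgroup: "additive_subgroup (gr b) M"
proof (rule additive_subgroupI')
  show "\<zero> \<in> gr b" unfolding gr_def by (rule rev_image_eqI[OF par_set_0]) (simp add: subst_gen_lin)
  show "x \<oplus> y \<in> gr b" if xy: "x \<in> gr b" "y \<in> gr b" for x y
  proof -
    obtain a c where "a \<in> par_set b" "c \<in> par_set b" "x = dn a \<cdot> v" "y = dn c \<cdot> v" using xy by (auto simp: gr_def)
    then show ?thesis unfolding gr_def by (intro rev_image_eqI[OF par_set_add]) (auto simp: subst_gen_lin app_plus)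
  qed
  show "const c \<cdot> x \<in> gr b" if x: "x \<in> gr b" for c x
  proof -
    obtain a where "a \<in> par_set b" "x = dn a \<cdot> v" using x by (auto simp: gr_def)
    then show ?thesis unfolding gr_def by (intro rev_image_eqI[OF par_set_const]) (auto simp: subst_gen_lin app_mult)
  qed
qed (auto simp: gr_def)

text \<open>Compared weight by weight: only one of the two parities can contribute to a given
  weight, so each of the two contributions vanishes.\<close>

lemma gr_indep:
  assumes "x \<in> gr False" "y \<in> gr True" "x \<oplus> y = \<zero>"
  shows "x = \<zero>" "y = \<zero>"
proof -
  obtain a b where a: "a \<in> par_set False" "x = dn a \<cdot> v" and b: "b \<in> par_set True" "y = dn b \<cdot> v"
    using assms by (auto simp: gr_def)
  have xy: "x \<in> carrier M" "y \<in> carrier M" using a b by simp_all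
  have z: "dn (a + b) \<cdot> v = \<zero>" using assms a b by (simp add: subst_gen_lin app_plus)
  have 0: "dn (ypart l \<mu> a) \<cdot> v \<oplus> dn (ypart l \<mu> b) \<cdot> v = \<zero>" for \<mu>
  proof -
    obtain p where "p \<cdot> dn (a + b) \<cdot> v = dn (ypart l \<mu> (a + b)) \<cdot> v" using ypart_proj[OF v_wsp] by blast
    then show ?thesis unfolding z by (simp add: qlin_add[OF qlin_ypart] subst_gen_lin app_plus)
  qed
  have ab: "ypart l \<mu> a = 0 \<or> ypart l \<mu> b = 0" for \<mu>
    using ypart_ppart[of l \<mu> a b] ppart_id[OF a(1)] ppart_id[OF b(1)] by simp
  have za: "dn (ypart l \<mu> a) \<cdot> v = \<zero>" for \<mu>
    using ab[of \<mu>]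
  proof (elim disjE)
    assume "ypart l \<mu> b = 0"
    then have "dn (ypart l \<mu> a) \<cdot> v \<oplus> \<zero> = \<zero>" using 0[of \<mu>] by (simp only: subst_gen_lin app_0 v_carrier)
    then show "dn (ypart l \<mu> a) \<cdot> v = \<zero>" by simp
  qed (simp add: subst_gen_lin)
  have "x = \<zero>" unfolding a(2) by (rule ypart_zero[OF za]) simp
  then show "x = \<zero>" "y = \<zero>" using assms(3) xy by simp_all
qed

lemma in_C: "in_C D M"
  unfolding in_C_def
proof (intro conjI exI[of _ gr])
  show "left_module (u_alg D) M" by (rule LM.left_module_axioms)
  show "internal_direct_sum M UNIV (weight_space D M)" by (rule weights_sum)
  show "internal_direct_sum M UNIV gr"
  proof (rule internal_direct_sumI[OF gr_subgroup])
    fix m assume "m \<in> carrier M"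
    then obtain y where y: "m = dn y \<cdot> v" by (rule hw_cases)
    have "m = (\<Oplus>b\<in>UNIV. dn (ppart b y) \<cdot> v)"
      unfolding y by (subst ppart_sum[of y]) (simp add: subst_gen_lin app_plus UNIV_bool)
    then show "spans_sum M UNIV gr m"
      unfolding spans_sum_def gr_def using ppart_in
      by (intro exI[of _ UNIV] exI[of _ "\<lambda>b. dn (ppart b y) \<cdot> v"]) auto
  next
    show "indep_sum M UNIV gr"
      unfolding indep_sum_def
    proof (intro allI impI ballI)
      fix F :: "bool set" and c k
      assume c: "\<forall>k\<in>F. c k \<in> gr k" "(\<Oplus>k\<in>F. c k) = \<zero>" "k \<in> F"
      have cc: "c k \<in> carrier M" if "k \<in> F" for k using c(1) that by (auto simp: gr_def)
      have "F \<in> Pow {False, True}" by (auto intro: bool.exhaust)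
      then consider "F = {}" | "F = {True}" | "F = {False}" | "F = UNIV"
        by (auto simp: Pow_insert UNIV_bool)
      then show "c k = \<zero>"
      proof cases
        case 4
        then show ?thesis using gr_indep[of "c False" "c True"] c cc by (cases k) (auto simp: UNIV_bool)
      qed (use c cc in auto)
    qed
  qed
  show "\<forall>a b. \<forall>u\<in>u_part D a. \<forall>m\<in>gr b. u \<odot> m \<in> gr (a \<noteq> b)"
  proof (intro allI ballI)
    fix a b u m assume u: "u \<in> u_part D a" and m: "m \<in> gr b"
    obtain x where x: "u = u_cls D x" "\<And>w. w \<in> Poly_Mapping.keys x \<Longrightarrow> odd (length (filter (gen_odd D) (letters w))) = a"
      using u by (auto simp: u_part_def)
    obtain y where y: "y \<in> par_set b" "m = dn y \<cdot> v" using m by (auto simp: gr_def)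
    have "u \<odot> m = dn (vact l x y) \<cdot> v" using app_dn[OF sing_v, of x y] by (simp add: x(1) y(2) app_def)
    then show "u \<odot> m \<in> gr (a \<noteq> b)" unfolding gr_def using vact_par[OF x(2) y(1)] by blast
  qed
  show "\<forall>\<mu>. \<forall>m\<in>weight_space D M \<mu>. \<exists>x\<in>weight_space D M \<mu> \<inter> gr False. \<exists>y\<in>weight_space D M \<mu> \<inter> gr True. m = x \<oplus> y"
  proof (intro allI ballI)
    fix \<mu> m assume m: "m \<in> wsp \<mu>"
    obtain y where y: "m = dn y \<cdot> v" using wsp_carrier[OF m] by (rule hw_cases)
    have e: "m = dn (ypart l \<mu> y) \<cdot> v" using ypart_eq[OF v_wsp] m y by simp
    have c: "ypart l \<mu> (ppart b y) = ppart b (ypart l \<mu> y)" for b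
      by (simp add: ypart_def ppart_def scal_scal mult.commute)
    have "dn (ppart b (ypart l \<mu> y)) \<cdot> v \<in> wsp \<mu> \<inter> gr b" for b
      using ypart_wsp[OF v_wsp, of \<mu> "ppart b y"] ppart_in[of b] by (auto simp: c gr_def)
    moreover have "m = dn (ppart False (ypart l \<mu> y)) \<cdot> v \<oplus> dn (ppart True (ypart l \<mu> y)) \<cdot> v"
      unfolding e by (subst ppart_sum) (simp add: subst_gen_lin app_plus)
    ultimately show "\<exists>x\<in>wsp \<mu> \<inter> gr False. \<exists>y\<in>wsp \<mu> \<inter> gr True. m = x \<oplus> y" by blast
  qed
qed

lemma integrable: "integrable_module D M"
  using hw_kills hw_Fnil by (rule integrableI)

lemma in_O_int: "in_O_int D M"
  unfolding in_O_int_def in_O_iff using in_C integrable hw_kills by blast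

end

section \<open>Eigenvalues of the Casimir operator\<close>

context umod begin

lemma ypart_ex: "ypart l \<mu> y \<noteq> 0 \<Longrightarrow> \<exists>w. \<mu> = l - wX D w"
proof (rule ccontr)
  assume *: "ypart l \<mu> y \<noteq> 0" "\<nexists>w. \<mu> = l - wX D w"
  have "ypart l \<mu> y = 0"
    by (rule qlin_eqI[OF qlin_ypart qlin_zero]) (use *(2) in \<open>auto simp: ypart_mon\<close>)
  then show False using * by simp
qed

lemma wX_zero: "wX D w = 0 \<longleftrightarrow> w = []"
proof
  assume "wX D w = 0"
  then have "wt (FM w) = wt (FM [])" using wX_eq_iff[of w "[]"] by simp
  then have "int (length w) = int (length ([] :: 'i list))" by (simp only: length_wt[symmetric])
  then show "w = []" by simp
qed simp

lemma ypart_top: "ypart l l y = const (Poly_Mapping.lookup y 0)"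
proof (rule qlin_eqI[OF qlin_ypart])
  show "qlin (\<lambda>y. const (Poly_Mapping.lookup y 0))" by (simp add: qlin_def lookup_add const_simps)
  show "ypart l l (mon w) = const (Poly_Mapping.lookup (mon w) 0)" for w
  proof (cases "w = []")
    case False
    then have "Poly_Mapping.lookup (mon w) 0 = 0" by (simp add: mon_def lookup_single zero_free_monoid_def)
    then show ?thesis using False by (simp add: ypart_mon wX_zero const_simps)
  next
    case True
    have "ypart l l (mon []) = mon []" by (simp only: ypart_mon) simp
    then show ?thesis using True by (simp add: mon_Nil const_simps)
  qed
qed

lemma finsum_in: "submod Z \<Longrightarrow> (\<And>a. a \<in> A \<Longrightarrow> c a \<in> Z) \<Longrightarrow> (\<Oplus>a\<in>A. c a) \<in> Z"
proof (induction A rule: infinite_finite_induct)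
  case (insert a F)
  then show ?case using submodD[OF insert.prems(1)] by (subst LM.M.finsum_insert) (auto simp: Pi_iff)
qed (auto simp: submodD(2))

lemma app_sum_in: "submod Z \<Longrightarrow> m \<in> carrier M \<Longrightarrow> (\<And>a. a \<in> A \<Longrightarrow> f a \<cdot> m \<in> Z) \<Longrightarrow> (sum f A) \<cdot> m \<in> Z"
  by (simp add: app_sum finsum_in)

text \<open>In positive degree the letter of the E-word that acts first already sends
  \<open>m\<close> into \<open>Z\<close>. Degree 0 contributes the scalar.\<close>

lemma OmG_mod:
  assumes Z: "submod Z" and m: "m \<in> carrier M" and E: "\<And>i. gE i \<cdot> m \<in> Z"
  shows "(OmG n \<mu> - const (gam \<mu>)) \<cdot> m \<in> Z"
proof -
  have u: "up (mon w) \<cdot> m \<in> Z" if "w \<noteq> []" for w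
    using that submodD(4)[OF Z E]
    by (cases w rule: rev_cases) (auto simp: mon_append subst_gen_mult app_mult m simp flip: gen_eq_mon)
  have "Cas (Suc k) \<mu> \<cdot> m \<in> Z" for k
    unfolding Cas_def casum_def
  proof (intro app_sum_in[OF Z m])
    fix v w :: "'i list" assume "w \<in> words (Suc k)"
    then have "up (mon w) \<cdot> m \<in> Z" by (intro u) (auto simp: words_def)
    then show "(const (cas_inv (Suc k) v w) * (dn (mon v) * up (scal (cf \<mu>) (mon w)))) \<cdot> m \<in> Z"
      using m by (simp add: app_mult subst_gen_lin submodD(4)[OF Z] del: subst_gen_mon)
  qed
  then have "(const (gam \<mu>) * (\<Sum>k<n. Cas (Suc k) \<mu>)) \<cdot> m \<in> Z"
    using m by (simp add: app_mult submodD(4)[OF Z] app_sum_in[OF Z m])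
  moreover have "OmG n \<mu> - const (gam \<mu>) = const (gam \<mu>) * (\<Sum>k<n. Cas (Suc k) \<mu>)"
    by (simp add: OmG_def Om_def sum.atMost_shift Cas_0 distrib_left)
  ultimately show ?thesis by simp
qed

lemma Om_sing:
  assumes "sing \<mu> z"
  shows "OmG n \<mu> \<cdot> z = const (gam \<mu>) \<cdot> z"
  using OmG_mod[OF submod_zero, of z n \<mu>] sing_carrier[OF assms] sing_gE[OF assms] by (simp add: app_eq_iff)

end

text \<open>The operator has eigenvalue \<open>gam l\<close> on \<open>v\<close> and commutes with
  the F. The bound \<open>N\<close> depends on \<open>y\<close>, because \<open>OmG_gF\<close> asks
  for vectors killed by all words at least as long as the truncation degree.\<close>

lemma (in umod) Om_dn:
  assumes s: "sing l v"
  shows "\<exists>N. \<forall>n\<ge>N. OmG n \<mu> \<cdot> dn (ypart l \<mu> y) \<cdot> v = const (gam l) \<cdot> dn (ypart l \<mu> y) \<cdot> v"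
proof (induction y rule: free_induct)
  have c: "v \<in> carrier M" using s by (rule sing_carrier)
  {
    case (mon a w)
    have k: "kills (Suc (length w)) (dn (mon w) \<cdot> v)" for w
      unfolding kills_def app_dn[OF s] using c by (auto simp: vact_up_long subst_gen_lin Suc_le_eq simp del: subst_gen_mon)
    have "OmG n (l - wX D w) \<cdot> dn (mon w) \<cdot> v = const (gam l) \<cdot> dn (mon w) \<cdot> v" if "length w \<le> n" for n
      using that
    proof (induction w)
      case Nil
      then show ?case using Om_sing[OF s] c by (simp add: mon_Nil app_one)
    next
      case (Cons j w)
      have e: "dn (mon (j # w)) \<cdot> v = gF j \<cdot> dn (mon w) \<cdot> v" using c by (simp add: mon_Cons[of "GF _"] app_mult)
      have "OmG n (l - wX D w - root D j) \<cdot> gF j \<cdot> dn (mon w) \<cdot> v = gF j \<cdot> OmG n (l - wX D w) \<cdot> dn (mon w) \<cdot> v"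
        using Cons.prems by (intro OmG_gF wsp_dn sing_wsp[OF s] kills_mono[OF k]) simp
      also have "\<dots> = const (gam l) \<cdot> gF j \<cdot> dn (mon w) \<cdot> v"
        using Cons c by (simp add: app_const_comm[of _ "gen _"] del: subst_gen_mon)
      finally show ?case unfolding e by (simp add: diff_diff_eq add.commute del: subst_gen_mon)
    qed
    then have "\<forall>n\<ge>length w. OmG n \<mu> \<cdot> dn (ypart l \<mu> (const a * mon w)) \<cdot> v = const (gam l) \<cdot> dn (ypart l \<mu> (const a * mon w)) \<cdot> v"
      using c by (auto simp: qlin_const[OF qlin_ypart] ypart_mon subst_gen_lin app_mult app_const_comm[of _ "OmG _ _"]
        app_const_const mult.commute simp del: subst_gen_mon)
    then show ?case by blast
  next
    case (add x y)
    then obtain A B where AB: "\<forall>n\<ge>A. OmG n \<mu> \<cdot> dn (ypart l \<mu> x) \<cdot> v = const (gam l) \<cdot> dn (ypart l \<mu> x) \<cdot> v"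
      "\<forall>n\<ge>B. OmG n \<mu> \<cdot> dn (ypart l \<mu> y) \<cdot> v = const (gam l) \<cdot> dn (ypart l \<mu> y) \<cdot> v" by blast
    then have "\<forall>n\<ge>max A B. OmG n \<mu> \<cdot> dn (ypart l \<mu> (x + y)) \<cdot> v = const (gam l) \<cdot> dn (ypart l \<mu> (x + y)) \<cdot> v"
      using c by (simp add: qlin_add[OF qlin_ypart] subst_gen_lin app_plus app_add)
    then show ?case by blast
  }
qed

context datum begin

text \<open>The two scalars differ by a factor \<open>\<pi>\<^sup>e q\<^sup>-\<^sup>N\<close> with \<open>N = \<Sum> d\<^sub>i (\<langle>i,\<lambda>\<rangle> + \<langle>i,\<mu>\<rangle> + 2)\<close>, summed over the letters
  of \<open>w\<close>, which is positive because both weights are dominant.\<close>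

lemma gam_diff:
  assumes "l \<in> dominant D" "l - wX D w \<in> dominant D" "w \<noteq> []"
  shows "(gam (l - wX D w) - gam l) dvd 1"
proof -
  have "\<exists>e. gam l = gam (l - wX D w) * qp e (- (\<Sum>i\<leftarrow>w. dd D i * (2 * cr i l - cr i (wX D w) + 2)))"
  proof (induction w)
    case Nil
    then show ?case by (intro exI[of _ 0]) simp
  next
    case (Cons i w)
    let ?\<mu> = "l - wX D (i # w)"
    have e: "l - wX D w = ?\<mu> + root D i" by simp
    \<comment> \<open>Prepending \<open>i\<close> raises the pairing in the summand for
      \<open>j\<close> by <j,i'>; since d_j <j,i'> = i.j, the total change is
      \<open>dotl D [i] w\<close>.\<close>
    have sw: "(\<Sum>j\<leftarrow>w. dd D j * (2 * cr j l - (cr j (root D i) + cr j (wX D w)) + 2)) =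
       (\<Sum>j\<leftarrow>w. dd D j * (2 * cr j l - cr j (wX D w) + 2)) - dotl D [i] w" for w
    proof -
      have "(\<Sum>j\<leftarrow>u. dd D j * (2 * cr j l - (cr j (root D i) + x j) + 2)) = (\<Sum>j\<leftarrow>u. dd D j * (2 * cr j l - x j + 2)) - dotl D [i] u" for u and x :: "'i \<Rightarrow> int"
      proof (induction u)
        case (Cons j u)
        have "dd D j * (2 * cr j l - (cr j (root D i) + x j) + 2) = dd D j * (2 * cr j l - x j + 2) - dot D i j"
          using cr_root[of j i] by (simp add: algebra_simps dot_sym[of j i])
        then show ?case using Cons by (simp add: dotl_Cons(2)[of D "[i]"])
      qed simp
      then show ?thesis .
    qed
    obtain t where t: "gam l = gam (l - wX D w) * qp t (- (\<Sum>i\<leftarrow>w. dd D i * (2 * cr i l - cr i (wX D w) + 2)))"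
      using Cons by blast
    have c: "dd D i * cr i (wX D w) = dotl D [i] w" by (rule cr_wX)
    have "gam l = gam ?\<mu> * qp (t + par D i * cr i ?\<mu>) (- 2 * dd D i * cr i ?\<mu> - 4 * dd D i - (\<Sum>i\<leftarrow>w. dd D i * (2 * cr i l - cr i (wX D w) + 2)))"
      unfolding t e gam_step tE_def by (simp add: mult_ac qp_mult)
    also have "- 2 * dd D i * cr i ?\<mu> - 4 * dd D i - (\<Sum>i\<leftarrow>w. dd D i * (2 * cr i l - cr i (wX D w) + 2))
      = - (\<Sum>j\<leftarrow>i # w. dd D j * (2 * cr j l - cr j (wX D (i # w)) + 2))"
      using sw[of w] c by (simp add: algebra_simps)
    finally show ?case by blast
  qed
  then obtain e where e: "gam l = gam (l - wX D w) * qp e (- (\<Sum>i\<leftarrow>w. dd D i * (2 * cr i l - cr i (wX D w) + 2)))" by blast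
  have pos: "dd D i * (2 * cr i l - cr i (wX D w) + 2) > 0" for i
  proof -
    have "0 \<le> cr i l" "0 \<le> cr i (l - wX D w)" using assms by (auto simp: dominant_def)
    then have "2 * cr i l - cr i (wX D w) + 2 > 0" by simp
    then show ?thesis using dd_pos[of i] by simp
  qed
  have "(\<Sum>i\<leftarrow>u. dd D i * (2 * cr i l - cr i (wX D w) + 2)) > 0" if "u \<noteq> []" for u
    using that
  proof (induction u)
    case (Cons j u)
    then show ?case using pos[of j] by (cases u) auto
  qed simp
  then have "(qp 0 0 - qp e (- (\<Sum>i\<leftarrow>w. dd D i * (2 * cr i l - cr i (wX D w) + 2)))) dvd 1"
    using assms(3) by (intro qp_diff_unit) force
  moreover have "gam (l - wX D w) - gam l = gam (l - wX D w) * (qp 0 0 - qp e (- (\<Sum>i\<leftarrow>w. dd D i * (2 * cr i l - cr i (wX D w) + 2))))"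
    by (subst e) (simp add: right_diff_distrib)
  ultimately show ?thesis using mult_dvd_mono[OF gam_unit] by fastforce
qed

end

section \<open>Eigenvectors of \<open>\<pi>\<close>\<close>

lemma two_unit_qpi: "(1 + 1 :: qpi) dvd 1"
  unfolding unit_qpi_iff ev_plus_simps ev_minus_simps using two_neq_zero_qfield by blast

text \<open>Modulo \<open>pi_elt - e\<close> the ground ring becomes a field, so an element is
  either invertible there or divisible by \<open>pi_elt - e\<close>. The witnesses are prescribed on
  the two components.\<close>

lemma pi_local:
  assumes "e = 1 \<or> e = - 1"
  shows "(\<exists>d a. d * c + a * (pi_elt - e) = 1) \<or> (\<exists>a. c = a * (pi_elt - e))"
proof -
  have n2: "- (1 :: qfield) - 1 \<noteq> 0" using two_neq_zero_qfield by (simp add: minus_one_neq_one_qfield)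
  have t: "x / (- (1 :: qfield) - 1) * (- 1 - 1) = x" "x / ((1 :: qfield) + 1) * (1 + 1) = x" for x
    by (rule nonzero_eq_divide_eq[THEN iffD1, OF _ refl], use n2 two_neq_zero_qfield in blast)+
  from assms show ?thesis
  proof (elim disjE)
    assume e: "e = 1"
    show ?thesis
    proof (cases "ev_plus c = 0")
      case True
      obtain a where "ev_plus a = 0" "ev_minus a = ev_minus c / (- 1 - 1)" using ev_surj by blast
      then have "c = a * (pi_elt - e)" unfolding qpi_eq_iff using True by (simp add: e t del: minus_add_distrib)
      then show ?thesis by blast
    next
      case False
      obtain d where d: "ev_plus d = 1 / ev_plus c" "ev_minus d = 0" using ev_surj by blast
      obtain a where a: "ev_plus a = 0" "ev_minus a = 1 / (- 1 - 1)" using ev_surj by blast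
      have "d * c + a * (pi_elt - e) = 1" unfolding qpi_eq_iff using False d a by (simp add: e t)
      then show ?thesis by blast
    qed
  next
    assume e: "e = - 1"
    show ?thesis
    proof (cases "ev_minus c = 0")
      case True
      obtain a where "ev_minus a = 0" "ev_plus a = ev_plus c / (1 + 1)" using ev_surj by blast
      then have "c = a * (pi_elt - e)" unfolding qpi_eq_iff using True t(2) by (simp add: e del: one_add_one)
      then show ?thesis by blast
    next
      case False
      obtain d where d: "ev_minus d = 1 / ev_minus c" "ev_plus d = 0" using ev_surj by blast
      obtain a where a: "ev_minus a = 0" "ev_plus a = 1 / (1 + 1)" using ev_surj by blast
      have "d * c + a * (pi_elt - e) = 1" unfolding qpi_eq_iff using False d a t(2) by (simp add: e del: one_add_one)
      then show ?thesis by blast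
    qed
  qed
qed

context umod begin

definition pev :: "qpi \<Rightarrow> 'm \<Rightarrow> bool" where
  "pev e s \<longleftrightarrow> (e = 1 \<or> e = - 1) \<and> const pi_elt \<cdot> s = const e \<cdot> s"

lemma pev_app: "pev e s \<Longrightarrow> s \<in> carrier M \<Longrightarrow> pev e (x \<cdot> s)"
  unfolding pev_def by (metis app_const_comm)

lemma pev_diff: "pev e s \<Longrightarrow> s \<in> carrier M \<Longrightarrow> const (a * (pi_elt - e)) \<cdot> s = \<zero>"
proof -
  assume s: "pev e s" "s \<in> carrier M"
  have "const pi_elt \<cdot> s = const e \<cdot> s" using s by (simp add: pev_def)
  then have "const (pi_elt - e) \<cdot> s = \<zero>" using s(2) by (simp add: app_eq_iff const_simps)
  then show "const (a * (pi_elt - e)) \<cdot> s = \<zero>" using s(2) by (simp flip: app_const_const)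
qed

lemma pev_field: "pev e s \<Longrightarrow> s \<in> carrier M \<Longrightarrow> const c \<cdot> s \<noteq> \<zero> \<Longrightarrow> \<exists>d. const d \<cdot> const c \<cdot> s = s"
proof -
  assume s: "pev e s" "s \<in> carrier M" "const c \<cdot> s \<noteq> \<zero>"
  have e: "e = 1 \<or> e = - 1" using s by (simp add: pev_def)
  have "c \<noteq> a * (pi_elt - e)" for a using s pev_diff by blast
  then obtain d a where da: "d * c + a * (pi_elt - e) = 1" using pi_local[OF e, of c] by blast
  have "const (d * c + a * (pi_elt - e)) \<cdot> s = const (d * c) \<cdot> s \<oplus> const (a * (pi_elt - e)) \<cdot> s"
    using s(2) by (simp add: const_simps app_plus)
  then have "s = const (d * c) \<cdot> s"
    unfolding da pev_diff[OF s(1,2)] using s(2) by (simp add: const_simps app_one)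
  then show ?thesis using s(2) by (intro exI[of _ d]) (simp add: app_const_const)
qed

lemma pev_unique: "pev e s \<Longrightarrow> pev e' s \<Longrightarrow> s \<in> carrier M \<Longrightarrow> s \<noteq> \<zero> \<Longrightarrow> e = e'"
proof (rule ccontr)
  assume s: "pev e s" "pev e' s" "s \<in> carrier M" "s \<noteq> \<zero>" and ne: "e \<noteq> e'"
  have "const e \<cdot> s = const e' \<cdot> s" using s by (simp add: pev_def)
  then have 0: "const (e - e') \<cdot> s = \<zero>" using s(3) by (simp add: app_eq_iff const_simps)
  have "e - e' = 1 + 1 \<or> e - e' = - (1 + 1)" using s(1,2) ne by (auto simp: pev_def)
  then have "e - e' dvd 1" using two_unit_qpi by (auto simp only: minus_dvd_iff)
  from const_unit_cancel[OF this s(3)] show False unfolding 0 using s(4) by simp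
qed

lemma pev_const: "s \<in> carrier M \<Longrightarrow> e = 1 \<or> e = - 1 \<Longrightarrow> pev e (const (pi_elt + e) \<cdot> s)"
proof -
  assume s: "s \<in> carrier M" "e = 1 \<or> e = - 1"
  have "pi_elt * (pi_elt + e) = e * (pi_elt + e)" unfolding qpi_eq_iff using s(2) by auto
  then show ?thesis using s by (simp add: pev_def app_const_const)
qed

lemma sing_const: "sing l s \<Longrightarrow> sing l (const c \<cdot> s)"
  unfolding sing_def using wsp_const wsp_carrier by (auto simp: app_const_comm[of _ "gen _"])

lemma kills_up: "kills n m \<Longrightarrow> m \<in> carrier M \<Longrightarrow> kills n (up (mon w) \<cdot> m)"
  unfolding kills_def
proof (intro allI impI)
  fix u :: "'i list" assume *: "\<forall>w. n \<le> length w \<longrightarrow> up (mon w) \<cdot> m = \<zero>" "m \<in> carrier M" "n \<le> length u"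
  have "up (mon (u @ w)) \<cdot> m = \<zero>" using *(1)[rule_format, of "u @ w"] *(3) by simp
  then show "up (mon u) \<cdot> up (mon w) \<cdot> m = \<zero>" using *(2) by (simp add: mon_append subst_gen_mult app_mult)
qed

text \<open>Such a word has maximal length among those that keep \<open>m\<close> outside
  \<open>Z\<close>. For \<open>Z\<close> zero it produces a singular vector, in general one that is
  singular modulo \<open>Z\<close>.\<close>

lemma top_word:
  assumes "kills n m" "m \<in> carrier M" "submod Z" "m \<notin> Z"
  shows "\<exists>w. up (mon w) \<cdot> m \<notin> Z \<and> (\<forall>i. gE i \<cdot> up (mon w) \<cdot> m \<in> Z)"
proof -
  let ?P = "\<lambda>k. \<forall>w. k \<le> length w \<longrightarrow> up (mon w) \<cdot> m \<in> Z"
  define k where "k = (LEAST k. ?P k)"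
  have "?P n" using assms(1) submodD(2)[OF assms(3)] by (auto simp: kills_def)
  then have k: "?P k" unfolding k_def by (rule LeastI)
  have "k \<noteq> 0"
  proof
    assume "k = 0"
    then have "up (mon []) \<cdot> m \<in> Z" using k by blast
    then show False using assms by (simp add: mon_Nil app_one)
  qed
  then obtain r where r: "k = Suc r" by (cases k) auto
  then have "\<not> ?P r" using not_less_Least[of r ?P] by (simp add: k_def)
  then obtain w where w: "r \<le> length w" "up (mon w) \<cdot> m \<notin> Z" by blast
  have "gE i \<cdot> up (mon w) \<cdot> m \<in> Z" for i
  proof -
    have "up (mon (i # w)) \<cdot> m \<in> Z" using k[rule_format, of "i # w"] w(1) r by simp
    then show ?thesis using assms(2) by (simp add: mon_Cons[of "GE _"] app_mult)
  qed
  then show ?thesis using w(2) by blast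
qed

end

lemma (in hw) submod_full:
  assumes v: "v \<noteq> \<zero>" "pev e v" and N: "submod N" "N \<noteq> {\<zero>}"
  shows "N = carrier M"
proof -
  obtain n where n: "n \<in> N" "n \<noteq> \<zero>" using N submodD(2)[OF N(1)] by blast
  obtain y where y: "n = dn y \<cdot> v" using submodD(1)[OF N(1) n(1)] by (rule hw_cases)
  \<comment> \<open>Some weight component of \<open>n\<close> is nonzero, and it lies in
    \<open>N\<close> again because the projection is the action of an algebra element.\<close>
  obtain \<mu> where \<mu>: "dn (ypart l \<mu> y) \<cdot> v \<noteq> \<zero>" using ypart_zero[of l y v] n(2) y by auto
  define x where "x = dn (ypart l \<mu> y) \<cdot> v"
  have xw: "x \<in> wsp \<mu>" unfolding x_def by (rule ypart_wsp[OF v_wsp])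
  have xc: "x \<in> carrier M" using xw by (rule wsp_carrier)
  obtain p where "p \<cdot> dn y \<cdot> v = x" using ypart_proj[OF v_wsp, of y \<mu>] unfolding x_def by blast
  then have xN: "x \<in> N" using submodD(4)[OF N(1) n(1), of p] y by simp
  obtain k where k: "kills k x" using hw_kills[OF xc] by blast
  have "x \<notin> {\<zero>}" using \<mu> by (simp add: x_def)
  then obtain w where w: "up (mon w) \<cdot> x \<notin> {\<zero>}" "\<forall>i. gE i \<cdot> up (mon w) \<cdot> x \<in> {\<zero>}"
    using top_word[OF k xc submod_zero] by blast
  define z where "z = up (mon w) \<cdot> x"
  define \<kappa> where "\<kappa> = \<mu> + wX D w"
  have z: "z \<noteq> \<zero>" "sing \<kappa> z" "z \<in> N"
    using w wsp_up[OF xw, of w] submodD(4)[OF N(1) xN] by (auto simp: z_def \<kappa>_def sing_def simp del: subst_gen_mon)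
  have zc: "z \<in> carrier M" using z(2) by (rule sing_carrier)
  obtain y' where y': "z = dn y' \<cdot> v" using zc by (rule hw_cases)
  have zy: "z = dn (ypart l \<kappa> y') \<cdot> v" using ypart_eq[OF v_wsp, of y' \<kappa>] sing_wsp[OF z(2)] y' by simp
  have "ypart l \<kappa> y' \<noteq> 0" using zy z(1) by (auto simp: subst_gen_lin)
  then obtain u where u: "\<kappa> = l - wX D u" using ypart_ex by blast
  have "0 \<le> cr i \<kappa>" for i
  proof -
    obtain n where "gF i ^ n \<cdot> z = \<zero>" using hw_Fnil[OF zc, of i] by (auto simp: Fnil_def)
    then show ?thesis
      using dominant_mod(1)[OF sing_wsp[OF z(2)] _ submod_zero, of i n] z(1) sing_gE[OF z(2)] by simp
  qed
  then have dk: "l - wX D u \<in> dominant D" by (simp add: u dominant_def)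
  have "u = []"
  proof (rule ccontr)
    assume "u \<noteq> []"
    then have gu: "(gam \<kappa> - gam l) dvd 1" using gam_diff[OF dom dk] by (simp add: u)
    obtain n where "OmG n \<kappa> \<cdot> z = const (gam l) \<cdot> z" using Om_dn[OF sing_v, of \<kappa> y'] unfolding zy[symmetric] by blast
    then have "const (gam \<kappa>) \<cdot> z = const (gam l) \<cdot> z" using Om_sing[OF z(2), of n] by simp
    then have gz: "const (gam \<kappa> - gam l) \<cdot> z = \<zero>" using zc by (simp add: app_eq_iff const_simps)
    from const_unit_cancel[OF gu zc] show False unfolding gz using z(1) by simp
  qed
  then have "z = const (Poly_Mapping.lookup y' 0) \<cdot> v" using zy by (simp add: u ypart_top subst_gen_const)
  then have "\<exists>d. const d \<cdot> z = v" using pev_field[OF v(2)] z(1) by simp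
  then have "v \<in> N" using submodD(4)[OF N(1) z(3)] by auto
  then have "carrier M \<subseteq> N" unfolding gen_v using submodD(4)[OF N(1)] by auto
  then show ?thesis using submodD(1)[OF N(1)] by blast
qed

lemma (in hw) simple:
  assumes "v \<noteq> \<zero>" "pev e v"
  shows "simple_in_O_int D M"
  unfolding simple_in_O_int_def submod_iff using in_O_int submod_full[OF assms] assms(1) v_carrier by blast

section \<open>Cyclic submodules generated by singular vectors\<close>

context umod begin

definition cyc :: "'m \<Rightarrow> 'm set" where "cyc s = (\<lambda>y. dn y \<cdot> s) ` UNIV"

lemma cyc_self: "s \<in> carrier M \<Longrightarrow> s \<in> cyc s"
  unfolding cyc_def by (rule image_eqI[of _ _ 1]) (simp_all add: app_one)

lemma submod_cyc: "sing l s \<Longrightarrow> submod (cyc s)"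
proof -
  assume s: "sing l s"
  have c: "s \<in> carrier M" using s by (rule sing_carrier)
  have "dn x \<cdot> s \<oplus> dn y \<cdot> s = dn (x + y) \<cdot> s" for x y using c by (simp add: subst_gen_lin app_plus)
  moreover have "\<zero> = dn 0 \<cdot> s" using c by (simp add: subst_gen_lin)
  ultimately show ?thesis using c unfolding submod_def cyc_def by (auto simp: app_dn[OF s])
qed

lemma umod_submod: "submod N \<Longrightarrow> umod D (M\<lparr>carrier := N\<rparr>)"
proof -
  assume N: "submod N"
  have "abelian_group (M\<lparr>carrier := N\<rparr>)"
  proof (rule abelian_groupI)
    fix x assume "x \<in> carrier (M\<lparr>carrier := N\<rparr>)"
    then have x: "x \<in> N" by simp
    then have "(- 1) \<cdot> x \<in> N" "(- 1) \<cdot> x \<oplus> x = \<zero>"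
      using submodD(4)[OF N x, of "- 1"] submodD(1)[OF N x] by (simp_all add: app_uminus app_one LM.M.l_neg)
    then show "\<exists>y\<in>carrier (M\<lparr>carrier := N\<rparr>). y \<oplus>\<^bsub>M\<lparr>carrier := N\<rparr>\<^esub> x = \<zero>\<^bsub>M\<lparr>carrier := N\<rparr>\<^esub>" by auto
  qed (use submodD[OF N] LM.M.a_assoc LM.M.a_comm in auto)
  moreover have "left_module_axioms (u_alg D) (M\<lparr>carrier := N\<rparr>)"
    by (rule left_module_axioms.intro)
      (use submodD[OF N] in \<open>auto simp: u_alg_simps app_plus app_add app_mult app_one simp flip: app_def\<close>)
  ultimately show ?thesis
    unfolding umod_def left_module_def using datum_axioms ring_u_alg by blast
qed

lemma app_sub: "submod N \<Longrightarrow> umod.app D (M\<lparr>carrier := N\<rparr>) x m = x \<cdot> m"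
  by (simp add: umod.app_def[OF umod_submod] app_def)

lemma sing_sub: "submod N \<Longrightarrow> s \<in> N \<Longrightarrow> umod.sing D (M\<lparr>carrier := N\<rparr>) l s \<longleftrightarrow> sing l s"
  unfolding sing_def umod.sing_def[OF umod_submod] using submodD(1)
  by (simp add: wsp_iff umod.wsp_iff[OF umod_submod] app_sub)

text \<open>Vectors that generate a copy of the plus part of V(l) for \<open>e = 1\<close>, or of
  its minus part for \<open>e = - 1\<close>, by \<open>good_V_iso\<close>.\<close>

definition good :: "qpi \<Rightarrow> 'x \<Rightarrow> 'm \<Rightarrow> bool" where
  "good e l s \<longleftrightarrow> sing l s \<and> s \<noteq> \<zero> \<and> pev e s \<and> l \<in> dominant D \<and> (\<forall>i. dn (gen i ^ hgt l i) \<cdot> s = \<zero>)"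

lemma good_carrier: "good e l s \<Longrightarrow> s \<in> carrier M"
  unfolding good_def using sing_carrier by blast

lemma good_submod: "good e l s \<Longrightarrow> submod (cyc s)"
  unfolding good_def using submod_cyc by blast

lemma good_hw: "good e l s \<Longrightarrow> hw D (M\<lparr>carrier := cyc s\<rparr>) l s"
proof -
  assume s: "good e l s"
  have N: "submod (cyc s)" using s by (rule good_submod)
  show ?thesis
    unfolding hw_def hw_axioms_def
    using umod_submod[OF N] s cyc_self[OF good_carrier[OF s]] by (simp add: app_sub[OF N] sing_sub[OF N] good_def) (simp add: cyc_def)
qed

lemma good_simple: "good e l s \<Longrightarrow> simple_in_O_int D (M\<lparr>carrier := cyc s\<rparr>)"
proof -
  assume s: "good e l s"
  have N: "submod (cyc s)" using s by (rule good_submod)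
  have "umod.pev D (M\<lparr>carrier := cyc s\<rparr>) e s"
    using s by (simp add: umod.pev_def[OF umod_submod[OF N]] app_sub[OF N] good_def pev_def)
  then show ?thesis using s by (intro hw.simple[OF good_hw[OF s]]) (simp_all add: good_def)
qed

lemma good_submod_cases:
  assumes s: "good e l s" and Z: "submod Z" "Z \<subseteq> cyc s"
  shows "Z = {\<zero>} \<or> Z = cyc s"
proof -
  have N: "submod (cyc s)" using s by (rule good_submod)
  have "umod.submod D (M\<lparr>carrier := cyc s\<rparr>) Z"
    using Z by (simp add: umod.submod_def[OF umod_submod[OF N]] app_sub[OF N] submod_def)
  then show ?thesis
    using good_simple[OF s] by (simp add: simple_in_O_int_def umod.submod_iff[OF umod_submod[OF N]])
qed

lemma good_weight:
  assumes s: "good e l s" and x: "x \<in> cyc s" "x \<noteq> \<zero>" "x \<in> wsp \<mu>"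
  shows "\<exists>w. \<mu> = l - wX D w"
proof -
  obtain y where "x = dn y \<cdot> s" using x by (auto simp: cyc_def)
  then have "x = dn (ypart l \<mu> y) \<cdot> s" using ypart_eq[of s l y \<mu>] s x by (simp add: good_def sing_wsp)
  then have "ypart l \<mu> y \<noteq> 0" using x good_carrier[OF s] by (auto simp: subst_gen_lin)
  then show ?thesis by (rule ypart_ex)
qed

text \<open>An isomorphism preserves weights and the action of pi. Each highest weight occurs in the
  other module, so \<open>l\<close> and \<open>l'\<close> differ by sums of roots in both
  directions, and these sums must be empty.\<close>

lemma good_iso_imp:
  assumes U: "umod D M'" and s: "good e l s" and s': "umod.good D M' e' l' s'"
    and iso: "module_isomorphic (u_alg D) (M\<lparr>carrier := cyc s\<rparr>) (M'\<lparr>carrier := umod.cyc D M' s'\<rparr>)"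
  shows "l = l' \<and> e = e'"
proof -
  interpret U: umod D M' by (rule U)
  obtain h where h: "bij_betw h (cyc s) (U.cyc s')"
      and hs: "\<And>r x. r \<in> carrier (u_alg D) \<Longrightarrow> x \<in> cyc s \<Longrightarrow> h (r \<odot> x) = r \<odot>\<^bsub>M'\<^esub> h x"
    using iso by (auto simp: module_isomorphic_def)
  note N = good_submod[OF s] and N' = U.good_submod[OF s']
  have ha: "h (u \<cdot> x) = U.app u (h x)" if "x \<in> cyc s" for u x
    using hs[OF _ that] by (simp add: app_def U.app_def)
  have h0: "h \<zero> = \<zero>\<^bsub>M'\<^esub>" using ha[OF submodD(2)[OF N], of 0] U.submodD(1)[OF N'] bij_betwE[OF h] submodD(2)[OF N]
    by simp
  have inj: "x = y" if "h x = h y" "x \<in> cyc s" "y \<in> cyc s" for x y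
    using bij_betw_imp_inj_on[OF h] that by (simp add: inj_on_def)
  have wt: "U.wsp \<mu> \<inter> U.cyc s' = h ` (wsp \<mu> \<inter> cyc s)" for \<mu>
  proof -
    have "h x \<in> U.wsp \<mu> \<longleftrightarrow> x \<in> wsp \<mu>" if x: "x \<in> cyc s" for x
    proof -
      have c: "x \<in> carrier M" "h x \<in> carrier M'" using submodD(1)[OF N x] U.submodD(1)[OF N'] bij_betwE[OF h] x by auto
      have "U.app u (h x) = U.app u' (h x) \<longleftrightarrow> u \<cdot> x = u' \<cdot> x" for u u'
        using inj[of "u \<cdot> x" "u' \<cdot> x"] submodD(4)[OF N x] by (auto simp flip: ha[OF x])
      then show ?thesis using c by (simp add: wsp_iff U.wsp_iff)
    qed
    then have "h ` (wsp \<mu> \<inter> cyc s) = U.wsp \<mu> \<inter> h ` cyc s" by blast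
    then show ?thesis using bij_betw_imp_surj_on[OF h] by blast
  qed
  have ss: "s \<in> cyc s" "s' \<in> U.cyc s'" "s \<in> wsp l" "s' \<in> U.wsp l'" "s \<noteq> \<zero>" "s' \<noteq> \<zero>\<^bsub>M'\<^esub>"
    using cyc_self[OF good_carrier[OF s]] U.cyc_self[OF U.good_carrier[OF s']] s s'
    by (auto simp: good_def U.good_def sing_wsp U.sing_wsp)
  have hn: "h s \<noteq> \<zero>\<^bsub>M'\<^esub>" using inj[of s \<zero>] ss submodD(2)[OF N] h0 by auto
  have "h s \<in> U.wsp l \<inter> U.cyc s'" unfolding wt using ss by blast
  then obtain w' where w': "l = l' - wX D w'" using U.good_weight[OF s' _ hn] by blast
  obtain x where x: "s' = h x" "x \<in> wsp l'" "x \<in> cyc s" using wt[of l'] ss by blast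
  then have "x \<noteq> \<zero>" using h0 ss by auto
  then obtain w where w: "l' = l - wX D w" using good_weight[OF s x(3) _ x(2)] by blast
  have "wX D (w @ w') = 0" using w w' by (simp add: algebra_simps wX_append)
  then have "w' = []" unfolding wX_zero by simp
  moreover have "e = e'"
  proof -
    obtain y where "h s = U.app (dn y) s'" using bij_betwE[OF h] ss by (auto simp: U.cyc_def)
    then have "U.pev e' (h s)" using s' U.pev_app[of e' s'] U.good_carrier[OF s'] by (simp add: U.good_def)
    then have "h (const pi_elt \<cdot> s) = h (const e' \<cdot> s)" by (simp add: ha[OF ss(1)] U.pev_def)
    then have "const pi_elt \<cdot> s = const e' \<cdot> s" using inj submodD(4)[OF N ss(1)] by blast
    then have "pev e' s" using s' by (simp add: pev_def U.good_def U.pev_def)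
    then show ?thesis using s pev_unique[of e s e'] good_carrier[OF s] by (simp add: good_def)
  qed
  ultimately show ?thesis using w' by simp
qed

end

section \<open>The modules \<open>V(\<lambda>)\<^sub>\<plusminus>\<close>\<close>

lemma module_isomorphic_refl: "module_isomorphic R M M"
  unfolding module_isomorphic_def by (intro exI[of _ "\<lambda>x. x"]) (auto simp: bij_betw_def)

context datum begin

text \<open>The generator of V(l) multiplied by pi + e. For a sign \<open>e\<close> the product of
  pi - e and pi + e is zero, so pi acts on this vector by \<open>e\<close>.\<close>

definition vs :: "qpi \<Rightarrow> 'x \<Rightarrow> 'i free_alg set set" where "vs e l = vcls l (const (pi_elt + e))"

lemma V_const: "l \<in> dominant D \<Longrightarrow> u_cls D (const c) \<odot>\<^bsub>V_module D l\<^esub> vcls l y = vcls l (const c * y)"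
proof -
  assume l: "l \<in> dominant D"
  interpret V: umod D "V_module D l" by (rule umod_V[OF l])
  have "V.app (const c) (V.app (dn y) (vcls l 1)) = V.app (dn (const c * y)) (vcls l 1)"
    using V.sing_carrier[OF V_sing(1)[OF l]] by (simp add: subst_gen_lin V.app_mult)
  then show ?thesis by (simp add: V_sing(2)[OF l]) (simp add: V.app_def)
qed

lemma V_good:
  assumes l: "l \<in> dominant D" and e: "e = 1 \<or> e = - 1"
  shows "umod.good D (V_module D l) e l (vs e l)"
    "umod.cyc D (V_module D l) (vs e l) = (\<lambda>m. u_cls D (const (pi_elt + e)) \<odot>\<^bsub>V_module D l\<^esub> m) ` carrier (V_module D l)"
    "umod.app D (V_module D l) (dn y) (vs e l) = vcls l (const (pi_elt + e) * y)"
proof -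
  interpret V: umod D "V_module D l" by (rule umod_V[OF l])
  note s = V_sing(1)[OF l]
  have c: "vcls l 1 \<in> carrier (V_module D l)" using s by (rule V.sing_carrier)
  have vs: "vs e l = V.app (const (pi_elt + e)) (vcls l 1)" by (simp add: vs_def V.app_def V_const[OF l])
  have a: "V.app (dn y) (vs e l) = vcls l (const (pi_elt + e) * y)" for y
    unfolding vs using c by (simp add: V.app_const_comm V_sing(2)[OF l]) (simp add: V.app_def V_const[OF l])
  show "V.app (dn y) (vs e l) = vcls l (const (pi_elt + e) * y)" by (rule a)
  show "V.cyc (vs e l) = (\<lambda>m. u_cls D (const (pi_elt + e)) \<odot>\<^bsub>V_module D l\<^esub> m) ` carrier (V_module D l)"
    unfolding V.cyc_def a V_simps(1) image_image V_const[OF l] ..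
  have "pi_elt + e \<noteq> 0"
    using e two_neq_zero_qfield minus_one_neq_one_qfield by (auto simp: qpi_eq_iff)
  then have "vs e l \<noteq> \<zero>\<^bsub>V_module D l\<^esub>" unfolding vs_def V_simps(3) using vcls_const_zero by blast
  moreover have "V.app (dn (gen i ^ hgt l i)) (vs e l) = \<zero>\<^bsub>V_module D l\<^esub>" for i
  proof -
    have "gen i ^ hgt l i \<in> Lid l" by (rule Lid_closed(6))
    then have "vcls l (gen i ^ hgt l i) = \<zero>\<^bsub>V_module D l\<^esub>" unfolding V_simps(3) vcls_eq by simp
    then have "V.app (const (pi_elt + e)) (vcls l (gen i ^ hgt l i)) = \<zero>\<^bsub>V_module D l\<^esub>" by simp
    then show ?thesis unfolding a by (simp add: V.app_def V_const[OF l])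
  qed
  ultimately show "V.good e l (vs e l)"
    unfolding V.good_def using V.sing_const[OF s] V.pev_const[OF c e] l by (simp add: vs)
qed

lemma V_parts:
  assumes l: "l \<in> dominant D"
  shows "V_plus D l = (V_module D l)\<lparr>carrier := umod.cyc D (V_module D l) (vs 1 l)\<rparr>"
    "V_minus D l = (V_module D l)\<lparr>carrier := umod.cyc D (V_module D l) (vs (- 1) l)\<rparr>"
  by (simp_all add: V_good(2)[OF l] pi_plus_part_def pi_minus_part_def)

lemma V_part_iso_iff:
  assumes "l \<in> dominant D" "l' \<in> dominant D" "e = 1 \<or> e = - 1" "e' = 1 \<or> e' = - 1"
  shows "module_isomorphic (u_alg D) ((V_module D l)\<lparr>carrier := umod.cyc D (V_module D l) (vs e l)\<rparr>)
    ((V_module D l')\<lparr>carrier := umod.cyc D (V_module D l') (vs e' l')\<rparr>) \<longleftrightarrow> l = l' \<and> e = e'"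
  using umod.good_iso_imp[OF umod_V umod_V V_good(1) V_good(1)] assms module_isomorphic_refl by blast

end

section \<open>The Casimir operator modulo a submodule\<close>

text \<open>A list of eigenvalues with repetitions is allowed, since eigenvalues are collected from
  several vectors by concatenation.\<close>

primrec shifts :: "'g free_alg \<Rightarrow> qpi list \<Rightarrow> 'g free_alg" where
  "shifts X [] = 1"
| "shifts X (c # cs) = (X - const c) * shifts X cs"

context umod begin

lemma wsp_sum: "m \<in> carrier M \<Longrightarrow> (\<And>a. a \<in> A \<Longrightarrow> f a \<cdot> m \<in> wsp \<mu>) \<Longrightarrow> (sum f A) \<cdot> m \<in> wsp \<mu>"
  by (induction A rule: infinite_finite_induct) (auto simp: app_plus wsp_add)

text \<open>The canonical element couples only words of equal weight, so the E-word raises the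
  weight by as much as the F-word lowers it.\<close>

lemma OmG_wsp: "m \<in> wsp \<mu> \<Longrightarrow> OmG n \<mu> \<cdot> m \<in> wsp \<mu>"
proof -
  assume m: "m \<in> wsp \<mu>"
  then have c: "m \<in> carrier M" by (rule wsp_carrier)
  have "Cas k \<mu> \<cdot> m \<in> wsp \<mu>" for k
    unfolding Cas_def casum_def
  proof (intro wsp_sum c)
    fix v w :: "'i list"
    let ?t = "dn (mon v) * up (scal (cf \<mu>) (mon w))"
    have e: "const (cas_inv k v w) * ?t = const (cas_inv k v w) * (if wt (FM v) = wt (FM w) then ?t else 0)"
      by (rule casum_term_cong) simp
    have "dn (mon v) \<cdot> up (mon w) \<cdot> m \<in> wsp \<mu>" if "wt (FM v) = wt (FM w)"
    proof -
      have "wX D v = wX D w" using that by (simp only: wX_eq_iff)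
      then show ?thesis using wsp_dn[OF wsp_up[OF m, of w], of v] by (simp del: subst_gen_mon)
    qed
    then show "(const (cas_inv k v w) * ?t) \<cdot> m \<in> wsp \<mu>"
      unfolding e using c by (simp add: app_mult subst_gen_lin app_const_comm[of _ "dn _"] wsp_const del: subst_gen_mon)
  qed
  then show ?thesis using c by (simp add: OmG_def Om_def app_mult wsp_const wsp_sum)
qed

lemma up_OmG: "m \<in> wsp \<mu> \<Longrightarrow> kills n m \<Longrightarrow> up (mon w) \<cdot> OmG n \<mu> \<cdot> m = OmG n (\<mu> + wX D w) \<cdot> up (mon w) \<cdot> m"
proof (induction w)
  case Nil
  then show ?case using wsp_carrier[OF Nil(1)] by (simp add: mon_Nil app_one)
next
  case (Cons i w)
  have c: "m \<in> carrier M" using Cons.prems(1) by (rule wsp_carrier)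
  have e: "up (mon (i # w)) \<cdot> x = gE i \<cdot> up (mon w) \<cdot> x" if "x \<in> carrier M" for x
    using that by (simp add: mon_Cons[of "GE _"] app_mult)
  have "gE i \<cdot> OmG n (\<mu> + wX D w) \<cdot> up (mon w) \<cdot> m = OmG n (\<mu> + wX D w + root D i) \<cdot> gE i \<cdot> up (mon w) \<cdot> m"
    by (rule OmG_gE[OF wsp_up[OF Cons.prems(1)] kills_up[OF Cons.prems(2) c]])
  then show ?case using Cons c by (simp add: e add_ac del: subst_gen_mon)
qed

lemma kills_OmG: "m \<in> wsp \<mu> \<Longrightarrow> kills n m \<Longrightarrow> kills n (OmG n \<mu> \<cdot> m)"
  unfolding kills_def[of n "OmG n \<mu> \<cdot> m"] by (simp add: up_OmG kills_def del: subst_gen_mon)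

lemma kills_diff_const:
  assumes "kills n x" "kills n y" "x \<in> carrier M" "y \<in> carrier M"
  shows "kills n (x \<ominus> const c \<cdot> y)"
proof -
  have "x \<ominus> const c \<cdot> y = x \<oplus> const (- c) \<cdot> y"
    using assms by (simp add: const_simps app_uminus a_minus_def)
  then show ?thesis using kills_gen_le[OF assms(1) kills_const[OF assms(2,4)], of "- c"] assms by simp
qed

lemma shifts_wsp: "m \<in> wsp \<mu> \<Longrightarrow> shifts (OmG n \<mu>) cs \<cdot> m \<in> wsp \<mu>"
  and shifts_kills: "m \<in> wsp \<mu> \<Longrightarrow> kills n m \<Longrightarrow> kills n (shifts (OmG n \<mu>) cs \<cdot> m)"
proof (induction cs)
  case Nil
  {
    case 1
    then show ?case using wsp_carrier[OF 1] by (simp add: app_one)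
  next
    case 2
    then show ?case using wsp_carrier[OF 2(1)] by (simp add: app_one)
  }
next
  case (Cons c cs)
  {
    case 1
    let ?x = "shifts (OmG n \<mu>) cs \<cdot> m"
    have x: "?x \<in> wsp \<mu>" using Cons 1 by blast
    have "shifts (OmG n \<mu>) (c # cs) \<cdot> m = OmG n \<mu> \<cdot> ?x \<oplus> const (- c) \<cdot> ?x"
      using wsp_carrier[OF 1] by (simp add: app_mult app_diff a_minus_def const_simps app_uminus)
    then show ?case using wsp_add[OF OmG_wsp[OF x] wsp_const[OF x]] by simp
  next
    case 2
    let ?x = "shifts (OmG n \<mu>) cs \<cdot> m"
    have x: "?x \<in> wsp \<mu>" "kills n ?x" using Cons 2 by blast+
    then show ?case
      using kills_diff_const[OF kills_OmG[OF x] x(2), of c] wsp_carrier[OF x(1)] wsp_carrier[OF 2(1)] by (simp add: app_mult app_diff)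
  }
qed

lemma shifts_gE:
  "m \<in> wsp \<mu> \<Longrightarrow> kills n m \<Longrightarrow> gE i \<cdot> shifts (OmG n \<mu>) cs \<cdot> m = shifts (OmG n (\<mu> + root D i)) cs \<cdot> gE i \<cdot> m"
proof (induction cs)
  case (Cons c cs)
  let ?x = "shifts (OmG n \<mu>) cs \<cdot> m"
  have c: "m \<in> carrier M" using Cons.prems(1) by (rule wsp_carrier)
  have "gE i \<cdot> shifts (OmG n \<mu>) (c # cs) \<cdot> m = gE i \<cdot> OmG n \<mu> \<cdot> ?x \<ominus> const c \<cdot> gE i \<cdot> ?x"
    using c by (simp add: app_mult app_diff app_add app_a_inv a_minus_def app_const_comm[of _ "gen _"])
  also have "gE i \<cdot> OmG n \<mu> \<cdot> ?x = OmG n (\<mu> + root D i) \<cdot> gE i \<cdot> ?x"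
    by (rule OmG_gE[OF shifts_wsp[OF Cons.prems(1)] shifts_kills[OF Cons.prems]])
  finally show ?case using Cons c by (simp add: app_mult app_diff)
qed (use wsp_carrier app_one in auto)

lemma shifts_mod:
  assumes Z: "submod Z" and m: "m \<in> carrier M" and X: "(X - const c) \<cdot> m \<in> Z"
  shows "(shifts X cs - const (\<Prod>d\<leftarrow>cs. c - d)) \<cdot> m \<in> Z"
proof (induction cs)
  case Nil
  then show ?case using m submodD(2)[OF Z] by (simp add: const_simps)
next
  case (Cons d cs)
  let ?P = "\<Prod>d\<leftarrow>cs. c - d"
  have a: "(X - const d) * const ?P = const ?P * (X - const c) + const ((c - d) * ?P)"
    by (simp add: const_comm[of "X - const d"] right_diff_distrib const_simps flip: mult.commute[of ?P])
  have "shifts X (d # cs) - const (\<Prod>d\<leftarrow>d # cs. c - d) = (X - const d) * (shifts X cs - const ?P) + const ?P * (X - const c)"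
    using a by (simp add: right_diff_distrib)
  then show ?case
    using m submodD(4)[OF Z Cons.IH] submodD(4)[OF Z X] by (simp add: app_plus app_mult submodD(3)[OF Z])
qed

lemma shifts_eigen:
  assumes m: "m \<in> carrier M" and X: "X \<cdot> m = const c \<cdot> m" and c: "c \<in> set cs"
  shows "shifts X cs \<cdot> m = \<zero>"
proof -
  have "(\<Prod>d\<leftarrow>cs. c - d) = 0" using c by (induction cs) auto
  moreover have "(X - const c) \<cdot> m \<in> {\<zero>}" using m X by (simp add: app_eq_iff[symmetric])
  ultimately show ?thesis using shifts_mod[OF submod_zero m, of X c cs] by (simp add: const_simps)
qed

section \<open>Sums of simple submodules\<close>

text \<open>A family of submodules is indexed by itself, so isomorphic summands stay apart as
  different subsets of the module.\<close>

definition Msum :: "'m set set \<Rightarrow> 'm set" where "Msum S = {m. spans_sum M S (\<lambda>N. N) m}"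

lemma MsumI: "finite F \<Longrightarrow> F \<subseteq> S \<Longrightarrow> (\<And>k. k \<in> F \<Longrightarrow> c k \<in> k) \<Longrightarrow> (\<Oplus>k\<in>F. c k) \<in> Msum S"
  unfolding Msum_def spans_sum_def by (intro CollectI exI[of _ F] exI[of _ c]) auto

lemma MsumE: "x \<in> Msum S \<Longrightarrow> (\<And>F c. finite F \<Longrightarrow> F \<subseteq> S \<Longrightarrow> \<forall>k\<in>F. c k \<in> k \<Longrightarrow> x = (\<Oplus>k\<in>F. c k) \<Longrightarrow> P) \<Longrightarrow> P"
  unfolding Msum_def spans_sum_def by blast

text \<open>Padding with zeros allows two elements of the sum to be written over a common finite
  family.\<close>

lemma Msum_ext:
  assumes S: "\<And>N. N \<in> S \<Longrightarrow> submod N" and m: "m \<in> Msum S" 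
  shows "\<exists>F. finite F \<and> F \<subseteq> S \<and> (\<forall>F'. finite F' \<longrightarrow> F \<subseteq> F' \<longrightarrow> F' \<subseteq> S \<longrightarrow> (\<exists>c. (\<forall>k\<in>F'. c k \<in> k) \<and> m = (\<Oplus>k\<in>F'. c k)))"
proof -
  obtain F c where F: "finite F" "F \<subseteq> S" "\<forall>k\<in>F. c k \<in> k" "m = (\<Oplus>k\<in>F. c k)"
    by (rule MsumE[OF m])
  have "\<exists>c. (\<forall>k\<in>F'. c k \<in> k) \<and> m = (\<Oplus>k\<in>F'. c k)" if F': "finite F'" "F \<subseteq> F'" "F' \<subseteq> S" for F'
  proof -
    let ?c = "\<lambda>k. if k \<in> F then c k else \<zero>"
    have cc: "c k \<in> carrier M" if "k \<in> F" for k using that F(2,3) submodD(1)[OF S] by blast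
    have "(\<Oplus>k\<in>F. c k) = (\<Oplus>k\<in>F'. ?c k)"
      using F' cc by (intro LM.M.add.finprod_mono_neutral_cong_left) auto
    moreover have "\<forall>k\<in>F'. ?c k \<in> k" using F(3) F'(3) submodD(2)[OF S] by auto
    ultimately show ?thesis using F(4) by (intro exI[of _ ?c]) simp
  qed
  then show ?thesis using F by blast
qed

lemma submod_Msum:
  assumes S: "\<And>N. N \<in> S \<Longrightarrow> submod N"
  shows "submod (Msum S)"
  unfolding submod_def
proof (intro conjI ballI allI subsetI)
  show "x \<in> carrier M" if "x \<in> Msum S" for x
  proof -
    obtain F c where F: "finite F" "F \<subseteq> S" "\<forall>k\<in>F. c k \<in> k" "x = (\<Oplus>k\<in>F. c k)"
      by (rule MsumE[OF \<open>x \<in> Msum S\<close>])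
    have "\<forall>k\<in>F. c k \<in> carrier M" using F(2,3) submodD(1)[OF S] by blast
    then show ?thesis unfolding F(4) by (intro LM.M.finsum_closed) auto
  qed
  show "\<zero> \<in> Msum S" unfolding Msum_def spans_sum_def by (auto intro!: exI[of _ "{}"])
  show "u \<cdot> x \<in> Msum S" if "x \<in> Msum S" for u x
  proof -
    obtain F c where F: "finite F" "F \<subseteq> S" "\<forall>k\<in>F. c k \<in> k" "x = (\<Oplus>k\<in>F. c k)"
      by (rule MsumE[OF \<open>x \<in> Msum S\<close>])
    have cc: "c k \<in> carrier M" "u \<cdot> c k \<in> k" if "k \<in> F" for k
      using that F(2,3) submodD(1)[OF S] submodD(4)[OF S] by blast+
    have "u \<cdot> x = (\<Oplus>k\<in>F. u \<cdot> c k)" unfolding F(4) using cc(1) by (rule app_finsum)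
    then show ?thesis using MsumI[OF F(1,2) cc(2)] by simp
  qed
  show "x \<oplus> y \<in> Msum S" if "x \<in> Msum S" "y \<in> Msum S" for x y
  proof -
    obtain A where A: "finite A" "A \<subseteq> S"
      "\<forall>F'. finite F' \<longrightarrow> A \<subseteq> F' \<longrightarrow> F' \<subseteq> S \<longrightarrow> (\<exists>c. (\<forall>k\<in>F'. c k \<in> k) \<and> x = (\<Oplus>k\<in>F'. c k))"
      using Msum_ext[OF S \<open>x \<in> Msum S\<close>] by blast
    obtain B where B: "finite B" "B \<subseteq> S"
      "\<forall>F'. finite F' \<longrightarrow> B \<subseteq> F' \<longrightarrow> F' \<subseteq> S \<longrightarrow> (\<exists>c. (\<forall>k\<in>F'. c k \<in> k) \<and> y = (\<Oplus>k\<in>F'. c k))"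
      using Msum_ext[OF S \<open>y \<in> Msum S\<close>] by blast
    have AB: "finite (A \<union> B)" "A \<union> B \<subseteq> S" using A B by auto
    obtain c where c: "\<forall>k\<in>A \<union> B. c k \<in> k" "x = (\<Oplus>k\<in>A \<union> B. c k)" using A(3) AB by blast
    obtain d where d: "\<forall>k\<in>A \<union> B. d k \<in> k" "y = (\<Oplus>k\<in>A \<union> B. d k)" using B(3) AB by blast
    have "\<forall>k\<in>A \<union> B. c k \<in> carrier M \<and> d k \<in> carrier M" using c(1) d(1) AB(2) submodD(1)[OF S] by blast
    then have "x \<oplus> y = (\<Oplus>k\<in>A \<union> B. c k \<oplus> d k)"
      unfolding c(2) d(2) by (intro LM.M.finsum_addf[symmetric]) auto
    moreover have "(\<Oplus>k\<in>A \<union> B. c k \<oplus> d k) \<in> Msum S"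
    proof (rule MsumI[OF AB])
      fix k assume k: "k \<in> A \<union> B"
      then have "submod k" using AB(2) S by blast
      then show "c k \<oplus> d k \<in> k" using k c(1) d(1) submodD(3) by blast
    qed
    ultimately show ?thesis by (simp only:)
  qed
qed

lemma Msum_member: "N \<in> S \<Longrightarrow> (\<And>N. N \<in> S \<Longrightarrow> submod N) \<Longrightarrow> N \<subseteq> Msum S"
proof
  fix x assume N: "N \<in> S" "\<And>N. N \<in> S \<Longrightarrow> submod N" "x \<in> N"
  have "x \<in> carrier M" using submodD(1)[OF N(2)[OF N(1)] N(3)] .
  then have "(\<Oplus>k\<in>{N}. x) = x" by (subst LM.M.finsum_insert) auto
  then show "x \<in> Msum S" using MsumI[of "{N}" S "\<lambda>_. x"] N by simp
qed

lemma indep_insert: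
  assumes S: "\<And>N. N \<in> insert N0 S \<Longrightarrow> submod N" and ind: "indep_sum M S (\<lambda>N. N)" and N0: "N0 \<inter> Msum S \<subseteq> {\<zero>}" "N0 \<notin> S"
  shows "indep_sum M (insert N0 S) (\<lambda>N. N)"
  unfolding indep_sum_def
proof (intro allI impI)
  fix F :: "'m set set" and c
  assume F: "finite F" "F \<subseteq> insert N0 S" "\<forall>k\<in>F. c k \<in> k" "(\<Oplus>k\<in>F. c k) = \<zero>"
  have indS: "\<forall>k\<in>F'. c k = \<zero>" if "finite F'" "F' \<subseteq> S" "\<forall>k\<in>F'. c k \<in> k" "(\<Oplus>k\<in>F'. c k) = \<zero>" for F'
    using ind[unfolded indep_sum_def, rule_format, of F' c] that by auto
  have cc: "c k \<in> carrier M" if "k \<in> F" for k using that F(2,3) submodD(1)[OF S] by blast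
  show "\<forall>k\<in>F. c k = \<zero>"
  proof (cases "N0 \<in> F")
    case False
    then show ?thesis using F by (intro indS) auto
  next
    case True
    let ?F = "F - {N0}"
    have F': "finite ?F" "?F \<subseteq> S" "\<forall>k\<in>?F. c k \<in> k" using F by auto
    have "(\<Oplus>k\<in>insert N0 ?F. c k) = c N0 \<oplus> (\<Oplus>k\<in>?F. c k)"
      using F'(1) cc True by (subst LM.M.finsum_insert) auto
    then have s: "c N0 \<oplus> (\<Oplus>k\<in>?F. c k) = \<zero>" using F(4) True by (simp add: insert_absorb)
    have sub: "submod (Msum S)" using S by (intro submod_Msum) auto
    have r: "(\<Oplus>k\<in>?F. c k) \<in> Msum S" using F'(3) by (intro MsumI F'(1,2)) auto
    then have "(\<Oplus>k\<in>?F. c k) \<oplus> c N0 \<in> Msum S"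
      using s submodD(1,2)[OF sub] cc[OF True] by (simp add: LM.M.a_comm)
    then have "c N0 \<in> Msum S" using submod_minus[OF sub _ r] cc[OF True] by blast
    then have c0: "c N0 = \<zero>" using F(3) True N0(1) by blast
    then have "(\<Oplus>k\<in>?F. c k) = \<zero>" using s submodD(1)[OF sub r] by simp
    then have "\<forall>k\<in>?F. c k = \<zero>" by (intro indS F')
    then show ?thesis using c0 by blast
  qed
qed

definition goods :: "'m set set" where "goods = {N. \<exists>e l s. good e l s \<and> N = cyc s}"

lemma goods_submod: "N \<in> goods \<Longrightarrow> submod N"
  unfolding goods_def using good_submod by blast

text \<open>By simplicity, a cyclic submodule outside a maximal independent family meets the sum of
  that family in zero or is contained in it. The first case contradicts maximality.\<close>

lemma maximal_goods:
  "\<exists>S \<subseteq> goods. indep_sum M S (\<lambda>N. N) \<and> (\<forall>N\<in>goods. N \<subseteq> Msum S)"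
proof -
  let ?A = "{S. S \<subseteq> goods \<and> indep_sum M S (\<lambda>N. N)}"
  have "\<exists>S\<in>?A. \<forall>X\<in>?A. S \<subseteq> X \<longrightarrow> X = S"
  proof (rule subset_Zorn_nonempty)
    have "{} \<in> ?A" by (auto simp: indep_sum_def)
    then show "?A \<noteq> {}" by blast
    fix C assume C: "C \<noteq> {}" "subset.chain ?A C"
    have CA: "C \<subseteq> ?A" using C(2) by (auto simp: subset.chain_def)
    have "indep_sum M (\<Union>C) (\<lambda>N. N)"
      unfolding indep_sum_def
    proof (intro allI impI)
      fix F :: "'m set set" and c
      assume F: "finite F" "F \<subseteq> \<Union>C" "\<forall>k\<in>F. c k \<in> k" "(\<Oplus>k\<in>F. c k) = \<zero>"
      obtain X where X: "X \<in> C" "F \<subseteq> X" using finite_subset_Union_chain[OF F(1,2) C] by blast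
      then have "indep_sum M X (\<lambda>N. N)" using CA by blast
      then show "\<forall>k\<in>F. c k = \<zero>" using F X(2) unfolding indep_sum_def by blast
    qed
    then show "\<Union>C \<in> ?A" using CA by blast
  qed
  then obtain S where S: "S \<subseteq> goods" "indep_sum M S (\<lambda>N. N)" and max: "\<forall>X\<in>?A. S \<subseteq> X \<longrightarrow> X = S" by (elim bexE CollectE conjE)
  have sub: "submod N" if "N \<in> S" for N using that S(1) goods_submod by blast
  have "N \<subseteq> Msum S" if N: "N \<in> goods" for N
  proof (cases "N \<in> S")
    case True
    then show ?thesis using Msum_member sub by blast
  next
    case False
    obtain e l s where s: "good e l s" "N = cyc s" using N by (auto simp: goods_def)
    have "submod (N \<inter> Msum S)"
      using goods_submod[OF N] submod_Msum[of S, OF sub] by (auto simp: submod_def)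
    then have "N \<inter> Msum S = {\<zero>} \<or> N \<inter> Msum S = cyc s" by (intro good_submod_cases[OF s(1)]) (auto simp: s(2))
    then show ?thesis
    proof (elim disjE)
      assume "N \<inter> Msum S = {\<zero>}"
      then have "indep_sum M (insert N S) (\<lambda>N. N)"
        using sub goods_submod[OF N] False by (intro indep_insert[OF _ S(2)]) auto
      then have "insert N S \<in> ?A" using S(1) N by blast
      then have "insert N S = S" using max by blast
      then show ?thesis using False by blast
    qed (use s in blast)
  qed
  then show ?thesis using S by blast
qed

lemma sing_good:
  assumes "sing l s" "s \<noteq> \<zero>" "pev e s" "\<And>i. Fnil i s"
  shows "good e l s"
proof -
  have "0 \<le> cr i l \<and> gF i ^ hgt l i \<cdot> s = \<zero>" for i
  proof -
    obtain n where "gF i ^ n \<cdot> s = \<zero>" using assms(4)[of i] by (auto simp: Fnil_def)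
    then show ?thesis
      using dominant_mod[OF sing_wsp[OF assms(1)] _ submod_zero, of i n] assms(2) sing_gE[OF assms(1)] by simp
  qed
  then show ?thesis using assms by (simp add: good_def dominant_def dn_power)
qed

text \<open>A singular vector need not be an eigenvector of pi. However, 2 s is the difference of
  (pi + 1) s and (pi - 1) s, each of which is zero or a good vector, and 2 is a unit.\<close>

lemma sing_in:
  assumes Z: "submod Z" and g: "\<And>N. N \<in> goods \<Longrightarrow> N \<subseteq> Z" and s: "sing l s" and F: "\<And>i m. m \<in> carrier M \<Longrightarrow> Fnil i m"
  shows "s \<in> Z"
proof -
  have c: "s \<in> carrier M" using s by (rule sing_carrier)
  have a: "const (pi_elt + e) \<cdot> s \<in> Z" if e: "e = 1 \<or> e = - 1" for e
  proof (cases "const (pi_elt + e) \<cdot> s = \<zero>")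
    case True
    then show ?thesis using submodD(2)[OF Z] by simp
  next
    case False
    have "good e l (const (pi_elt + e) \<cdot> s)" using False pev_const[OF c e] F c by (intro sing_good sing_const[OF s]) auto
    then show ?thesis using g[of "cyc (const (pi_elt + e) \<cdot> s)"] cyc_self[of "const (pi_elt + e) \<cdot> s"] c by (auto simp: goods_def)
  qed
  have "const (1 + 1) = const (pi_elt + 1) + const (- 1) * (const (pi_elt + - 1) :: ('i, 'y) u_gen free_alg)"
    by (simp add: algebra_simps flip: const_simps)
  then have "const (1 + 1) \<cdot> s = const (pi_elt + 1) \<cdot> s \<oplus> const (- 1) \<cdot> const (pi_elt + - 1) \<cdot> s"
    using c by (simp only: app_plus app_mult)
  then have "const (1 + 1) \<cdot> s \<in> Z" using submodD(3)[OF Z a submodD(4)[OF Z a], of 1 "- 1"] by simp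
  then show ?thesis using submod_const_unit[OF Z _ two_unit_qpi c] by blast
qed

section \<open>Complete reducibility\<close>

text \<open>Quantifying over all larger truncations and all lists containing \<open>cs\<close> makes
  the property stable under sums, and lets finitely many instances share one truncation and one
  list.\<close>

definition killed :: "'x \<Rightarrow> 'm \<Rightarrow> bool" where
  "killed \<kappa> x \<longleftrightarrow> x \<in> carrier M \<and> (\<exists>N cs. (\<forall>c\<in>set cs. \<exists>l\<in>dominant D. \<exists>w. \<kappa> = l - wX D w \<and> c = gam l) \<and>
     (\<forall>n\<ge>N. \<forall>ds. set cs \<subseteq> set ds \<longrightarrow> shifts (OmG n \<kappa>) ds \<cdot> x = \<zero>))"

lemma killed_add: "killed \<kappa> x \<Longrightarrow> killed \<kappa> y \<Longrightarrow> killed \<kappa> (x \<oplus> y)"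
proof -
  assume x: "killed \<kappa> x" and y: "killed \<kappa> y"
  obtain N1 c1 where 1: "\<forall>c\<in>set c1. \<exists>l\<in>dominant D. \<exists>w. \<kappa> = l - wX D w \<and> c = gam l"
    "\<forall>n\<ge>N1. \<forall>ds. set c1 \<subseteq> set ds \<longrightarrow> shifts (OmG n \<kappa>) ds \<cdot> x = \<zero>" using x unfolding killed_def by blast
  obtain N2 c2 where 2: "\<forall>c\<in>set c2. \<exists>l\<in>dominant D. \<exists>w. \<kappa> = l - wX D w \<and> c = gam l"
    "\<forall>n\<ge>N2. \<forall>ds. set c2 \<subseteq> set ds \<longrightarrow> shifts (OmG n \<kappa>) ds \<cdot> y = \<zero>" using y unfolding killed_def by blast
  have xy: "x \<in> carrier M" "y \<in> carrier M" using x y by (auto simp: killed_def)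
  show ?thesis
    unfolding killed_def
  proof (intro conjI exI[of _ "max N1 N2"] exI[of _ "c1 @ c2"])
    show "\<forall>n\<ge>max N1 N2. \<forall>ds. set (c1 @ c2) \<subseteq> set ds \<longrightarrow> shifts (OmG n \<kappa>) ds \<cdot> (x \<oplus> y) = \<zero>"
      using 1(2) 2(2) xy by (simp add: app_add)
    show "\<forall>c\<in>set (c1 @ c2). \<exists>l\<in>dominant D. \<exists>w. \<kappa> = l - wX D w \<and> c = gam l"
      unfolding set_append ball_Un using 1(1) 2(1) by blast
  qed (simp add: xy)
qed

lemma killed_zero: "killed \<kappa> \<zero>"
  unfolding killed_def by (intro conjI exI[of _ 0] exI[of _ "[]"]) auto

lemma killed_finsum: "finite A \<Longrightarrow> (\<And>a. a \<in> A \<Longrightarrow> killed \<kappa> (c a)) \<Longrightarrow> killed \<kappa> (\<Oplus>a\<in>A. c a)"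
proof (induction A rule: finite_induct)
  case (insert a F)
  have "c k \<in> carrier M" if "k \<in> insert a F" for k using insert.prems[OF that] by (simp add: killed_def)
  then show ?case using insert killed_add by (subst LM.M.finsum_insert) auto
qed (simp add: killed_zero)

lemma killed_good: "good e l s \<Longrightarrow> x \<in> cyc s \<Longrightarrow> x \<in> wsp \<kappa> \<Longrightarrow> killed \<kappa> x"
proof (cases "x = \<zero>")
  case False
  assume s: "good e l s" and x: "x \<in> cyc s" "x \<in> wsp \<kappa>"
  obtain w where w: "\<kappa> = l - wX D w" using good_weight[OF s x(1) False x(2)] by blast
  obtain y where "x = dn y \<cdot> s" using x by (auto simp: cyc_def)
  then have y: "x = dn (ypart l \<kappa> y) \<cdot> s" using ypart_eq[of s l y \<kappa>] s x by (simp add: good_def sing_wsp)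
  obtain N where N: "\<forall>n\<ge>N. OmG n \<kappa> \<cdot> x = const (gam l) \<cdot> x"
    using Om_dn[of l s \<kappa> y] s unfolding y good_def by blast
  have c: "x \<in> carrier M" using x(2) by (rule wsp_carrier)
  have "\<forall>n\<ge>N. \<forall>ds. set [gam l] \<subseteq> set ds \<longrightarrow> shifts (OmG n \<kappa>) ds \<cdot> x = \<zero>"
    using shifts_eigen[OF c] N by simp
  moreover have "\<forall>c\<in>set [gam l]. \<exists>l\<in>dominant D. \<exists>w. \<kappa> = l - wX D w \<and> c = gam l"
    using s w by (auto simp: good_def)
  ultimately show ?thesis unfolding killed_def using c by blast
qed (simp add: killed_zero)

text \<open>The summands of a weight vector are not known to be weight vectors. A single algebra
  element is produced that fixes weight \<open>\<kappa>\<close> and sends every summand into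
  it.\<close>

lemma proj_family:
  assumes "finite F" "\<And>k. k \<in> F \<Longrightarrow> k \<in> goods" "\<And>k. k \<in> F \<Longrightarrow> c k \<in> k"
  shows "\<exists>p. (\<forall>x\<in>wsp \<kappa>. p \<cdot> x = x) \<and> (\<forall>k\<in>F. p \<cdot> c k \<in> wsp \<kappa>)"
  using assms
proof (induction F rule: finite_induct)
  case empty
  then show ?case using app_one wsp_carrier by (intro exI[of _ 1]) auto
next
  case (insert k F)
  then obtain p where p: "\<forall>x\<in>wsp \<kappa>. p \<cdot> x = x" "\<forall>k\<in>F. p \<cdot> c k \<in> wsp \<kappa>" by blast
  have "k \<in> goods" using insert.prems(1) by blast
  then obtain e l s where s: "good e l s" "k = cyc s" unfolding goods_def by blast
  have cc: "c j \<in> carrier M" if "j \<in> insert k F" for j using submodD(1)[OF goods_submod] insert.prems that by blast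
  have "p \<cdot> c k \<in> cyc s" using submodD(4)[OF good_submod[OF s(1)]] insert.prems s(2) by blast
  then obtain y where y: "p \<cdot> c k = dn y \<cdot> s" by (auto simp: cyc_def)
  have sw: "s \<in> wsp l" using s(1) by (simp add: good_def sing_wsp)
  obtain r where r: "r \<cdot> dn y \<cdot> s = dn (ypart l \<kappa> y) \<cdot> s" "\<forall>x\<in>wsp \<kappa>. r \<cdot> x = x" using ypart_proj[OF sw] by blast
  show ?case
  proof (intro exI[of _ "r * p"] conjI ballI)
    show "(r * p) \<cdot> x = x" if "x \<in> wsp \<kappa>" for x using that p(1) r(2) wsp_carrier[OF that] by (simp add: app_mult)
    show "(r * p) \<cdot> c j \<in> wsp \<kappa>" if "j \<in> insert k F" for j
      using that p(2) r y cc ypart_wsp[OF sw] by (auto simp: app_mult)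
  qed
qed

lemma killed_Msum:
  assumes S: "S \<subseteq> goods" and x: "x \<in> Msum S" "x \<in> wsp \<kappa>"
  shows "killed \<kappa> x"
proof -
  obtain F c where F: "finite F" "F \<subseteq> S" "\<forall>k\<in>F. c k \<in> k" "x = (\<Oplus>k\<in>F. c k)"
    by (rule MsumE[OF x(1)])
  have g: "k \<in> goods" if "k \<in> F" for k using that F S by blast
  obtain p where p: "\<forall>x\<in>wsp \<kappa>. p \<cdot> x = x" "\<forall>k\<in>F. p \<cdot> c k \<in> wsp \<kappa>"
    using proj_family[OF F(1) g, of c \<kappa>] F(3) by blast
  have cc: "c k \<in> carrier M" "p \<cdot> c k \<in> k" if "k \<in> F" for k
    using F(3) submodD(1,4)[OF goods_submod[OF g[OF that]]] that by blast+
  have kk: "killed \<kappa> (p \<cdot> c k)" if k: "k \<in> F" for k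
  proof -
    obtain e l s where "good e l s" "k = cyc s" using g[OF k] by (auto simp: goods_def)
    then show ?thesis using killed_good cc(2)[OF k] p(2) k by blast
  qed
  have "killed \<kappa> (\<Oplus>k\<in>F. p \<cdot> c k)" by (rule killed_finsum[OF F(1) kk])
  moreover have "x = p \<cdot> x" using p(1) x(2) by simp
  then have "x = (\<Oplus>k\<in>F. p \<cdot> c k)" unfolding F(4) using cc(1) by (simp add: app_finsum)
  ultimately show ?thesis by simp
qed

lemma prod_list_unit: "(\<And>c. c \<in> set cs \<Longrightarrow> c dvd 1) \<Longrightarrow> prod_list cs dvd (1 :: qpi)"
proof (induction cs)
  case (Cons c cs)
  then show ?case using mult_dvd_mono[of c 1 "prod_list cs" 1] by simp
qed simp

lemma Msum_full:
  assumes O: "in_O_int D M" and S: "S \<subseteq> goods" "\<And>N. N \<in> goods \<Longrightarrow> N \<subseteq> Msum S" and m: "m \<in> carrier M"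
  shows "m \<in> Msum S"
proof (rule ccontr)
  let ?Z = "Msum S"
  assume mn: "m \<notin> ?Z"
  have Z: "submod ?Z" using S(1) goods_submod by (intro submod_Msum) blast
  have ki: "\<exists>n. kills n m" if "m \<in> carrier M" for m using O that by (simp add: in_O_int_def in_O_iff)
  have F: "Fnil i m" if "m \<in> carrier M" for i m using O that by (intro integrable_Fnil) (simp_all add: in_O_int_def)
  have "internal_direct_sum M UNIV wsp" using O by (simp add: in_O_int_def in_O_iff in_C_def)
  then have "spans_sum M UNIV wsp m" using m by (rule internal_direct_sum_spans)
  then obtain A c where A: "\<forall>k\<in>A. c k \<in> wsp k" "m = (\<Oplus>k\<in>A. c k)" unfolding spans_sum_def by blast
  \<comment> \<open>Some weight component of \<open>m\<close> is outside the sum, so the argument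
    continues with a weight vector.\<close>
  then obtain k where k: "k \<in> A" "c k \<notin> ?Z" using mn finsum_in[OF Z, of A c] by blast
  then have ck: "c k \<in> wsp k" using A(1) by blast
  note ckc = wsp_carrier[OF ck]
  obtain n0 where n0: "kills n0 (c k)" using ki[OF ckc] by blast
  obtain w where w: "up (mon w) \<cdot> c k \<notin> ?Z" "\<forall>i. gE i \<cdot> up (mon w) \<cdot> c k \<in> ?Z"
    using top_word[OF n0 ckc Z k(2)] by blast
  define x where "x = up (mon w) \<cdot> c k"
  define \<mu> where "\<mu> = k + wX D w"
  have x: "x \<in> wsp \<mu>" "x \<notin> ?Z" "\<And>i. gE i \<cdot> x \<in> ?Z" "kills n0 x"
    using wsp_up[OF ck, of w] w kills_up[OF n0 ckc, of w] by (simp_all add: x_def \<mu>_def del: subst_gen_mon)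
  have xc: "x \<in> carrier M" using x(1) by (rule wsp_carrier)
  have "0 \<le> cr i \<mu>" for i
  proof -
    obtain n where "gF i ^ n \<cdot> x = \<zero>" using F[OF xc, of i] by (auto simp: Fnil_def)
    then have "gF i ^ n \<cdot> x \<in> ?Z" using submodD(2)[OF Z] by simp
    then show ?thesis by (rule dominant_mod(1)[OF x(1,2) Z x(3)])
  qed
  then have d\<mu>: "\<mu> \<in> dominant D" by (simp add: dominant_def)
  have "\<forall>i. \<exists>N cs. (\<forall>c\<in>set cs. \<exists>l\<in>dominant D. \<exists>w. \<mu> + root D i = l - wX D w \<and> c = gam l) \<and>
     (\<forall>n\<ge>N. \<forall>ds. set cs \<subseteq> set ds \<longrightarrow> shifts (OmG n (\<mu> + root D i)) ds \<cdot> gE i \<cdot> x = \<zero>)"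
    using killed_Msum[OF S(1) x(3) wsp_gE[OF x(1)]] unfolding killed_def by blast
  from choice[OF this] obtain N where
    "\<forall>i. \<exists>cs. (\<forall>c\<in>set cs. \<exists>l\<in>dominant D. \<exists>w. \<mu> + root D i = l - wX D w \<and> c = gam l) \<and>
     (\<forall>n\<ge>N i. \<forall>ds. set cs \<subseteq> set ds \<longrightarrow> shifts (OmG n (\<mu> + root D i)) ds \<cdot> gE i \<cdot> x = \<zero>)" ..
  from choice[OF this] obtain cs where
    "\<forall>i. (\<forall>c\<in>set (cs i). \<exists>l\<in>dominant D. \<exists>w. \<mu> + root D i = l - wX D w \<and> c = gam l) \<and>
     (\<forall>n\<ge>N i. \<forall>ds. set (cs i) \<subseteq> set ds \<longrightarrow> shifts (OmG n (\<mu> + root D i)) ds \<cdot> gE i \<cdot> x = \<zero>)" ..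
  then have cs1: "\<And>i c. c \<in> set (cs i) \<Longrightarrow> \<exists>l\<in>dominant D. \<exists>w. \<mu> + root D i = l - wX D w \<and> c = gam l"
    and cs2: "\<And>i n ds. N i \<le> n \<Longrightarrow> set (cs i) \<subseteq> set ds \<Longrightarrow> shifts (OmG n (\<mu> + root D i)) ds \<cdot> gE i \<cdot> x = \<zero>"
    by blast+
  obtain js :: "'i list" where js: "set js = UNIV" using finite_list[of "UNIV :: 'i set"] by auto
  define ds where "ds = concat (map cs js)"
  \<comment> \<open>One truncation for all \<open>i\<close>, large enough for \<open>x\<close> and
    for every bound \<open>N i\<close>.\<close>
  define n where "n = n0 + sum N UNIV"
  have n: "n0 \<le> n" "N i \<le> n" for i using member_le_sum[of i UNIV N] by (simp_all add: n_def)
  have ds: "set ds = (\<Union>i. set (cs i))" by (simp add: ds_def js)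
  define z where "z = shifts (OmG n \<mu>) ds \<cdot> x"
  have kx: "kills n x" by (rule kills_mono[OF x(4) n(1)])
  have "gE i \<cdot> z = \<zero>" for i
    unfolding z_def shifts_gE[OF x(1) kx] by (rule cs2[OF n(2)]) (auto simp: ds)
  then have "sing \<mu> z" unfolding sing_def z_def using shifts_wsp[OF x(1)] by blast
  then have zZ: "z \<in> ?Z" using sing_in[OF Z S(2) _ F] by blast
  let ?P = "\<Prod>d\<leftarrow>ds. gam \<mu> - d"
  have "(shifts (OmG n \<mu>) ds - const ?P) \<cdot> x \<in> ?Z" by (intro shifts_mod[OF Z xc] OmG_mod[OF Z xc] x(3))
  \<comment> \<open>Subtracting the congruence from \<open>z\<close>, which lies in the sum,
    isolates the scalar multiple \<open>const ?P \<cdot> x\<close>.\<close>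
  then have "(- 1) \<cdot> (shifts (OmG n \<mu>) ds - const ?P) \<cdot> x \<oplus> z \<in> ?Z" using submodD(3,4)[OF Z] zZ by blast
  moreover have "(- 1) \<cdot> (shifts (OmG n \<mu>) ds - const ?P) \<cdot> x \<oplus> z = (- (shifts (OmG n \<mu>) ds - const ?P) + shifts (OmG n \<mu>) ds) \<cdot> x"
    unfolding z_def using xc by (simp only: app_plus app_uminus app_closed app_one)
  ultimately have Px: "const ?P \<cdot> x \<in> ?Z" by simp
  have "?P dvd 1"
  proof (rule prod_list_unit)
    fix e assume "e \<in> set (map (\<lambda>d. gam \<mu> - d) ds)"
    then obtain i d where d: "e = gam \<mu> - d" "d \<in> set (cs i)" by (auto simp: ds)
    then obtain l w where l: "l \<in> dominant D" "\<mu> + root D i = l - wX D w" "d = gam l" using cs1 by blast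
    \<comment> \<open>The additional letter \<open>i\<close> makes the word nonempty even if
      \<open>w\<close> is empty, as \<open>gam_diff\<close> demands.\<close>
    then have e: "\<mu> = l - wX D (i # w)" by (simp add: algebra_simps)
    show "e dvd 1" unfolding d(1) l(3) using gam_diff[OF l(1), of "i # w"] d\<mu> unfolding e[symmetric] by simp
  qed
  then show False using submod_const_unit[OF Z Px _ xc] x(2) by blast
qed

lemma semisimple:
  assumes O: "in_O_int D M"
  shows "\<exists>S. internal_direct_sum M S (\<lambda>N. N) \<and> (\<forall>N\<in>S. \<exists>e l s. good e l s \<and> N = cyc s)"
proof -
  obtain S where S: "S \<subseteq> goods" "indep_sum M S (\<lambda>N. N)" "\<forall>N\<in>goods. N \<subseteq> Msum S"
    using maximal_goods by blast
  have "internal_direct_sum M S (\<lambda>N. N)"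
  proof (rule internal_direct_sumI[OF _ _ S(2)])
    show "additive_subgroup N M" if "N \<in> S" for N using submod_subgroup goods_submod S(1) that by blast
    show "spans_sum M S (\<lambda>N. N) m" if m: "m \<in> carrier M" for m
      using Msum_full[OF O S(1) _ m] S(3) unfolding Msum_def by blast
  qed
  then show ?thesis using S(1) unfolding goods_def by blast
qed

text \<open>The words in the F killing the two generators are compared. Relations of the generator
  of the part of V carry over to \<open>s\<close> by \<open>Lid_app\<close>; the converse comes from
  simplicity of that part.\<close>

lemma good_V_iso:
  assumes s: "good e l s"
  shows "module_isomorphic (u_alg D) (M\<lparr>carrier := cyc s\<rparr>) ((V_module D l)\<lparr>carrier := umod.cyc D (V_module D l) (vs e l)\<rparr>)"
proof -
  have l: "l \<in> dominant D" and e: "e = 1 \<or> e = - 1" and ss: "sing l s" and pe: "pev e s"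
    using s by (auto simp: good_def pev_def)
  have c: "s \<in> carrier M" using s by (rule good_carrier)
  interpret V: umod D "V_module D l" by (rule umod_V[OF l])
  let ?t = "vs e l"
  note t = V_good(1)[OF l e] and at = V_good(3)[OF l e]
  have tc: "?t \<in> carrier (V_module D l)" using t by (rule V.good_carrier)
  have st: "V.sing l ?t" using t by (simp add: V.good_def)
  have sl: "dn (gen i ^ hgt l i) \<cdot> s = \<zero>" for i using s by (simp add: good_def)
  have 1: "dn y \<cdot> s = \<zero>" if y: "V.app (dn y) ?t = \<zero>\<^bsub>V_module D l\<^esub>" for y
  proof -
    \<comment> \<open>The generator \<open>vs e l\<close> contains the factor pi + e, which acts on
      multiples of \<open>s\<close> by \<open>e + e\<close>, a unit.\<close>
    have "const (pi_elt + e) * y \<in> Lid l" using y unfolding at V_simps(3) vcls_eq by simp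
    then have "dn (const (pi_elt + e) * y) \<cdot> s = \<zero>" by (rule Lid_app[OF c sl])
    then have "const (pi_elt + e) \<cdot> dn y \<cdot> s = \<zero>" using c by (simp add: subst_gen_lin app_mult)
    moreover have "const pi_elt \<cdot> dn y \<cdot> s = const e \<cdot> dn y \<cdot> s" using pev_app[OF pe c] by (simp add: pev_def)
    moreover have "const (a + b) \<cdot> dn y \<cdot> s = const a \<cdot> dn y \<cdot> s \<oplus> const b \<cdot> dn y \<cdot> s" for a b
      using c by (simp only: const_simps(3) app_plus app_closed)
    ultimately have 0: "const (e + e) \<cdot> dn y \<cdot> s = \<zero>" by (simp only:)
    have "e + e = 1 + 1 \<or> e + e = - (1 + 1)" using e by auto
    then have "e + e dvd 1" using two_unit_qpi by (auto simp only: minus_dvd_iff)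
    from const_unit_cancel[OF this, of "dn y \<cdot> s"] show ?thesis unfolding 0 using c by simp
  qed
  have 2: "V.app (dn y) ?t = \<zero>\<^bsub>V_module D l\<^esub>" if y: "dn y \<cdot> s = \<zero>" for y
  proof -
    \<comment> \<open>The kernel of the map from the part of V onto the submodule generated by
      \<open>s\<close>; it is proper because \<open>s\<close> is nonzero.\<close>
    let ?Z = "{V.app (dn y) ?t |y. dn y \<cdot> s = \<zero>}"
    have "V.submod ?Z"
      unfolding V.submod_def
    proof (intro conjI ballI allI subsetI)
      show "\<zero>\<^bsub>V_module D l\<^esub> \<in> ?Z" using tc c by (intro CollectI exI[of _ 0]) (simp add: subst_gen_lin)
      show "x \<oplus>\<^bsub>V_module D l\<^esub> y \<in> ?Z" if xy: "x \<in> ?Z" "y \<in> ?Z" for x y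
      proof -
        obtain a b where "x = V.app (dn a) ?t" "y = V.app (dn b) ?t" "dn a \<cdot> s = \<zero>" "dn b \<cdot> s = \<zero>" using xy by blast
        then show ?thesis using tc c by (intro CollectI exI[of _ "a + b"]) (simp add: subst_gen_lin app_plus V.app_plus)
      qed
      show "V.app u x \<in> ?Z" if x: "x \<in> ?Z" for u x
      proof -
        obtain a where "x = V.app (dn a) ?t" "dn a \<cdot> s = \<zero>" using x by blast
        then show ?thesis using app_dn[OF ss, of u a] V.app_dn[OF st, of u a] by (intro CollectI exI[of _ "vact l u a"]) simp
      qed
    qed (use tc in auto)
    moreover have "?Z \<subseteq> V.cyc ?t" by (auto simp: V.cyc_def)
    ultimately have "?Z = {\<zero>\<^bsub>V_module D l\<^esub>} \<or> ?Z = V.cyc ?t" by (rule V.good_submod_cases[OF t])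
    moreover have "?Z \<noteq> V.cyc ?t"
    proof
      assume "?Z = V.cyc ?t"
      then have "?t \<in> ?Z" using V.cyc_self[OF tc] by simp
      then obtain a where a: "?t = V.app (dn a) ?t" "dn a \<cdot> s = \<zero>" by blast
      then have "V.app 1 ?t = V.app (dn a) ?t" using tc by (simp add: V.app_one)
      then have "V.app (dn (1 - a)) ?t = \<zero>\<^bsub>V_module D l\<^esub>" using tc by (simp add: V.app_eq_iff subst_gen_lin)
      then have "dn (1 - a) \<cdot> s = \<zero>" by (rule 1)
      then have "1 \<cdot> s = dn a \<cdot> s" using c by (simp add: app_eq_iff subst_gen_lin)
      then show False using a(2) c s by (simp add: app_one good_def)
    qed
    ultimately show ?thesis using y by blast
  qed
  have eq: "dn x \<cdot> s = dn y \<cdot> s \<longleftrightarrow> V.app (dn x) ?t = V.app (dn y) ?t" for x y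
    using 1[of "x - y"] 2[of "x - y"] c tc by (auto simp: app_eq_iff V.app_eq_iff subst_gen_lin)
  define h where "h x = V.app (dn (SOME y. x = dn y \<cdot> s)) ?t" for x
  have h: "h (dn y \<cdot> s) = V.app (dn y) ?t" for y
  proof -
    have "dn y \<cdot> s = dn (SOME z. dn y \<cdot> s = dn z \<cdot> s) \<cdot> s" by (rule someI[of _ y]) simp
    then show ?thesis unfolding h_def eq by simp
  qed
  show ?thesis
    unfolding module_isomorphic_def
  proof (intro exI[of _ h] conjI ballI)
    show "bij_betw h (carrier (M\<lparr>carrier := cyc s\<rparr>)) (carrier ((V_module D l)\<lparr>carrier := V.cyc ?t\<rparr>))"
      unfolding bij_betw_def inj_on_def cyc_def V.cyc_def by (auto simp: h eq image_image)
  next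
    fix x y assume "x \<in> carrier (M\<lparr>carrier := cyc s\<rparr>)" "y \<in> carrier (M\<lparr>carrier := cyc s\<rparr>)"
    then obtain a b where ab: "x = dn a \<cdot> s" "y = dn b \<cdot> s" by (auto simp: cyc_def)
    have "x \<oplus> y = dn (a + b) \<cdot> s" using c by (simp add: ab subst_gen_lin app_plus)
    moreover have "h x \<oplus>\<^bsub>V_module D l\<^esub> h y = V.app (dn (a + b)) ?t" using tc by (simp add: ab h subst_gen_lin V.app_plus)
    ultimately show "h (x \<oplus>\<^bsub>M\<lparr>carrier := cyc s\<rparr>\<^esub> y) = h x \<oplus>\<^bsub>(V_module D l)\<lparr>carrier := V.cyc ?t\<rparr>\<^esub> h y" by (simp add: h)
  next
    fix r x assume "r \<in> carrier (u_alg D)" "x \<in> carrier (M\<lparr>carrier := cyc s\<rparr>)"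
    then obtain u a where ua: "r = u_cls D u" "x = dn a \<cdot> s" by (auto simp: cyc_def u_alg_simps)
    have "r \<odot> x = dn (vact l u a) \<cdot> s" unfolding ua using app_dn[OF ss, of u a] by (simp add: app_def)
    moreover have "r \<odot>\<^bsub>V_module D l\<^esub> h x = V.app (dn (vact l u a)) ?t"
      unfolding ua h using V.app_dn[OF st, of u a] by (simp add: V.app_def)
    ultimately show "h (r \<odot>\<^bsub>M\<lparr>carrier := cyc s\<rparr>\<^esub> x) = r \<odot>\<^bsub>(V_module D l)\<lparr>carrier := V.cyc ?t\<rparr>\<^esub> h x" by (simp add: h)
  qed
qed

end

theorem corollary3p3p3:
  fixes D :: "('i::finite, 'y::ab_group_add, 'x::ab_group_add) root_data"
  assumes "super_cartan_datum D"
    and "root_datum D"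
    and "parity_compatible D"
  shows
    "(\<forall>l\<in>dominant D. simple_in_O_int D (V_plus D l) \<and> simple_in_O_int D (V_minus D l)) \<and>
     (\<forall>l\<in>dominant D. \<forall>l'\<in>dominant D.
        (module_isomorphic (u_alg D) (V_plus D l) (V_plus D l') \<longleftrightarrow> l = l') \<and>
        (module_isomorphic (u_alg D) (V_minus D l) (V_minus D l') \<longleftrightarrow> l = l') \<and>
        \<not> module_isomorphic (u_alg D) (V_plus D l) (V_minus D l')) \<and>
     (\<forall>M :: (('i, 'y) u_elt, 'm) module. in_O_int D M \<longrightarrow>
        (\<exists>S :: 'm set set. internal_direct_sum M S (\<lambda>N. N) \<and>
           (\<forall>N\<in>S. submodule N (u_alg D) M \<and>
              (\<exists>l\<in>dominant D.
                 module_isomorphic (u_alg D) (M\<lparr>carrier := N\<rparr>) (V_plus D l) \<or>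
                 module_isomorphic (u_alg D) (M\<lparr>carrier := N\<rparr>) (V_minus D l)))))"
proof -
  interpret datum D using assms by unfold_locales
  \<comment> \<open>Distinguishes the plus parts from the minus parts in the last claim of
    (b).\<close>
  have pm: "(1 :: qpi) \<noteq> - 1" using minus_one_neq_one_qfield by (auto simp: qpi_eq_iff)
  show ?thesis
  proof (intro conjI ballI allI impI)
    fix l assume l: "l \<in> dominant D"
    show "simple_in_O_int D (V_plus D l)" "simple_in_O_int D (V_minus D l)"
      unfolding V_parts[OF l] by (rule umod.good_simple[OF umod_V[OF l] V_good(1)[OF l]]; simp)+
    fix l' assume l': "l' \<in> dominant D"
    show "module_isomorphic (u_alg D) (V_plus D l) (V_plus D l') \<longleftrightarrow> l = l'"
      "module_isomorphic (u_alg D) (V_minus D l) (V_minus D l') \<longleftrightarrow> l = l'"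
      "\<not> module_isomorphic (u_alg D) (V_plus D l) (V_minus D l')"
      unfolding V_parts[OF l] V_parts[OF l'] using V_part_iso_iff[OF l l'] pm by simp_all
  next
    fix M :: "(('i, 'y) u_elt, 'm) module" assume O: "in_O_int D M"
    interpret umod D M using O datum_axioms by (simp add: umod_def in_O_int_def in_O_def in_C_def)
    obtain S where S: "internal_direct_sum M S (\<lambda>N. N)" "\<forall>N\<in>S. \<exists>e l s. good e l s \<and> N = cyc s"
      using semisimple[OF O] by blast
    have "submodule N (u_alg D) M \<and> (\<exists>l\<in>dominant D.
        module_isomorphic (u_alg D) (M\<lparr>carrier := N\<rparr>) (V_plus D l) \<or>
        module_isomorphic (u_alg D) (M\<lparr>carrier := N\<rparr>) (V_minus D l))" if N: "N \<in> S" for N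
    proof -
      obtain e l s where s: "good e l s" "N = cyc s" using S(2) N by blast
      have l: "l \<in> dominant D" and e: "e = 1 \<or> e = - 1" using s(1) by (auto simp: good_def pev_def)
      have "module_isomorphic (u_alg D) (M\<lparr>carrier := N\<rparr>) (V_plus D l) \<or>
        module_isomorphic (u_alg D) (M\<lparr>carrier := N\<rparr>) (V_minus D l)"
        unfolding V_parts[OF l] using good_V_iso[OF s(1)] e by (auto simp: s(2))
      then show ?thesis using l good_submod[OF s(1)] by (auto simp: s(2) submod_iff)
    qed
    then show "\<exists>S :: 'm set set. internal_direct_sum M S (\<lambda>N. N) \<and>
           (\<forall>N\<in>S. submodule N (u_alg D) M \<and>
              (\<exists>l\<in>dominant D.
                 module_isomorphic (u_alg D) (M\<lparr>carrier := N\<rparr>) (V_plus D l) \<or>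
                 module_isomorphic (u_alg D) (M\<lparr>carrier := N\<rparr>) (V_minus D l)))"
      using S(1) by blast
  qed
qed

end
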